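(* Let $T$ be a complete NIP theory, let $\pi(x)$ be a partial type and $\kappa$ a cardinal. The following are equivalent: (1) $\mathrm{dlr}(\pi)<\kappa$; (2) for every set $A$ (containing the parameters of $\pi$), every family $(I_i:i<\kappa)$ of sequences mutually stable over $A$ and every $a\models\pi$, there is $i<\kappa$ such that $I_i$ is stable over $Aa$; (3) for every set $A$ (containing the parameters of $\pi$), every cardinal $\lambda$, every family $(I_i:i<\lambda)$ of sequences mutually stable over $A$ and every $a\models\pi$, there is $X\subseteq\lambda$ with $|X|<\kappa$ such that the sequences $(I_i:i\in\lambda\setminus X)$ are mutually stable over $Aa$.
   Context: $\mathcal U$ is a monster model of $T$. $I+J$ denotes concatenation. Sequences $(I_i:i<\alpha)$ are mutually indiscernible over $A$ if each $I_i$ is indiscernible over $A\cup\bigcup_{j\neq i}I_j$. A family $(I_i:i<\alpha)$ of indiscernible sequences is mutually stable over $A$ if there exist infinite sequences $J_i^0,J_i^1$ ($i<\alpha$) such that each $J_i^0+I_i+J_i^1$ is indiscernible and the sequences $(J_i^0+J_i^1:i<\alpha)$ are mutually indiscernible over $A$; a single indiscernible sequence $I$ is stable over $A$ if the family $(I)$ is. Op-dimension: $\mathrm{dlr}(\pi)<\kappa$ means, for some (equivalently any) $B$ over which $\pi$ is defined, there do NOT exist $a\models\pi$, a family $(I_i:i<\kappa)$ of sequences mutually indiscernible over $B$ with $I_i=(b^i_j:j\in\mathcal I_i)$, and formulas $\phi_i(x;y_i)\in L(B)$ such that each set $\{j\in\mathcal I_i:\models\phi_i(a;b^i_j)\}$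 is infinite and co-infinite in $\mathcal I_i$. *)

theory Defs
  imports Main
begin

unbundle cardinal_syntax

section \<open>First-order logic with equality\<close>

record ('f, 'r) lang =
  fsyms :: "'f set"
  farity :: "'f \<Rightarrow> nat"
  rsyms :: "'r set"
  rarity :: "'r \<Rightarrow> nat"

datatype 'f trm = Var nat | App 'f "'f trm list"

datatype ('f, 'r) fm =
    Eq "'f trm" "'f trm"
  | Rel 'r "'f trm list"
  | Neg "('f, 'r) fm"
  | Conj "('f, 'r) fm" "('f, 'r) fm"
  | All nat "('f, 'r) fm"

primrec wf_trm :: "('f, 'r) lang \<Rightarrow> 'f trm \<Rightarrow> bool" where
  "wf_trm L (Var v) \<longleftrightarrow> True"
| "wf_trm L (App f ts) \<longleftrightarrow>
     f \<in> fsyms L \<and> length ts = farity L f \<and> list_all (\<lambda>b. b) (map (wf_trm L) ts)"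

primrec wf_fm :: "('f, 'r) lang \<Rightarrow> ('f, 'r) fm \<Rightarrow> bool" where
  "wf_fm L (Eq s t) \<longleftrightarrow> wf_trm L s \<and> wf_trm L t"
| "wf_fm L (Rel R ts) \<longleftrightarrow> R \<in> rsyms L \<and> length ts = rarity L R \<and> (\<forall>t\<in>set ts. wf_trm L t)"
| "wf_fm L (Neg \<phi>) \<longleftrightarrow> wf_fm L \<phi>"
| "wf_fm L (Conj \<phi> \<psi>) \<longleftrightarrow> wf_fm L \<phi> \<and> wf_fm L \<psi>"
| "wf_fm L (All v \<phi>) \<longleftrightarrow> wf_fm L \<phi>"

primrec fv_trm :: "'f trm \<Rightarrow> nat set" where
  "fv_trm (Var v) = {v}"
| "fv_trm (App f ts) = \<Union> (set (map fv_trm ts))"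

primrec fv :: "('f, 'r) fm \<Rightarrow> nat set" where
  "fv (Eq s t) = fv_trm s \<union> fv_trm t"
| "fv (Rel R ts) = \<Union> (fv_trm ` set ts)"
| "fv (Neg \<phi>) = fv \<phi>"
| "fv (Conj \<phi> \<psi>) = fv \<phi> \<union> fv \<psi>"
| "fv (All v \<phi>) = fv \<phi> - {v}"

text \<open>The \<open>L\<close>-formulas in the variables \<open>v\<^sub>0, \<dots>, v\<^sub>n\<^sub>-\<^sub>1\<close>; sentences are the case \<open>n = 0\<close>.\<close>

definition fmlas :: "('f, 'r) lang \<Rightarrow> nat \<Rightarrow> ('f, 'r) fm set" where
  "fmlas L n = {\<phi>. wf_fm L \<phi> \<and> fv \<phi> \<subseteq> {..<n}}"

record ('f, 'r, 'm) struct =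
  univ :: "'m set"
  fint :: "'f \<Rightarrow> 'm list \<Rightarrow> 'm"
  rint :: "'r \<Rightarrow> 'm list \<Rightarrow> bool"

definition structure_of :: "('f, 'r) lang \<Rightarrow> ('f, 'r, 'm) struct \<Rightarrow> bool" where
  "structure_of L M \<longleftrightarrow> univ M \<noteq> {} \<and>
     (\<forall>f\<in>fsyms L. \<forall>xs\<in>lists (univ M). length xs = farity L f \<longrightarrow> fint M f xs \<in> univ M)"

primrec eval_trm :: "('f, 'r, 'm) struct \<Rightarrow> (nat \<Rightarrow> 'm) \<Rightarrow> 'f trm \<Rightarrow> 'm" where
  "eval_trm M e (Var v) = e v"
| "eval_trm M e (App f ts) = fint M f (map (eval_trm M e) ts)"

primrec sat :: "('f, 'r, 'm) struct \<Rightarrow> (nat \<Rightarrow> 'm) \<Rightarrow> ('f, 'r) fm \<Rightarrow> bool" where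
  "sat M e (Eq s t) \<longleftrightarrow> eval_trm M e s = eval_trm M e t"
| "sat M e (Rel R ts) \<longleftrightarrow> rint M R (map (eval_trm M e) ts)"
| "sat M e (Neg \<phi>) \<longleftrightarrow> \<not> sat M e \<phi>"
| "sat M e (Conj \<phi> \<psi>) \<longleftrightarrow> sat M e \<phi> \<and> sat M e \<psi>"
| "sat M e (All v \<phi>) \<longleftrightarrow> (\<forall>x\<in>univ M. sat M (e(v := x)) \<phi>)"

definition model_of :: "('f, 'r) lang \<Rightarrow> ('f, 'r) fm set \<Rightarrow> ('f, 'r, 'm) struct \<Rightarrow> bool" where
  "model_of L T M \<longleftrightarrow> structure_of L M \<and>
     (\<forall>\<phi>\<in>T. \<forall>e. range e \<subseteq> univ M \<longrightarrow> sat M e \<phi>)"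

text \<open>
  HOL cannot quantify over models of all types inside a definition. Since the type of
  formulas is infinite and has at least as many elements as there are \<open>L\<close>-symbols, it is
  enough, by Loewenheim-Skolem, to consider the models whose universe is a subset of that type.
\<close>

definition entails :: "('f, 'r) lang \<Rightarrow> ('f, 'r) fm set \<Rightarrow> ('f, 'r) fm \<Rightarrow> bool" where
  "entails L T \<phi> \<longleftrightarrow>
     (\<forall>M :: ('f, 'r, ('f, 'r) fm) struct. model_of L T M \<longrightarrow> model_of L {\<phi>} M)"

definition complete_theory :: "('f, 'r) lang \<Rightarrow> ('f, 'r) fm set \<Rightarrow> bool" where
  "complete_theory L T \<longleftrightarrow> T \<subseteq> fmlas L 0 \<and>
     (\<exists>M :: ('f, 'r, ('f, 'r) fm) struct. model_of L T M) \<and>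
     (\<forall>\<phi>\<in>fmlas L 0. entails L T \<phi> \<or> entails L T (Neg \<phi>))"

section \<open>Formulas with parameters and partial types\<close>

text \<open>
  Tuples are finite and represented as lists. A pair \<open>(\<phi>, c)\<close> stands for the formula
  \<open>\<phi>(x; c)\<close> with parameters \<open>c\<close>: the variables of \<open>x = (x\<^sub>0, \<dots>, x\<^sub>n\<^sub>-\<^sub>1)\<close> are
  \<open>v\<^sub>0, \<dots>, v\<^sub>n\<^sub>-\<^sub>1\<close>, and the parameters are substituted for the variables from \<open>v\<^sub>n\<close> on.
\<close>

type_synonym ('f, 'r, 'm) pfm = "('f, 'r) fm \<times> 'm list"

definition pfmlas :: "('f, 'r) lang \<Rightarrow> 'm set \<Rightarrow> nat \<Rightarrow> ('f, 'r, 'm) pfm set" where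
  "pfmlas L B n = {(\<phi>, c). c \<in> lists B \<and> \<phi> \<in> fmlas L (n + length c)}"

definition psat :: "('f, 'r, 'm) struct \<Rightarrow> ('f, 'r, 'm) pfm \<Rightarrow> 'm list \<Rightarrow> bool" where
  "psat M p a \<longleftrightarrow> sat M (\<lambda>i. (a @ snd p) ! i) (fst p)"

definition params :: "('f, 'r, 'm) pfm set \<Rightarrow> 'm set" where
  "params \<pi> = (\<Union>p\<in>\<pi>. set (snd p))"

definition tuples :: "('f, 'r, 'm) struct \<Rightarrow> nat \<Rightarrow> 'm list set" where
  "tuples M n = {a \<in> lists (univ M). length a = n}"

definition realizes :: "('f, 'r, 'm) struct \<Rightarrow> nat \<Rightarrow> ('f, 'r, 'm) pfm set \<Rightarrow> 'm list \<Rightarrow> bool" where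
  "realizes M n \<pi> a \<longleftrightarrow> a \<in> tuples M n \<and> (\<forall>p\<in>\<pi>. psat M p a)"

definition partial_type_over ::
    "('f, 'r) lang \<Rightarrow> ('f, 'r, 'm) struct \<Rightarrow> 'm set \<Rightarrow> nat \<Rightarrow> ('f, 'r, 'm) pfm set \<Rightarrow> bool" where
  "partial_type_over L M B n \<pi> \<longleftrightarrow> \<pi> \<subseteq> pfmlas L B n \<and>
     (\<forall>\<pi>0\<subseteq>\<pi>. finite \<pi>0 \<longrightarrow> (\<exists>a. realizes M n \<pi>0 a))"

section \<open>Monster models\<close>

text \<open>
  The cardinal \<open>kb\<close> measures smallness: subsets of the monster model, index orders of sequences
  and families of sequences are small if they have cardinality less than \<open>kb\<close>. Every small
  linear order or cardinal is isomorphic to one on a subset of the carrier type of \<open>kb\<close>.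
\<close>

definition small_subset :: "('f, 'r, 'm) struct \<Rightarrow> 'k rel \<Rightarrow> 'm set \<Rightarrow> bool" where
  "small_subset M kb A \<longleftrightarrow> A \<subseteq> univ M \<and> |A| <o kb"

definition saturated :: "('f, 'r) lang \<Rightarrow> ('f, 'r, 'm) struct \<Rightarrow> 'k rel \<Rightarrow> bool" where
  "saturated L M kb \<longleftrightarrow>
     (\<forall>A n \<pi>. small_subset M kb A \<and> partial_type_over L M A n \<pi> \<longrightarrow> (\<exists>a. realizes M n \<pi> a))"

definition automorphism :: "('f, 'r) lang \<Rightarrow> ('f, 'r, 'm) struct \<Rightarrow> ('m \<Rightarrow> 'm) \<Rightarrow> bool" where
  "automorphism L M \<sigma> \<longleftrightarrow> bij_betw \<sigma> (univ M) (univ M) \<and>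
     (\<forall>f\<in>fsyms L. \<forall>xs\<in>tuples M (farity L f). \<sigma> (fint M f xs) = fint M f (map \<sigma> xs)) \<and>
     (\<forall>R\<in>rsyms L. \<forall>xs\<in>tuples M (rarity L R). rint M R xs \<longleftrightarrow> rint M R (map \<sigma> xs))"

definition elementary_map ::
    "('f, 'r) lang \<Rightarrow> ('f, 'r, 'm) struct \<Rightarrow> 'm set \<Rightarrow> ('m \<Rightarrow> 'm) \<Rightarrow> bool" where
  "elementary_map L M A g \<longleftrightarrow> g ` A \<subseteq> univ M \<and>
     (\<forall>c\<in>lists A. \<forall>\<phi>\<in>fmlas L (length c).
        sat M (\<lambda>i. c ! i) \<phi> \<longleftrightarrow> sat M (\<lambda>i. map g c ! i) \<phi>)"

definition strongly_homogeneous :: "('f, 'r) lang \<Rightarrow> ('f, 'r, 'm) struct \<Rightarrow> 'k rel \<Rightarrow> bool" where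
  "strongly_homogeneous L M kb \<longleftrightarrow>
     (\<forall>A g. small_subset M kb A \<and> elementary_map L M A g \<longrightarrow>
        (\<exists>\<sigma>. automorphism L M \<sigma> \<and> (\<forall>x\<in>A. \<sigma> x = g x)))"

text \<open>
  The number of \<open>L\<close>-formulas is \<open>|T| = |L| + \<aleph>\<^sub>0\<close>. Regularity of \<open>kb\<close> makes the union
  of a small family of small sets small.
\<close>

definition monster_model ::
    "('f, 'r) lang \<Rightarrow> ('f, 'r) fm set \<Rightarrow> ('f, 'r, 'm) struct \<Rightarrow> 'k rel \<Rightarrow> bool" where
  "monster_model L T U kb \<longleftrightarrow>
     Card_order kb \<and> regularCard kb \<and> |{\<phi> :: ('f, 'r) fm. wf_fm L \<phi>}| <o kb \<and>
     model_of L T U \<and> saturated L U kb \<and> strongly_homogeneous L U kb"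

text \<open>
  A complete theory is NIP if, in its monster model, no formula \<open>\<phi>(x; y)\<close> shatters an infinite
  set of tuples.
\<close>

definition shatters ::
    "('f, 'r, 'm) struct \<Rightarrow> nat \<Rightarrow> ('f, 'r) fm \<Rightarrow> 'm list set \<Rightarrow> bool" where
  "shatters M m \<phi> S \<longleftrightarrow>
     (\<forall>S0\<subseteq>S. \<exists>b\<in>tuples M m. \<forall>a\<in>S. sat M (\<lambda>i. (a @ b) ! i) \<phi> \<longleftrightarrow> a \<in> S0)"

definition NIP :: "('f, 'r) lang \<Rightarrow> ('f, 'r, 'm) struct \<Rightarrow> bool" where
  "NIP L U \<longleftrightarrow>
     (\<forall>n m. \<forall>\<phi>\<in>fmlas L (n + m). \<not> (\<exists>S\<subseteq>tuples U n. infinite S \<and> shatters U m \<phi> S))"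

section \<open>Indiscernible sequences\<close>

text \<open>
  A sequence is a reflexive linear order \<open>r\<close>, whose field is the index set, together with a
  tuple for each index; values outside the index set are irrelevant.
\<close>

type_synonym ('i, 'm) tseq = "'i rel \<times> ('i \<Rightarrow> 'm list)"

abbreviation idx :: "('i, 'm) tseq \<Rightarrow> 'i set" where
  "idx I \<equiv> Field (fst I)"

definition elems :: "('i, 'm) tseq \<Rightarrow> 'm set" where
  "elems I = (\<Union>j\<in>idx I. set (snd I j))"

definition sequence_of :: "('f, 'r, 'm) struct \<Rightarrow> nat \<Rightarrow> ('i, 'm) tseq \<Rightarrow> bool" where
  "sequence_of M m I \<longleftrightarrow> Linear_order (fst I) \<and> snd I ` idx I \<subseteq> tuples M m"

definition seq_append :: "('i, 'm) tseq \<Rightarrow> ('j, 'm) tseq \<Rightarrow> ('i + 'j, 'm) tseq"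
    (infixl \<open>\<oplus>\<^sub>s\<close> 65) where
  "I \<oplus>\<^sub>s J =
     (map_prod Inl Inl ` fst I \<union> map_prod Inr Inr ` fst J \<union> (Inl ` idx I) \<times> (Inr ` idx J),
      case_sum (snd I) (snd J))"

definition increasing :: "'i rel \<Rightarrow> 'i list \<Rightarrow> bool" where
  "increasing r js \<longleftrightarrow> set js \<subseteq> Field r \<and> sorted_wrt (\<lambda>i j. (i, j) \<in> r \<and> i \<noteq> j) js"

definition indiscernible ::
    "('f, 'r) lang \<Rightarrow> ('f, 'r, 'm) struct \<Rightarrow> 'm set \<Rightarrow> ('i, 'm) tseq \<Rightarrow> bool" where
  "indiscernible L M A I \<longleftrightarrow> (\<exists>m. sequence_of M m I \<and>
     (\<forall>is js. increasing (fst I) is \<and> increasing (fst I) js \<and> length is = length js \<longrightarrow>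
        (\<forall>p\<in>pfmlas L A (length is * m).
           psat M p (concat (map (snd I) is)) \<longleftrightarrow> psat M p (concat (map (snd I) js)))))"

definition mutually_indiscernible ::
    "('f, 'r) lang \<Rightarrow> ('f, 'r, 'm) struct \<Rightarrow> 'm set \<Rightarrow> 'x set \<Rightarrow> ('x \<Rightarrow> ('i, 'm) tseq) \<Rightarrow> bool" where
  "mutually_indiscernible L M A X I \<longleftrightarrow>
     (\<forall>i\<in>X. indiscernible L M (A \<union> (\<Union>j\<in>X - {i}. elems (I j))) (I i))"

definition small_seq :: "'k rel \<Rightarrow> ('i, 'm) tseq \<Rightarrow> bool" where
  "small_seq kb I \<longleftrightarrow> |idx I| <o kb"

definition mutually_stable ::
    "('f, 'r) lang \<Rightarrow> ('f, 'r, 'm) struct \<Rightarrow> 'k rel \<Rightarrow> 'm set \<Rightarrow> 'x set \<Rightarrow>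
      ('x \<Rightarrow> ('k, 'm) tseq) \<Rightarrow> bool" where
  "mutually_stable L U kb A X I \<longleftrightarrow>
     (\<forall>i\<in>X. small_seq kb (I i) \<and> indiscernible L U {} (I i)) \<and>
     (\<exists>(J0 :: 'x \<Rightarrow> ('k, 'm) tseq) (J1 :: 'x \<Rightarrow> ('k, 'm) tseq).
        (\<forall>i\<in>X. small_seq kb (J0 i) \<and> small_seq kb (J1 i) \<and>
           infinite (idx (J0 i)) \<and> infinite (idx (J1 i)) \<and>
           indiscernible L U {} (J0 i \<oplus>\<^sub>s I i \<oplus>\<^sub>s J1 i)) \<and>
        mutually_indiscernible L U A X (\<lambda>i. J0 i \<oplus>\<^sub>s J1 i))"

definition stable_over ::
    "('f, 'r) lang \<Rightarrow> ('f, 'r, 'm) struct \<Rightarrow> 'k rel \<Rightarrow> 'm set \<Rightarrow> ('k, 'm) tseq \<Rightarrow> bool" where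
  "stable_over L U kb A I \<longleftrightarrow> mutually_stable L U kb A {()} (\<lambda>_. I)"

section \<open>Op-dimension\<close>

text \<open>
  Cardinals are relations satisfying \<^const>\<open>Card_order\<close>; the ordinals \<open>i < \<kappa>\<close> are the
  elements of \<open>Field \<kappa>\<close>.
\<close>

definition dlr_pattern ::
    "('f, 'r) lang \<Rightarrow> ('f, 'r, 'm) struct \<Rightarrow> 'k rel \<Rightarrow> 'm set \<Rightarrow> nat \<Rightarrow> ('f, 'r, 'm) pfm set \<Rightarrow>
      'k rel \<Rightarrow> bool" where
  "dlr_pattern L U kb B n \<pi> \<kappa> \<longleftrightarrow>
     (\<exists>a (I :: 'k \<Rightarrow> ('k, 'm) tseq) m \<phi>.
        realizes U n \<pi> a \<and>
        mutually_indiscernible L U B (Field \<kappa>) I \<and>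
        (\<forall>i\<in>Field \<kappa>. small_seq kb (I i) \<and> sequence_of U (m i) (I i) \<and>
           \<phi> i \<in> pfmlas L B (n + m i) \<and>
           infinite {j \<in> idx (I i). psat U (\<phi> i) (a @ snd (I i) j)} \<and>
           infinite {j \<in> idx (I i). \<not> psat U (\<phi> i) (a @ snd (I i) j)}))"

definition dlr_less ::
    "('f, 'r) lang \<Rightarrow> ('f, 'r, 'm) struct \<Rightarrow> 'k rel \<Rightarrow> nat \<Rightarrow> ('f, 'r, 'm) pfm set \<Rightarrow>
      'k rel \<Rightarrow> bool" where
  "dlr_less L U kb n \<pi> \<kappa> \<longleftrightarrow>
     (\<exists>B. small_subset U kb B \<and> params \<pi> \<subseteq> B \<and> \<not> dlr_pattern L U kb B n \<pi> \<kappa>)"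

end

theory Submission
  imports Defs Complex_Main "HOL-Library.Ramsey" "HOL-Library.Product_Lexorder" "HOL-Library.Countable_Set"
begin

text \<open>
  (3) implies (2) by taking \<open>\<lambda> = \<kappa>\<close>. For (1) implies (3), choose the outer sequences \<open>J\<^sup>0\<^sub>i\<close> and \<open>J\<^sup>1\<^sub>i\<close> as
  mutually indiscernible over \<open>A\<close>, \<open>a\<close> and all the \<open>I\<^sub>i\<close>. If \<open>J\<^sup>0\<^sub>i + J\<^sup>1\<^sub>i\<close> is not indiscernible over \<open>a\<close> and
  the other sequences, some formula with parameters in \<open>a\<close>, \<open>A\<close> and elements far from the cut is true on
  the end of \<open>J\<^sup>0\<^sub>i\<close> and false on the beginning of \<open>J\<^sup>1\<^sub>i\<close>; \<open>\<kappa>\<close> such indices would form a pattern as in the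
  definition of op-dimension. For (2) implies (1), a pattern is a mutually stable family, and none of
  its members is stable over \<open>Aa\<close>: if \<open>J\<^sup>0 + I + J\<^sup>1\<close> is indiscernible and \<open>J\<^sup>0 + J\<^sup>1\<close> is indiscernible over
  \<open>a\<close>, every formula over \<open>a\<close> is finite or cofinite on \<open>I\<close>.

  The last fact is where NIP enters. Otherwise finite sequences on which \<open>\<phi>(a, y)\<close> is false could be
  inserted in every cut of an \<open>a\<close>-indiscernible sequence on which it is true. Bounded alternation then
  yields finitely many rows with a gap, and in each gap a finite sequence, such that no choice of one
  new element inside each of these sequences can be inserted simultaneously. The rows are removed one
  at a time, since nested copies of the sequence in the last row, each inconsistent with its own tuple in
  the other rows, again lead to a formula that alternates too often.
\<close>

section \<open>Renaming variables\<close>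

text \<open>When rows are removed, the sequences added in the last row and the tuples found in the
  other rows each fit the array, but need not fit it together. The next sequences must nevertheless
  fit over the earlier tuples. If sequences planted shortly before the intended gap kept failing
  over those tuples, then by pigeonhole one row would fail often, while pieces of the array between
  the failures behave well, against the alternation bound. Rows have the order of the rationals so
  that gaps and the sequences in them can be moved and rescaled.

  A formula that detects a cut has parameters far from the cut, while op-dimension speaks of a
  prescribed base. Hence the array and \<open>a\<close> are replaced by a copy that is indiscernible
  over a base containing both, and the parameters are appended to the tuples of the sequences.

  Types are taken of environments, that is of assignments on arbitrary sets of variables, since
  types in infinitely many variables are realized throughout. Homogeneity appears as the extension
  of an assignment with prescribed type.\<close>

lemma finite_fv_trm: "finite (fv_trm t)"
  by (induction t) auto

lemma finite_fv: "finite (fv \<phi>)"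
  by (induction \<phi>) (auto simp: finite_fv_trm)

lemma eval_trm_cong: "(\<And>v. v \<in> fv_trm t \<Longrightarrow> e v = e' v) \<Longrightarrow> eval_trm M e t = eval_trm M e' t"
proof (induction t)
  case (App f ts)
  hence "map (eval_trm M e) ts = map (eval_trm M e') ts" by auto
  thus ?case by (metis eval_trm.simps(2))
qed simp

lemma sat_cong: "(\<And>v. v \<in> fv \<phi> \<Longrightarrow> e v = e' v) \<Longrightarrow> sat M e \<phi> = sat M e' \<phi>"
proof (induction \<phi> arbitrary: e e')
  case (Eq s t)
  thus ?case using eval_trm_cong[of s e e' M] eval_trm_cong[of t e e' M] by auto
next
  case (Rel R ts)
  hence "map (eval_trm M e) ts = map (eval_trm M e') ts"
    by (auto intro!: eval_trm_cong)
  thus ?case by (metis sat.simps(2))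
next
  case (Neg \<phi>)
  thus ?case by (metis fv.simps(3) sat.simps(3))
next
  case (Conj \<phi> \<psi>)
  thus ?case by (metis UnI1 UnI2 fv.simps(4) sat.simps(4))
next
  case (All v \<phi>)
  have "sat M (e(v := x)) \<phi> = sat M (e'(v := x)) \<phi>" for x
    by (rule All.IH) (use All.prems in auto)
  thus ?case by simp
qed

primrec ren_trm :: "(nat \<Rightarrow> nat) \<Rightarrow> 'f trm \<Rightarrow> 'f trm" where
  "ren_trm g (Var v) = Var (g v)"
| "ren_trm g (App f ts) = App f (map (ren_trm g) ts)"

lemma wf_ren_trm: "wf_trm L t \<Longrightarrow> wf_trm L (ren_trm g t)"
  by (induction t) (auto simp: list_all_iff)

lemma fv_ren_trm: "fv_trm (ren_trm g t) = g ` fv_trm t"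
  by (induction t) auto

lemma eval_ren_trm: "eval_trm M e (ren_trm g t) = eval_trm M (e \<circ> g) t"
proof (induction t)
  case (App f ts)
  hence "map (eval_trm M e \<circ> ren_trm g) ts = map (eval_trm M (e \<circ> g)) ts"
    by (simp del: comp_apply add: comp_apply[of _ "ren_trm g"])
  thus ?case by (metis eval_trm.simps(2) list.map_comp ren_trm.simps(2))
qed (simp add: comp_def)

text \<open>Capture is avoided at a quantifier by a bound variable outside the image of the free
  variables, to which \<open>v\<close> is redirected; this changes \<open>g\<close>, so the
  induction is over all \<open>g\<close>. As \<open>g\<close> need not be injective, variables may
  also be identified.\<close>

lemma renaming:
  "wf_fm L \<phi> \<Longrightarrow>
   \<exists>\<phi>'. wf_fm L \<phi>' \<and> fv \<phi>' \<subseteq> g ` fv \<phi> \<and> (\<forall>e. sat M e \<phi>' \<longleftrightarrow> sat M (e \<circ> g) \<phi>)"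
proof (induction \<phi> arbitrary: g)
  case (Eq s t)
  thus ?case
    by (intro exI[of _ "Eq (ren_trm g s) (ren_trm g t)"])
      (auto simp: wf_ren_trm fv_ren_trm eval_ren_trm comp_def)
next
  case (Rel R ts)
  have "map (eval_trm M e) (map (ren_trm g) ts) = map (eval_trm M (e \<circ> g)) ts" for e
    by (auto simp: eval_ren_trm simp del: comp_apply intro: comp_apply[THEN trans])
  hence "sat M e (Rel R (map (ren_trm g) ts)) = sat M (e \<circ> g) (Rel R ts)" for e
    by (metis sat.simps(2))
  moreover have "fv (Rel R (map (ren_trm g) ts)) \<subseteq> g ` fv (Rel R ts)"
    by (auto simp: fv_ren_trm)
  moreover have "wf_fm L (Rel R (map (ren_trm g) ts))"
    using Rel by (auto simp: wf_ren_trm)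
  ultimately show ?case by blast
next
  case (Neg \<phi>)
  then obtain \<phi>' where "wf_fm L \<phi>'" "fv \<phi>' \<subseteq> g ` fv \<phi>" "\<forall>e. sat M e \<phi>' \<longleftrightarrow> sat M (e \<circ> g) \<phi>"
    by (metis wf_fm.simps(3))
  thus ?case by (intro exI[of _ "Neg \<phi>'"]) (auto simp: comp_def)
next
  case (Conj \<phi> \<psi>)
  then obtain \<phi>' \<psi>' where "wf_fm L \<phi>'" "fv \<phi>' \<subseteq> g ` fv \<phi>" "\<forall>e. sat M e \<phi>' \<longleftrightarrow> sat M (e \<circ> g) \<phi>"
    "wf_fm L \<psi>'" "fv \<psi>' \<subseteq> g ` fv \<psi>" "\<forall>e. sat M e \<psi>' \<longleftrightarrow> sat M (e \<circ> g) \<psi>"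
    by (metis wf_fm.simps(4))
  thus ?case by (intro exI[of _ "Conj \<phi>' \<psi>'"]) (auto simp: comp_def)
next
  case (All v \<phi>)
  obtain w where w: "w \<notin> g ` fv \<phi>"
    using finite_fv[of \<phi>] ex_new_if_finite[of "g ` fv \<phi>"] by auto
  obtain \<phi>' where \<phi>': "wf_fm L \<phi>'" "fv \<phi>' \<subseteq> g(v := w) ` fv \<phi>"
      "\<And>e. sat M e \<phi>' \<longleftrightarrow> sat M (e \<circ> g(v := w)) \<phi>"
    using All.IH[of "g(v := w)"] All.prems by (metis wf_fm.simps(5))
  have "sat M (e(w := x)) \<phi>' \<longleftrightarrow> sat M ((e \<circ> g)(v := x)) \<phi>" for e x
    unfolding \<phi>'(3) using w by (intro sat_cong) auto
  hence "sat M e (All w \<phi>') = sat M (e \<circ> g) (All v \<phi>)" for e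
    unfolding sat.simps by simp
  moreover have "fv (All w \<phi>') \<subseteq> g ` fv (All v \<phi>)" using \<phi>'(2) by (auto split: if_splits)
  ultimately show ?case using \<phi>'(1) by (metis wf_fm.simps(5))
qed

section \<open>Definable predicates on environments\<close>

locale struct_env =
  fixes L :: "('f, 'r) lang" and U :: "('f, 'r, 'm) struct"
  assumes univ_nonempty: "univ U \<noteq> {}"
begin

definition envs :: "('v \<Rightarrow> 'm) set" where
  "envs = {h. range h \<subseteq> univ U}"

text \<open>
  \<open>dfn A S P\<close>: on environments in \<open>U\<close>, the predicate \<open>P\<close> is given by a formula with parameters
  in \<open>A\<close> whose free variables are read off at elements of \<open>S\<close>.
\<close>

definition dfn :: "'m set \<Rightarrow> 'v set \<Rightarrow> (('v \<Rightarrow> 'm) \<Rightarrow> bool) \<Rightarrow> bool" where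
  "dfn A S P \<longleftrightarrow> (\<exists>\<phi> f. wf_fm L \<phi> \<and> (\<forall>i\<in>fv \<phi>. f i \<in> Inl ` S \<union> Inr ` A) \<and>
     (\<forall>h\<in>envs. P h \<longleftrightarrow> sat U (\<lambda>i. case_sum h id (f i)) \<phi>))"

text \<open>Equality of the types over \<open>A\<close> of the families \<open>(h v)\<close> and
  \<open>(h' v)\<close> for \<open>v\<close> in \<open>S\<close>. Predicates are used instead of
  formulas applied to lists because \<open>S\<close> is often infinite.\<close>

definition teq :: "'m set \<Rightarrow> 'v set \<Rightarrow> ('v \<Rightarrow> 'm) \<Rightarrow> ('v \<Rightarrow> 'm) \<Rightarrow> bool" where
  "teq A S h h' \<longleftrightarrow> (\<forall>P. dfn A S P \<longrightarrow> (P h \<longleftrightarrow> P h'))"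

lemma envsI: "(\<And>v. h v \<in> univ U) \<Longrightarrow> h \<in> envs"
  by (auto simp: envs_def)

lemma envsD: "h \<in> envs \<Longrightarrow> h v \<in> univ U"
  by (auto simp: envs_def)

lemma envs_comp: "h \<in> envs \<Longrightarrow> h \<circ> g \<in> envs"
  by (auto simp: envs_def)

lemma envs_upd: "h \<in> envs \<Longrightarrow> x \<in> univ U \<Longrightarrow> h(v := x) \<in> envs"
  by (auto simp: envs_def)

lemma envs_merge: "h \<in> envs \<Longrightarrow> h' \<in> envs \<Longrightarrow> (\<lambda>v. if Q v then h v else h' v) \<in> envs"
  by (auto simp: envs_def)

lemma dfnI:
  assumes "wf_fm L \<phi>" "\<And>i. i \<in> fv \<phi> \<Longrightarrow> f i \<in> Inl ` S \<union> Inr ` A"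
    "\<And>h. h \<in> envs \<Longrightarrow> P h \<longleftrightarrow> sat U (\<lambda>i. case_sum h id (f i)) \<phi>"
  shows "dfn A S P"
  unfolding dfn_def using assms by blast

lemma dfn_mono:
  assumes "dfn A S P" "A \<subseteq> A'" "S \<subseteq> S'"
  shows "dfn A' S' P"
proof -
  obtain \<phi> f where f: "wf_fm L \<phi>" "\<forall>i\<in>fv \<phi>. f i \<in> Inl ` S \<union> Inr ` A"
    "\<forall>h\<in>envs. P h \<longleftrightarrow> sat U (\<lambda>i. case_sum h id (f i)) \<phi>"
    using assms(1) unfolding dfn_def by blast
  have "f i \<in> Inl ` S' \<union> Inr ` A'" if "i \<in> fv \<phi>" for i
    using f(2) that assms(2,3) by blast
  thus ?thesis using dfnI[of \<phi> f S' A' P] f(1,3) by simp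
qed

lemma dfn_cong:
  assumes "dfn A S P" "\<And>h. h \<in> envs \<Longrightarrow> P h \<longleftrightarrow> Q h"
  shows "dfn A S Q"
proof -
  obtain \<phi> f where "wf_fm L \<phi>" "\<forall>i\<in>fv \<phi>. f i \<in> Inl ` S \<union> Inr ` A"
    "\<forall>h\<in>envs. P h \<longleftrightarrow> sat U (\<lambda>i. case_sum h id (f i)) \<phi>"
    using assms(1) unfolding dfn_def by blast
  thus ?thesis using dfnI[of \<phi> f S A Q] assms(2) by simp
qed

lemma dfn_finite_support:
  assumes "dfn A S P"
  obtains A0 S0 where "finite A0" "finite S0" "A0 \<subseteq> A" "S0 \<subseteq> S" "dfn A0 S0 P"
proof -
  obtain \<phi> f where f: "wf_fm L \<phi>" "\<forall>i\<in>fv \<phi>. f i \<in> Inl ` S \<union> Inr ` A"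
    "\<forall>h\<in>envs. P h \<longleftrightarrow> sat U (\<lambda>i. case_sum h id (f i)) \<phi>"
    using assms unfolding dfn_def by blast
  define A0 where "A0 = {a\<in>A. Inr a \<in> f ` fv \<phi>}"
  define S0 where "S0 = {a\<in>S. Inl a \<in> f ` fv \<phi>}"
  have "finite (Inr ` A0 :: ('a + 'm) set)" "finite (Inl ` S0 :: ('a + 'm) set)"
    by (rule finite_subset[of _ "f ` fv \<phi>"]; force simp: A0_def S0_def finite_fv)+
  hence fin: "finite A0" "finite S0"
    using finite_image_iff[of Inl S0] finite_image_iff[of Inr A0] by auto
  have "dfn A0 S0 P"
    unfolding dfn_def
  proof (intro exI conjI)
    show "\<forall>i\<in>fv \<phi>. f i \<in> Inl ` S0 \<union> Inr ` A0"
      using f(2) unfolding A0_def S0_def by (force simp: image_iff)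
  qed (use f in auto)
  with fin show thesis by (intro that[of A0 S0]) (auto simp: A0_def S0_def)
qed

lemma dfn_local:
  assumes "dfn A S P" "h \<in> envs" "h' \<in> envs" "\<And>v. v \<in> S \<Longrightarrow> h v = h' v"
  shows "P h = P h'"
proof -
  obtain \<phi> f where f: "wf_fm L \<phi>" "\<forall>i\<in>fv \<phi>. f i \<in> Inl ` S \<union> Inr ` A"
    "\<forall>h\<in>envs. P h \<longleftrightarrow> sat U (\<lambda>i. case_sum h id (f i)) \<phi>"
    using assms unfolding dfn_def by blast
  have "sat U (\<lambda>i. case_sum h id (f i)) \<phi> \<longleftrightarrow> sat U (\<lambda>i. case_sum h' id (f i)) \<phi>"
    by (rule sat_cong) (use f(2) assms(4) in force)
  with f assms show ?thesis by auto
qed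

text \<open>The common source of reindexing variables and of fixing some of them: \<open>g\<close>
  sends a variable to a variable or to a parameter. That parameters lie in the universe is asked of
  all variables, also outside \<open>S\<close>, because the substituted assignment must again be an
  environment.\<close>

lemma dfn_subst:
  assumes "dfn A S P" "\<And>v c. g v = Inr c \<Longrightarrow> c \<in> univ U"
    and "\<And>v. v \<in> S \<Longrightarrow> g v \<in> Inl ` S' \<union> Inr ` A'" "A \<subseteq> A'"
  shows "dfn A' S' (\<lambda>h. P (\<lambda>v. case_sum h id (g v)))"
proof -
  obtain \<phi> f where f: "wf_fm L \<phi>" "\<forall>i\<in>fv \<phi>. f i \<in> Inl ` S \<union> Inr ` A"
    "\<forall>h\<in>envs. P h \<longleftrightarrow> sat U (\<lambda>i. case_sum h id (f i)) \<phi>"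
    using assms unfolding dfn_def by blast
  define f' where "f' i = (case f i of Inl v \<Rightarrow> g v | Inr c \<Rightarrow> Inr c)" for i
  have 1: "\<forall>i\<in>fv \<phi>. f' i \<in> Inl ` S' \<union> Inr ` A'"
    unfolding f'_def using assms(3,4) f(2) by (fastforce split: sum.splits)
  have 2: "P (\<lambda>v. case_sum h id (g v)) \<longleftrightarrow> sat U (\<lambda>i. case_sum h id (f' i)) \<phi>" if "h \<in> envs" for h
  proof -
    have "(\<lambda>v. case_sum h id (g v)) \<in> envs"
      using that assms(2) by (intro envsI) (auto split: sum.splits simp: envsD)
    moreover have "(\<lambda>i. case_sum (\<lambda>v. case_sum h id (g v)) id (f i)) = (\<lambda>i. case_sum h id (f' i))"
      by (rule ext) (auto simp: f'_def split: sum.splits)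
    ultimately show ?thesis using f(3) by auto
  qed
  show ?thesis unfolding dfn_def using f(1) 1 2 by blast
qed

lemma dfn_reindex:
  assumes "dfn A S P" "g ` S \<subseteq> S'"
  shows "dfn A S' (\<lambda>h. P (h \<circ> g))"
proof -
  have "dfn A S' (\<lambda>h. P (\<lambda>v. case_sum h id (Inl (g v))))"
    by (rule dfn_subst[OF assms(1)]) (use assms(2) in auto)
  thus ?thesis by (simp add: comp_def)
qed

lemma dfn_fix:
  assumes "dfn A S P" "c \<in> envs" "A \<subseteq> A'" "c ` (S \<inter> T) \<subseteq> A'" "S - T \<subseteq> S'"
  shows "dfn A' S' (\<lambda>h. P (\<lambda>v. if v \<in> T then c v else h v))"
proof -
  have "dfn A' S' (\<lambda>h. P (\<lambda>v. case_sum h id (if v \<in> T then Inr (c v) else Inl v)))"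
    by (rule dfn_subst[OF assms(1)]) (use assms envsD in \<open>auto split: if_splits\<close>)
  thus ?thesis by (rule dfn_cong) (rule arg_cong[of _ _ P], auto)
qed

text \<open>Inverse to \<open>dfn_fix\<close>: parameters become variables. As \<open>c\<close> may
  repeat a value, one variable is chosen for each parameter; parameters already in \<open>A\<close>
  stay parameters.\<close>

lemma dfn_unfix:
  assumes "dfn (A \<union> c ` T) S P"
  obtains Q where "dfn A (S \<union> T) Q"
    "\<And>h. h \<in> envs \<Longrightarrow> (\<And>v. v \<in> T \<Longrightarrow> h v = c v) \<Longrightarrow> Q h \<longleftrightarrow> P h"
proof -
  obtain \<phi> f where f: "wf_fm L \<phi>" "\<forall>i\<in>fv \<phi>. f i \<in> Inl ` S \<union> Inr ` (A \<union> c ` T)"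
    "\<forall>h\<in>envs. P h \<longleftrightarrow> sat U (\<lambda>i. case_sum h id (f i)) \<phi>"
    using assms unfolding dfn_def by blast
  define f' where "f' i = (case f i of Inl v \<Rightarrow> Inl v
      | Inr d \<Rightarrow> if d \<in> A then Inr d else Inl (SOME v. v \<in> T \<and> c v = d))" for i
  have some: "(SOME v. v \<in> T \<and> c v = d) \<in> T \<and> c (SOME v. v \<in> T \<and> c v = d) = d" if "d \<in> c ` T" for d
    using that by (metis (mono_tags, lifting) imageE someI_ex)
  show thesis
  proof
    show "dfn A (S \<union> T) (\<lambda>h. sat U (\<lambda>i. case_sum h id (f' i)) \<phi>)"
      unfolding dfn_def
    proof (intro exI conjI)
      show "\<forall>i\<in>fv \<phi>. f' i \<in> Inl ` (S \<union> T) \<union> Inr ` A"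
      proof
        fix i assume "i \<in> fv \<phi>"
        then consider v where "v \<in> S" "f i = Inl v" | d where "d \<in> A" "f i = Inr d"
          | d where "d \<in> c ` T" "d \<notin> A" "f i = Inr d" using f(2) by blast
        thus "f' i \<in> Inl ` (S \<union> T) \<union> Inr ` A"
          by cases (use some in \<open>simp_all add: f'_def\<close>)
      qed
    qed (use f(1) in auto)
  next
    fix h assume h: "h \<in> envs" "\<And>v. v \<in> T \<Longrightarrow> h v = c v"
    have "sat U (\<lambda>i. case_sum h id (f' i)) \<phi> \<longleftrightarrow> sat U (\<lambda>i. case_sum h id (f i)) \<phi>"
    proof (rule sat_cong)
      fix i assume "i \<in> fv \<phi>"
      then consider v where "v \<in> S" "f i = Inl v" | d where "d \<in> A" "f i = Inr d"
        | d where "d \<in> c ` T" "d \<notin> A" "f i = Inr d" using f(2) by blast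
      thus "case_sum h id (f' i) = case_sum h id (f i)"
        by cases (use some h(2) in \<open>simp_all add: f'_def\<close>)
    qed
    thus "sat U (\<lambda>i. case_sum h id (f' i)) \<phi> \<longleftrightarrow> P h" using f(3) h(1) by blast
  qed
qed

lemma dfn_Neg:
  assumes "dfn A S P"
  shows "dfn A S (\<lambda>h. \<not> P h)"
proof -
  obtain \<phi> f where f: "wf_fm L \<phi>" "\<forall>i\<in>fv \<phi>. f i \<in> Inl ` S \<union> Inr ` A"
    "\<forall>h\<in>envs. P h \<longleftrightarrow> sat U (\<lambda>i. case_sum h id (f i)) \<phi>"
    using assms unfolding dfn_def by blast
  show ?thesis
    unfolding dfn_def
  proof (intro exI conjI ballI)
    show "wf_fm L (Neg \<phi>)" using f by simp
    show "f i \<in> Inl ` S \<union> Inr ` A" if "i \<in> fv (Neg \<phi>)" for i using that f(2) by auto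
    show "(\<not> P h) \<longleftrightarrow> sat U (\<lambda>i. case_sum h id (f i)) (Neg \<phi>)" if "h \<in> envs" for h
      using f(3) that by simp
  qed
qed

lemma dfn_Conj:
  assumes "dfn A S P" "dfn A S Q"
  shows "dfn A S (\<lambda>h. P h \<and> Q h)"
proof -
  obtain \<phi> f where f: "wf_fm L \<phi>" "\<forall>i\<in>fv \<phi>. f i \<in> Inl ` S \<union> Inr ` A"
    "\<forall>h\<in>envs. P h \<longleftrightarrow> sat U (\<lambda>i. case_sum h id (f i)) \<phi>"
    using assms(1) unfolding dfn_def by blast
  obtain \<psi> g where g: "wf_fm L \<psi>" "\<forall>i\<in>fv \<psi>. g i \<in> Inl ` S \<union> Inr ` A"
    "\<forall>h\<in>envs. Q h \<longleftrightarrow> sat U (\<lambda>i. case_sum h id (g i)) \<psi>"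
    using assms(2) unfolding dfn_def by blast
  \<comment> \<open>The two formulas read their variables in unrelated ways, so they are first moved
    to the even and to the odd variables.\<close>
  obtain \<phi>' where \<phi>': "wf_fm L \<phi>'" "fv \<phi>' \<subseteq> (\<lambda>i. 2 * i) ` fv \<phi>"
    "\<And>e. sat U e \<phi>' \<longleftrightarrow> sat U (e \<circ> (\<lambda>i. 2 * i)) \<phi>"
    using renaming[OF f(1), of "\<lambda>i. 2 * i" U] by blast
  obtain \<psi>' where \<psi>': "wf_fm L \<psi>'" "fv \<psi>' \<subseteq> (\<lambda>i. Suc (2 * i)) ` fv \<psi>"
    "\<And>e. sat U e \<psi>' \<longleftrightarrow> sat U (e \<circ> (\<lambda>i. Suc (2 * i))) \<psi>"
    using renaming[OF g(1), of "\<lambda>i. Suc (2 * i)" U] by blast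
  define k where "k i = (if even i then f (i div 2) else g (i div 2))" for i :: nat
  have k: "k (2 * i) = f i" "k (Suc (2 * i)) = g i" for i
    by (auto simp: k_def)
  show ?thesis
    unfolding dfn_def
  proof (intro exI conjI ballI)
    show "wf_fm L (Conj \<phi>' \<psi>')" using \<phi>' \<psi>' by simp
    show "k i \<in> Inl ` S \<union> Inr ` A" if "i \<in> fv (Conj \<phi>' \<psi>')" for i
    proof -
      from that have "i \<in> (\<lambda>i. 2 * i) ` fv \<phi> \<or> i \<in> (\<lambda>i. Suc (2 * i)) ` fv \<psi>"
        using \<phi>'(2) \<psi>'(2) by auto
      thus ?thesis using f(2) g(2) k by auto
    qed
    show "P h \<and> Q h \<longleftrightarrow> sat U (\<lambda>i. case_sum h id (k i)) (Conj \<phi>' \<psi>')" if "h \<in> envs" for h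
      using that f(3) g(3) by (simp add: \<phi>'(3) \<psi>'(3) comp_def k)
  qed
qed

lemma dfn_True: "dfn A S (\<lambda>h. True)"
  unfolding dfn_def
  by (intro exI[of _ "All 0 (Eq (Var 0) (Var 0))"]) auto

lemma dfn_const: "dfn A S (\<lambda>h. b)"
  using dfn_True dfn_Neg[OF dfn_True] by (cases b) auto

lemma dfn_Ball:
  assumes "finite \<Sigma>" "\<And>p. p \<in> \<Sigma> \<Longrightarrow> dfn A S (F p)"
  shows "dfn A S (\<lambda>h. \<forall>p\<in>\<Sigma>. F p h)"
  using assms
proof (induction \<Sigma>)
  case (insert p \<Sigma>)
  thus ?case using dfn_Conj[of A S "F p" "\<lambda>h. \<forall>p\<in>\<Sigma>. F p h"] by simp
qed (simp add: dfn_True)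

lemma dfn_iff:
  assumes "dfn A S P" "dfn A S Q"
  shows "dfn A S (\<lambda>h. P h \<longleftrightarrow> Q h)"
  by (rule dfn_cong[OF dfn_Conj[OF dfn_Neg[OF dfn_Conj[OF assms(1) dfn_Neg[OF assms(2)]]]
     dfn_Neg[OF dfn_Conj[OF assms(2) dfn_Neg[OF assms(1)]]]]]) auto

lemma dfn_eq_const: "v \<in> S \<Longrightarrow> c \<in> A \<Longrightarrow> dfn A S (\<lambda>h. h v = c)"
  unfolding dfn_def
  by (intro exI[of _ "Eq (Var 0) (Var 1)"] exI[of _ "\<lambda>i. if i = 0 then Inl v else Inr c"]) auto

lemma dfn_Ex1:
  assumes "dfn A S P"
  shows "dfn A (S - {v}) (\<lambda>h. \<exists>x\<in>univ U. P (h(v := x)))"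
proof -
  obtain \<phi> f where f: "wf_fm L \<phi>" "\<forall>i\<in>fv \<phi>. f i \<in> Inl ` S \<union> Inr ` A"
    "\<forall>h\<in>envs. P h \<longleftrightarrow> sat U (\<lambda>i. case_sum h id (f i)) \<phi>"
    using assms(1) unfolding dfn_def by blast
  \<comment> \<open>Every variable that is read at \<open>v\<close> is merged into variable 0 and
    the others are shifted by one, so that a single quantifier binds them all.\<close>
  define g where "g i = (if f i = Inl v then 0 else Suc i)" for i
  obtain \<phi>' where \<phi>': "wf_fm L \<phi>'" "fv \<phi>' \<subseteq> g ` fv \<phi>" "\<And>e. sat U e \<phi>' \<longleftrightarrow> sat U (e \<circ> g) \<phi>"
    using renaming[OF f(1), of g U] by blast
  define f' where "f' i = (case i of 0 \<Rightarrow> Inl v | Suc j \<Rightarrow> f j)" for i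
  have *: "sat U ((\<lambda>i. case_sum h id (f' i))(0 := x)) \<phi>' \<longleftrightarrow> P (h(v := x))"
    if "h \<in> envs" "x \<in> univ U" for h x
  proof -
    have "((\<lambda>i. case_sum h id (f' i))(0 := x) \<circ> g) = (\<lambda>i. case_sum (h(v := x)) id (f i))"
      by (rule ext) (auto simp: g_def f'_def split: sum.splits)
    thus ?thesis using f(3) that by (simp add: \<phi>'(3) envs_upd)
  qed
  show ?thesis
    unfolding dfn_def
  proof (intro exI conjI ballI)
    show "wf_fm L (Neg (All 0 (Neg \<phi>')))" using \<phi>' by simp
    show "f' i \<in> Inl ` (S - {v}) \<union> Inr ` A" if "i \<in> fv (Neg (All 0 (Neg \<phi>')))" for i
      using that \<phi>'(2) f(2) by (force simp: g_def f'_def split: if_splits)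
    show "(\<exists>x\<in>univ U. P (h(v := x))) \<longleftrightarrow> sat U (\<lambda>i. case_sum h id (f' i)) (Neg (All 0 (Neg \<phi>')))"
      if "h \<in> envs" for h
      using *[OF that] by simp
  qed
qed

lemma dfn_Ex_finite:
  assumes "finite F" "dfn A S P"
  shows "dfn A (S - F) (\<lambda>h. \<exists>h'\<in>envs. (\<forall>v. v \<notin> F \<longrightarrow> h' v = h v) \<and> P h')"
  using assms
proof (induction F)
  case empty
  have "(\<exists>h'\<in>envs. (\<forall>v. h' v = h v) \<and> P h') \<longleftrightarrow> P h" if "h \<in> envs" for h
    using that by (metis ext)
  thus ?case using empty by (auto intro: dfn_cong)
next
  case (insert v F)
  have "dfn A (S - F - {v})
     (\<lambda>h. \<exists>x\<in>univ U. \<exists>h'\<in>envs. (\<forall>w. w \<notin> F \<longrightarrow> h' w = (h(v := x)) w) \<and> P h')"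
    using dfn_Ex1[OF insert.IH[OF insert.prems]] .
  moreover have "S - F - {v} = S - insert v F" by auto
  moreover have "(\<exists>x\<in>univ U. \<exists>h'\<in>envs. (\<forall>w. w \<notin> F \<longrightarrow> h' w = (h(v := x)) w) \<and> P h') \<longleftrightarrow>
      (\<exists>h'\<in>envs. (\<forall>w. w \<notin> insert v F \<longrightarrow> h' w = h w) \<and> P h')" for h
  proof
    assume "\<exists>h'\<in>envs. (\<forall>w. w \<notin> insert v F \<longrightarrow> h' w = h w) \<and> P h'"
    then obtain h' where h': "h' \<in> envs" "\<And>w. w \<notin> insert v F \<Longrightarrow> h' w = h w" "P h'" by auto
    thus "\<exists>x\<in>univ U. \<exists>h'\<in>envs. (\<forall>w. w \<notin> F \<longrightarrow> h' w = (h(v := x)) w) \<and> P h'"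
      by (intro bexI[of _ "h' v"] bexI[of _ h']) (auto simp: envsD)
  next
    assume "\<exists>x\<in>univ U. \<exists>h'\<in>envs. (\<forall>w. w \<notin> F \<longrightarrow> h' w = (h(v := x)) w) \<and> P h'"
    then obtain x h' where "h' \<in> envs" "\<forall>w. w \<notin> F \<longrightarrow> h' w = (h(v := x)) w" "P h'" by blast
    thus "\<exists>h'\<in>envs. (\<forall>w. w \<notin> insert v F \<longrightarrow> h' w = h w) \<and> P h'"
      by (intro bexI[of _ h']) auto
  qed
  ultimately show ?case by (auto intro: dfn_cong)
qed

text \<open>Quantification over all variables outside \<open>T\<close>, of which there may be
  infinitely many: finite support reduces it to finitely many quantifiers.\<close>

lemma dfn_Ex:
  assumes "dfn A S P"
  shows "dfn A (S \<inter> T) (\<lambda>h. \<exists>h'\<in>envs. (\<forall>v\<in>T. h' v = h v) \<and> P h')"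
proof -
  obtain A0 S0 where fin: "finite A0" "finite S0" "A0 \<subseteq> A" "S0 \<subseteq> S" "dfn A0 S0 P"
    using dfn_finite_support[OF assms] .
  have "dfn A0 (S0 - (S0 - T)) (\<lambda>h. \<exists>h'\<in>envs. (\<forall>v. v \<notin> S0 - T \<longrightarrow> h' v = h v) \<and> P h')"
    by (rule dfn_Ex_finite) (use fin in auto)
  hence "dfn A (S \<inter> T) (\<lambda>h. \<exists>h'\<in>envs. (\<forall>v. v \<notin> S0 - T \<longrightarrow> h' v = h v) \<and> P h')"
    by (rule dfn_mono) (use fin in auto)
  thus ?thesis
  proof (rule dfn_cong)
    fix h :: "'a \<Rightarrow> 'm" assume h: "h \<in> envs"
    show "(\<exists>h'\<in>envs. (\<forall>v. v \<notin> S0 - T \<longrightarrow> h' v = h v) \<and> P h') \<longleftrightarrow>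
      (\<exists>h'\<in>envs. (\<forall>v\<in>T. h' v = h v) \<and> P h')"
    proof
      assume "\<exists>h'\<in>envs. (\<forall>v\<in>T. h' v = h v) \<and> P h'"
      then obtain h' where h': "h' \<in> envs" "\<And>v. v \<in> T \<Longrightarrow> h' v = h v" "P h'" by auto
      define k where "k v = (if v \<in> S0 then h' v else h v)" for v
      have "k \<in> envs" using h h' by (auto simp: k_def[abs_def] intro: envs_merge)
      moreover have "P k" using dfn_local[OF fin(5) \<open>k \<in> envs\<close> h'(1)] h'(3) by (auto simp: k_def)
      ultimately show "\<exists>h'\<in>envs. (\<forall>v. v \<notin> S0 - T \<longrightarrow> h' v = h v) \<and> P h'"
        using h'(2) by (intro bexI[of _ k]) (auto simp: k_def)
    qed auto
  qed
qed

subsection \<open>Formulas with parameters and definable predicates\<close>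

lemma nth_index: "x \<in> set xs \<Longrightarrow> \<exists>i<length xs. xs ! i = x"
  by (metis in_set_conv_nth)

text \<open>Passage from predicates back to formulas \<open>\<phi>(x; c)\<close>. Each variable is
  read at one chosen position of \<open>xs\<close> and each parameter at one chosen position of
  \<open>cs\<close>, so repetitions in these lists do no harm.\<close>

lemma dfn_imp_pfm:
  assumes "dfn B S Q" "S \<subseteq> set xs"
  obtains p where "p \<in> pfmlas L B (length xs)" "\<And>h. h \<in> envs \<Longrightarrow> psat U p (map h xs) \<longleftrightarrow> Q h"
proof -
  obtain \<phi> f where f: "wf_fm L \<phi>" "\<forall>i\<in>fv \<phi>. f i \<in> Inl ` S \<union> Inr ` B"
    "\<forall>h\<in>envs. Q h \<longleftrightarrow> sat U (\<lambda>i. case_sum h id (f i)) \<phi>"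
    using assms(1) unfolding dfn_def by blast
  have "finite (Inr ` {a\<in>B. Inr a \<in> f ` fv \<phi>} :: ('a + 'm) set)"
    by (rule finite_subset[of _ "f ` fv \<phi>"]) (auto simp: finite_fv)
  hence "finite {a\<in>B. Inr a \<in> f ` fv \<phi>}"
    by (rule finite_imageD) simp
  then obtain cs where cs: "set cs = {a\<in>B. Inr a \<in> f ` fv \<phi>}"
    by (meson finite_list)
  define ind' where "ind' ys y = (SOME i. i < length ys \<and> ys ! i = y)" for ys :: "'a list" and y
  have ind': "ind' ys y < length ys \<and> ys ! ind' ys y = y" if "y \<in> set ys" for ys :: "'a list" and y
    unfolding ind'_def by (rule someI_ex) (use nth_index[OF that] in auto)
  define indm where "indm ys y = (SOME i. i < length ys \<and> ys ! i = y)" for ys :: "'m list" and y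
  have indm: "indm ys y < length ys \<and> ys ! indm ys y = y" if "y \<in> set ys" for ys :: "'m list" and y
    unfolding indm_def by (rule someI_ex) (use nth_index[OF that] in auto)
  define g where "g i = (case f i of Inl v \<Rightarrow> ind' xs v | Inr c \<Rightarrow> length xs + indm cs c)" for i
  obtain \<phi>' where \<phi>': "wf_fm L \<phi>'" "fv \<phi>' \<subseteq> g ` fv \<phi>" "\<And>e. sat U e \<phi>' \<longleftrightarrow> sat U (e \<circ> g) \<phi>"
    using renaming[OF f(1), of g U] by blast
  have g: "(\<exists>v\<in>S. f i = Inl v \<and> g i < length xs \<and> xs ! g i = v) \<or>
      (\<exists>c\<in>B. f i = Inr c \<and> length xs \<le> g i \<and> g i < length xs + length cs \<and> cs ! (g i - length xs) = c)"
    if i: "i \<in> fv \<phi>" for i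
  proof -
    consider v where "v \<in> S" "f i = Inl v" | c where "c \<in> B" "f i = Inr c" using f(2) i by blast
    thus ?thesis
    proof cases
      case 1
      thus ?thesis using ind'[of v xs] assms(2) by (auto simp: g_def)
    next
      case 2
      hence "c \<in> set cs" using i by (force simp: cs)
      thus ?thesis using indm[of c cs] 2 by (auto simp: g_def)
    qed
  qed
  show thesis
  proof
    have "fv \<phi>' \<subseteq> {..<length xs + length cs}" using \<phi>'(2) g by fastforce
    thus "(\<phi>', cs) \<in> pfmlas L B (length xs)"
      using \<phi>'(1) by (auto simp: pfmlas_def fmlas_def cs)
    fix h :: "'a \<Rightarrow> 'm" assume h: "h \<in> envs"
    have "sat U ((\<lambda>i. (map h xs @ cs) ! i) \<circ> g) \<phi> \<longleftrightarrow> sat U (\<lambda>i. case_sum h id (f i)) \<phi>"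
      by (rule sat_cong) (use g in \<open>fastforce simp: nth_append\<close>)
    thus "psat U (\<phi>', cs) (map h xs) = Q h"
      using f(3) h by (simp add: psat_def \<phi>'(3))
  qed
qed

lemma pfm_imp_dfn:
  assumes "p \<in> pfmlas L B (length xs)"
  shows "dfn B (set xs) (\<lambda>h. psat U p (map h xs))"
proof -
  obtain \<phi> cs where p: "p = (\<phi>, cs)" by (cases p)
  have w: "wf_fm L \<phi>" "fv \<phi> \<subseteq> {..<length xs + length cs}" "set cs \<subseteq> B"
    using assms by (auto simp: p pfmlas_def fmlas_def)
  show ?thesis
    unfolding dfn_def p
  proof (intro exI conjI ballI)
    let ?f = "\<lambda>i. if i < length xs then Inl (xs ! i) else Inr (cs ! (i - length xs))"
    show "wf_fm L \<phi>" using w by simp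
    show "?f i \<in> Inl ` set xs \<union> Inr ` B" if "i \<in> fv \<phi>" for i
    proof (cases "i < length xs")
      case False
      hence "i - length xs < length cs" using that w(2) by fastforce
      thus ?thesis using False w(3) nth_mem by fastforce
    qed auto
    show "psat U (\<phi>, cs) (map h xs) \<longleftrightarrow> sat U (\<lambda>i. case_sum h id (?f i)) \<phi>" for h
      unfolding psat_def by (simp, rule sat_cong) (use w(2) in \<open>force simp: nth_append\<close>)
  qed
qed

subsection \<open>Equality of types\<close>

lemma teqD: "teq A S h h' \<Longrightarrow> dfn A S P \<Longrightarrow> P h \<longleftrightarrow> P h'"
  by (auto simp: teq_def)

lemma teq_refl: "teq A S h h" by (simp add: teq_def)

lemma teq_sym: "teq A S h h' \<Longrightarrow> teq A S h' h" unfolding teq_def by blast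

lemma teq_trans: "teq A S h h' \<Longrightarrow> teq A S h' h'' \<Longrightarrow> teq A S h h''" unfolding teq_def by blast

lemma teq_mono: "teq A' S' h h' \<Longrightarrow> A \<subseteq> A' \<Longrightarrow> S \<subseteq> S' \<Longrightarrow> teq A S h h'"
  unfolding teq_def using dfn_mono[of A S _ A' S'] by blast

lemma teq_agree: "h \<in> envs \<Longrightarrow> h' \<in> envs \<Longrightarrow> (\<And>v. v \<in> S \<Longrightarrow> h v = h' v) \<Longrightarrow> teq A S h h'"
  unfolding teq_def using dfn_local[of A S _ h h'] by blast

lemma teq_reindex: "teq A S' h h' \<Longrightarrow> g ` S \<subseteq> S' \<Longrightarrow> teq A S (h \<circ> g) (h' \<circ> g)"
  unfolding teq_def using dfn_reindex[of A S _ g S'] by blast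

lemma teq_finite:
  assumes "\<And>S0. finite S0 \<Longrightarrow> S0 \<subseteq> S \<Longrightarrow> teq A S0 h h'"
  shows "teq A S h h'"
  unfolding teq_def
proof (intro allI impI)
  fix P :: "('a \<Rightarrow> 'm) \<Rightarrow> bool" assume "dfn A S P"
  then obtain A0 S0 where "finite S0" "A0 \<subseteq> A" "S0 \<subseteq> S" "dfn A0 S0 P"
    by (rule dfn_finite_support)
  thus "P h = P h'" using assms[of S0] teqD[of A S0 h h' P] dfn_mono[of A0 S0 P A S0] by blast
qed

end

section \<open>Realizing types in saturated models\<close>

text \<open>Uncountability of \<open>kb\<close> makes every countable set of variables small, so
  that types of arrays indexed by naturals and rationals can be realized. Regularity keeps the union
  of a small family of small sequences small.\<close>

locale monster = struct_env L U
  for L :: "('f, 'r) lang" and U :: "('f, 'r, 'm) struct" +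
  fixes kb :: "'k rel"
  assumes kb_card: "Card_order kb" and kb_regular: "regularCard kb" and kb_unc: "natLeq <o kb"
    and kb_sat: "saturated L U kb"
begin

lemma kb_inf: "\<not> finite (Field kb)"
proof
  assume "finite (Field kb)"
  hence "|Field kb| <o natLeq" by (simp add: finite_iff_ordLess_natLeq)
  hence "|Field kb| <o kb" using kb_unc ordLess_transitive by blast
  thus False using card_of_Field_ordIso[OF kb_card] not_ordLess_ordIso by blast
qed

lemma kb_Cinf: "Cinfinite kb"
  using kb_inf kb_card by (simp add: cinfinite_def)

lemma small_countable: "countable S \<Longrightarrow> |S| <o kb"
  using kb_unc ordLeq_ordLess_trans card_of_nat ordLeq_ordIso_trans
  by (metis UNIV_I card_of_ordLeqI countableE)

lemma small_subset_mono: "|T| <o kb \<Longrightarrow> S \<subseteq> T \<Longrightarrow> |S| <o kb"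
  by (meson card_of_mono1 ordLeq_ordLess_trans)

lemma small_image: "|S| <o kb \<Longrightarrow> |f ` S| <o kb"
  by (meson card_of_image ordLeq_ordLess_trans)

lemma small_Un: "|S| <o kb \<Longrightarrow> |T| <o kb \<Longrightarrow> |S \<union> T| <o kb"
  using card_of_Un_ordLess_infinite_Field kb_inf kb_card by blast

lemma small_UN: "|I| <o kb \<Longrightarrow> (\<And>i. i \<in> I \<Longrightarrow> |F i| <o kb) \<Longrightarrow> |\<Union>i\<in>I. F i| <o kb"
  using regularCard_UNION_bound[OF kb_Cinf kb_regular] by blast

lemma small_finite: "finite S \<Longrightarrow> |S| <o kb"
  by (simp add: small_countable countable_finite)

lemma small_Sigma: "|I| <o kb \<Longrightarrow> (\<And>i. i \<in> I \<Longrightarrow> |F i| <o kb) \<Longrightarrow> |Sigma I F| <o kb"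
  unfolding Sigma_def by (intro small_UN) (auto intro: small_finite)

text \<open>Saturation realizes types in finitely many variables, whereas \<open>V\<close> may be
  infinite. A maximal partial assignment that is finitely consistent with \<open>\<Sigma>\<close> is
  total: its values form a small set of parameters, and the conditions projected to one further
  variable form a type in one variable over them.\<close>

theorem realize:
  fixes V :: "'v set"
  assumes V: "|V| <o kb" and A: "|A| <o kb" "A \<subseteq> univ U"
    and \<Sigma>: "\<And>P. P \<in> \<Sigma> \<Longrightarrow> dfn A V P"
    and fin: "\<And>\<Sigma>0. finite \<Sigma>0 \<Longrightarrow> \<Sigma>0 \<subseteq> \<Sigma> \<Longrightarrow> \<exists>h\<in>envs. \<forall>P\<in>\<Sigma>0. P h"
  shows "\<exists>h\<in>envs. \<forall>P\<in>\<Sigma>. P h"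
proof -
  \<comment> \<open>The partial assignment is kept as a set of pairs. That it is single valued
    follows from consistency with any two of its pairs.\<close>
  define ok where "ok G \<longleftrightarrow> (\<forall>\<Sigma>0 G0. finite \<Sigma>0 \<and> \<Sigma>0 \<subseteq> \<Sigma> \<and> finite G0 \<and> G0 \<subseteq> G \<longrightarrow>
    (\<exists>h\<in>envs. (\<forall>q\<in>G0. h (fst q) = snd q) \<and> (\<forall>P\<in>\<Sigma>0. P h)))" for G :: "('v \<times> 'm) set"
  define \<G> where "\<G> = {G. G \<subseteq> V \<times> univ U \<and> ok G}"
  have okD: "\<exists>h\<in>envs. (\<forall>q\<in>G0. h (fst q) = snd q) \<and> (\<forall>P\<in>\<Sigma>0. P h)"
    if "ok G" "finite \<Sigma>0" "\<Sigma>0 \<subseteq> \<Sigma>" "finite G0" "G0 \<subseteq> G" for G \<Sigma>0 G0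
    using that unfolding ok_def by simp
  have "{} \<in> \<G>" using fin by (auto simp: \<G>_def ok_def)
  moreover have "\<Union>\<C> \<in> \<G>" if c: "\<C> \<noteq> {}" "subset.chain \<G> \<C>" for \<C>
  proof -
    have sub: "\<C> \<subseteq> \<G>" using c by (simp add: subset_chain_def)
    have "ok (\<Union>\<C>)"
      unfolding ok_def
    proof (intro allI impI, elim conjE)
      fix \<Sigma>0 G0 assume *: "finite \<Sigma>0" "\<Sigma>0 \<subseteq> \<Sigma>" "finite G0" "G0 \<subseteq> \<Union>\<C>"
      obtain G where G: "G \<in> \<C>" "G0 \<subseteq> G"
        using finite_subset_Union_chain[OF *(3,4) c] by blast
      hence "ok G" using sub by (auto simp: \<G>_def)
      thus "\<exists>h\<in>envs. (\<forall>q\<in>G0. h (fst q) = snd q) \<and> (\<forall>P\<in>\<Sigma>0. P h)"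
        using okD * G by blast
    qed
    thus ?thesis using sub by (auto simp: \<G>_def)
  qed
  ultimately obtain G where G: "G \<in> \<G>" "\<And>G'. G' \<in> \<G> \<Longrightarrow> G \<subseteq> G' \<Longrightarrow> G' = G"
    using subset_Zorn_nonempty[of \<G>] by blast
  have okG: "ok G" and GV: "G \<subseteq> V \<times> univ U" using G(1) by (auto simp: \<G>_def)
  have sv: "x = y" if "(v, x) \<in> G" "(v, y) \<in> G" for v x y
    using okD[OF okG, of "{}" "{(v, x), (v, y)}"] that by auto
  have "|snd ` G| \<le>o |V|"
  proof -
    have "snd ` G \<subseteq> (\<lambda>v. THE x. (v, x) \<in> G) ` V"
    proof
      fix x assume "x \<in> snd ` G"
      then obtain v where v: "(v, x) \<in> G" by auto
      hence "(THE x. (v, x) \<in> G) = x" using sv by blast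
      thus "x \<in> (\<lambda>v. THE x. (v, x) \<in> G) ` V" using v GV by force
    qed
    thus ?thesis by (meson card_of_image card_of_mono1 ordLeq_transitive)
  qed
  hence sm: "|snd ` G| <o kb" using V ordLeq_ordLess_trans by blast
  define B where "B = A \<union> snd ` G"
  have Bsm: "|B| <o kb" and BU: "B \<subseteq> univ U"
    using small_Un[OF A(1) sm] A(2) GV by (auto simp: B_def)
  have dom: "V \<subseteq> fst ` G"
  proof
    fix v assume v: "v \<in> V"
    show "v \<in> fst ` G"
    proof (rule ccontr)
      assume nv: "v \<notin> fst ` G"
      \<comment> \<open>The conditions \<open>\<Sigma>0\<close> and the values prescribed by
        \<open>G0\<close>, projected to the new variable \<open>v\<close>.\<close>
      define Q where "Q \<Sigma>0 G0 h \<longleftrightarrow> (\<exists>h'\<in>envs. (\<forall>w\<in>{v}. h' w = h w) \<and>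
          ((\<forall>q\<in>G0. h' (fst q) = snd q) \<and> (\<forall>P\<in>\<Sigma>0. P h')))" for \<Sigma>0 G0 and h :: "'v \<Rightarrow> 'm"
      define I where "I = {(\<Sigma>0, G0). finite \<Sigma>0 \<and> \<Sigma>0 \<subseteq> \<Sigma> \<and> finite G0 \<and> G0 \<subseteq> G}"
      have dQ: "dfn B {v} (Q (fst i) (snd i))" if iI: "i \<in> I" for i
      proof -
        obtain \<Sigma>0 G0 where i: "i = (\<Sigma>0, G0)" "finite \<Sigma>0" "\<Sigma>0 \<subseteq> \<Sigma>" "finite G0" "G0 \<subseteq> G"
          using iI unfolding I_def by blast
        have 1: "dfn B V (\<lambda>h. \<forall>q\<in>G0. h (fst q) = snd q)"
        proof (rule dfn_Ball)
          fix q assume "q \<in> G0"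
          hence "q \<in> G" using i by auto
          thus "dfn B V (\<lambda>h. h (fst q) = snd q)"
            using GV by (intro dfn_eq_const) (auto simp: B_def)
        qed (use i in simp)
        have 2: "dfn B V (\<lambda>h. \<forall>P\<in>\<Sigma>0. P h)"
        proof (rule dfn_Ball)
          fix P assume "P \<in> \<Sigma>0"
          hence "dfn A V P" using i \<Sigma> by auto
          thus "dfn B V P" by (rule dfn_mono) (auto simp: B_def)
        qed (use i in simp)
        have "dfn B (V \<inter> {v}) (Q \<Sigma>0 G0)"
          unfolding Q_def by (rule dfn_Ex) (rule dfn_Conj[OF 1 2])
        thus ?thesis using v by (auto simp: i)
      qed
      have "\<forall>i\<in>I. \<exists>p. p \<in> pfmlas L B (length [v]) \<and> (\<forall>h\<in>envs. psat U p (map h [v]) \<longleftrightarrow> Q (fst i) (snd i) h)"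
      proof
        fix i assume "i \<in> I"
        show "\<exists>p. p \<in> pfmlas L B (length [v]) \<and> (\<forall>h\<in>envs. psat U p (map h [v]) \<longleftrightarrow> Q (fst i) (snd i) h)"
        proof (rule dfn_imp_pfm[OF dQ[OF \<open>i \<in> I\<close>], of "[v]"])
          fix p assume "p \<in> pfmlas L B (length [v])"
            "\<And>h. h \<in> envs \<Longrightarrow> psat U p (map h [v]) = Q (fst i) (snd i) h"
          thus ?thesis by blast
        qed simp
      qed
      then obtain p where p: "\<And>i. i \<in> I \<Longrightarrow> p i \<in> pfmlas L B 1"
        "\<And>i h. i \<in> I \<Longrightarrow> h \<in> envs \<Longrightarrow> psat U (p i) [h v] \<longleftrightarrow> Q (fst i) (snd i) h"
        by (metis (no_types, lifting) One_nat_def length_Cons list.map(1,2) list.size(3))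
      have "partial_type_over L U B 1 (p ` I)"
        unfolding partial_type_over_def
      proof (intro conjI allI impI)
        show "p ` I \<subseteq> pfmlas L B 1" using p(1) by auto
        fix \<pi>0 assume "\<pi>0 \<subseteq> p ` I" "finite \<pi>0"
        then obtain I0 where I0: "I0 \<subseteq> I" "finite I0" "\<pi>0 = p ` I0"
          by (meson finite_subset_image)
        have F: "finite (\<Union>(fst ` I0))" "\<Union>(fst ` I0) \<subseteq> \<Sigma>" "finite (\<Union>(snd ` I0))" "\<Union>(snd ` I0) \<subseteq> G"
        proof -
          have "\<forall>i\<in>I0. finite (fst i) \<and> fst i \<subseteq> \<Sigma> \<and> finite (snd i) \<and> snd i \<subseteq> G"
            using I0(1) unfolding I_def by fastforce
          thus "finite (\<Union>(fst ` I0))" "\<Union>(fst ` I0) \<subseteq> \<Sigma>" "finite (\<Union>(snd ` I0))" "\<Union>(snd ` I0) \<subseteq> G"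
            using I0(2) by blast+
        qed
        obtain h where h: "h \<in> envs" "\<forall>q\<in>\<Union>(snd ` I0). h (fst q) = snd q" "\<forall>P\<in>\<Union>(fst ` I0). P h"
          using okD[OF okG F] by (elim bexE conjE)
        have "Q (fst i) (snd i) h" if "i \<in> I0" for i
          unfolding Q_def using h that by (intro bexI[of _ h]) auto
        hence "psat U (p i) [h v]" if "i \<in> I0" for i using p(2) h(1) I0 that by blast
        hence "realizes U 1 \<pi>0 [h v]"
          using h(1) I0 by (auto simp: realizes_def tuples_def envsD)
        thus "\<exists>a. realizes U 1 \<pi>0 a" by blast
      qed
      then obtain a where a: "realizes U 1 (p ` I) a"
        using kb_sat Bsm BU unfolding saturated_def small_subset_def by blast
      then obtain x where x: "a = [x]" "x \<in> univ U"
        by (auto simp: realizes_def tuples_def length_Suc_conv)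
      have "insert (v, x) G \<in> \<G>"
        unfolding \<G>_def mem_Collect_eq
      proof
        show "insert (v, x) G \<subseteq> V \<times> univ U" using GV v x by auto
        show "ok (insert (v, x) G)"
          unfolding ok_def
        proof (intro allI impI, elim conjE)
          fix \<Sigma>0 G0 assume *: "finite \<Sigma>0" "\<Sigma>0 \<subseteq> \<Sigma>" "finite G0" "G0 \<subseteq> insert (v, x) G"
          define i where "i = (\<Sigma>0, G0 - {(v, x)})"
          have i: "i \<in> I" using * by (auto simp: I_def i_def)
          have "psat U (p i) [x]" using a i x by (auto simp: realizes_def)
          moreover have "(\<lambda>_. x) \<in> envs" using x by (auto simp: envs_def)
          ultimately have "Q (fst i) (snd i) (\<lambda>_. x)" using p(2)[OF i, of "\<lambda>_. x"] by blast
          then obtain h' where "h' \<in> envs" "h' v = x" "\<forall>q\<in>G0 - {(v, x)}. h' (fst q) = snd q"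
            "\<forall>P\<in>\<Sigma>0. P h'" unfolding Q_def i_def by auto
          thus "\<exists>h\<in>envs. (\<forall>q\<in>G0. h (fst q) = snd q) \<and> (\<forall>P\<in>\<Sigma>0. P h)"
            by (intro bexI[of _ h'] conjI) auto
        qed
      qed
      from G(2)[OF this] have "(v, x) \<in> G" by auto
      with nv show False by force
    qed
  qed
  define h where "h v = (if v \<in> V then THE x. (v, x) \<in> G else SOME x. x \<in> univ U)" for v
  have hG: "(v, h v) \<in> G" if "v \<in> V" for v
  proof -
    obtain x where "(v, x) \<in> G" using dom \<open>v \<in> V\<close> by force
    moreover from this have "(THE x. (v, x) \<in> G) = x" using sv by blast
    ultimately show ?thesis using that by (simp add: h_def)
  qed
  have henv: "h \<in> envs"
  proof (rule envsI)
    fix v show "h v \<in> univ U"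
    proof (cases "v \<in> V")
      case True thus ?thesis using hG GV by blast
    next
      case False thus ?thesis using univ_nonempty by (auto simp: h_def some_in_eq)
    qed
  qed
  have "P h" if P: "P \<in> \<Sigma>" for P
  proof -
    obtain A0 S0 where S0: "finite S0" "S0 \<subseteq> V" "dfn A0 S0 P"
      using dfn_finite_support[OF \<Sigma>[OF P]] by metis
    obtain h' where h': "h' \<in> envs" "\<forall>q\<in>(\<lambda>v. (v, h v)) ` S0. h' (fst q) = snd q" "P h'"
      using okD[OF okG, of "{P}" "(\<lambda>v. (v, h v)) ` S0"] P S0(1,2) hG by auto
    thus ?thesis using dfn_local[OF S0(3) henv h'(1)] by auto
  qed
  with henv show ?thesis by blast
qed

text \<open>The form of homogeneity used in place of automorphisms. A finite part of the type of
  \<open>h\<close> on \<open>W\<close>, with the variables outside \<open>S\<close> quantified, is a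
  condition on \<open>S\<close> that holds at \<open>h\<close>, hence at \<open>h'\<close>;
  saturation then supplies the missing values over those of \<open>h'\<close>.\<close>

lemma extend_type:
  assumes small: "|W| <o kb" "|A| <o kb" "A \<subseteq> univ U" and h: "h \<in> envs" "h' \<in> envs"
    and S: "S \<subseteq> W" and eq: "teq A S h h'"
  shows "\<exists>k\<in>envs. (\<forall>v\<in>S. k v = h' v) \<and> teq A W k h"
proof -
  let ?B = "A \<union> h' ` S"
  define \<Sigma> where "\<Sigma> = {P. dfn A W P \<and> P h} \<union> (\<lambda>v k. k v = h' v) ` S"
  have "\<exists>k\<in>envs. \<forall>P\<in>\<Sigma>. P k"
  proof (rule realize)
    show "|W| <o kb" by (rule small)
    show "|?B| <o kb" using small small_Un small_image small_subset_mono[OF _ S] by blast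
    show "?B \<subseteq> univ U" using small envsD[OF h(2)] by auto
    show "dfn ?B W P" if "P \<in> \<Sigma>" for P
    proof -
      from that consider "dfn A W P" | v where "v \<in> S" "P = (\<lambda>k. k v = h' v)"
        unfolding \<Sigma>_def by auto
      thus ?thesis
        by cases (use S in \<open>auto intro: dfn_mono dfn_eq_const\<close>)
    qed
    fix \<Sigma>0 assume f: "finite \<Sigma>0" "\<Sigma>0 \<subseteq> \<Sigma>"
    define \<Sigma>1 where "\<Sigma>1 = {P \<in> \<Sigma>0. dfn A W P \<and> P h}"
    have "dfn A W (\<lambda>h. \<forall>P\<in>\<Sigma>1. P h)" by (rule dfn_Ball) (use f in \<open>auto simp: \<Sigma>1_def\<close>)
    hence "dfn A (W \<inter> S) (\<lambda>k. \<exists>k'\<in>envs. (\<forall>v\<in>S. k' v = k v) \<and> (\<forall>P\<in>\<Sigma>1. P k'))"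
      by (rule dfn_Ex)
    moreover have "W \<inter> S = S" using S by auto
    moreover have "\<exists>k'\<in>envs. (\<forall>v\<in>S. k' v = h v) \<and> (\<forall>P\<in>\<Sigma>1. P k')"
      using h by (intro bexI[of _ h]) (auto simp: \<Sigma>1_def)
    ultimately have "\<exists>k'\<in>envs. (\<forall>v\<in>S. k' v = h' v) \<and> (\<forall>P\<in>\<Sigma>1. P k')"
      using teqD[OF eq, of "\<lambda>k. \<exists>k'\<in>envs. (\<forall>v\<in>S. k' v = k v) \<and> (\<forall>P\<in>\<Sigma>1. P k')"] by simp
    then obtain k where k: "k \<in> envs" "\<forall>v\<in>S. k v = h' v" "\<forall>P\<in>\<Sigma>1. P k" by blast
    have "P k" if PS: "P \<in> \<Sigma>0" for P
    proof (cases "P \<in> \<Sigma>1")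
      case False
      then obtain v where "v \<in> S" "P = (\<lambda>k. k v = h' v)"
        using PS f unfolding \<Sigma>_def \<Sigma>1_def by blast
      thus ?thesis using k by auto
    qed (use k in auto)
    thus "\<exists>k\<in>envs. \<forall>P\<in>\<Sigma>0. P k" using k by blast
  qed
  then obtain k where k: "k \<in> envs" "\<And>P. P \<in> \<Sigma> \<Longrightarrow> P k" by blast
  have "teq A W k h"
    unfolding teq_def
  proof (intro allI impI)
    fix P :: "('a \<Rightarrow> 'm) \<Rightarrow> bool" assume P: "dfn A W P"
    show "P k = P h"
    proof (cases "P h")
      case True
      thus ?thesis using k(2)[of P] P by (auto simp: \<Sigma>_def)
    next
      case False
      thus ?thesis using k(2)[of "\<lambda>h. \<not> P h"] dfn_Neg[OF P] by (auto simp: \<Sigma>_def)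
    qed
  qed
  moreover have "\<forall>v\<in>S. k v = h' v" using k(2) by (auto simp: \<Sigma>_def)
  ultimately show ?thesis using k(1) by blast
qed

end

section \<open>Mutually indiscernible families\<close>

text \<open>Positions are pairs of a row and an index. Nothing is compared across rows, and only the
  values of \<open>\<sigma>\<close> on \<open>S\<close> matter.\<close>

definition rmono :: "('x \<Rightarrow> 'i rel) \<Rightarrow> ('x \<Rightarrow> 'j rel) \<Rightarrow> ('x \<times> 'i) set \<Rightarrow> ('x \<times> 'i \<Rightarrow> 'x \<times> 'j) \<Rightarrow> bool" where
  "rmono r r' S \<sigma> \<longleftrightarrow> (\<forall>p\<in>S. fst (\<sigma> p) = fst p \<and> snd (\<sigma> p) \<in> Field (r' (fst p))) \<and>
     (\<forall>p\<in>S. \<forall>q\<in>S. fst p = fst q \<and> (snd p, snd q) \<in> r (fst p) \<and> snd p \<noteq> snd q \<longrightarrow>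
        (snd (\<sigma> p), snd (\<sigma> q)) \<in> r' (fst p) \<and> snd (\<sigma> p) \<noteq> snd (\<sigma> q))"

text \<open>The variables at the positions in \<open>S\<close>: a position in row \<open>i\<close>
  carries a tuple of length \<open>m i\<close>.\<close>

definition vs :: "('x \<Rightarrow> nat) \<Rightarrow> ('x \<times> 'i) set \<Rightarrow> (('x \<times> 'i) \<times> nat) set" where
  "vs m S = {(p, c). p \<in> S \<and> c < m (fst p)}"

abbreviation lift :: "('a \<Rightarrow> 'b) \<Rightarrow> 'a \<times> nat \<Rightarrow> 'b \<times> nat" where
  "lift \<sigma> \<equiv> map_prod \<sigma> id"

abbreviation rdom :: "'x set \<Rightarrow> ('x \<Rightarrow> 'i rel) \<Rightarrow> ('x \<times> 'i) set" where
  "rdom X r \<equiv> Sigma X (\<lambda>i. Field (r i))"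

lemma rmonoD:
  assumes "rmono r r' S \<sigma>" "p \<in> S"
  shows "fst (\<sigma> p) = fst p" "snd (\<sigma> p) \<in> Field (r' (fst p))"
    and "q \<in> S \<Longrightarrow> fst p = fst q \<Longrightarrow> (snd p, snd q) \<in> r (fst p) \<Longrightarrow> snd p \<noteq> snd q \<Longrightarrow>
      (snd (\<sigma> p), snd (\<sigma> q)) \<in> r' (fst p) \<and> snd (\<sigma> p) \<noteq> snd (\<sigma> q)"
  using assms unfolding rmono_def by blast+

lemma rmonoI:
  assumes "\<And>p. p \<in> S \<Longrightarrow> fst (\<sigma> p) = fst p" "\<And>p. p \<in> S \<Longrightarrow> snd (\<sigma> p) \<in> Field (r' (fst p))"
    and "\<And>p q. p \<in> S \<Longrightarrow> q \<in> S \<Longrightarrow> fst p = fst q \<Longrightarrow> (snd p, snd q) \<in> r (fst p) \<Longrightarrow> snd p \<noteq> snd q \<Longrightarrow>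
      (snd (\<sigma> p), snd (\<sigma> q)) \<in> r' (fst p) \<and> snd (\<sigma> p) \<noteq> snd (\<sigma> q)"
  shows "rmono r r' S \<sigma>"
  using assms unfolding rmono_def by blast

lemma rmono_subset: "rmono r r' S \<sigma> \<Longrightarrow> T \<subseteq> S \<Longrightarrow> rmono r r' T \<sigma>"
  unfolding rmono_def by blast

lemma rmono_id: "S \<subseteq> rdom X r \<Longrightarrow> rmono r r S id"
  unfolding rmono_def by auto

lemma rmono_image: "rmono r r' S \<sigma> \<Longrightarrow> S \<subseteq> rdom X r \<Longrightarrow> \<sigma> ` S \<subseteq> rdom X r'"
  unfolding rmono_def by (force simp: prod_eq_iff mem_Sigma_iff)

lemma rmono_comp:
  assumes "rmono r r' S \<sigma>" "rmono r' r'' (\<sigma> ` S) \<tau>"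
  shows "rmono r r'' S (\<tau> \<circ> \<sigma>)"
proof (rule rmonoI)
  fix p assume p: "p \<in> S"
  show "fst ((\<tau> \<circ> \<sigma>) p) = fst p" "snd ((\<tau> \<circ> \<sigma>) p) \<in> Field (r'' (fst p))"
    using rmonoD(1,2)[OF assms(1) p] rmonoD(1,2)[OF assms(2), of "\<sigma> p"] p by auto
next
  fix p q assume *: "p \<in> S" "q \<in> S" "fst p = fst q" "(snd p, snd q) \<in> r (fst p)" "snd p \<noteq> snd q"
  show "(snd ((\<tau> \<circ> \<sigma>) p), snd ((\<tau> \<circ> \<sigma>) q)) \<in> r'' (fst p) \<and> snd ((\<tau> \<circ> \<sigma>) p) \<noteq> snd ((\<tau> \<circ> \<sigma>) q)"
    using rmonoD(3)[OF assms(1) *(1,2,3,4,5)] rmonoD(1)[OF assms(1) *(1)] rmonoD(1)[OF assms(1) *(2)]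
      rmonoD(3)[OF assms(2), of "\<sigma> p" "\<sigma> q"] * by simp
qed

lemma domD: "S \<subseteq> rdom X r \<Longrightarrow> p \<in> S \<Longrightarrow> fst p \<in> X \<and> snd p \<in> Field (r (fst p))"
  by (metis mem_Sigma_iff prod.collapse subsetD)

lemma vs_mono: "S \<subseteq> T \<Longrightarrow> vs m S \<subseteq> vs m T"
  by (auto simp: vs_def)

lemma lift_vs: "(\<And>p. p \<in> S \<Longrightarrow> fst (\<sigma> p) = fst p) \<Longrightarrow> \<sigma> ` S \<subseteq> T \<Longrightarrow> lift \<sigma> ` vs m S \<subseteq> vs m T"
  by (fastforce simp: vs_def)

lemma Linear_orderD:
  assumes "Linear_order r"
  shows "trans r" "antisym r" "x \<in> Field r \<Longrightarrow> y \<in> Field r \<Longrightarrow> (x, y) \<in> r \<or> (y, x) \<in> r"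
proof -
  show "trans r" "antisym r"
    using assms by (simp_all add: order_on_defs)
  show "x \<in> Field r \<Longrightarrow> y \<in> Field r \<Longrightarrow> (x, y) \<in> r \<or> (y, x) \<in> r"
    using assms by (cases "x = y") (auto simp: order_on_defs total_on_def refl_on_def)
qed

lemma rmono_inj:
  assumes "rmono r r' S \<sigma>" "S \<subseteq> rdom X r" "\<And>i. i \<in> X \<Longrightarrow> Linear_order (r i)"
  shows "inj_on \<sigma> S"
proof (rule inj_onI, rule ccontr)
  fix p q assume *: "p \<in> S" "q \<in> S" "\<sigma> p = \<sigma> q" "p \<noteq> q"
  hence f: "fst p = fst q" using rmonoD(1)[OF assms(1)] by metis
  hence s: "snd p \<noteq> snd q" using * by (auto simp: prod_eq_iff)
  have "(snd p, snd q) \<in> r (fst p) \<or> (snd q, snd p) \<in> r (fst p)"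
    using Linear_orderD(3)[OF assms(3), of "fst p"] * f domD[OF assms(2)] by metis
  thus False using rmonoD(3)[OF assms(1)] * f s by metis
qed

lemma infinite_order_monotone:
  assumes "Linear_order r" "infinite (Field r)"
  obtains f :: "nat \<Rightarrow> 'i" and b :: bool where "range f \<subseteq> Field r"
    "\<And>x y. x < y \<Longrightarrow> f x \<noteq> f y" "\<And>x y. x < y \<Longrightarrow> if b then (f x, f y) \<in> r else (f y, f x) \<in> r"
proof -
  obtain g :: "nat \<Rightarrow> 'i" where g: "inj g" "range g \<subseteq> Field r"
    using assms(2) infinite_countable_subset by blast
  define col where "col u = (if (g (Min u), g (Max u)) \<in> r then 1 else 0 :: nat)" for u
  have "\<exists>Y t. Y \<subseteq> UNIV \<and> infinite Y \<and> t < 2 \<and> (\<forall>x\<in>Y. \<forall>y\<in>Y. x \<noteq> y \<longrightarrow> col {x, y} = t)"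
    by (rule Ramsey2) (auto simp: col_def)
  then obtain Y t where Y': "infinite Y" "\<forall>x\<in>Y. \<forall>y\<in>Y. x \<noteq> y \<longrightarrow> col {x, y} = t"
    by blast
  note Y = Y'(1) Y'(2)[rule_format]
  define f where "f = g \<circ> enumerate Y"
  have en: "enumerate Y x \<in> Y" "x < y \<Longrightarrow> enumerate Y x < enumerate Y y" for x y
    using Y(1) by (auto simp: enumerate_in_set enumerate_mono)
  show thesis
  proof (rule that[of f "t = 1"])
    show "range f \<subseteq> Field r" using g by (auto simp: f_def)
    fix x y :: nat assume xy: "x < y"
    thus "f x \<noteq> f y" using en(2)[OF xy] g(1) by (auto simp: f_def dest: injD)
    have "col {enumerate Y x, enumerate Y y} = t" using Y(2) en xy by (metis less_irrefl)
    moreover have "Min {enumerate Y x, enumerate Y y} = enumerate Y x"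
      "Max {enumerate Y x, enumerate Y y} = enumerate Y y"
      using en(2)[OF xy] by auto
    ultimately have "(f x, f y) \<in> r \<longleftrightarrow> t = 1" by (auto simp: col_def f_def split: if_splits)
    moreover have "(f x, f y) \<in> r \<or> (f y, f x) \<in> r"
      using Linear_orderD(3)[OF assms(1), of "f x" "f y"] g(2) by (auto simp: f_def)
    ultimately show "if t = 1 then (f x, f y) \<in> r else (f y, f x) \<in> r" by auto
  qed
qed

subsection \<open>Ramsey's theorem for monotone maps\<close>

definition gmono :: "('p \<Rightarrow> 'p \<Rightarrow> bool) \<Rightarrow> 'p set \<Rightarrow> ('p \<Rightarrow> nat) \<Rightarrow> bool" where
  "gmono G S \<rho> \<longleftrightarrow> (\<forall>p\<in>S. \<forall>q\<in>S. G p q \<longrightarrow> \<rho> p < \<rho> q)"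

text \<open>The number of image points below \<open>\<rho> p\<close> is the number of predecessors
  of \<open>p\<close>, whichever embedding is taken.\<close>

lemma gmono_unique:
  assumes S: "finite S" "\<And>p q. p \<in> S \<Longrightarrow> q \<in> S \<Longrightarrow> p \<noteq> q \<Longrightarrow> G p q \<or> G q p"
    and "gmono G S \<rho>" "gmono G S \<rho>'" "\<rho> ` S = \<rho>' ` S" "p \<in> S"
  shows "\<rho> p = \<rho>' p"
proof -
  have eq: "{x \<in> \<rho> ` S. x < \<rho> p} = \<rho> ` {q \<in> S. G q p}" if "gmono G S \<rho>" for \<rho>
    using that S(2) \<open>p \<in> S\<close> unfolding gmono_def
    by (auto intro!: imageI) (metis less_asym less_irrefl)
  have inj: "inj_on \<rho> S" if "gmono G S \<rho>" for \<rho>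
    using that S(2) unfolding gmono_def inj_on_def by (metis less_irrefl)
  have c: "card {x \<in> \<rho> ` S. x < \<rho> p} = card {q \<in> S. G q p}" if "gmono G S \<rho>" for \<rho>
    unfolding eq[OF that] by (rule card_image) (rule inj_on_subset[OF inj[OF that]], auto)
  have "\<not> \<rho>1 p < \<rho>2 p" if g: "gmono G S \<rho>1" "gmono G S \<rho>2" "\<rho>1 ` S = \<rho>2 ` S" for \<rho>1 \<rho>2
  proof
    assume l: "\<rho>1 p < \<rho>2 p"
    have "{x \<in> \<rho>1 ` S. x < \<rho>1 p} \<subset> {x \<in> \<rho>2 ` S. x < \<rho>2 p}"
      using l \<open>p \<in> S\<close> g(3) by (auto intro: less_trans)
    hence "card {x \<in> \<rho>1 ` S. x < \<rho>1 p} < card {x \<in> \<rho>2 ` S. x < \<rho>2 p}"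
      by (intro psubset_card_mono) (use S in auto)
    thus False using c[OF g(1)] c[OF g(2)] by linarith
  qed
  thus ?thesis using assms(3-5) by (metis linorder_neqE_nat)
qed

text \<open>By \<open>gmono_unique\<close> an embedding of \<open>S\<close> into the naturals is
  determined by its image, so \<open>Q\<close> becomes a colouring of the sets of naturals of size
  \<open>card S\<close>.\<close>

lemma Ramsey_gmono:
  assumes S: "finite S" "\<And>p q. p \<in> S \<Longrightarrow> q \<in> S \<Longrightarrow> p \<noteq> q \<Longrightarrow> G p q \<or> G q p"
    and Q: "\<And>\<rho> \<rho>'. (\<And>p. p \<in> S \<Longrightarrow> \<rho> p = \<rho>' p) \<Longrightarrow> Q \<rho> \<longleftrightarrow> Q \<rho>'" and Y0: "infinite (Y0 :: nat set)"
  shows "\<exists>Y\<subseteq>Y0. infinite Y \<and> (\<forall>\<rho> \<rho>'. gmono G S \<rho> \<and> gmono G S \<rho>' \<and> \<rho> ` S \<subseteq> Y \<and> \<rho>' ` S \<subseteq> Y \<longrightarrow>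
    (Q \<rho> \<longleftrightarrow> Q \<rho>'))"
proof -
  define col where "col u = (if \<exists>\<rho>. gmono G S \<rho> \<and> \<rho> ` S = u \<and> Q \<rho> then 1 else 0 :: nat)" for u
  have "\<exists>Y t. Y \<subseteq> Y0 \<and> infinite Y \<and> t < 2 \<and>
     (\<forall>X. X \<subseteq> Y \<and> finite X \<and> card X = card S \<longrightarrow> col X = t)"
    by (rule Ramsey) (use Y0 in \<open>auto simp: col_def\<close>)
  then obtain Y t where Y: "Y \<subseteq> Y0" "infinite Y"
    "\<forall>X. X \<subseteq> Y \<and> finite X \<and> card X = card S \<longrightarrow> col X = t"
    by blast
  have "Q \<rho> \<longleftrightarrow> t = 1" if \<rho>: "gmono G S \<rho>" "\<rho> ` S \<subseteq> Y" for \<rho>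
  proof -
    have "inj_on \<rho> S"
      using \<rho>(1) S(2) unfolding gmono_def inj_on_def by (metis less_irrefl)
    hence "col (\<rho> ` S) = t" using Y(3) \<rho>(2) S(1) by (simp add: card_image)
    moreover have "Q \<rho>' = Q \<rho>" if "gmono G S \<rho>'" "\<rho>' ` S = \<rho> ` S" for \<rho>'
      using Q gmono_unique[OF S that(1) \<rho>(1) that(2)] by blast
    ultimately show ?thesis using \<rho>(1) unfolding col_def by (metis zero_neq_one)
  qed
  hence "\<forall>\<rho> \<rho>'. gmono G S \<rho> \<and> gmono G S \<rho>' \<and> \<rho> ` S \<subseteq> Y \<and> \<rho>' ` S \<subseteq> Y \<longrightarrow> (Q \<rho> \<longleftrightarrow> Q \<rho>')"
    by simp
  with Y(1,2) show ?thesis by (intro exI[of _ Y] conjI)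
qed

lemma Ramsey_gmono_family:
  assumes "finite I" and S: "\<And>i. i \<in> I \<Longrightarrow> finite (S i)"
    "\<And>i p q. i \<in> I \<Longrightarrow> p \<in> S i \<Longrightarrow> q \<in> S i \<Longrightarrow> p \<noteq> q \<Longrightarrow> G p q \<or> G q p"
    and Q: "\<And>i \<rho> \<rho>'. i \<in> I \<Longrightarrow> (\<And>p. p \<in> S i \<Longrightarrow> \<rho> p = \<rho>' p) \<Longrightarrow> Q i \<rho> \<longleftrightarrow> Q i \<rho>'"
  shows "\<exists>Y :: nat set. infinite Y \<and> (\<forall>i\<in>I. \<forall>\<rho> \<rho>'. gmono G (S i) \<rho> \<and> gmono G (S i) \<rho>' \<and>
      \<rho> ` S i \<subseteq> Y \<and> \<rho>' ` S i \<subseteq> Y \<longrightarrow> (Q i \<rho> \<longleftrightarrow> Q i \<rho>'))"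
  using assms
proof (induction I)
  case empty
  show ?case by (intro exI[of _ UNIV]) auto
next
  case (insert i I)
  have "\<exists>Y :: nat set. infinite Y \<and> (\<forall>i\<in>I. \<forall>\<rho> \<rho>'. gmono G (S i) \<rho> \<and> gmono G (S i) \<rho>' \<and>
      \<rho> ` S i \<subseteq> Y \<and> \<rho>' ` S i \<subseteq> Y \<longrightarrow> (Q i \<rho> \<longleftrightarrow> Q i \<rho>'))"
  proof (rule insert.IH)
    show "finite (S j)" if "j \<in> I" for j using insert.prems(1)[of j] that by simp
    show "G p q \<or> G q p" if "j \<in> I" "p \<in> S j" "q \<in> S j" "p \<noteq> q" for j p q
      using insert.prems(2)[of j p q] that by simp
    show "Q j \<rho> = Q j \<rho>'" if "j \<in> I" "\<And>p. p \<in> S j \<Longrightarrow> \<rho> p = \<rho>' p" for j \<rho> \<rho>'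
      using insert.prems(3)[of j \<rho> \<rho>'] that by simp
  qed
  then obtain Y0 :: "nat set" where Y0: "infinite Y0" "\<forall>i\<in>I. \<forall>\<rho> \<rho>'. gmono G (S i) \<rho> \<and> gmono G (S i) \<rho>' \<and>
      \<rho> ` S i \<subseteq> Y0 \<and> \<rho>' ` S i \<subseteq> Y0 \<longrightarrow> (Q i \<rho> \<longleftrightarrow> Q i \<rho>')" by blast
  have "\<exists>Y\<subseteq>Y0. infinite Y \<and> (\<forall>\<rho> \<rho>'. gmono G (S i) \<rho> \<and> gmono G (S i) \<rho>' \<and> \<rho> ` S i \<subseteq> Y \<and> \<rho>' ` S i \<subseteq> Y \<longrightarrow>
    (Q i \<rho> \<longleftrightarrow> Q i \<rho>'))"
  proof (rule Ramsey_gmono)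
    show "finite (S i)" using insert.prems(1)[of i] by simp
    show "G p q \<or> G q p" if "p \<in> S i" "q \<in> S i" "p \<noteq> q" for p q
      using insert.prems(2)[of i p q] that by simp
    show "Q i \<rho> = Q i \<rho>'" if "\<And>p. p \<in> S i \<Longrightarrow> \<rho> p = \<rho>' p" for \<rho> \<rho>'
      using insert.prems(3)[of i \<rho> \<rho>'] that by simp
  qed (rule Y0(1))
  then obtain Y where Y: "Y \<subseteq> Y0" "infinite Y"
    "\<forall>\<rho> \<rho>'. gmono G (S i) \<rho> \<and> gmono G (S i) \<rho>' \<and> \<rho> ` S i \<subseteq> Y \<and> \<rho>' ` S i \<subseteq> Y \<longrightarrow> (Q i \<rho> \<longleftrightarrow> Q i \<rho>')"
    by (elim exE conjE)
  show ?case
  proof (intro exI[of _ Y] conjI ballI allI impI, rule Y(2))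
    fix j \<rho> \<rho>' assume "j \<in> insert i I" and *: "gmono G (S j) \<rho> \<and> gmono G (S j) \<rho>' \<and> \<rho> ` S j \<subseteq> Y \<and> \<rho>' ` S j \<subseteq> Y"
    show "Q j \<rho> = Q j \<rho>'"
    proof (cases "j = i")
      case True
      thus ?thesis using Y(3) * by simp
    next
      case False
      hence j: "j \<in> I" using \<open>j \<in> insert i I\<close> by simp
      have "gmono G (S j) \<rho> \<and> gmono G (S j) \<rho>' \<and> \<rho> ` S j \<subseteq> Y0 \<and> \<rho>' ` S j \<subseteq> Y0"
        using * Y(1) by (meson order_trans)
      thus ?thesis using Y0(2) j by simp
    qed
  qed
qed

lemma gmono_exists:
  assumes "finite S" "\<And>p q r. p \<in> S \<Longrightarrow> q \<in> S \<Longrightarrow> r \<in> S \<Longrightarrow> G p q \<Longrightarrow> G q r \<Longrightarrow> G p r"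
    "\<And>p. p \<in> S \<Longrightarrow> \<not> G p p" "infinite (Y :: nat set)"
  obtains \<rho> where "gmono G S \<rho>" "range \<rho> \<subseteq> Y"
proof -
  define \<rho> where "\<rho> p = enumerate Y (card {q \<in> S. G q p})" for p
  have "gmono G S \<rho>"
    unfolding gmono_def
  proof (intro ballI impI)
    fix p q assume *: "p \<in> S" "q \<in> S" "G p q"
    have "{x \<in> S. G x p} \<subset> {x \<in> S. G x q}" using * assms(2,3) by blast
    hence "card {x \<in> S. G x p} < card {x \<in> S. G x q}" by (intro psubset_card_mono) (use assms in auto)
    thus "\<rho> p < \<rho> q" unfolding \<rho>_def using assms(4) by (rule enumerate_mono)
  qed
  moreover have "range \<rho> \<subseteq> Y" using assms(4) by (auto simp: \<rho>_def enumerate_in_set)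
  ultimately show thesis by (rule that)
qed

section \<open>Mutual indiscernibility of environments and the extraction of indiscernible
  arrays\<close>

context monster
begin

text \<open>Mutual indiscernibility with all rows moved at once. The agreement with the definition
  by single rows over the union of the others is shown in \<open>mi_senv\<close> and
  \<open>mutually_indiscernible_mi\<close>.\<close>

definition mi :: "'m set \<Rightarrow> 'x set \<Rightarrow> ('x \<Rightarrow> 'i rel) \<Rightarrow> ('x \<Rightarrow> nat) \<Rightarrow> (('x \<times> 'i) \<times> nat \<Rightarrow> 'm) \<Rightarrow> bool" where
  "mi A X r m h \<longleftrightarrow> (\<forall>S \<tau>. finite S \<and> S \<subseteq> rdom X r \<and> rmono r r S \<tau> \<longrightarrow>
     teq A (vs m S) h (h \<circ> lift \<tau>))"

text \<open>Invariance under self-maps gives invariance under embeddings of other index orders: on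
  finitely many positions the second embedding is the first followed by a monotone map, because by
  linearity the first is injective with increasing inverse.\<close>

lemma mi_two:
  assumes mi: "mi A X r m h" and h: "h \<in> envs" and lin: "\<And>i. i \<in> X \<Longrightarrow> Linear_order (r i)"
    "\<And>i. i \<in> X \<Longrightarrow> Linear_order (r' i)"
    and S: "S \<subseteq> rdom X r'" and \<sigma>: "rmono r' r S \<sigma>1" "rmono r' r S \<sigma>2"
  shows "teq A (vs m S) (h \<circ> lift \<sigma>1) (h \<circ> lift \<sigma>2)"
proof (rule teq_finite)
  fix S0 assume S0: "finite S0" "S0 \<subseteq> vs m S"
  define F where "F = fst ` S0"
  have F: "finite F" "F \<subseteq> S" "S0 \<subseteq> vs m F" using S0 by (force simp: F_def vs_def)+
  have \<sigma>F: "rmono r' r F \<sigma>1" "rmono r' r F \<sigma>2" using \<sigma> F(2) rmono_subset by blast+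
  have inj: "inj_on \<sigma>1 F" using rmono_inj[OF \<sigma>F(1) _ lin(2)] F(2) S by blast
  define \<tau> where "\<tau> p = \<sigma>2 (inv_into F \<sigma>1 p)" for p
  have \<tau>: "\<tau> (\<sigma>1 p) = \<sigma>2 p" if "p \<in> F" for p using that inj by (simp add: \<tau>_def)
  have im: "\<sigma>1 ` F \<subseteq> rdom X r" using rmono_image[OF \<sigma>F(1)] F(2) S by blast
  have "rmono r r (\<sigma>1 ` F) \<tau>"
  proof (rule rmonoI)
    fix p assume "p \<in> \<sigma>1 ` F"
    thus "fst (\<tau> p) = fst p" "snd (\<tau> p) \<in> Field (r (fst p))"
      using \<tau> rmonoD(1,2)[OF \<sigma>F(1)] rmonoD(1,2)[OF \<sigma>F(2)] by auto
  next
    fix p q assume *: "p \<in> \<sigma>1 ` F" "q \<in> \<sigma>1 ` F" "fst p = fst q" "(snd p, snd q) \<in> r (fst p)" "snd p \<noteq> snd q"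
    then obtain a b where ab: "a \<in> F" "b \<in> F" "p = \<sigma>1 a" "q = \<sigma>1 b" by blast
    have f: "fst a = fst b" "fst p = fst a" "fst q = fst a" using * ab rmonoD(1)[OF \<sigma>F(1)] by auto
    have X: "fst a \<in> X" "snd a \<in> Field (r' (fst a))" "snd b \<in> Field (r' (fst a))"
      using ab F(2) f domD[OF S, of a] domD[OF S, of b] by auto
    have ne: "snd a \<noteq> snd b" using f(1) *(5) ab(3,4) by (metis prod.collapse)
    have "(snd b, snd a) \<notin> r' (fst a)"
    proof
      assume "(snd b, snd a) \<in> r' (fst a)"
      hence "(snd q, snd p) \<in> r (fst a)" using rmonoD(3)[OF \<sigma>F(1) ab(2) ab(1)] f ne ab by auto
      thus False using Linear_orderD(2)[OF lin(1)[OF X(1)]] * f by (auto dest: antisymD)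
    qed
    hence "(snd a, snd b) \<in> r' (fst a)" using Linear_orderD(3)[OF lin(2)[OF X(1)] X(2,3)] by blast
    thus "(snd (\<tau> p), snd (\<tau> q)) \<in> r (fst p) \<and> snd (\<tau> p) \<noteq> snd (\<tau> q)"
      using rmonoD(3)[OF \<sigma>F(2) ab(1) ab(2)] f ne ab \<tau> by auto
  qed
  hence t: "teq A (vs m (\<sigma>1 ` F)) h (h \<circ> lift \<tau>)" using mi im F(1) unfolding mi_def by blast
  have "teq A (vs m F) (h \<circ> lift \<sigma>1) (h \<circ> lift \<tau> \<circ> lift \<sigma>1)"
    by (rule teq_reindex[OF t]) (rule lift_vs, use rmonoD(1)[OF \<sigma>F(1)] in auto)
  moreover have "teq A (vs m F) (h \<circ> lift \<tau> \<circ> lift \<sigma>1) (h \<circ> lift \<sigma>2)"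
    by (rule teq_agree) (use h \<tau> in \<open>auto intro!: envs_comp simp: vs_def\<close>)
  ultimately have "teq A (vs m F) (h \<circ> lift \<sigma>1) (h \<circ> lift \<sigma>2)" by (rule teq_trans)
  thus "teq A S0 (h \<circ> lift \<sigma>1) (h \<circ> lift \<sigma>2)" by (rule teq_mono) (use F(3) in auto)
qed

lemma miI_two:
  assumes "\<And>S \<tau>. finite S \<Longrightarrow> S \<subseteq> rdom X r \<Longrightarrow> rmono r r S \<tau> \<Longrightarrow> teq A (vs m S) h (h \<circ> lift \<tau>)"
  shows "mi A X r m h"
  using assms unfolding mi_def by blast

lemma mi_reindex:
  assumes mi: "mi A X r m h" and h: "h \<in> envs" and lin: "\<And>i. i \<in> X \<Longrightarrow> Linear_order (r i)"
    "\<And>i. i \<in> X \<Longrightarrow> Linear_order (r' i)" and \<sigma>: "rmono r' r (rdom X r') \<sigma>"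
  shows "mi A X r' m (h \<circ> lift \<sigma>)"
proof (rule miI_two)
  fix S :: "('a \<times> 'c) set" and \<tau> assume S: "finite S" "S \<subseteq> rdom X r'" "rmono r' r' S \<tau>"
  have "\<tau> ` S \<subseteq> rdom X r'" by (rule rmono_image[OF S(3,2)])
  hence "rmono r' r S (\<sigma> \<circ> \<tau>)" using rmono_comp[OF S(3)] rmono_subset[OF \<sigma>] by blast
  hence "teq A (vs m S) (h \<circ> lift \<sigma>) (h \<circ> lift (\<sigma> \<circ> \<tau>))"
    using mi_two[OF mi h lin S(2)] rmono_subset[OF \<sigma> S(2)] by blast
  thus "teq A (vs m S) (h \<circ> lift \<sigma>) (h \<circ> lift \<sigma> \<circ> lift \<tau>)"
    by (simp add: comp_assoc map_prod_compose[symmetric] del: map_prod_compose)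
qed

lemma small_vs:
  assumes "|X| <o kb" "\<And>i. i \<in> X \<Longrightarrow> |Field (r i)| <o kb"
  shows "|vs m (rdom X r)| <o kb"
proof (rule small_subset_mono)
  show "|rdom X r \<times> (UNIV :: nat set)| <o kb"
    by (intro small_Sigma assms small_countable) auto
  show "vs m (rdom X r) \<subseteq> rdom X r \<times> UNIV" by (auto simp: vs_def)
qed

text \<open>The last conclusion says that \<open>h'\<close> inherits whatever is true of all order
  preserving copies in \<open>h\<close>. By compactness only finitely many positions and formulas
  matter, and for these Ramsey's theorem finds a suitable copy inside \<open>h\<close>
  itself.\<close>

theorem extraction:
  fixes h :: "('x \<times> 'i) \<times> nat \<Rightarrow> 'm" and r :: "'x \<Rightarrow> 'i rel" and r' :: "'x \<Rightarrow> 'j rel"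
  assumes h: "h \<in> envs" and A: "|A| <o kb" "A \<subseteq> univ U" and X: "|X| <o kb"
    and r: "\<And>i. i \<in> X \<Longrightarrow> Linear_order (r i)" "\<And>i. i \<in> X \<Longrightarrow> infinite (Field (r i))"
    and r': "\<And>i. i \<in> X \<Longrightarrow> Linear_order (r' i)" "\<And>i. i \<in> X \<Longrightarrow> |Field (r' i)| <o kb"
  obtains h' where "h' \<in> envs" "mi A X r' m h'"
    "\<And>S P. finite S \<Longrightarrow> S \<subseteq> rdom X r' \<Longrightarrow> dfn A (vs m S) P \<Longrightarrow>
       (\<And>\<sigma>. rmono r' r S \<sigma> \<Longrightarrow> P (h \<circ> lift \<sigma>)) \<Longrightarrow> P h'"
proof -
  define ES where "ES = {P. \<exists>S. finite S \<and> S \<subseteq> rdom X r' \<and> dfn A (vs m S) P \<and>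
    (\<forall>\<sigma>. rmono r' r S \<sigma> \<longrightarrow> P (h \<circ> lift \<sigma>))}"
  define MI where "MI = {(P, S, \<tau>). finite S \<and> S \<subseteq> rdom X r' \<and> rmono r' r' S \<tau> \<and> dfn A (vs m S) P}"
  define mp where "mp = (\<lambda>(P :: (('x \<times> 'j) \<times> nat \<Rightarrow> 'm) \<Rightarrow> bool, S :: ('x \<times> 'j) set, \<tau> :: 'x \<times> 'j \<Rightarrow> 'x \<times> 'j) k.
      P k \<longleftrightarrow> P (k \<circ> lift \<tau>))"
  have "\<exists>k\<in>envs. \<forall>P\<in>ES \<union> mp ` MI. P k"
  proof (rule realize)
    show "|vs m (rdom X r')| <o kb" using small_vs X r'(2) by blast
    show "|A| <o kb" "A \<subseteq> univ U" by (rule A)+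
    show "dfn A (vs m (rdom X r')) P" if P: "P \<in> ES \<union> mp ` MI" for P
    proof (cases "P \<in> ES")
      case True
      then obtain S where "S \<subseteq> rdom X r'" "dfn A (vs m S) P" unfolding ES_def by blast
      thus ?thesis using dfn_mono[of A "vs m S" P A] vs_mono by blast
    next
      case False
      then obtain Q S \<tau> where Q: "P = mp (Q, S, \<tau>)" "S \<subseteq> rdom X r'" "rmono r' r' S \<tau>" "dfn A (vs m S) Q"
        using P unfolding MI_def by blast
      have "dfn A (vs m (rdom X r')) Q" using dfn_mono[OF Q(4)] vs_mono[OF Q(2)] by blast
      moreover have "dfn A (vs m (rdom X r')) (\<lambda>k. Q (k \<circ> lift \<tau>))"
        by (rule dfn_reindex[OF Q(4)])
          (rule lift_vs, use rmonoD(1)[OF Q(3)] rmono_image[OF Q(3,2)] in auto)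
      ultimately show ?thesis unfolding Q(1) mp_def by (simp add: dfn_iff)
    qed
    fix \<Sigma>0 assume \<Sigma>0: "finite \<Sigma>0" "\<Sigma>0 \<subseteq> ES \<union> mp ` MI"
    obtain MI0 where MI0: "finite MI0" "MI0 \<subseteq> MI" "\<Sigma>0 - ES = mp ` MI0"
      using finite_subset_image[of "\<Sigma>0 - ES" mp MI] \<Sigma>0 by blast
    have "\<forall>P\<in>\<Sigma>0 \<inter> ES. \<exists>S. finite S \<and> S \<subseteq> rdom X r' \<and> dfn A (vs m S) P \<and>
      (\<forall>\<sigma>. rmono r' r S \<sigma> \<longrightarrow> P (h \<circ> lift \<sigma>))" unfolding ES_def by blast
    then obtain SE where SE: "\<And>P. P \<in> \<Sigma>0 \<inter> ES \<Longrightarrow> finite (SE P) \<and> SE P \<subseteq> rdom X r' \<and> dfn A (vs m (SE P)) P \<and>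
      (\<forall>\<sigma>. rmono r' r (SE P) \<sigma> \<longrightarrow> P (h \<circ> lift \<sigma>))" by metis
    define S1 where "S1 q = fst (snd q)" for q :: "((('x \<times> 'j) \<times> nat \<Rightarrow> 'm) \<Rightarrow> bool) \<times> ('x \<times> 'j) set \<times> ('x \<times> 'j \<Rightarrow> 'x \<times> 'j)"
    define T1 where "T1 q = snd (snd q)" for q :: "((('x \<times> 'j) \<times> nat \<Rightarrow> 'm) \<Rightarrow> bool) \<times> ('x \<times> 'j) set \<times> ('x \<times> 'j \<Rightarrow> 'x \<times> 'j)"
    have MI0': "finite (S1 q)" "S1 q \<subseteq> rdom X r'" "rmono r' r' (S1 q) (T1 q)" "dfn A (vs m (S1 q)) (fst q)"
      if "q \<in> MI0" for q
    proof -
      have "q \<in> MI" using MI0(2) that by blast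
      thus "finite (S1 q)" "S1 q \<subseteq> rdom X r'" "rmono r' r' (S1 q) (T1 q)" "dfn A (vs m (S1 q)) (fst q)"
        unfolding MI_def S1_def T1_def by (cases q; simp)+
    qed
    define T where "T = (\<Union>P\<in>\<Sigma>0 \<inter> ES. SE P) \<union> (\<Union>q\<in>MI0. S1 q \<union> T1 q ` S1 q)"
    have Tfin: "finite T" unfolding T_def using SE MI0(1) MI0'(1) \<Sigma>0(1) by auto
    have T1im: "T1 q ` S1 q \<subseteq> rdom X r'" if "q \<in> MI0" for q
      using rmono_image[OF MI0'(3,2)] that by blast
    have Tdom: "T \<subseteq> rdom X r'"
    proof -
      have "SE P \<subseteq> rdom X r'" if "P \<in> \<Sigma>0 \<inter> ES" for P using SE[OF that] by blast
      moreover have "S1 q \<union> T1 q ` S1 q \<subseteq> rdom X r'" if "q \<in> MI0" for q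
        using MI0'(2)[OF that] T1im[OF that] by blast
      ultimately show ?thesis unfolding T_def by blast
    qed
    have "\<forall>i\<in>X. \<exists>f b. range f \<subseteq> Field (r i) \<and> (\<forall>x y. x < (y::nat) \<longrightarrow> f x \<noteq> f y \<and>
       (if b then (f x, f y) \<in> r i else (f y, f x) \<in> r i))"
    proof
      fix i assume i: "i \<in> X"
      show "\<exists>f b. range f \<subseteq> Field (r i) \<and> (\<forall>x y. x < (y::nat) \<longrightarrow> f x \<noteq> f y \<and>
         (if b then (f x, f y) \<in> r i else (f y, f x) \<in> r i))"
        using infinite_order_monotone[OF r(1)[OF i] r(2)[OF i]] by metis
    qed
    then obtain f b where fb: "\<And>i. i \<in> X \<Longrightarrow> range (f i) \<subseteq> Field (r i)"
      "\<And>i x y. i \<in> X \<Longrightarrow> x < (y::nat) \<Longrightarrow> f i x \<noteq> f i y"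
      "\<And>i x y. i \<in> X \<Longrightarrow> x < y \<Longrightarrow> if b i then (f i x, f i y) \<in> r i else (f i y, f i x) \<in> r i"
      by metis
    obtain num :: "'x \<Rightarrow> nat" where num: "inj_on num (fst ` T)"
      using finite_imp_inj_to_nat_seg[of "fst ` T"] Tfin by blast
    \<comment> \<open>One linear order on the finitely many positions: row after row, and within a
      row the order of \<open>r'\<close>, reversed if the sequence chosen in that row of
      \<open>h\<close> descends. Every \<open>G\<close>-increasing numbering by naturals then gives
      a monotone map into \<open>h\<close>, so that Ramsey's theorem for a single set
      \<open>Y\<close> serves all rows.\<close>
    define G where "G p q \<longleftrightarrow> num (fst p) < num (fst q) \<or> (fst p = fst q \<and> snd p \<noteq> snd q \<and>
      (if b (fst p) then (snd p, snd q) \<in> r' (fst p) else (snd q, snd p) \<in> r' (fst p)))" for p q :: "'x \<times> 'j"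
    have Gtot: "G p q \<or> G q p" if "p \<in> T" "q \<in> T" "p \<noteq> q" for p q
    proof (cases "fst p = fst q")
      case True
      have "fst p \<in> X" "snd p \<in> Field (r' (fst p))" "snd q \<in> Field (r' (fst p))"
        using domD[OF Tdom, of p] domD[OF Tdom, of q] that True by auto
      hence "(snd p, snd q) \<in> r' (fst p) \<or> (snd q, snd p) \<in> r' (fst p)"
        using Linear_orderD(3)[OF r'(1)] by blast
      moreover have "snd p \<noteq> snd q" using True that by (auto simp: prod_eq_iff)
      ultimately show ?thesis using True unfolding G_def by auto
    next
      case False
      hence "num (fst p) \<noteq> num (fst q)" using num that by (auto dest: inj_onD)
      thus ?thesis unfolding G_def by auto
    qed
    have Girr: "\<not> G p p" for p unfolding G_def by auto
    have Gtr: "G p s" if "p \<in> T" "q \<in> T" "s \<in> T" "G p q" "G q s" for p q s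
    proof -
      have X: "fst p \<in> X" using domD[OF Tdom, of p] that by auto
      have tr: "trans (r' (fst p))" "antisym (r' (fst p))" using Linear_orderD(1,2)[OF r'(1)[OF X]] by auto
      show ?thesis
      proof (cases "fst p = fst q \<and> fst q = fst s")
        case True
        thus ?thesis using that(4,5) tr unfolding G_def by (auto split: if_splits dest: transD antisymD)
      next
        case False
        thus ?thesis using that(4,5) unfolding G_def by auto
      qed
    qed
    have Gpres: "G (T1 q p) (T1 q p')" if q: "q \<in> MI0" "p \<in> S1 q" "p' \<in> S1 q" "G p p'" for q p p'
    proof -
      have 1: "fst (T1 q p) = fst p" "fst (T1 q p') = fst p'" using rmonoD(1)[OF MI0'(3)] q by auto
      show ?thesis
        using q(4) 1 rmonoD(3)[OF MI0'(3)[OF q(1)] q(2) q(3)] rmonoD(3)[OF MI0'(3)[OF q(1)] q(3) q(2)]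
        unfolding G_def by (auto split: if_splits)
    qed
    define \<theta> where "\<theta> \<rho> p = (fst p, f (fst p) (\<rho> p))" for \<rho> :: "'x \<times> 'j \<Rightarrow> nat" and p
    have "\<exists>Y :: nat set. infinite Y \<and> (\<forall>q\<in>MI0. \<forall>\<rho> \<rho>'. gmono G (S1 q) \<rho> \<and> gmono G (S1 q) \<rho>' \<and>
      \<rho> ` S1 q \<subseteq> Y \<and> \<rho>' ` S1 q \<subseteq> Y \<longrightarrow> (fst q (h \<circ> lift (\<theta> \<rho>)) \<longleftrightarrow> fst q (h \<circ> lift (\<theta> \<rho>'))))"
    proof (rule Ramsey_gmono_family[OF MI0(1)])
      show "finite (S1 q)" if "q \<in> MI0" for q using MI0'(1) that .
      show "G p p' \<or> G p' p" if "q \<in> MI0" "p \<in> S1 q" "p' \<in> S1 q" "p \<noteq> p'" for q p p'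
        using Gtot that unfolding T_def by blast
      show "fst q (h \<circ> lift (\<theta> \<rho>)) = fst q (h \<circ> lift (\<theta> \<rho>'))"
        if "q \<in> MI0" "\<And>p. p \<in> S1 q \<Longrightarrow> \<rho> p = \<rho>' p" for q \<rho> \<rho>'
        by (rule dfn_local[OF MI0'(4)[OF that(1)]])
          (use h that(2) in \<open>auto intro!: envs_comp simp: vs_def \<theta>_def\<close>)
    qed
    then obtain Y :: "nat set" where Y: "infinite Y" "\<forall>q\<in>MI0. \<forall>\<rho> \<rho>'. gmono G (S1 q) \<rho> \<and> gmono G (S1 q) \<rho>' \<and>
      \<rho> ` S1 q \<subseteq> Y \<and> \<rho>' ` S1 q \<subseteq> Y \<longrightarrow> (fst q (h \<circ> lift (\<theta> \<rho>)) \<longleftrightarrow> fst q (h \<circ> lift (\<theta> \<rho>')))"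
      by blast
    obtain \<rho> where \<rho>: "gmono G T \<rho>" "range \<rho> \<subseteq> Y"
      using gmono_exists[of T G Y] Tfin Gtr Girr Y(1) by blast
    have rm: "rmono r' r T (\<theta> \<rho>)"
    proof (rule rmonoI)
      fix p assume "p \<in> T"
      hence "fst p \<in> X" using domD[OF Tdom, of p] by auto
      thus "fst (\<theta> \<rho> p) = fst p" "snd (\<theta> \<rho> p) \<in> Field (r (fst p))"
        using fb(1) by (auto simp: \<theta>_def)
    next
      fix p q assume *: "p \<in> T" "q \<in> T" "fst p = fst q" "(snd p, snd q) \<in> r' (fst p)" "snd p \<noteq> snd q"
      hence X: "fst p \<in> X" using domD[OF Tdom, of p] by auto
      have "if b (fst p) then G p q else G q p" using * unfolding G_def by auto
      hence "if b (fst p) then \<rho> p < \<rho> q else \<rho> q < \<rho> p" using \<rho>(1) * unfolding gmono_def by auto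
      thus "(snd (\<theta> \<rho> p), snd (\<theta> \<rho> q)) \<in> r (fst p) \<and> snd (\<theta> \<rho> p) \<noteq> snd (\<theta> \<rho> q)"
        using fb(2,3)[OF X] * by (force simp: \<theta>_def split: if_splits)
    qed
    let ?k = "h \<circ> lift (\<theta> \<rho>)"
    show "\<exists>k\<in>envs. \<forall>P\<in>\<Sigma>0. P k"
    proof (intro bexI[of _ ?k] ballI)
      show "?k \<in> envs" using h by (rule envs_comp)
      fix P assume P: "P \<in> \<Sigma>0"
      show "P ?k"
      proof (cases "P \<in> ES")
        case True
        hence "SE P \<subseteq> T" using P unfolding T_def by blast
        thus ?thesis using SE[of P] True P rmono_subset[OF rm] by blast
      next
        case False
        then obtain q where q: "q \<in> MI0" "P = mp q" using MI0(3) P by blast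
        have 1: "gmono G (S1 q) \<rho>" using \<rho>(1) q(1) unfolding gmono_def T_def by blast
        \<comment> \<open>A monotone map of positions respects \<open>G\<close>, so the numbering
          composed with it is again increasing and homogeneity of \<open>Y\<close> compares the
          two.\<close>
        have 2: "gmono G (S1 q) (\<rho> \<circ> T1 q)"
          unfolding gmono_def
        proof (intro ballI impI)
          fix p p' assume p: "p \<in> S1 q" "p' \<in> S1 q" "G p p'"
          hence "T1 q p \<in> T" "T1 q p' \<in> T" using q(1) unfolding T_def by blast+
          thus "(\<rho> \<circ> T1 q) p < (\<rho> \<circ> T1 q) p'" using Gpres[OF q(1) p] \<rho>(1) unfolding gmono_def by auto
        qed
        have "fst q ?k = fst q (h \<circ> lift (\<theta> (\<rho> \<circ> T1 q)))"
          by (rule Y(2)[rule_format, OF q(1)]) (use \<rho>(2) 1 2 in auto)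
        also have "\<dots> = fst q (?k \<circ> lift (T1 q))"
          by (rule dfn_local[OF MI0'(4)[OF q(1)]])
            (use h rmonoD(1)[OF MI0'(3)[OF q(1)]] in \<open>auto intro!: envs_comp simp: vs_def \<theta>_def\<close>)
        finally show ?thesis by (cases q) (simp add: q(2) mp_def T1_def)
      qed
    qed
  qed
  then obtain k where k: "k \<in> envs" "\<And>P. P \<in> ES \<union> mp ` MI \<Longrightarrow> P k" by blast
  show thesis
  proof (rule that[OF k(1)])
    show "mi A X r' m k"
    proof (rule miI_two)
      fix S \<tau> assume S: "finite S" "S \<subseteq> rdom X r'" "rmono r' r' S \<tau>"
      show "teq A (vs m S) k (k \<circ> lift \<tau>)"
        unfolding teq_def
      proof (intro allI impI)
        fix P assume "dfn A (vs m S) P"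
        hence "(P, S, \<tau>) \<in> MI" using S by (simp add: MI_def)
        hence "mp (P, S, \<tau>) k" using k(2) by blast
        thus "P k = P (k \<circ> lift \<tau>)" by (simp add: mp_def)
      qed
    qed
    fix S P assume "finite S" "S \<subseteq> rdom X r'" "dfn A (vs m S) P" "\<And>\<sigma>. rmono r' r S \<sigma> \<Longrightarrow> P (h \<circ> lift \<sigma>)"
    hence "P \<in> ES" unfolding ES_def by blast
    thus "P k" using k(2) by blast
  qed
qed

end

section \<open>Sequences and environments\<close>

lemma increasing_exists:
  assumes "finite F" "F \<subseteq> Field r" "Linear_order r"
  shows "\<exists>xs. set xs = F \<and> increasing r xs"
  using assms(1,2)
proof (induction F)
  case empty
  thus ?case by (intro exI[of _ "[]"]) (auto simp: increasing_def)
next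
  case (insert x F)
  then obtain xs where xs: "set xs = F" "increasing r xs" by auto
  have tr: "trans r" "antisym r" using Linear_orderD(1,2)[OF assms(3)] .
  have tot: "(y, x) \<in> r \<or> (x, y) \<in> r" if "y \<in> F" for y
    using Linear_orderD(3)[OF assms(3), of y x] insert.prems that by auto
  let ?ys = "filter (\<lambda>y. (y, x) \<in> r) xs @ x # filter (\<lambda>y. (y, x) \<notin> r) xs"
  have "set ?ys = insert x F" using xs by auto
  moreover have "increasing r ?ys"
    unfolding increasing_def sorted_wrt_append sorted_wrt.simps(2)
  proof (intro conjI ballI)
    show "set ?ys \<subseteq> Field r" using xs insert.prems by auto
    show "sorted_wrt (\<lambda>i j. (i, j) \<in> r \<and> i \<noteq> j) (filter (\<lambda>y. (y, x) \<in> r) xs)"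
      "sorted_wrt (\<lambda>i j. (i, j) \<in> r \<and> i \<noteq> j) (filter (\<lambda>y. (y, x) \<notin> r) xs)"
      using xs(2) by (auto simp: increasing_def intro: sorted_wrt_filter)
    fix z assume z: "z \<in> set (filter (\<lambda>y. (y, x) \<notin> r) xs)"
    thus "(x, z) \<in> r" "x \<noteq> z" using tot xs insert.hyps by auto
  next
    fix y z assume y: "y \<in> set (filter (\<lambda>y. (y, x) \<in> r) xs)" and z: "z \<in> set (x # filter (\<lambda>y. (y, x) \<notin> r) xs)"
    have "(x, z) \<in> r" using z tot xs insert.prems tot[of x] assms(3)
      by (auto simp: order_on_defs refl_on_def)
    thus "(y, z) \<in> r" using y transD[OF tr(1)] by auto
    show "y \<noteq> z" using y z xs insert.hyps by auto
  qed
  ultimately show ?case by blast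
qed

lemma increasing_nth:
  assumes "increasing r xs" "a < b" "b < length xs"
  shows "(xs ! a, xs ! b) \<in> r" "xs ! a \<noteq> xs ! b"
  using assms sorted_wrt_nth_less[of "\<lambda>i j. (i, j) \<in> r \<and> i \<noteq> j" xs a b] by (auto simp: increasing_def)

lemma increasing_map:
  assumes "increasing r xs" "f ` set xs \<subseteq> Field r'"
    "\<And>x y. x \<in> set xs \<Longrightarrow> y \<in> set xs \<Longrightarrow> (x, y) \<in> r \<Longrightarrow> x \<noteq> y \<Longrightarrow> (f x, f y) \<in> r' \<and> f x \<noteq> f y"
  shows "increasing r' (map f xs)"
proof -
  have "sorted_wrt (\<lambda>i j. (f i, f j) \<in> r' \<and> f i \<noteq> f j) xs"
  proof (rule sorted_wrt_mono_rel)
    show "sorted_wrt (\<lambda>i j. (i, j) \<in> r \<and> i \<noteq> j) xs" using assms(1) by (simp add: increasing_def)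
    show "(f x, f y) \<in> r' \<and> f x \<noteq> f y" if "x \<in> set xs" "y \<in> set xs" "(x, y) \<in> r \<and> x \<noteq> y" for x y
      using assms(3)[of x y] that by simp
  qed
  thus ?thesis using assms(2) by (auto simp: increasing_def sorted_wrt_map)
qed

subsection \<open>Concatenation\<close>

lemma seq_append_simps [simp]:
  "(Inl a, Inl b) \<in> fst (I \<oplus>\<^sub>s J) \<longleftrightarrow> (a, b) \<in> fst I"
  "(Inr c, Inr d) \<in> fst (I \<oplus>\<^sub>s J) \<longleftrightarrow> (c, d) \<in> fst J"
  "(Inl a, Inr d) \<in> fst (I \<oplus>\<^sub>s J) \<longleftrightarrow> a \<in> idx I \<and> d \<in> idx J"
  "(Inr c, Inl b) \<notin> fst (I \<oplus>\<^sub>s J)"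
  "snd (I \<oplus>\<^sub>s J) (Inl a) = snd I a" "snd (I \<oplus>\<^sub>s J) (Inr c) = snd J c"
  by (auto simp: seq_append_def)

lemma idx_seq_append [simp]: "idx (I \<oplus>\<^sub>s J) = Inl ` idx I \<union> Inr ` idx J"
proof (intro set_eqI iffI)
  fix x assume "x \<in> idx (I \<oplus>\<^sub>s J)"
  then obtain y where "(x, y) \<in> fst (I \<oplus>\<^sub>s J) \<or> (y, x) \<in> fst (I \<oplus>\<^sub>s J)" by (auto simp: Field_def)
  thus "x \<in> Inl ` idx I \<union> Inr ` idx J"
    by (cases x; cases y) (auto intro: FieldI1 FieldI2)
next
  fix x assume x: "x \<in> Inl ` idx I \<union> Inr ` idx J"
  then consider a b where "x = Inl a" "(a, b) \<in> fst I \<or> (b, a) \<in> fst I"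
    | a b where "x = Inr a" "(a, b) \<in> fst J \<or> (b, a) \<in> fst J" by (auto simp: Field_def)
  thus "x \<in> idx (I \<oplus>\<^sub>s J)"
  proof cases
    case 1
    hence "(Inl a, Inl b) \<in> fst (I \<oplus>\<^sub>s J) \<or> (Inl b, Inl a) \<in> fst (I \<oplus>\<^sub>s J)" by simp
    thus ?thesis using 1(1) by (metis FieldI1 FieldI2)
  next
    case 2
    hence "(Inr a, Inr b) \<in> fst (I \<oplus>\<^sub>s J) \<or> (Inr b, Inr a) \<in> fst (I \<oplus>\<^sub>s J)" by simp
    thus ?thesis using 2(1) by (metis FieldI1 FieldI2)
  qed
qed

lemma Linear_orderI:
  assumes "\<And>x. x \<in> Field r \<Longrightarrow> (x, x) \<in> r" "\<And>x y z. (x, y) \<in> r \<Longrightarrow> (y, z) \<in> r \<Longrightarrow> (x, z) \<in> r"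
    "\<And>x y. (x, y) \<in> r \<Longrightarrow> (y, x) \<in> r \<Longrightarrow> x = y"
    "\<And>x y. x \<in> Field r \<Longrightarrow> y \<in> Field r \<Longrightarrow> (x, y) \<in> r \<or> (y, x) \<in> r"
  shows "Linear_order r"
  using assms unfolding order_on_defs refl_on_def trans_def antisym_def total_on_def
  by (auto intro: FieldI1 FieldI2)

lemma Linear_orderE:
  assumes "Linear_order r"
  shows "x \<in> Field r \<Longrightarrow> (x, x) \<in> r" "(x, y) \<in> r \<Longrightarrow> (y, z) \<in> r \<Longrightarrow> (x, z) \<in> r"
    "(x, y) \<in> r \<Longrightarrow> (y, x) \<in> r \<Longrightarrow> x = y"
    "x \<in> Field r \<Longrightarrow> y \<in> Field r \<Longrightarrow> (x, y) \<in> r \<or> (y, x) \<in> r"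
  using assms Linear_orderD[OF assms] by (auto dest: transD antisymD)

lemma Linear_order_seq_append:
  assumes "Linear_order (fst I)" "Linear_order (fst J)"
  shows "Linear_order (fst (I \<oplus>\<^sub>s J))"
proof (rule Linear_orderI)
  fix x y z
  note E = Linear_orderE[OF assms(1)] Linear_orderE[OF assms(2)]
  show "(x, x) \<in> fst (I \<oplus>\<^sub>s J)" if "x \<in> idx (I \<oplus>\<^sub>s J)"
    using that E(1,5) by auto
  show "(x, z) \<in> fst (I \<oplus>\<^sub>s J)" if "(x, y) \<in> fst (I \<oplus>\<^sub>s J)" "(y, z) \<in> fst (I \<oplus>\<^sub>s J)"
    using that by (cases x; cases y; cases z) (auto intro: E(2,6) FieldI1 FieldI2)
  show "x = y" if "(x, y) \<in> fst (I \<oplus>\<^sub>s J)" "(y, x) \<in> fst (I \<oplus>\<^sub>s J)"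
    using that by (cases x; cases y) (auto intro: E(3,7))
  show "(x, y) \<in> fst (I \<oplus>\<^sub>s J) \<or> (y, x) \<in> fst (I \<oplus>\<^sub>s J)" if "x \<in> idx (I \<oplus>\<^sub>s J)" "y \<in> idx (I \<oplus>\<^sub>s J)"
    using that E(4)[of "projl x" "projl y"] E(8)[of "projr x" "projr y"] by auto
qed

lemma Linear_order_seq_appendD:
  assumes "Linear_order (fst (I \<oplus>\<^sub>s J))"
  shows "Linear_order (fst I)" "Linear_order (fst J)"
proof -
  note E = Linear_orderE[OF assms]
  show "Linear_order (fst I)"
  proof (rule Linear_orderI)
    fix x y z
    show "(x, x) \<in> fst I" if "x \<in> idx I" using E(1)[of "Inl x"] that by simp
    show "(x, z) \<in> fst I" if "(x, y) \<in> fst I" "(y, z) \<in> fst I"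
      using E(2)[of "Inl x" "Inl y" "Inl z"] that by simp
    show "x = y" if "(x, y) \<in> fst I" "(y, x) \<in> fst I" using E(3)[of "Inl x" "Inl y"] that by simp
    show "(x, y) \<in> fst I \<or> (y, x) \<in> fst I" if "x \<in> idx I" "y \<in> idx I"
      using E(4)[of "Inl x" "Inl y"] that by simp
  qed
  show "Linear_order (fst J)"
  proof (rule Linear_orderI)
    fix x y z
    show "(x, x) \<in> fst J" if "x \<in> idx J" using E(1)[of "Inr x"] that by simp
    show "(x, z) \<in> fst J" if "(x, y) \<in> fst J" "(y, z) \<in> fst J"
      using E(2)[of "Inr x" "Inr y" "Inr z"] that by simp
    show "x = y" if "(x, y) \<in> fst J" "(y, x) \<in> fst J" using E(3)[of "Inr x" "Inr y"] that by simp
    show "(x, y) \<in> fst J \<or> (y, x) \<in> fst J" if "x \<in> idx J" "y \<in> idx J"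
      using E(4)[of "Inr x" "Inr y"] that by simp
  qed
qed

lemma sequence_of_append: "sequence_of M m (I \<oplus>\<^sub>s J) \<longleftrightarrow> sequence_of M m I \<and> sequence_of M m J"
proof -
  have "Linear_order (fst (I \<oplus>\<^sub>s J)) \<longleftrightarrow> Linear_order (fst I) \<and> Linear_order (fst J)"
    using Linear_order_seq_append Linear_order_seq_appendD by blast
  moreover have "snd (I \<oplus>\<^sub>s J) ` idx (I \<oplus>\<^sub>s J) = snd I ` idx I \<union> snd J ` idx J"
    by (simp add: image_Un image_image)
  ultimately show ?thesis unfolding sequence_of_def by auto
qed

lemma sequence_of_length: "sequence_of M m I \<Longrightarrow> t \<in> idx I \<Longrightarrow> length (snd I t) = m"
  by (auto simp: sequence_of_def tuples_def)

lemma sequence_of_unique: "sequence_of M m I \<Longrightarrow> sequence_of M m' I \<Longrightarrow> t \<in> idx I \<Longrightarrow> m = m'"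
  using sequence_of_length by metis

subsection \<open>Mutually indiscernible sequences as environments\<close>

context monster
begin

lemma dfn_pfm_ex:
  assumes "dfn B S Q" "S \<subseteq> set xs"
  shows "\<exists>p\<in>pfmlas L B (length xs). \<forall>h\<in>envs. psat U p (map h xs) \<longleftrightarrow> Q h"
proof (rule dfn_imp_pfm[OF assms])
  fix p assume "p \<in> pfmlas L B (length xs)" "\<And>h. h \<in> envs \<Longrightarrow> psat U p (map h xs) = Q h"
  thus ?thesis by (intro bexI[of _ p] ballI)
qed

lemma dfn_unfix_ex:
  assumes "dfn (A \<union> c ` T) S P"
  shows "\<exists>Q. dfn A (S \<union> T) Q \<and> (\<forall>h\<in>envs. (\<forall>v\<in>T. h v = c v) \<longrightarrow> (Q h \<longleftrightarrow> P h))"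
proof (rule dfn_unfix[OF assms])
  fix Q :: "('a \<Rightarrow> 'm) \<Rightarrow> bool"
  assume "dfn A (S \<union> T) Q" "\<And>h. h \<in> envs \<Longrightarrow> (\<And>v. v \<in> T \<Longrightarrow> h v = c v) \<Longrightarrow> Q h = P h"
  thus ?thesis by (intro exI[of _ Q] conjI ballI impI) auto
qed

lemma dfn_finite_ex:
  assumes "dfn A S P"
  shows "\<exists>S0. finite S0 \<and> S0 \<subseteq> S \<and> dfn A S0 P"
proof (rule dfn_finite_support[OF assms])
  fix A0 S0 assume "finite A0" "finite S0" "A0 \<subseteq> A" "S0 \<subseteq> S" "dfn A0 S0 P"
  thus ?thesis using dfn_mono[of A0 S0 P A S0] by blast
qed

definition u0 :: 'm where "u0 = (SOME x. x \<in> univ U)"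

lemma u0: "u0 \<in> univ U"
  unfolding u0_def using univ_nonempty by (simp add: some_in_eq)

text \<open>A family of sequences read as one assignment; variables that name no coordinate get the
  default \<open>u0\<close>.\<close>

definition senv :: "'x set \<Rightarrow> ('x \<Rightarrow> nat) \<Rightarrow> ('x \<Rightarrow> ('i, 'm) tseq) \<Rightarrow> ('x \<times> 'i) \<times> nat \<Rightarrow> 'm" where
  "senv X m I = (\<lambda>((i, t), c). if i \<in> X \<and> t \<in> idx (I i) \<and> c < m i then snd (I i) t ! c else u0)"

lemma senv_envs:
  assumes "\<And>i. i \<in> X \<Longrightarrow> sequence_of U (m i) (I i)"
  shows "senv X m I \<in> envs"
proof (rule envsI)
  fix v :: "('a \<times> 'b) \<times> nat"
  obtain i t c where v: "v = ((i, t), c)" by (metis prod.exhaust)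
  show "senv X m I v \<in> univ U"
  proof (cases "i \<in> X \<and> t \<in> idx (I i) \<and> c < m i")
    case True
    hence "snd (I i) t \<in> tuples U (m i)" using assms[of i] by (auto simp: sequence_of_def)
    thus ?thesis using True by (auto simp: v senv_def tuples_def in_lists_conv_set)
  qed (auto simp: v senv_def u0)
qed

definition vlist :: "'x \<Rightarrow> nat \<Rightarrow> 'i list \<Rightarrow> (('x \<times> 'i) \<times> nat) list" where
  "vlist i m ts = concat (map (\<lambda>t. map (\<lambda>c. ((i, t), c)) [0..<m]) ts)"

lemma set_vlist: "set (vlist i m ts) = {((i, t), c) | t c. t \<in> set ts \<and> c < m}"
  unfolding vlist_def by auto

lemma length_vlist: "length (vlist i m ts) = length ts * m"
  unfolding vlist_def by (induction ts) auto

lemma map_vlist: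
  assumes "\<And>t. t \<in> set ts \<Longrightarrow> length (f t) = m" "\<And>t c. t \<in> set ts \<Longrightarrow> c < m \<Longrightarrow> h ((i, t), c) = f t ! c"
  shows "map h (vlist i m ts) = concat (map f ts)"
proof -
  have "map h (map (\<lambda>c. ((i, t), c)) [0..<m]) = f t" if "t \<in> set ts" for t
    using assms that by (intro nth_equalityI) auto
  thus ?thesis unfolding vlist_def map_concat by (auto intro!: arg_cong[of _ _ concat])
qed

lemma elems_senv:
  assumes "\<And>i. i \<in> X \<Longrightarrow> sequence_of U (m i) (I i)" "j \<in> X"
    "\<And>i t c. i \<in> X \<Longrightarrow> t \<in> idx (I i) \<Longrightarrow> c < m i \<Longrightarrow> h ((i, t), c) = snd (I i) t ! c"
  shows "elems (I j) = h ` vs m ({j} \<times> idx (I j))"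
proof (intro set_eqI iffI)
  fix x assume "x \<in> elems (I j)"
  then obtain t where t: "t \<in> idx (I j)" "x \<in> set (snd (I j) t)" by (auto simp: elems_def)
  then obtain c where "c < m j" "x = snd (I j) t ! c"
    using sequence_of_length[OF assms(1)[OF assms(2)] t(1)] by (auto simp: in_set_conv_nth)
  thus "x \<in> h ` vs m ({j} \<times> idx (I j))"
    using t(1) assms(2,3) by (auto simp: vs_def intro!: image_eqI[of _ _ "((j, t), c)"])
next
  fix x assume "x \<in> h ` vs m ({j} \<times> idx (I j))"
  then obtain t c where "t \<in> idx (I j)" "c < m j" "x = h ((j, t), c)" by (auto simp: vs_def)
  thus "x \<in> elems (I j)"
    using assms(2) assms(3)[OF assms(2)] sequence_of_length[OF assms(1)[OF assms(2)], of t] nth_mem[of c "snd (I j) t"]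
    unfolding elems_def by (metis UN_I)
qed

text \<open>Rows are moved one at a time. While row \<open>i\<close> is moved, all other
  coordinates, moved already or not, are elements of the other sequences and belong to the base over
  which row \<open>i\<close> is indiscernible.\<close>

lemma mi_senv:
  assumes mut: "mutually_indiscernible L U A X I"
    and seq: "\<And>i. i \<in> X \<Longrightarrow> sequence_of U (m i) (I i)"
  shows "mi A X (\<lambda>i. fst (I i)) m (senv X m I)"
proof (rule miI_two)
  let ?r = "\<lambda>i. fst (I i)" and ?h = "senv X m I"
  have henv: "?h \<in> envs" by (rule senv_envs[OF seq])
  have hval: "?h ((i, t), c) = snd (I i) t ! c" if "i \<in> X" "t \<in> idx (I i)" "c < m i" for i t c
    using that by (simp add: senv_def)
  fix S \<tau> assume S: "finite S" "S \<subseteq> rdom X ?r" "rmono ?r ?r S \<tau>"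
  define \<tau>R where "\<tau>R R p = (if fst p \<in> R then \<tau> p else p)" for R p
  have \<tau>dom: "\<tau> p \<in> rdom X ?r" "fst (\<tau> p) = fst p" if "p \<in> S" for p
    using rmono_image[OF S(3,2)] rmonoD(1)[OF S(3)] that by auto
  have \<tau>Rdom: "fst (\<tau>R R p) = fst p" "fst p \<in> X" "snd (\<tau>R R p) \<in> idx (I (fst p))" if "p \<in> S" for p R
    using domD[OF S(2) that] \<tau>dom[OF that] rmonoD(2)[OF S(3) that] by (auto simp: \<tau>R_def)
  have step: "teq A (vs m S) ?h (?h \<circ> lift (\<tau>R R))" if "finite R" for R
    using that
  proof (induction R)
    case empty
    show ?case by (rule teq_agree) (use henv in \<open>auto intro!: envs_comp simp: \<tau>R_def\<close>)
  next
    case (insert i R)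
    let ?h1 = "?h \<circ> lift (\<tau>R R)" and ?h2 = "?h \<circ> lift (\<tau>R (insert i R))"
    have env: "?h1 \<in> envs" "?h2 \<in> envs" using henv by (auto intro: envs_comp)
    have "teq A (vs m S) ?h1 ?h2"
    proof (cases "i \<in> X")
      case False
      show ?thesis
      proof (rule teq_agree[OF env])
        fix v assume "v \<in> vs m S"
        hence "fst (fst v) \<noteq> i" using \<tau>Rdom(2) False by (auto simp: vs_def)
        thus "?h1 v = ?h2 v" by (cases v) (auto simp: \<tau>R_def)
      qed
    next
      case iX: True
      define E where "E = (\<Union>j\<in>X - {i}. elems (I j))"
      obtain ts where ts: "set ts = snd ` {p \<in> S. fst p = i}" "increasing (?r i) ts"
        using increasing_exists[of "snd ` {p \<in> S. fst p = i}" "?r i"] S(1) domD[OF S(2)] seq[OF iX]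
        by (auto simp: sequence_of_def image_subset_iff)
      have tsS: "(i, t) \<in> S \<longleftrightarrow> t \<in> set ts" for t unfolding ts(1) by force
      have tsi: "t \<in> idx (I i)" if "t \<in> set ts" for t using ts(2) that by (auto simp: increasing_def)
      define js where "js = map (\<lambda>t. snd (\<tau> (i, t))) ts"
      have js: "increasing (?r i) js"
        unfolding js_def
      proof (rule increasing_map[OF ts(2)])
        show "(\<lambda>t. snd (\<tau> (i, t))) ` set ts \<subseteq> idx (I i)"
          using rmonoD(2)[OF S(3)] tsS by force
        fix x y assume "x \<in> set ts" "y \<in> set ts" "(x, y) \<in> ?r i" "x \<noteq> y"
        thus "(snd (\<tau> (i, x)), snd (\<tau> (i, y))) \<in> ?r i \<and> snd (\<tau> (i, x)) \<noteq> snd (\<tau> (i, y))"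
          using rmonoD(3)[OF S(3), of "(i, x)" "(i, y)"] tsS by auto
      qed
      have jsi: "t \<in> idx (I i)" if "t \<in> set js" for t using js that by (auto simp: increasing_def)
      show ?thesis
        unfolding teq_def
      proof (intro allI impI)
        fix P assume P: "dfn A (vs m S) P"
        define T where "T = {v :: ('a \<times> 'b) \<times> nat. fst (fst v) \<noteq> i}"
        have d1: "dfn (A \<union> E) (set (vlist i (m i) ts)) (\<lambda>k. P (\<lambda>v. if v \<in> T then ?h1 v else k v))"
        proof (rule dfn_fix[OF P env(1)])
          show "?h1 ` (vs m S \<inter> T) \<subseteq> A \<union> E"
          proof
            fix x assume "x \<in> ?h1 ` (vs m S \<inter> T)"
            then obtain p c where p: "p \<in> S" "c < m (fst p)" "fst p \<noteq> i" "x = ?h (\<tau>R R p, c)"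
              by (auto simp: vs_def T_def)
            hence "x = snd (I (fst p)) (snd (\<tau>R R p)) ! c"
              using hval[of "fst p" "snd (\<tau>R R p)" c] \<tau>Rdom(1,3)[OF p(1), of R] \<tau>Rdom(2)[OF p(1)] by (metis prod.collapse)
            moreover have "length (snd (I (fst p)) (snd (\<tau>R R p))) = m (fst p)"
              using sequence_of_length[OF seq] \<tau>Rdom(3)[OF p(1), of R] \<tau>Rdom(2)[OF p(1)] by blast
            ultimately have "x \<in> elems (I (fst p))"
              using \<tau>Rdom(3)[OF p(1), of R] p(2) nth_mem[of c "snd (I (fst p)) (snd (\<tau>R R p))"] unfolding elems_def by (metis UN_I)
            thus "x \<in> A \<union> E" using \<tau>Rdom(2)[OF p(1)] p(3) by (auto simp: E_def)
          qed
          show "vs m S - T \<subseteq> set (vlist i (m i) ts)"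
            using tsS by (auto simp: vs_def T_def set_vlist)
        qed simp
        obtain p where p': "p \<in> pfmlas L (A \<union> E) (length (vlist i (m i) ts))"
          "\<forall>k\<in>envs. psat U p (map k (vlist i (m i) ts)) \<longleftrightarrow> P (\<lambda>v. if v \<in> T then ?h1 v else k v)"
          using dfn_pfm_ex[OF d1 order_refl] by (elim bexE)
        note p = p'(1) p'(2)[rule_format]
        have m1: "map ?h (vlist i (m i) ts) = concat (map (snd (I i)) ts)"
          by (rule map_vlist) (use sequence_of_length[OF seq[OF iX]] tsi hval[OF iX] in auto)
        have m2: "map (?h \<circ> lift \<tau>) (vlist i (m i) ts) = concat (map (snd (I i)) js)"
          unfolding js_def map_map comp_def[of "snd (I i)"]
        proof (rule map_vlist)
          fix t assume t: "t \<in> set ts"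
          hence 1: "snd (\<tau> (i, t)) \<in> idx (I i)" using jsi by (auto simp: js_def)
          thus "length (snd (I i) (snd (\<tau> (i, t)))) = m i" using sequence_of_length[OF seq[OF iX]] by blast
          fix c assume "c < m i"
          moreover have "\<tau> (i, t) = (i, snd (\<tau> (i, t)))" using \<tau>dom(2)[of "(i, t)"] tsS t by (metis fst_conv prod.collapse)
          ultimately show "(?h \<circ> lift \<tau>) ((i, t), c) = snd (I i) (snd (\<tau> (i, t))) ! c"
            using hval[OF iX 1] by (metis comp_apply id_apply map_prod_simp)
        qed
        \<comment> \<open>For the empty list both sides coincide. Otherwise an element of the
          sequence identifies the tuple length hidden in \<open>indiscernible\<close> with
          \<open>m i\<close>.\<close>
        have "psat U p (concat (map (snd (I i)) ts)) = psat U p (concat (map (snd (I i)) js))"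
        proof (cases "ts = []")
          case False
          have "indiscernible L U (A \<union> E) (I i)"
            using mut iX unfolding mutually_indiscernible_def E_def by simp
          then obtain m' where m': "sequence_of U m' (I i)"
            "\<forall>is js. increasing (?r i) is \<and> increasing (?r i) js \<and> length is = length js \<longrightarrow>
              (\<forall>p\<in>pfmlas L (A \<union> E) (length is * m').
                 psat U p (concat (map (snd (I i)) is)) \<longleftrightarrow> psat U p (concat (map (snd (I i)) js)))"
            unfolding indiscernible_def by (elim exE conjE)
          have "m' = m i" using sequence_of_unique[OF m'(1) seq[OF iX] tsi[of "hd ts"]] False by simp
          thus ?thesis using m'(2)[rule_format, of ts js p] ts(2) js p(1) by (simp add: js_def length_vlist)
        qed (simp add: js_def)
        hence "psat U p (map ?h (vlist i (m i) ts)) = psat U p (map (?h \<circ> lift \<tau>) (vlist i (m i) ts))"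
          unfolding m1 m2 .
        hence "P (\<lambda>v. if v \<in> T then ?h1 v else ?h v) \<longleftrightarrow> P (\<lambda>v. if v \<in> T then ?h1 v else (?h \<circ> lift \<tau>) v)"
          using p(2)[OF henv] p(2)[OF envs_comp[OF henv]] by blast
        moreover have "P (\<lambda>v. if v \<in> T then ?h1 v else ?h v) \<longleftrightarrow> P ?h1"
        proof (rule dfn_local[OF P envs_merge[OF env(1) henv] env(1)])
          fix v assume "v \<in> vs m S"
          show "(if v \<in> T then ?h1 v else ?h v) = ?h1 v"
            using insert.hyps by (cases v) (auto simp: T_def \<tau>R_def)
        qed
        moreover have "P (\<lambda>v. if v \<in> T then ?h1 v else (?h \<circ> lift \<tau>) v) \<longleftrightarrow> P ?h2"
        proof (rule dfn_local[OF P envs_merge[OF env(1) envs_comp[OF henv]] env(2)])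
          fix v assume "v \<in> vs m S"
          show "(if v \<in> T then ?h1 v else (?h \<circ> lift \<tau>) v) = ?h2 v"
            by (cases v) (auto simp: T_def \<tau>R_def)
        qed
        ultimately show "P ?h1 = P ?h2" by blast
      qed
    qed
    thus ?case using insert.IH teq_trans by blast
  qed
  have "teq A (vs m S) ?h (?h \<circ> lift (\<tau>R (fst ` S)))" using step S(1) by blast
  moreover have "teq A (vs m S) (?h \<circ> lift (\<tau>R (fst ` S))) (?h \<circ> lift \<tau>)"
  proof (rule teq_agree)
    fix v assume "v \<in> vs m S"
    hence "fst (fst v) \<in> fst ` S" by (auto simp: vs_def)
    thus "(?h \<circ> lift (\<tau>R (fst ` S))) v = (?h \<circ> lift \<tau>) v" by (cases v) (auto simp: \<tau>R_def)
  qed (use henv in \<open>auto intro!: envs_comp\<close>)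
  ultimately show "teq A (vs m S) ?h (?h \<circ> lift \<tau>)" by (rule teq_trans)
qed

text \<open>A formula with parameters from the other rows is turned into a formula in the variables
  of those rows. The monotone map that carries \<open>ts\<close> to \<open>js\<close> in row
  \<open>i\<close> and fixes the other rows then leaves its truth unchanged.\<close>

lemma mutually_indiscernible_mi:
  assumes mi: "mi A X (\<lambda>i. fst (I i)) m h" and henv: "h \<in> envs"
    and seq: "\<And>i. i \<in> X \<Longrightarrow> sequence_of U (m i) (I i)"
    and hval: "\<And>i t c. i \<in> X \<Longrightarrow> t \<in> idx (I i) \<Longrightarrow> c < m i \<Longrightarrow> h ((i, t), c) = snd (I i) t ! c"
  shows "mutually_indiscernible L U A X I"
  unfolding mutually_indiscernible_def
proof
  fix i assume iX: "i \<in> X"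
  let ?r = "\<lambda>i. fst (I i)"
  define T where "T = vs m (Sigma (X - {i}) (\<lambda>j. idx (I j)))"
  have E: "(\<Union>j\<in>X - {i}. elems (I j)) = h ` T"
  proof -
    have "(\<Union>j\<in>X - {i}. elems (I j)) = (\<Union>j\<in>X - {i}. h ` vs m ({j} \<times> idx (I j)))"
      using elems_senv[OF seq _ hval] by auto
    also have "\<dots> = h ` T" unfolding T_def vs_def by (auto simp: image_UN[symmetric] intro!: arg_cong[of _ _ "(`) h"])
    finally show ?thesis .
  qed
  show "indiscernible L U (A \<union> (\<Union>j\<in>X - {i}. elems (I j))) (I i)"
    unfolding indiscernible_def E
  proof (intro exI[of _ "m i"] conjI allI impI ballI, rule seq[OF iX], elim conjE)
    fix ts js p assume ts: "increasing (?r i) ts" and js: "increasing (?r i) js" and len: "length ts = length js"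
      and p: "p \<in> pfmlas L (A \<union> h ` T) (length ts * m i)"
    let ?xs = "vlist i (m i) ts"
    have d0: "dfn (A \<union> h ` T) (set ?xs) (\<lambda>k. psat U p (map k ?xs))"
      by (rule pfm_imp_dfn) (use p in \<open>simp add: length_vlist\<close>)
    obtain Q where Q: "dfn A (set ?xs \<union> T) Q"
      "\<forall>k\<in>envs. (\<forall>v\<in>T. k v = h v) \<longrightarrow> (Q k \<longleftrightarrow> psat U p (map k ?xs))"
      using dfn_unfix_ex[OF d0] by (elim exE conjE)
    obtain S0 where S0: "finite S0" "S0 \<subseteq> set ?xs \<union> T" "dfn A S0 Q"
      using dfn_finite_ex[OF Q(1)] by (elim exE conjE)
    define S where "S = fst ` S0"
    have tsi: "t \<in> idx (I i)" if "t \<in> set ts" for t using ts that by (auto simp: increasing_def)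
    have jsi: "t \<in> idx (I i)" if "t \<in> set js" for t using js that by (auto simp: increasing_def)
    have SD: "(fst p = i \<and> snd p \<in> set ts) \<or> (fst p \<in> X \<and> fst p \<noteq> i \<and> snd p \<in> idx (I (fst p)))" if "p \<in> S" for p
      using that S0(2) by (force simp: S_def T_def vs_def set_vlist)
    have S0v: "S0 \<subseteq> vs m S" using S0(2) by (force simp: S_def T_def vs_def set_vlist)
    have "dfn A (vs m S) Q" using dfn_mono[OF S0(3) order_refl S0v] .
    define ix where "ix t = (SOME a. a < length ts \<and> ts ! a = t)" for t
    have ix: "ix t < length ts \<and> ts ! ix t = t" if "t \<in> set ts" for t
      unfolding ix_def by (rule someI_ex) (use that in \<open>auto simp: in_set_conv_nth\<close>)
    define \<tau> where "\<tau> p = (if fst p = i then (i, js ! ix (snd p)) else p)" for p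
    have lin: "Linear_order (?r i)" using seq[OF iX] by (simp add: sequence_of_def)
    have "rmono ?r ?r S \<tau>"
    proof (rule rmonoI)
      fix q assume "q \<in> S"
      thus "fst (\<tau> q) = fst q" "snd (\<tau> q) \<in> idx (I (fst q))"
        using SD[of q] ix[of "snd q"] jsi len by (auto simp: \<tau>_def)
    next
      fix q q' assume *: "q \<in> S" "q' \<in> S" "fst q = fst q'" "(snd q, snd q') \<in> ?r (fst q)" "snd q \<noteq> snd q'"
      show "(snd (\<tau> q), snd (\<tau> q')) \<in> ?r (fst q) \<and> snd (\<tau> q) \<noteq> snd (\<tau> q')"
      proof (cases "fst q = i")
        case True
        hence t: "snd q \<in> set ts" "snd q' \<in> set ts" using SD[OF *(1)] SD[OF *(2)] *(3) by auto
        have "\<not> ix (snd q') < ix (snd q)"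
          using increasing_nth(1)[OF ts, of "ix (snd q')" "ix (snd q)"] ix[OF t(1)] ix[OF t(2)] *(4,5) True
            Linear_orderE(3)[OF lin] by metis
        moreover have "ix (snd q) \<noteq> ix (snd q')" using ix[OF t(1)] ix[OF t(2)] *(5) by metis
        ultimately show ?thesis
          using increasing_nth[OF js, of "ix (snd q)" "ix (snd q')"] ix[OF t(2)] len True *(3) by (auto simp: \<tau>_def)
      qed (use * in \<open>auto simp: \<tau>_def\<close>)
    qed
    moreover have "S \<subseteq> rdom X ?r"
    proof
      fix q assume "q \<in> S"
      thus "q \<in> rdom X ?r" using SD[of q] iX tsi by (cases q) auto
    qed
    ultimately have t: "teq A (vs m S) h (h \<circ> lift \<tau>)" using mi S0(1) unfolding mi_def S_def by blast
    have "Q h = Q (h \<circ> lift \<tau>)" by (rule teqD[OF t \<open>dfn A (vs m S) Q\<close>])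
    moreover have "Q h = psat U p (map h ?xs)" using Q(2) henv by simp
    moreover have "Q (h \<circ> lift \<tau>) = psat U p (map (h \<circ> lift \<tau>) ?xs)"
    proof (rule Q(2)[rule_format, OF envs_comp[OF henv]])
      fix v assume "v \<in> T"
      hence "fst (fst v) \<noteq> i" by (auto simp: T_def vs_def)
      thus "(h \<circ> lift \<tau>) v = h v" by (cases v) (auto simp: \<tau>_def)
    qed
    moreover have "map h ?xs = concat (map (snd (I i)) ts)"
      by (rule map_vlist) (use sequence_of_length[OF seq[OF iX]] tsi hval[OF iX] in auto)
    moreover have "map (h \<circ> lift \<tau>) ?xs = concat (map (snd (I i)) js)"
    proof -
      have "map (h \<circ> lift \<tau>) ?xs = concat (map (\<lambda>t. snd (I i) (js ! ix t)) ts)"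
        by (rule map_vlist) (use sequence_of_length[OF seq[OF iX]] jsi hval[OF iX] ix len in \<open>auto simp: \<tau>_def\<close>)
      also have "map (\<lambda>t. snd (I i) (js ! ix t)) ts = map (snd (I i)) js"
      proof (rule nth_equalityI)
        fix a assume a: "a < length (map (\<lambda>t. snd (I i) (js ! ix t)) ts)"
        have "ix (ts ! a) = a"
        proof (rule ccontr)
          assume ne: "ix (ts ! a) \<noteq> a"
          have "ix (ts ! a) < length ts" "ts ! ix (ts ! a) = ts ! a" using ix[of "ts ! a"] a by auto
          thus False
            using increasing_nth(2)[OF ts, of a "ix (ts ! a)"] increasing_nth(2)[OF ts, of "ix (ts ! a)" a] ne a
            by (metis length_map linorder_neqE_nat)
        qed
        thus "map (\<lambda>t. snd (I i) (js ! ix t)) ts ! a = map (snd (I i)) js ! a" using a len by simp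
      qed (simp add: len)
      finally show ?thesis .
    qed
    ultimately show "psat U p (concat (map (snd (I i)) ts)) = psat U p (concat (map (snd (I i)) js))" by simp
  qed
qed

lemma indiscernible_single: "indiscernible L U A I \<longleftrightarrow> mutually_indiscernible L U A {()} (\<lambda>_. I)"
  by (auto simp: mutually_indiscernible_def)

end

section \<open>Bounded alternation\<close>

locale nip_monster = monster L U kb
  for L :: "('f, 'r) lang" and U :: "('f, 'r, 'm) struct" and kb :: "'k rel" +
  assumes nip: "NIP L U"
begin

lemma envs_case_sum: "v \<in> envs \<Longrightarrow> c \<in> envs \<Longrightarrow> case_sum v c \<in> envs"
  by (rule envsI) (auto split: sum.splits intro: envsD)

text \<open>From a long alternating sequence any pattern of truth values is read off by choosing the
  even or the odd member of each consecutive pair. Indiscernibility transfers all finite patterns to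
  \<open>w\<close>, and compactness then makes its tuples a shattered infinite set. Only the type of
  \<open>w'\<close> enters, so one bound serves all sequences of that type.\<close>

lemma nip_alternation:
  fixes w :: "nat \<times> 'c \<Rightarrow> 'm" and \<theta> :: "('c + 'p \<Rightarrow> 'm) \<Rightarrow> bool"
  assumes w: "w \<in> envs" and Cs: "finite Cs" and \<theta>: "dfn {} (Inl ` Cs \<union> Inr ` Ps) \<theta>"
    and ind: "\<And>S \<tau>. strict_mono_on S \<tau> \<Longrightarrow> teq {} (S \<times> Cs) w (w \<circ> map_prod \<tau> id)"
  shows "\<exists>b>0. \<forall>N\<ge>b. \<forall>w'\<in>envs. \<forall>c\<in>envs. teq {} ({..<2 * N} \<times> Cs) w' w \<longrightarrow>
    \<not> (\<forall>i<2 * N. \<theta> (case_sum (\<lambda>x. w' (i, x)) c) \<longleftrightarrow> even i)"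
proof (rule ccontr)
  assume "\<not> ?thesis"
  hence alt: "\<exists>N\<ge>b. \<exists>w'\<in>envs. \<exists>c\<in>envs. teq {} ({..<2 * N} \<times> Cs) w' w \<and>
      (\<forall>i<2 * N. \<theta> (case_sum (\<lambda>x. w' (i, x)) c) \<longleftrightarrow> even i)" if "b > 0" for b
    using that by blast
  obtain S0 where S0: "finite S0" "S0 \<subseteq> Inl ` Cs \<union> Inr ` Ps" "dfn {} S0 \<theta>"
    using dfn_finite_ex[OF \<theta>] by (elim exE conjE)
  define P0 where "P0 = {p. Inr p \<in> S0}"
  have "finite (Inr ` P0 :: ('c + 'p) set)" by (rule finite_subset[OF _ S0(1)]) (auto simp: P0_def)
  hence P0: "finite P0" by (rule finite_imageD) simp
  have \<theta>0: "dfn {} (Inl ` Cs \<union> Inr ` P0) \<theta>"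
    by (rule dfn_mono[OF S0(3)]) (use S0(2) in \<open>auto simp: P0_def\<close>)
  have fin: "\<exists>c\<in>envs. \<forall>i<N. \<theta> (case_sum (\<lambda>x. w (i, x)) c) \<longleftrightarrow> i \<in> \<eta>" for N :: nat and \<eta> :: "nat set"
  proof -
    obtain N' w' c where N': "N' \<ge> Suc N" "w' \<in> envs" "c \<in> envs" "teq {} ({..<2 * N'} \<times> Cs) w' w"
      "\<forall>i<2 * N'. \<theta> (case_sum (\<lambda>x. w' (i, x)) c) \<longleftrightarrow> even i"
      using alt[of "Suc N"] by (metis zero_less_Suc)
    define \<tau> where "\<tau> i = 2 * i + (if i \<in> \<eta> then 0 else 1)" for i :: nat
    have \<tau>: "strict_mono_on {..<N} \<tau>" by (rule strict_mono_onI) (auto simp: \<tau>_def)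
    have \<tau>N: "\<tau> i < 2 * N'" "even (\<tau> i) \<longleftrightarrow> i \<in> \<eta>" if "i < N" for i using that N'(1) by (auto simp: \<tau>_def)
    have t: "teq {} ({..<N} \<times> Cs) (w' \<circ> map_prod \<tau> id) w"
    proof (rule teq_trans)
      show "teq {} ({..<N} \<times> Cs) (w' \<circ> map_prod \<tau> id) (w \<circ> map_prod \<tau> id)"
        by (rule teq_reindex[OF N'(4)]) (use \<tau>N(1) in auto)
      show "teq {} ({..<N} \<times> Cs) (w \<circ> map_prod \<tau> id) w" by (rule teq_sym[OF ind[OF \<tau>]])
    qed
    define g where "g i y = (case y of Inl x \<Rightarrow> Inl (i, x) | Inr p \<Rightarrow> Inr p)"
      for i :: nat and y :: "'c + 'p"
    have d1: "dfn {} (Inl ` ({..<N} \<times> Cs) \<union> Inr ` P0) (\<lambda>k. \<theta> (k \<circ> g i))" if "i < N" for i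
      by (rule dfn_reindex[OF \<theta>0]) (use that in \<open>auto simp: g_def\<close>)
    have "dfn {} (Inl ` ({..<N} \<times> Cs) \<union> Inr ` P0) (\<lambda>k. \<forall>i\<in>{..<N}. \<theta> (k \<circ> g i) \<longleftrightarrow> i \<in> \<eta>)"
      by (rule dfn_Ball) (auto intro!: dfn_iff dfn_const d1)
    from dfn_Ex[OF this, of "range Inl"]
    have d2: "dfn {} (Inl ` ({..<N} \<times> Cs)) (\<lambda>k. \<exists>k'\<in>envs. (\<forall>v\<in>range Inl. k' v = k v) \<and>
       (\<forall>i\<in>{..<N}. \<theta> (k' \<circ> g i) \<longleftrightarrow> i \<in> \<eta>))"
      by (rule dfn_mono) auto
    define E where "E k \<longleftrightarrow> (\<exists>k'\<in>envs. (\<forall>v\<in>range Inl. k' v = k v) \<and> (\<forall>i\<in>{..<N}. \<theta> (k' \<circ> g i) \<longleftrightarrow> i \<in> \<eta>))"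
      for k :: "(nat \<times> 'c) + 'p \<Rightarrow> 'm"
    \<comment> \<open>The parameter variables are quantified in \<open>E\<close>; their values in
      the argument are filled in with \<open>u0\<close>.\<close>
    have E: "E (case_sum v (\<lambda>_. u0)) \<longleftrightarrow> (\<exists>c\<in>envs. \<forall>i<N. \<theta> (case_sum (\<lambda>x. v (i, x)) c) \<longleftrightarrow> i \<in> \<eta>)" if "v \<in> envs" for v
    proof
      assume "E (case_sum v (\<lambda>_. u0))"
      then obtain k' where k': "k' \<in> envs" "\<And>x. k' (Inl x) = v x" "\<And>i. i < N \<Longrightarrow> \<theta> (k' \<circ> g i) \<longleftrightarrow> i \<in> \<eta>"
        unfolding E_def by auto
      have "k' \<circ> g i = case_sum (\<lambda>x. v (i, x)) (k' \<circ> Inr)" for i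
        by (rule ext) (auto simp: g_def k'(2) split: sum.splits)
      hence "\<forall>i<N. \<theta> (case_sum (\<lambda>x. v (i, x)) (k' \<circ> Inr)) \<longleftrightarrow> i \<in> \<eta>" using k'(3) by simp
      thus "\<exists>c\<in>envs. \<forall>i<N. \<theta> (case_sum (\<lambda>x. v (i, x)) c) \<longleftrightarrow> i \<in> \<eta>"
        using envs_comp[OF k'(1), of Inr] by blast
    next
      assume "\<exists>c\<in>envs. \<forall>i<N. \<theta> (case_sum (\<lambda>x. v (i, x)) c) \<longleftrightarrow> i \<in> \<eta>"
      then obtain c where c: "c \<in> envs" "\<forall>i<N. \<theta> (case_sum (\<lambda>x. v (i, x)) c) \<longleftrightarrow> i \<in> \<eta>" by (elim bexE)
      have "case_sum v c \<in> envs" using that c(1) by (rule envs_case_sum)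
      moreover have "case_sum v c \<circ> g i = case_sum (\<lambda>x. v (i, x)) c" for i
        by (rule ext) (auto simp: g_def split: sum.splits)
      ultimately show "E (case_sum v (\<lambda>_. u0))"
        unfolding E_def using c(2) by (intro bexI[of _ "case_sum v c"]) auto
    qed
    have dE: "dfn {} (Inl ` ({..<N} \<times> Cs)) E" using d2 unfolding E_def[abs_def] .
    have d3': "dfn {} ({..<N} \<times> Cs) (\<lambda>v. E (\<lambda>y. case_sum v id (case y of Inl z \<Rightarrow> Inl z | Inr _ \<Rightarrow> Inr u0)))"
      by (rule dfn_subst[OF dE]) (use u0 in \<open>auto split: sum.splits\<close>)
    have eq3: "(\<lambda>y. case_sum v id (case y of Inl z \<Rightarrow> Inl z | Inr _ \<Rightarrow> Inr u0)) = case_sum v (\<lambda>_. u0)" for v :: "nat \<times> 'c \<Rightarrow> 'm"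
      by (rule ext) (auto split: sum.splits)
    have d3: "dfn {} ({..<N} \<times> Cs) (\<lambda>v. E (case_sum v (\<lambda>_. u0)))"
      by (rule dfn_cong[OF d3']) (simp only: eq3)
    have "E (case_sum (w' \<circ> map_prod \<tau> id) (\<lambda>_. u0))"
      unfolding E[OF envs_comp[OF N'(2)]]
      using N'(3,5) \<tau>N by (intro bexI[of _ c]) auto
    hence "E (case_sum w (\<lambda>_. u0))" using teqD[OF t d3] by blast
    thus ?thesis unfolding E[OF w] .
  qed
  have real: "\<exists>c\<in>envs. \<forall>i. \<theta> (case_sum (\<lambda>x. w (i, x)) c) \<longleftrightarrow> i \<in> \<eta>" for \<eta> :: "nat set"
  proof -
    define F where "F i c \<longleftrightarrow> (\<theta> (case_sum (\<lambda>x. w (i, x)) c) \<longleftrightarrow> i \<in> \<eta>)" for i and c :: "'p \<Rightarrow> 'm"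
    have "\<exists>c\<in>envs. \<forall>P\<in>range F. P c"
    proof (rule realize)
      show "|P0| <o kb" using P0 by (rule small_finite)
      show "|w ` (UNIV \<times> Cs)| <o kb"
        by (rule small_countable) (use Cs in \<open>auto intro: countable_finite\<close>)
      show "w ` (UNIV \<times> Cs) \<subseteq> univ U" using w by (auto simp: envs_def)
      show "dfn (w ` (UNIV \<times> Cs)) P0 P" if PF: "P \<in> range F" for P
      proof -
        obtain i where i: "P = F i" using PF by blast
        have d4: "dfn (w ` (UNIV \<times> Cs)) P0 (\<lambda>c. \<theta> (\<lambda>y. case_sum c id (case y of Inl x \<Rightarrow> Inr (w (i, x)) | Inr p \<Rightarrow> Inl p)))"
          by (rule dfn_subst[OF \<theta>0]) (use envsD[OF w] in \<open>auto split: sum.splits\<close>)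
        have eq4: "(\<lambda>y. case_sum c id (case y of Inl x \<Rightarrow> Inr (w (i, x)) | Inr p \<Rightarrow> Inl p)) = case_sum (\<lambda>x. w (i, x)) c" for c
          by (rule ext) (auto split: sum.splits)
        have "dfn (w ` (UNIV \<times> Cs)) P0 (\<lambda>c. \<theta> (case_sum (\<lambda>x. w (i, x)) c))"
          by (rule dfn_cong[OF d4]) (simp only: eq4)
        from dfn_iff[OF this dfn_const] show ?thesis unfolding i F_def[abs_def] .
      qed
      fix \<Sigma>0 assume "finite \<Sigma>0" "\<Sigma>0 \<subseteq> range F"
      then obtain I where I: "finite I" "\<Sigma>0 = F ` I" by (meson finite_subset_image)
      then obtain N where N: "\<forall>i\<in>I. i < N" using finite_nat_set_iff_bounded by blast
      obtain c where "c \<in> envs" "\<forall>i<N. \<theta> (case_sum (\<lambda>x. w (i, x)) c) \<longleftrightarrow> i \<in> \<eta>" using fin[of N \<eta>] by (elim bexE)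
      thus "\<exists>c\<in>envs. \<forall>P\<in>\<Sigma>0. P c" using N I(2) by (intro bexI[of _ c]) (auto simp: F_def)
    qed
    thus ?thesis unfolding F_def by auto
  qed
  obtain cs where cs: "set cs = Cs" using finite_list[OF Cs] by (elim exE)
  obtain ps where ps: "set ps = P0" using finite_list[OF P0] by (elim exE)
  let ?xs = "map Inl cs @ map Inr ps :: ('c + 'p) list"
  have sub: "Inl ` Cs \<union> Inr ` P0 \<subseteq> set ?xs" using cs ps by auto
  obtain p where p: "p \<in> pfmlas L {} (length ?xs)" "\<forall>h\<in>envs. psat U p (map h ?xs) \<longleftrightarrow> \<theta> h"
    using dfn_pfm_ex[OF \<theta>0 sub] by (elim bexE)
  obtain \<phi> where \<phi>: "p = (\<phi>, [])" "\<phi> \<in> fmlas L (length cs + length ps)"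
    using p(1) by (cases p) (auto simp: pfmlas_def)
  define tup where "tup i = map (\<lambda>x. w (i, x)) cs" for i
  have sat: "sat U (\<lambda>a. (tup i @ map c ps) ! a) \<phi> \<longleftrightarrow> \<theta> (case_sum (\<lambda>x. w (i, x)) c)" if "c \<in> envs" for i c
  proof -
    have "(\<lambda>x. w (i, x)) \<in> envs" by (rule envsI) (rule envsD[OF w])
    hence "case_sum (\<lambda>x. w (i, x)) c \<in> envs" using that by (rule envs_case_sum)
    from p(2)[rule_format, OF this] show ?thesis
      by (simp add: psat_def \<phi> tup_def comp_def)
  qed
  have "shatters U (length ps) \<phi> (range tup)"
    unfolding shatters_def
  proof (intro allI impI)
    fix S0 assume S0: "S0 \<subseteq> range tup"
    obtain c where c: "c \<in> envs" "\<forall>i. \<theta> (case_sum (\<lambda>x. w (i, x)) c) \<longleftrightarrow> i \<in> {i. tup i \<in> S0}"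
      using real[of "{i. tup i \<in> S0}"] by (elim bexE)
    show "\<exists>b\<in>tuples U (length ps). \<forall>a\<in>range tup. sat U (\<lambda>i. (a @ b) ! i) \<phi> \<longleftrightarrow> a \<in> S0"
    proof (intro bexI[of _ "map c ps"] ballI)
      show "map c ps \<in> tuples U (length ps)" using envsD[OF c(1)] by (auto simp: tuples_def)
      fix a assume "a \<in> range tup"
      then obtain i where a: "a = tup i" by blast
      show "sat U (\<lambda>i. (a @ map c ps) ! i) \<phi> \<longleftrightarrow> a \<in> S0"
        unfolding a sat[OF c(1)] using spec[OF c(2), of i] by simp
    qed
  qed
  \<comment> \<open>The shattered set is infinite: a parameter that is true exactly at the index
    \<open>i\<close> separates the tuple at \<open>i\<close> from the others.\<close>
  moreover have "inj tup"
  proof (rule injI)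
    fix i j assume ij: "tup i = tup j"
    obtain c where c: "c \<in> envs" "\<forall>l. \<theta> (case_sum (\<lambda>x. w (l, x)) c) \<longleftrightarrow> l \<in> {i}"
      using real[of "{i}"] by (elim bexE)
    have "\<theta> (case_sum (\<lambda>x. w (i, x)) c)" using spec[OF c(2), of i] by simp
    hence "\<theta> (case_sum (\<lambda>x. w (j, x)) c)"
      unfolding sat[OF c(1), of i, symmetric] sat[OF c(1), of j, symmetric] ij .
    thus "i = j" using spec[OF c(2), of j] by simp
  qed
  hence "infinite (range tup)" by (simp add: finite_image_iff)
  moreover have "range tup \<subseteq> tuples U (length cs)" using envsD[OF w] by (auto simp: tuples_def tup_def)
  ultimately show False using nip \<phi>(2) unfolding NIP_def by blast
qed

text \<open>Realizes finitely many complete types at once, each pulled back along its own map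
  \<open>g i\<close> of variables, with the values on \<open>F\<close> prescribed. One formula from
  each type suffices for finite satisfiability, since types are closed under conjunction.\<close>

lemma compactness:
  fixes K :: "'v \<Rightarrow> 'm" and h :: "'x \<Rightarrow> 'u \<Rightarrow> 'm" and g :: "'x \<Rightarrow> 'u \<Rightarrow> 'v"
  assumes I: "finite Idx" and W: "|W| <o kb" and A: "|A| <o kb" "A \<subseteq> univ U"
    and F: "F \<subseteq> W" and g: "\<And>i. i \<in> Idx \<Longrightarrow> g i ` T i \<subseteq> W"
    and K: "K \<in> envs" and h: "\<And>i. i \<in> Idx \<Longrightarrow> h i \<in> envs"
    and fin: "\<And>P. (\<And>i. i \<in> Idx \<Longrightarrow> dfn A (T i) (P i)) \<Longrightarrow> (\<And>i. i \<in> Idx \<Longrightarrow> P i (h i)) \<Longrightarrow>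
      \<exists>z\<in>envs. (\<forall>v\<in>F. z v = K v) \<and> (\<forall>i\<in>Idx. P i (z \<circ> g i))"
  shows "\<exists>z\<in>envs. (\<forall>v\<in>F. z v = K v) \<and> (\<forall>i\<in>Idx. teq A (T i) (z \<circ> g i) (h i))"
proof -
  define TP where "TP i = {P. dfn A (T i) P \<and> P (h i)}" for i
  define pull where "pull i P z \<longleftrightarrow> P (z \<circ> g i)" for i P and z :: "'v \<Rightarrow> 'm"
  define \<Sigma> where "\<Sigma> = (\<lambda>v z. z v = K v) ` F \<union> (\<Union>i\<in>Idx. pull i ` TP i)"
  let ?B = "A \<union> K ` F"
  have "\<exists>z\<in>envs. \<forall>P\<in>\<Sigma>. P z"
  proof (rule realize)
    show "|W| <o kb" by (rule W)
    show "|?B| <o kb" by (intro small_Un small_image A small_subset_mono[OF W F])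
    show "?B \<subseteq> univ U" using A(2) envsD[OF K] by auto
    show "dfn ?B W P" if P: "P \<in> \<Sigma>" for P
    proof -
      from P consider v where "v \<in> F" "P = (\<lambda>z. z v = K v)" | i Q where "i \<in> Idx" "Q \<in> TP i" "P = pull i Q"
        unfolding \<Sigma>_def by blast
      thus ?thesis
      proof cases
        case 1
        thus ?thesis using F by (auto intro!: dfn_eq_const)
      next
        case 2
        hence "dfn A W (\<lambda>z. Q (z \<circ> g i))" by (intro dfn_reindex[of A "T i"]) (auto simp: TP_def g)
        thus ?thesis unfolding 2(3) pull_def[abs_def] by (rule dfn_mono) auto
      qed
    qed
    fix \<Sigma>0 assume \<Sigma>0: "finite \<Sigma>0" "\<Sigma>0 \<subseteq> \<Sigma>"
    have exQ: "\<forall>i. \<exists>Q. Q \<subseteq> TP i \<and> finite Q \<and> \<Sigma>0 \<inter> pull i ` TP i = pull i ` Q"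
    proof
      fix i
      show "\<exists>Q. Q \<subseteq> TP i \<and> finite Q \<and> \<Sigma>0 \<inter> pull i ` TP i = pull i ` Q"
        using finite_subset_image[of "\<Sigma>0 \<inter> pull i ` TP i" "pull i" "TP i"] \<Sigma>0(1) by blast
    qed
    obtain Q where Q: "\<forall>i. Q i \<subseteq> TP i \<and> finite (Q i) \<and> \<Sigma>0 \<inter> pull i ` TP i = pull i ` Q i"
      using choice[OF exQ] by (elim exE)
    define P where "P i u \<longleftrightarrow> (\<forall>R\<in>Q i. R u)" for i and u :: "'u \<Rightarrow> 'm"
    have "\<exists>z\<in>envs. (\<forall>v\<in>F. z v = K v) \<and> (\<forall>i\<in>Idx. P i (z \<circ> g i))"
    proof (rule fin)
      fix i assume "i \<in> Idx"
      have "dfn A (T i) (\<lambda>u. \<forall>R\<in>Q i. R u)"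
      proof (rule dfn_Ball)
        show "finite (Q i)" using Q by simp
        show "dfn A (T i) R" if "R \<in> Q i" for R
        proof -
          have "R \<in> TP i" using Q that by blast
          thus ?thesis by (simp add: TP_def)
        qed
      qed
      thus "dfn A (T i) (P i)" unfolding P_def[abs_def] .
      show "P i (h i)" unfolding P_def
      proof
        fix R assume "R \<in> Q i"
        hence "R \<in> TP i" using Q by blast
        thus "R (h i)" by (simp add: TP_def)
      qed
    qed
    then obtain z where z: "z \<in> envs" "\<forall>v\<in>F. z v = K v" "\<forall>i\<in>Idx. P i (z \<circ> g i)" by (elim bexE conjE)
    show "\<exists>z\<in>envs. \<forall>P\<in>\<Sigma>0. P z"
    proof (intro bexI[OF _ z(1)] ballI)
      fix R assume R: "R \<in> \<Sigma>0"
      show "R z"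
      proof (cases "R \<in> (\<lambda>v z. z v = K v) ` F")
        case True
        thus ?thesis using z(2) by auto
      next
        case False
        then obtain i where i: "i \<in> Idx" "R \<in> pull i ` TP i" using R \<Sigma>0(2) unfolding \<Sigma>_def by blast
        hence "R \<in> pull i ` Q i" using Q R by blast
        then obtain R' where R': "R' \<in> Q i" "R = pull i R'" by blast
        show ?thesis unfolding R'(2) pull_def using bspec[OF z(3) i(1)] R'(1) unfolding P_def by (rule bspec)
      qed
    qed
  qed
  then obtain z where z: "z \<in> envs" "\<forall>P\<in>\<Sigma>. P z" by (elim bexE)
  have "teq A (T i) (z \<circ> g i) (h i)" if i: "i \<in> Idx" for i
    unfolding teq_def
  proof (intro allI impI)
    fix P :: "('u \<Rightarrow> 'm) \<Rightarrow> bool" assume P: "dfn A (T i) P"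
    have *: "R (z \<circ> g i)" if "R \<in> TP i" for R
    proof -
      have "pull i R \<in> \<Sigma>" unfolding \<Sigma>_def by (intro UnI2 UN_I[OF i] imageI that)
      from bspec[OF z(2) this] show ?thesis unfolding pull_def .
    qed
    show "P (z \<circ> g i) = P (h i)"
    proof (cases "P (h i)")
      case True
      thus ?thesis using *[of P] P by (simp add: TP_def)
    next
      case False
      thus ?thesis using *[of "\<lambda>u. \<not> P u"] dfn_Neg[OF P] by (simp add: TP_def)
    qed
  qed
  moreover have "\<forall>v\<in>F. z v = K v"
  proof
    fix v assume "v \<in> F"
    hence "(\<lambda>z. z v = K v) \<in> \<Sigma>" unfolding \<Sigma>_def by (intro UnI1 imageI)
    from bspec[OF z(2) this] show "z v = K v" .
  qed
  ultimately show ?thesis using z(1) by blast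
qed

end

section \<open>Arrays of indiscernible sequences with gaps\<close>

text \<open>The piecewise linear map fixing everything outside \<open>(a, b)\<close> and sending \<open>a\<^sub>1, a\<^sub>2\<close> to \<open>d\<^sub>1, d\<^sub>2\<close>.\<close>

definition pwl :: "rat \<Rightarrow> rat \<Rightarrow> rat \<Rightarrow> rat \<Rightarrow> rat \<Rightarrow> rat \<Rightarrow> rat \<Rightarrow> rat" where
  "pwl a b a1 a2 d1 d2 q =
    (if q \<le> a \<or> b \<le> q then q
     else if q < a1 then a + (q - a) * ((d1 - a) / (a1 - a))
     else if q \<le> a2 then d1 + (q - a1) * ((d2 - d1) / (a2 - a1))
     else b - (b - q) * ((b - d2) / (b - a2)))"

lemma pwl_range:
  assumes "a < a1" "a1 < a2" "a2 < b" "a < d1" "d1 < d2" "d2 < b"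
  shows "q \<le> a \<or> b \<le> q \<Longrightarrow> pwl a b a1 a2 d1 d2 q = q"
    "a < q \<Longrightarrow> q < a1 \<Longrightarrow> a < pwl a b a1 a2 d1 d2 q \<and> pwl a b a1 a2 d1 d2 q < d1"
    "a1 \<le> q \<Longrightarrow> q \<le> a2 \<Longrightarrow> d1 \<le> pwl a b a1 a2 d1 d2 q \<and> pwl a b a1 a2 d1 d2 q \<le> d2"
    "a2 < q \<Longrightarrow> q < b \<Longrightarrow> d2 < pwl a b a1 a2 d1 d2 q \<and> pwl a b a1 a2 d1 d2 q < b"
proof -
  show "q \<le> a \<or> b \<le> q \<Longrightarrow> pwl a b a1 a2 d1 d2 q = q" by (auto simp: pwl_def)
next
  assume q: "a < q" "q < a1"
  let ?s = "(d1 - a) / (a1 - a)"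
  have s: "?s > 0" using assms by simp
  have "(q - a) * ?s < (a1 - a) * ?s" using s q by (intro mult_strict_right_mono) auto
  hence "(q - a) * ?s < d1 - a" using assms by simp
  moreover have "0 < (q - a) * ?s" using s q by (intro mult_pos_pos) auto
  ultimately show "a < pwl a b a1 a2 d1 d2 q \<and> pwl a b a1 a2 d1 d2 q < d1"
    using q assms by (auto simp: pwl_def)
next
  assume q: "a1 \<le> q" "q \<le> a2"
  let ?s = "(d2 - d1) / (a2 - a1)"
  have s: "?s > 0" using assms by simp
  have "(q - a1) * ?s \<le> (a2 - a1) * ?s" using s q by (intro mult_right_mono) auto
  hence "(q - a1) * ?s \<le> d2 - d1" using assms by simp
  moreover have "0 \<le> (q - a1) * ?s" using s q by (intro mult_nonneg_nonneg) auto
  ultimately show "d1 \<le> pwl a b a1 a2 d1 d2 q \<and> pwl a b a1 a2 d1 d2 q \<le> d2"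
    using q assms by (auto simp: pwl_def)
next
  assume q: "a2 < q" "q < b"
  let ?s = "(b - d2) / (b - a2)"
  have s: "?s > 0" using assms by simp
  have "(b - q) * ?s < (b - a2) * ?s" using s q by (intro mult_strict_right_mono) auto
  hence "(b - q) * ?s < b - d2" using assms by simp
  moreover have "0 < (b - q) * ?s" using s q by (intro mult_pos_pos) auto
  ultimately show "d2 < pwl a b a1 a2 d1 d2 q \<and> pwl a b a1 a2 d1 d2 q < b"
    using q assms by (auto simp: pwl_def)
qed

lemma pwl_strict_mono:
  assumes o: "a < a1" "a1 < a2" "a2 < b" "a < d1" "d1 < d2" "d2 < b" and xy: "x < y"
  shows "pwl a b a1 a2 d1 d2 x < pwl a b a1 a2 d1 d2 y"
proof -
  let ?f = "pwl a b a1 a2 d1 d2"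
  note R = pwl_range[OF o]
  consider "x \<le> a" "y \<le> a" | "x \<le> a" "a < y" "y < b" | "x \<le> a" "b \<le> y" | "b \<le> x"
    | "a < x" "x < b" "b \<le> y" | "a < x" "x < b" "y < b" using xy by linarith
  thus ?thesis
  proof cases
    case 2
    have "a < ?f y" using R(2-4)[of y] 2 o by linarith
    thus ?thesis using R(1)[of x] 2 by simp
  next
    case 5
    have "?f x < b" using R(2-4)[of x] 5 o by linarith
    thus ?thesis using R(1)[of y] 5 by simp
  next
    case 6
    then consider "y < a1" | "x < a1" "a1 \<le> y" | "a1 \<le> x" "y \<le> a2" | "a1 \<le> x" "x \<le> a2" "a2 < y" | "a2 < x"
      by linarith
    thus ?thesis
    proof cases
      case 1
      have "(x - a) * ((d1 - a) / (a1 - a)) < (y - a) * ((d1 - a) / (a1 - a))"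
        using o xy by (intro mult_strict_right_mono) auto
      thus ?thesis using 1 6 xy by (auto simp: pwl_def)
    next
      case 2
      thus ?thesis using R(2)[of x] R(3)[of y] R(4)[of y] 6 o xy by linarith
    next
      case 3
      have "(x - a1) * ((d2 - d1) / (a2 - a1)) < (y - a1) * ((d2 - d1) / (a2 - a1))"
        using o xy by (intro mult_strict_right_mono) auto
      thus ?thesis using 3 6 xy by (auto simp: pwl_def)
    next
      case 4
      thus ?thesis using R(3)[of x] R(4)[of y] 6 xy by linarith
    next
      case 5
      have "(b - y) * ((b - d2) / (b - a2)) < (b - x) * ((b - d2) / (b - a2))"
        using o xy by (intro mult_strict_right_mono) auto
      thus ?thesis using 5 6 xy o by (auto simp: pwl_def)
    qed
  qed (use xy in \<open>auto simp: pwl_def\<close>)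
qed

text \<open>Affine coordinates for the gap of radius \<open>d\<close> around \<open>p\<close>, with
  centre 0 and ends -1 and 1. A finite sequence in a gap is thus given by a set \<open>X\<close> of
  relative positions that survives every change of centre and scale.\<close>

definition pl :: "rat \<Rightarrow> rat \<Rightarrow> rat \<Rightarrow> rat" where
  "pl p d x = p + d * x"

lemma pl_0 [simp]: "pl p d 0 = p" by (simp add: pl_def)

lemma pl_bound: "0 < d \<Longrightarrow> \<bar>x\<bar> \<le> 1 \<Longrightarrow> \<bar>pl p d x - p\<bar> \<le> d"
  using mult_left_mono[of "\<bar>x\<bar>" 1 d] by (simp add: pl_def abs_mult)

lemma pl_less: "0 < d \<Longrightarrow> pl p d x < pl p d y \<longleftrightarrow> x < y" by (simp add: pl_def)

lemma pl_eq: "0 < d \<Longrightarrow> pl p d x = pl p d y \<longleftrightarrow> x = y" by (simp add: pl_def)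

lemma pl_inv: "0 < d \<Longrightarrow> (pl p d x - p) / d = x" by (simp add: pl_def)

definition rowmono :: "(nat \<times> rat) set \<Rightarrow> (nat \<times> rat \<Rightarrow> nat \<times> rat) \<Rightarrow> bool" where
  "rowmono S \<tau> \<longleftrightarrow> (\<forall>q\<in>S. fst (\<tau> q) = fst q) \<and>
     (\<forall>q\<in>S. \<forall>q'\<in>S. fst q = fst q' \<and> snd q < snd q' \<longrightarrow> snd (\<tau> q) < snd (\<tau> q'))"

lemma rowmonoI:
  assumes "\<And>k x. (k, x) \<in> S \<Longrightarrow> fst (\<tau> (k, x)) = k"
    "\<And>k x y. (k, x) \<in> S \<Longrightarrow> (k, y) \<in> S \<Longrightarrow> x < y \<Longrightarrow> snd (\<tau> (k, x)) < snd (\<tau> (k, y))"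
  shows "rowmono S \<tau>"
  using assms unfolding rowmono_def by auto

lemma lift_times: "(\<And>q. q \<in> S \<Longrightarrow> f q \<in> T) \<Longrightarrow> lift f ` (S \<times> N) \<subseteq> T \<times> N"
  by force

text \<open>Only the type of \<open>e\<close> matters: it is the reference type of a mutually
  indiscernible array, with which other arrays are compared by \<open>Es\<close>.\<close>

locale ref_array = nip_monster L U kb
  for L :: "('f, 'r) lang" and U :: "('f, 'r, 'm) struct" and kb :: "'k rel" +
  fixes e :: "(nat \<times> rat) \<times> nat \<Rightarrow> 'm" and m :: nat
  assumes e_env: "e \<in> envs"
    and e_ind: "\<And>S \<tau>. rowmono S \<tau> \<Longrightarrow> teq {} (S \<times> {..<m}) e (e \<circ> lift \<tau>)"
begin

text \<open>\<open>Es D s\<close>: the tuples of \<open>s\<close> at the positions in \<open>D\<close> have the type of those of \<open>e\<close>.\<close>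

definition Es :: "(nat \<times> rat) set \<Rightarrow> ((nat \<times> rat) \<times> nat \<Rightarrow> 'm) \<Rightarrow> bool" where
  "Es D s \<longleftrightarrow> s \<in> envs \<and> teq {} (D \<times> {..<m}) s e"

definition agree :: "(nat \<times> rat) set \<Rightarrow> ((nat \<times> rat) \<times> nat \<Rightarrow> 'm) \<Rightarrow> ((nat \<times> rat) \<times> nat \<Rightarrow> 'm) \<Rightarrow> bool" where
  "agree D s s' \<longleftrightarrow> (\<forall>q\<in>D. \<forall>c<m. s (q, c) = s' (q, c))"

lemma agreeD: "agree D s s' \<Longrightarrow> q \<in> D \<Longrightarrow> c < m \<Longrightarrow> s (q, c) = s' (q, c)"
  by (simp add: agree_def)

lemma agreeI: "(\<And>q c. q \<in> D \<Longrightarrow> c < m \<Longrightarrow> s (q, c) = s' (q, c)) \<Longrightarrow> agree D s s'"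
  by (simp add: agree_def)

lemma agree_mono: "agree D s s' \<Longrightarrow> D' \<subseteq> D \<Longrightarrow> agree D' s s'"
  by (auto simp: agree_def)

lemma agree_trans: "agree D s s' \<Longrightarrow> agree D s' s'' \<Longrightarrow> agree D s s''"
  by (simp add: agree_def)

lemma Es_env: "Es D s \<Longrightarrow> s \<in> envs" by (simp add: Es_def)

lemma Es_mono: "Es D s \<Longrightarrow> D' \<subseteq> D \<Longrightarrow> Es D' s"
  unfolding Es_def by (meson Sigma_mono order_refl teq_mono)

lemma teq_agree': "s \<in> envs \<Longrightarrow> s' \<in> envs \<Longrightarrow> agree D s s' \<Longrightarrow> teq {} (D \<times> {..<m}) s s'"
  by (rule teq_agree) (auto simp: agree_def)

lemma Es_agree: "Es D s \<Longrightarrow> s' \<in> envs \<Longrightarrow> agree D s' s \<Longrightarrow> Es D s'"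
  using teq_agree' teq_trans unfolding Es_def by blast

lemma Es_reindex:
  assumes "Es D s" "rowmono D' \<tau>" "\<tau> ` D' \<subseteq> D"
  shows "Es D' (s \<circ> lift \<tau>)"
proof -
  have "teq {} (D' \<times> {..<m}) (s \<circ> lift \<tau>) (e \<circ> lift \<tau>)"
    by (rule teq_reindex[of _ "D \<times> {..<m}"]) (use assms in \<open>auto simp: Es_def\<close>)
  thus ?thesis
    using teq_trans[OF _ teq_sym[OF e_ind[OF assms(2)]]] envs_comp assms(1) unfolding Es_def by blast
qed

lemma EsD: "Es D s \<Longrightarrow> dfn {} (D \<times> {..<m}) P \<Longrightarrow> P s \<longleftrightarrow> P e"
  unfolding Es_def using teqD[of "{}" "D \<times> {..<m}" s e P] by blast

lemma small_pos: "|(W :: (nat \<times> rat) set) \<times> {..<m}| <o kb"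
  by (rule small_countable) simp

lemma extend_pos:
  assumes "h \<in> envs" "h' \<in> envs" "S \<subseteq> W" "teq {} (S \<times> {..<m}) h h'"
  shows "\<exists>k\<in>envs. agree S k h' \<and> teq {} (W \<times> {..<m}) k h"
proof -
  have "\<exists>k\<in>envs. (\<forall>v\<in>S \<times> {..<m}. k v = h' v) \<and> teq {} (W \<times> {..<m}) k h"
    by (rule extend_type) (use assms small_pos small_finite in auto)
  thus ?thesis unfolding agree_def by auto
qed

lemma Es_extend:
  assumes "Es D s" "D \<subseteq> D'"
  shows "\<exists>s'. agree D s' s \<and> Es D' s'"
proof -
  have "\<exists>k\<in>envs. agree D k s \<and> teq {} (D' \<times> {..<m}) k e"
    by (rule extend_pos[OF e_env _ assms(2)]) (use assms(1) teq_sym in \<open>auto simp: Es_def\<close>)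
  thus ?thesis unfolding Es_def by blast
qed

text \<open>The last clause fills a margin of width \<open>\<epsilon>\<close> on both sides of the
  gap. Positions around a gap that has been moved can be mapped back into this margin by a piecewise
  linear map.\<close>

definition gapok :: "nat \<Rightarrow> rat \<Rightarrow> rat \<Rightarrow> rat \<Rightarrow> (nat \<times> rat) set \<Rightarrow> bool" where
  "gapok M p d \<epsilon> D \<longleftrightarrow> 0 < d \<and> 0 < \<epsilon> \<and>
     (\<forall>k<M. \<forall>q. \<bar>q - p\<bar> \<le> d \<longrightarrow> (k, q) \<notin> D) \<and>
     (\<forall>k<M. \<forall>q. d < \<bar>q - p\<bar> \<and> \<bar>q - p\<bar> < d + \<epsilon> \<longrightarrow> (k, q) \<in> D)"

text \<open>
  \<open>StarT M\<close>: there is an array with a gap in each of its first \<open>M\<close> rows, and in each gap a finite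
  sequence at the positions \<open>pl p d ` X\<close> that can be inserted in its own row, such that there are
  no elements \<open>y\<^sub>k\<close>, lying at \<open>p\<close> inside these finite sequences, that can be inserted simultaneously.
\<close>

definition StarT :: "nat \<Rightarrow> bool" where
  "StarT M \<longleftrightarrow> (\<exists>p d \<epsilon> D X K. gapok M p d \<epsilon> D \<and> finite X \<and> X \<subseteq> {-1..1} - {0} \<and> Es D K \<and>
     (\<forall>k<M. Es (D \<union> {k} \<times> pl p d ` X) K) \<and>
     \<not> (\<exists>z. agree (D \<union> {..<M} \<times> pl p d ` X) z K \<and> Es (D \<union> {..<M} \<times> {p}) z \<and>
          (\<forall>k<M. Es (D \<union> {k} \<times> insert p (pl p d ` X)) z)))"

text \<open>Without rows nothing has to be inserted, and \<open>K\<close> itself is a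
  solution.\<close>

lemma not_StarT_0: "\<not> StarT 0"
  by (auto simp: StarT_def agree_def)

text \<open>By compactness, finitely many positions \<open>C\<close> and one formula
  \<open>\<beta>\<close> of the reference type are responsible for the failure. It therefore
  persists for every \<open>z\<close> that fits row by row over \<open>C\<close> alone.\<close>

lemma gap_compact:
  assumes K: "K \<in> envs" and X: "finite X" and pD: "\<And>k. k < M \<Longrightarrow> (k, p) \<notin> D"
    and no: "\<not> (\<exists>z. agree (D \<union> {..<M} \<times> X) z K \<and> Es (D \<union> {..<M} \<times> {p}) z \<and>
          (\<forall>k<M. Es (D \<union> {k} \<times> insert p X) z))"
  shows "\<exists>C \<beta>. finite C \<and> C \<subseteq> D \<and> dfn {} ((C \<union> {..<M} \<times> {p}) \<times> {..<m}) \<beta> \<and> \<beta> e \<and>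
    (\<forall>z\<in>envs. agree (C \<union> {..<M} \<times> X) z K \<and> (\<forall>k<M. Es (C \<union> {k} \<times> insert p X) z) \<longrightarrow> \<not> \<beta> z)"
proof (rule ccontr)
  assume "\<not> ?thesis"
  hence neg: "\<forall>C \<beta>. finite C \<and> C \<subseteq> D \<and> dfn {} ((C \<union> {..<M} \<times> {p}) \<times> {..<m}) \<beta> \<and> \<beta> e \<longrightarrow>
    (\<exists>z\<in>envs. agree (C \<union> {..<M} \<times> X) z K \<and> (\<forall>k<M. Es (C \<union> {k} \<times> insert p X) z) \<and> \<beta> z)"
    by meson
  define T where "T i = (case i of 0 \<Rightarrow> D \<union> {..<M} \<times> {p} | Suc k \<Rightarrow> D \<union> {k} \<times> insert p X) \<times> {..<m}" for i :: nat
  have "\<exists>z\<in>envs. (\<forall>v\<in>(D \<union> {..<M} \<times> X) \<times> {..<m}. z v = K v) \<and> (\<forall>i\<in>{..M}. teq {} (T i) (z \<circ> id) e)"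
  proof (rule compactness)
    show "|UNIV :: ((nat \<times> rat) \<times> nat) set| <o kb" by (rule small_countable) simp
    show "|{} :: 'm set| <o kb" by (rule small_finite) simp
    fix P assume P: "\<And>i. i \<in> {..M} \<Longrightarrow> dfn {} (T i) (P i)" "\<And>i. i \<in> {..M} \<Longrightarrow> P i e"
    have "\<forall>i\<in>{..M}. \<exists>S0. finite S0 \<and> S0 \<subseteq> T i \<and> dfn {} S0 (P i)"
      using dfn_finite_ex[OF P(1)] by blast
    then obtain S where S: "\<forall>i\<in>{..M}. finite (S i) \<and> S i \<subseteq> T i \<and> dfn {} (S i) (P i)"
      using bchoice[of "{..M}" "\<lambda>i S0. finite S0 \<and> S0 \<subseteq> T i \<and> dfn {} S0 (P i)"] by blast
    define C where "C = fst ` (\<Union>i\<in>{..M}. S i) \<inter> D"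
    have C: "finite C" "C \<subseteq> D" using S by (auto simp: C_def)
    have S0: "S 0 \<subseteq> (C \<union> {..<M} \<times> {p}) \<times> {..<m}"
      using S[rule_format, of 0] unfolding C_def T_def by force
    have SS: "S (Suc k) \<subseteq> (C \<union> {k} \<times> insert p X) \<times> {..<m}" if "k < M" for k
      using S[rule_format, of "Suc k"] that unfolding C_def T_def by force
    have dP0: "dfn {} ((C \<union> {..<M} \<times> {p}) \<times> {..<m}) (P 0)"
      using S[rule_format, of 0] dfn_mono[OF _ order_refl S0] by simp
    have "\<exists>z\<in>envs. agree (C \<union> {..<M} \<times> X) z K \<and> (\<forall>k<M. Es (C \<union> {k} \<times> insert p X) z) \<and> P 0 z"
      by (rule neg[rule_format]) (use C dP0 P(2)[of 0] in simp)
    then obtain z where z: "z \<in> envs" "agree (C \<union> {..<M} \<times> X) z K" "\<forall>k<M. Es (C \<union> {k} \<times> insert p X) z" "P 0 z"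
      by (elim bexE conjE)
    \<comment> \<open>Away from the finitely many positions in question \<open>z\<close> is replaced
      by \<open>K\<close>, so that agreement with \<open>K\<close> holds on all of
      \<open>D\<close>.\<close>
    define z' where "z' v = (if fst v \<in> C \<union> {..<M} \<times> insert p X then z v else K v)" for v
    have z'env: "z' \<in> envs" unfolding z'_def[abs_def] by (rule envs_merge[OF z(1) K])
    have "P i z'" if i: "i \<le> M" for i
    proof -
      have "P i z' = P i z"
      proof (rule dfn_local[of "{}" "S i"])
        show "dfn {} (S i) (P i)" using S i by simp
        fix v assume "v \<in> S i"
        hence "fst v \<in> C \<union> {..<M} \<times> insert p X"
          using S0 SS[of "i - 1"] i by (cases i) auto
        thus "z' v = z v" by (simp add: z'_def)
      qed (rule z'env, rule z(1))
      also have "P i z"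
      proof (cases i)
        case (Suc k)
        hence "dfn {} ((C \<union> {k} \<times> insert p X) \<times> {..<m}) (P i)"
          using S i dfn_mono[OF _ order_refl SS[of k]] by simp
        thus ?thesis using EsD[of "C \<union> {k} \<times> insert p X" z "P i"] z(3) Suc i P(2)[of i] by simp
      qed (use z(4) in simp)
      finally show ?thesis by simp
    qed
    moreover have "\<forall>v\<in>(D \<union> {..<M} \<times> X) \<times> {..<m}. z' v = K v"
    proof
      fix v assume v: "v \<in> (D \<union> {..<M} \<times> X) \<times> {..<m}"
      show "z' v = K v"
      proof (cases "fst v \<in> C \<union> {..<M} \<times> X")
        case True
        thus ?thesis using z(2) v by (cases v) (auto simp: z'_def agree_def)
      next
        case False
        hence "fst v \<in> D" using v by auto
        hence "fst v \<notin> {..<M} \<times> {p}" using pD by auto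
        thus ?thesis using False by (cases v) (auto simp: z'_def)
      qed
    qed
    ultimately show "\<exists>z\<in>envs. (\<forall>v\<in>(D \<union> {..<M} \<times> X) \<times> {..<m}. z v = K v) \<and> (\<forall>i\<in>{..M}. P i (z \<circ> id))"
      using z'env by (intro bexI[of _ z']) auto
  qed (use e_env K in auto)
  then obtain z where z: "z \<in> envs" "\<forall>v\<in>(D \<union> {..<M} \<times> X) \<times> {..<m}. z v = K v" "\<forall>i\<in>{..M}. teq {} (T i) z e"
    by (auto simp: comp_id)
  have "agree (D \<union> {..<M} \<times> X) z K" using z(2) by (auto simp: agree_def)
  moreover have "Es (D \<union> {..<M} \<times> {p}) z" using z(1,3) by (auto simp: Es_def T_def dest: bspec[of _ _ 0])
  moreover have "Es (D \<union> {k} \<times> insert p X) z" if "k < M" for k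
    using z(1) bspec[OF z(3), of "Suc k"] that by (auto simp: Es_def T_def)
  ultimately show False using no by blast
qed

text \<open>Moves the gap with centre \<open>p\<close> and radius \<open>d\<close> to centre
  \<open>p' k\<close> and radius \<open>d' k\<close> in each row \<open>k\<close>, while the base
  \<open>C\<close> stays in place.\<close>

definition mv :: "(nat \<times> rat) set \<Rightarrow> rat \<Rightarrow> rat \<Rightarrow> (nat \<Rightarrow> rat) \<Rightarrow> (nat \<Rightarrow> rat) \<Rightarrow> nat \<times> rat \<Rightarrow> nat \<times> rat" where
  "mv C p d p' d' q = (if q \<in> C then q else (fst q, pl (p' (fst q)) (d' (fst q)) ((snd q - p) / d)))"

lemma mv_pl: "0 < d \<Longrightarrow> (k, pl p d x) \<notin> C \<Longrightarrow> mv C p d p' d' (k, pl p d x) = (k, pl (p' k) (d' k) x)"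
  by (simp add: mv_def pl_inv)

text \<open>The finite sequences of \<open>K\<close> can be planted, with the same type over
  \<open>C\<close>, in smaller gaps of another array \<open>D'\<close>, as long as everything
  happens closer to \<open>p\<close> than the elements of \<open>C\<close>. In each of the first
  \<open>M\<close> rows \<open>\<tau>\<close> is piecewise linear, maps the new gap onto the old one
  and fixes what lies at distance at least \<open>b\<close> from \<open>p\<close>; the copy of
  \<open>K\<close> read through it is laid over \<open>s\<close> by
  \<open>extend_pos\<close>.\<close>

lemma gap_transfer:
  assumes gap: "gapok M p d \<epsilon> D" and CD: "C \<subseteq> D" and X: "X \<subseteq> {-1..1}"
    and b: "d < b" "b \<le> d + \<epsilon>" and Cb: "\<And>k q. (k, q) \<in> C \<Longrightarrow> k < M \<Longrightarrow> b \<le> \<bar>q - p\<bar>"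
    and K: "K \<in> envs" "\<And>k. k < M \<Longrightarrow> Es (D \<union> {k} \<times> pl p d ` X) K"
    and D': "C \<subseteq> D'" "\<And>k q. (k, q) \<in> D' - C \<Longrightarrow> k < M \<and> \<bar>q - p\<bar> < b"
    and s: "Es D' s" and DK: "Es D K"
    and p': "\<And>k. k < M \<Longrightarrow> 0 < d' k" "\<And>k. k < M \<Longrightarrow> \<bar>p' k - p\<bar> + d' k < b"
      "\<And>k q. k < M \<Longrightarrow> \<bar>q - p' k\<bar> \<le> d' k \<Longrightarrow> (k, q) \<notin> D'"
  shows "\<exists>K'. K' \<in> envs \<and> agree D' K' s \<and> (\<forall>k<M. Es (D' \<union> {k} \<times> pl (p' k) (d' k) ` X) K') \<and>
    teq {} ((C \<union> {..<M} \<times> pl p d ` X) \<times> {..<m}) (K' \<circ> lift (mv C p d p' d')) K"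
proof -
  have d: "0 < d" using gap by (simp add: gapok_def)
  define f where "f k = pwl (p - b) (p + b) (p' k - d' k) (p' k + d' k) (p - d) (p + d)" for k
  define \<tau> where "\<tau> q = (if fst q < M then (fst q, f (fst q) (snd q)) else q)" for q :: "nat \<times> rat"
  have o: "p - b < p' k - d' k" "p' k - d' k < p' k + d' k" "p' k + d' k < p + b"
    "p - b < p - d" "p - d < p + d" "p + d < p + b" if "k < M" for k
    using p'(1,2)[OF that] b d by (auto simp: abs_if split: if_splits)
  have fm: "f k x < f k y" if "k < M" "x < y" for k x y
    unfolding f_def by (rule pwl_strict_mono[OF o[OF that(1)] that(2)])
  have fpl: "f k (pl (p' k) (d' k) x) = pl p d x" if "k < M" "x \<in> X" for k x
  proof -
    have x: "-1 \<le> x" "x \<le> 1" using that X by auto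
    hence "\<bar>pl (p' k) (d' k) x - p' k\<bar> \<le> d' k" using pl_bound[OF p'(1)[OF that(1)], of x] by (simp add: abs_le_iff)
    hence "p' k - d' k \<le> pl (p' k) (d' k) x" "pl (p' k) (d' k) x \<le> p' k + d' k" by (auto simp: abs_le_iff)
    hence "f k (pl (p' k) (d' k) x) = p - d + (pl (p' k) (d' k) x - (p' k - d' k)) * ((p + d - (p - d)) / (p' k + d' k - (p' k - d' k)))"
      using o[OF that(1)] unfolding f_def pwl_def by auto
    also have "\<dots> = pl p d x" using p'(1)[OF that(1)] by (simp add: pl_def field_simps)
    finally show ?thesis .
  qed
  have fC: "\<tau> q = q" if "q \<in> C" for q
  proof (cases "fst q < M")
    case True
    obtain k x where q: "q = (k, x)" by (cases q)
    have "b \<le> \<bar>x - p\<bar>" using Cb that True by (auto simp: q)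
    hence "x \<le> p - b \<or> p + b \<le> x" by (auto simp: abs_if split: if_splits)
    thus ?thesis by (simp add: q \<tau>_def f_def pwl_def)
  qed (simp add: \<tau>_def)
  have fD: "\<tau> q \<in> D" if "q \<in> D'" for q
  proof (cases "q \<in> C")
    case True
    thus ?thesis using fC CD by auto
  next
    case False
    obtain k x where q: "q = (k, x)" by (cases q)
    have k: "k < M" and xb: "\<bar>x - p\<bar> < b" using D' that False by (auto simp: q)
    have x: "\<not> \<bar>x - p' k\<bar> \<le> d' k" using p'(3)[OF k, of x] that by (auto simp: q)
    then consider "p - b < x" "x < p' k - d' k" | "p' k + d' k < x" "x < p + b"
      using xb by (auto simp: abs_if split: if_splits)
    hence "d < \<bar>f k x - p\<bar> \<and> \<bar>f k x - p\<bar> < b"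
    proof cases
      case 1
      thus ?thesis using pwl_range(2)[OF o[OF k], of x] d unfolding f_def by (simp add: abs_if)
    next
      case 2
      thus ?thesis using pwl_range(4)[OF o[OF k], of x] d unfolding f_def by (simp add: abs_if)
    qed
    thus ?thesis using gap k b by (auto simp: q \<tau>_def gapok_def)
  qed
  let ?X' = "\<lambda>k. pl (p' k) (d' k) ` X"
  let ?W = "D' \<union> Sigma {..<M} ?X'"
  have rm: "rowmono ?W \<tau>"
    by (rule rowmonoI) (use fm in \<open>auto simp: \<tau>_def\<close>)
  have "teq {} (D' \<times> {..<m}) (K \<circ> lift \<tau>) s"
  proof -
    have "Es D' (K \<circ> lift \<tau>)"
      by (rule Es_reindex[OF DK]) (use rm fD in \<open>auto simp: rowmono_def\<close>)
    thus ?thesis using s teq_trans teq_sym unfolding Es_def by blast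
  qed
  hence "\<exists>k\<in>envs. agree D' k s \<and> teq {} (?W \<times> {..<m}) k (K \<circ> lift \<tau>)"
    by (intro extend_pos) (use K(1) s in \<open>auto simp: Es_def intro: envs_comp\<close>)
  then obtain K' where K': "K' \<in> envs" "agree D' K' s" "teq {} (?W \<times> {..<m}) K' (K \<circ> lift \<tau>)" by blast
  have "Es (D' \<union> {k} \<times> ?X' k) K'" if k: "k < M" for k
  proof -
    have "Es (D' \<union> {k} \<times> ?X' k) (K \<circ> lift \<tau>)"
    proof (rule Es_reindex[OF K(2)[OF k]])
      show "rowmono (D' \<union> {k} \<times> ?X' k) \<tau>" using rm k by (auto simp: rowmono_def)
      show "\<tau> ` (D' \<union> {k} \<times> ?X' k) \<subseteq> D \<union> {k} \<times> pl p d ` X"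
      proof
        fix q' assume "q' \<in> \<tau> ` (D' \<union> {k} \<times> ?X' k)"
        then consider q where "q \<in> D'" "q' = \<tau> q" | x where "x \<in> X" "q' = \<tau> (k, pl (p' k) (d' k) x)" by blast
        thus "q' \<in> D \<union> {k} \<times> pl p d ` X"
        proof cases
          case 1
          thus ?thesis using fD by simp
        next
          case 2
          thus ?thesis using fpl[OF k 2(1)] k by (simp add: \<tau>_def)
        qed
      qed
    qed
    moreover have "teq {} ((D' \<union> {k} \<times> ?X' k) \<times> {..<m}) K' (K \<circ> lift \<tau>)"
      by (rule teq_mono[OF K'(3)]) (use k in auto)
    ultimately show ?thesis using K'(1) teq_trans unfolding Es_def by blast
  qed
  moreover have "teq {} ((C \<union> {..<M} \<times> pl p d ` X) \<times> {..<m}) (K' \<circ> lift (mv C p d p' d')) K"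
  proof -
    let ?T = "C \<union> {..<M} \<times> pl p d ` X"
    have notC: "(k, pl p d x) \<notin> C" if "k < M" "x \<in> X" for k x
      using Cb[of k "pl p d x"] pl_bound[OF d, of x p] that X b(1) by (force simp: abs_le_iff)
    have mvq: "mv C p d p' d' q \<in> ?W \<and> \<tau> (mv C p d p' d' q) = q" if qT: "q \<in> ?T" for q
    proof (cases "q \<in> C")
      case True
      thus ?thesis using fC D'(1) by (auto simp: mv_def)
    next
      case False
      then obtain k x where q: "q = (k, pl p d x)" "k < M" "x \<in> X" using qT by auto
      hence "mv C p d p' d' q = (k, pl (p' k) (d' k) x)" using mv_pl[OF d] notC by auto
      thus ?thesis using q fpl by (auto simp: \<tau>_def)
    qed
    have "teq {} (?T \<times> {..<m}) (K' \<circ> lift (mv C p d p' d')) (K \<circ> lift \<tau> \<circ> lift (mv C p d p' d'))"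
      by (rule teq_reindex[OF K'(3) lift_times]) (use mvq in blast)
    moreover have "teq {} (?T \<times> {..<m}) (K \<circ> lift \<tau> \<circ> lift (mv C p d p' d')) K"
      by (rule teq_agree) (use mvq K(1) in \<open>auto intro!: envs_comp\<close>)
    ultimately show ?thesis by (rule teq_trans)
  qed
  ultimately show ?thesis using K' by blast
qed

subsection \<open>Alternation along arrays\<close>

text \<open>The order hypothesis forces \<open>f2\<close> to identify whatever \<open>f1\<close>
  identifies, so \<open>f2\<close> factors through \<open>f1\<close> by a monotone map.\<close>

lemma e_two:
  assumes f: "\<And>a. a \<in> S \<Longrightarrow> fst (f1 a) = fst (f2 a)"
    "\<And>a b. a \<in> S \<Longrightarrow> b \<in> S \<Longrightarrow> fst (f1 a) = fst (f1 b) \<Longrightarrow> snd (f1 a) < snd (f1 b) \<longleftrightarrow> snd (f2 a) < snd (f2 b)"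
  shows "teq {} (S \<times> {..<m}) (e \<circ> lift f1) (e \<circ> lift f2)"
proof -
  define \<tau> where "\<tau> q = f2 (inv_into S f1 q)" for q
  have \<tau>: "\<tau> (f1 a) = f2 a" if "a \<in> S" for a
  proof -
    define b where "b = inv_into S f1 (f1 a)"
    have b: "b \<in> S" "f1 b = f1 a" using that by (auto simp: b_def inv_into_into f_inv_into_f)
    have "fst (f2 b) = fst (f2 a)" using f(1)[OF b(1)] f(1)[OF that] b(2) by simp
    moreover have "snd (f2 b) = snd (f2 a)"
      using f(2)[OF b(1) that] f(2)[OF that b(1)] b(2) by simp
    ultimately show ?thesis by (simp add: \<tau>_def b_def[symmetric] prod_eq_iff)
  qed
  have "rowmono (f1 ` S) \<tau>"
    unfolding rowmono_def using \<tau> f by auto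
  hence "teq {} (f1 ` S \<times> {..<m}) e (e \<circ> lift \<tau>)" by (rule e_ind)
  hence "teq {} (S \<times> {..<m}) (e \<circ> lift f1) (e \<circ> lift \<tau> \<circ> lift f1)"
    by (rule teq_reindex) (rule lift_times, simp)
  moreover have "teq {} (S \<times> {..<m}) (e \<circ> lift \<tau> \<circ> lift f1) (e \<circ> lift f2)"
    by (rule teq_agree) (use \<tau> e_env in \<open>auto intro!: envs_comp\<close>)
  ultimately show ?thesis by (rule teq_trans)
qed

lemma Es_two:
  assumes "Es D s" "f1 ` S \<subseteq> D" "\<And>a. a \<in> S \<Longrightarrow> fst (f1 a) = fst (f2 a)"
    "\<And>a b. a \<in> S \<Longrightarrow> b \<in> S \<Longrightarrow> fst (f1 a) = fst (f1 b) \<Longrightarrow> snd (f1 a) < snd (f1 b) \<longleftrightarrow> snd (f2 a) < snd (f2 b)"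
  shows "teq {} (S \<times> {..<m}) (s \<circ> lift f1) (e \<circ> lift f2)"
proof -
  have "teq {} (D \<times> {..<m}) s e" using assms(1) by (simp add: Es_def)
  hence "teq {} (S \<times> {..<m}) (s \<circ> lift f1) (e \<circ> lift f1)"
    by (rule teq_reindex) (rule lift_times, use assms(2) in auto)
  thus ?thesis using teq_trans e_two[of S f1 f2] assms(3,4) by blast
qed

text \<open>Copies of a finite configuration \<open>X\<close> placed one after another:
  \<open>ro\<close> gives the row of each element, \<open>lt\<close> the order inside a copy, and in
  every row a later copy lies beyond an earlier one. This fixes the order pattern of all the blocks
  together.\<close>

definition blk :: "('x \<Rightarrow> nat) \<Rightarrow> ('x \<Rightarrow> 'x \<Rightarrow> bool) \<Rightarrow> nat \<Rightarrow> 'x set \<Rightarrow> (nat \<Rightarrow> 'x \<Rightarrow> nat \<times> rat) \<Rightarrow> bool" where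
  "blk ro lt N X f \<longleftrightarrow> (\<forall>i<N. \<forall>x\<in>X. fst (f i x) = ro x) \<and>
     (\<forall>i j. i < j \<and> j < N \<longrightarrow> (\<forall>x\<in>X. \<forall>y\<in>X. ro x = ro y \<longrightarrow> snd (f i x) < snd (f j y))) \<and>
     (\<forall>i<N. \<forall>x\<in>X. \<forall>y\<in>X. ro x = ro y \<longrightarrow> (snd (f i x) < snd (f i y) \<longleftrightarrow> lt x y))"

lemma blkD:
  assumes "blk ro lt N X f"
  shows "i < N \<Longrightarrow> x \<in> X \<Longrightarrow> fst (f i x) = ro x"
    "i < j \<Longrightarrow> j < N \<Longrightarrow> x \<in> X \<Longrightarrow> y \<in> X \<Longrightarrow> ro x = ro y \<Longrightarrow> snd (f i x) < snd (f j y)"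
    "i < N \<Longrightarrow> x \<in> X \<Longrightarrow> y \<in> X \<Longrightarrow> ro x = ro y \<Longrightarrow> snd (f i x) < snd (f i y) \<longleftrightarrow> lt x y"
  using assms unfolding blk_def by blast+

lemma blk_order:
  assumes b: "blk ro lt N X f" "blk ro lt N' X f'" and ij: "i < N" "j < N" "i' < N'" "j' < N'"
    and eq: "i < j \<longleftrightarrow> i' < j'" "j < i \<longleftrightarrow> j' < i'" and xy: "x \<in> X" "y \<in> X" "ro x = ro y"
  shows "snd (f i x) < snd (f j y) \<longleftrightarrow> snd (f' i' x) < snd (f' j' y)"
proof -
  consider "i < j" | "j < i" | "i = j" by linarith
  thus ?thesis
  proof cases
    case 1
    thus ?thesis using blkD(2)[OF b(1) 1 ij(2) xy] blkD(2)[OF b(2) _ ij(4) xy, of i'] eq by simp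
  next
    case 2
    hence "snd (f j y) < snd (f i x)" "snd (f' j' y) < snd (f' i' x)"
      using blkD(2)[OF b(1) 2 ij(1) xy(2,1)] blkD(2)[OF b(2) _ ij(3) xy(2,1), of j'] eq xy by auto
    thus ?thesis by simp
  next
    case 3
    hence "i' = j'" using eq by auto
    thus ?thesis using 3 blkD(3)[OF b(1) ij(1) xy] blkD(3)[OF b(2) ij(3) xy] by simp
  qed
qed

text \<open>Consecutive blocks form an indiscernible sequence of tuples whose type depends only on
  \<open>ro\<close> and \<open>lt\<close>. The bound is therefore independent of the array
  \<open>s\<close> and of the places \<open>f\<close>; \<open>f0\<close> supplies an infinite
  reference sequence of blocks.\<close>

lemma array_alternation:
  fixes \<theta> :: "(('x \<times> nat) + 'p \<Rightarrow> 'm) \<Rightarrow> bool"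
  assumes X: "finite X" and \<theta>: "dfn {} (Inl ` (X \<times> {..<m}) \<union> Inr ` Ps) \<theta>" and f0: "\<And>N. blk ro lt N X f0"
  shows "\<exists>b>0. \<forall>N\<ge>b. \<forall>D s f. \<forall>c\<in>envs. Es D s \<and> blk ro lt (2 * N) X f \<and> (\<forall>i<2 * N. \<forall>x\<in>X. f i x \<in> D) \<longrightarrow>
    \<not> (\<forall>i<2 * N. \<theta> (case_sum (\<lambda>y. s (f i (fst y), snd y)) c) \<longleftrightarrow> even i)"
proof -
  define asc where "asc y = ((fst y, fst (snd y)), snd (snd y))" for y :: "nat \<times> ('x \<times> nat)"
  define w where "w = e \<circ> lift (\<lambda>z. f0 (fst z) (snd z)) \<circ> asc"
  have "\<exists>b>0. \<forall>N\<ge>b. \<forall>w'\<in>envs. \<forall>c\<in>envs. teq {} ({..<2 * N} \<times> (X \<times> {..<m})) w' w \<longrightarrow>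
    \<not> (\<forall>i<2 * N. \<theta> (case_sum (\<lambda>x. w' (i, x)) c) \<longleftrightarrow> even i)"
  proof (rule nip_alternation)
    show "w \<in> envs" unfolding w_def by (intro envs_comp e_env)
    show "finite (X \<times> {..<m})" using X by simp
    show "dfn {} (Inl ` (X \<times> {..<m}) \<union> Inr ` Ps) \<theta>" by (rule \<theta>)
    fix S and \<tau> :: "nat \<Rightarrow> nat" assume \<tau>: "strict_mono_on S \<tau>"
    have t: "teq {} ((S \<times> X) \<times> {..<m}) (e \<circ> lift (\<lambda>z. f0 (fst z) (snd z))) (e \<circ> lift (\<lambda>z. f0 (\<tau> (fst z)) (snd z)))"
    proof (rule e_two)
      fix a assume "a \<in> S \<times> X"
      thus "fst (f0 (fst a) (snd a)) = fst (f0 (\<tau> (fst a)) (snd a))"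
        using blkD(1)[OF f0, of "fst a" "Suc (fst a)"] blkD(1)[OF f0, of "\<tau> (fst a)" "Suc (\<tau> (fst a))"] by auto
    next
      fix a b assume a: "a \<in> S \<times> X" and b: "b \<in> S \<times> X" and "fst (f0 (fst a) (snd a)) = fst (f0 (fst b) (snd b))"
      hence ro: "ro (snd a) = ro (snd b)"
        using blkD(1)[OF f0, of "fst a" "Suc (fst a)"] blkD(1)[OF f0, of "fst b" "Suc (fst b)"] by auto
      show "snd (f0 (fst a) (snd a)) < snd (f0 (fst b) (snd b)) \<longleftrightarrow> snd (f0 (\<tau> (fst a)) (snd a)) < snd (f0 (\<tau> (fst b)) (snd b))"
      proof (rule blk_order[OF f0[of "Suc (max (fst a) (fst b))"] f0[of "Suc (max (\<tau> (fst a)) (\<tau> (fst b)))"]])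
        show "fst a < fst b \<longleftrightarrow> \<tau> (fst a) < \<tau> (fst b)" "fst b < fst a \<longleftrightarrow> \<tau> (fst b) < \<tau> (fst a)"
          using strict_mono_on_less[OF \<tau>] a b by auto
      qed (use a b ro in auto)
    qed
    have "teq {} (S \<times> (X \<times> {..<m})) (e \<circ> lift (\<lambda>z. f0 (fst z) (snd z)) \<circ> asc) (e \<circ> lift (\<lambda>z. f0 (\<tau> (fst z)) (snd z)) \<circ> asc)"
      by (rule teq_reindex[OF t]) (auto simp: asc_def)
    moreover have "e \<circ> lift (\<lambda>z. f0 (\<tau> (fst z)) (snd z)) \<circ> asc = w \<circ> map_prod \<tau> id"
      by (rule ext) (auto simp: w_def asc_def)
    ultimately show "teq {} (S \<times> (X \<times> {..<m})) w (w \<circ> map_prod \<tau> id)" unfolding w_def by simp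
  qed
  then obtain b where b: "b > 0" "\<forall>N\<ge>b. \<forall>w'\<in>envs. \<forall>c\<in>envs. teq {} ({..<2 * N} \<times> (X \<times> {..<m})) w' w \<longrightarrow>
    \<not> (\<forall>i<2 * N. \<theta> (case_sum (\<lambda>x. w' (i, x)) c) \<longleftrightarrow> even i)" by (elim exE conjE)
  show ?thesis
  proof (intro exI[of _ b] conjI allI ballI impI, rule b(1), elim conjE)
    fix N D s f and c :: "'p \<Rightarrow> 'm" assume N: "b \<le> N" and c: "c \<in> envs" and Es: "Es D s" and f: "blk ro lt (2 * N) X f"
      and fD: "\<forall>i<2 * N. \<forall>x\<in>X. f i x \<in> D"
    define w' where "w' = s \<circ> lift (\<lambda>z. f (fst z) (snd z)) \<circ> asc"
    have t: "teq {} (({..<2 * N} \<times> X) \<times> {..<m}) (s \<circ> lift (\<lambda>z. f (fst z) (snd z))) (e \<circ> lift (\<lambda>z. f0 (fst z) (snd z)))"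
    proof (rule Es_two[OF Es])
      show "(\<lambda>z. f (fst z) (snd z)) ` ({..<2 * N} \<times> X) \<subseteq> D" using fD by auto
      fix a assume a: "a \<in> {..<2 * N} \<times> X"
      thus "fst (f (fst a) (snd a)) = fst (f0 (fst a) (snd a))"
        using blkD(1)[OF f] blkD(1)[OF f0[of "2 * N"]] by auto
      fix b assume "b \<in> {..<2 * N} \<times> X" "fst (f (fst a) (snd a)) = fst (f (fst b) (snd b))"
      thus "snd (f (fst a) (snd a)) < snd (f (fst b) (snd b)) \<longleftrightarrow> snd (f0 (fst a) (snd a)) < snd (f0 (fst b) (snd b))"
        using a blkD(1)[OF f] by (intro blk_order[OF f f0[of "2 * N"]]) auto
    qed
    have "teq {} ({..<2 * N} \<times> (X \<times> {..<m})) w' w"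
      unfolding w'_def w_def by (rule teq_reindex[OF t]) (auto simp: asc_def)
    moreover have "w' \<in> envs" unfolding w'_def by (intro envs_comp Es_env[OF Es])
    ultimately have "\<not> (\<forall>i<2 * N. \<theta> (case_sum (\<lambda>x. w' (i, x)) c) \<longleftrightarrow> even i)" using b(2) N c by blast
    moreover have "(\<lambda>x. w' (i, x)) = (\<lambda>y. s (f i (fst y), snd y))" for i
      by (rule ext) (simp add: w'_def asc_def)
    ultimately show "\<not> (\<forall>i<2 * N. \<theta> (case_sum (\<lambda>y. s (f i (fst y), snd y)) c) \<longleftrightarrow> even i)" by simp
  qed
qed

end

subsection \<open>Removing a row\<close>

text \<open>A failure of insertion in \<open>Suc M\<close> rows, of which row \<open>M\<close> is to
  be removed. In these rows no element of the finite part \<open>C\<close> responsible for it is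
  closer to \<open>p\<close> than \<open>b\<close>, which is the room for the construction. The
  number \<open>n\<close> of stages is left open and comes later from an alternation bound.\<close>

locale gap_game = ref_array L U kb e m
  for L :: "('f, 'r) lang" and U :: "('f, 'r, 'm) struct" and kb :: "'k rel"
    and e :: "(nat \<times> rat) \<times> nat \<Rightarrow> 'm" and m :: nat +
  fixes M :: nat and p d \<epsilon> :: rat and D :: "(nat \<times> rat) set" and X :: "rat set"
    and K :: "(nat \<times> rat) \<times> nat \<Rightarrow> 'm" and C :: "(nat \<times> rat) set" and b :: rat and n :: nat
  assumes gap: "gapok (Suc M) p d \<epsilon> D" and X: "finite X" "X \<subseteq> {-1..1} - {0}"
    and DK: "Es D K" and K: "\<And>k. k < Suc M \<Longrightarrow> Es (D \<union> {k} \<times> pl p d ` X) K"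
    and C: "finite C" "C \<subseteq> D" and b: "d < b" "b \<le> d + \<epsilon>"
    and Cb: "\<And>k q. (k, q) \<in> C \<Longrightarrow> k < Suc M \<Longrightarrow> b \<le> \<bar>q - p\<bar>"
begin

abbreviation CX :: "(nat \<times> rat) set" where "CX \<equiv> C \<union> {..<Suc M} \<times> pl p d ` X"

text \<open>Chosen such that \<open>P 0\<close> and \<open>P (Suc n)\<close> are the ends of the
  interval of radius \<open>b\<close> around \<open>p\<close>, while the \<open>n\<close> points
  between them are centres of gaps of radius \<open>w\<close> that stay \<open>2 * w\<close>
  apart.\<close>

definition w :: rat where "w = b / (2 * (of_nat n + 1))"

definition P :: "nat \<Rightarrow> rat" where "P j = p - b + 4 * w * of_nat j"

text \<open>Within the interval the rows below \<open>M\<close> are filled except for the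
  \<open>n\<close> gaps. Row \<open>M\<close> keeps only its part of \<open>C\<close>, so that
  sequences of every scale can be placed around \<open>p\<close> there.\<close>

definition DV :: "(nat \<times> rat) set" where
  "DV = C \<union> {(k, q). k < M \<and> \<bar>q - p\<bar> < b \<and> (\<forall>j\<in>{1..n}. w < \<bar>q - P j\<bar>)}"

text \<open>Below 1 and below every \<open>|x|\<close> with \<open>x\<close> in \<open>X\<close>;
  positive because 0 is not in \<open>X\<close>. A copy of \<open>X\<close> shrunk once more by this
  factor is closer to \<open>p\<close> than every element of the preceding copy, so the copies are
  nested around \<open>p\<close>.\<close>

definition \<mu> :: rat where "\<mu> = Min (insert 1 (abs ` X)) / 2"

definition Ip :: "nat \<Rightarrow> (nat \<times> rat) set" where "Ip j = {M} \<times> pl p (\<mu> ^ j * d) ` X"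

definition IA :: "nat \<Rightarrow> (nat \<times> rat) set" where "IA j = (\<Union>i\<in>{1..j}. Ip i)"

definition Y :: "nat \<Rightarrow> (nat \<times> rat) set" where "Y j = {..<M} \<times> P ` {1..j}"

text \<open>Carries the original gap to the place of stage \<open>Suc j\<close>: the gap around
  \<open>P (Suc j)\<close> in the rows below \<open>M\<close>, the next smaller scale around
  \<open>p\<close> in row \<open>M\<close>.\<close>

definition nu :: "nat \<Rightarrow> nat \<times> rat \<Rightarrow> nat \<times> rat" where
  "nu j = mv C p d (\<lambda>k. if k < M then P (Suc j) else p) (\<lambda>k. if k < M then w else \<mu> ^ Suc j * d)"

lemma d0: "0 < d" using gap by (simp add: gapok_def)

lemma b0: "0 < b" using b(1) d0 by simp

lemma w0: "0 < w" unfolding w_def using b0 by (intro divide_pos_pos mult_pos_pos) auto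

lemma w4: "4 * w * (of_nat n + 1) = 2 * b"
proof -
  have "(of_nat n + 1 :: rat) \<noteq> 0" by (metis of_nat_Suc of_nat_neq_0 add.commute)
  thus ?thesis by (simp add: w_def field_simps)
qed

lemma P_mono: "i \<le> j \<Longrightarrow> P i \<le> P j" using w0 by (simp add: P_def)

lemma P_Suc: "P (Suc j) = P j + 4 * w" by (simp add: P_def algebra_simps)

lemma P_less: "i < j \<Longrightarrow> P i + 4 * w \<le> P j" using P_mono[of "Suc i" j] P_Suc[of i] by simp

lemma P_0: "P 0 = p - b" by (simp add: P_def)

lemma P_top: "P (Suc n) = p + b" using w4 by (simp add: P_def algebra_simps)

lemma P_lower: "p - b \<le> P j" using P_mono[of 0 j] P_0 by simp

lemma P_upper: "j \<le> n \<Longrightarrow> P j + 4 * w \<le> p + b" using P_less[of j "Suc n"] P_top by simp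

lemma P_bound: "1 \<le> j \<Longrightarrow> j \<le> n \<Longrightarrow> \<bar>P j - p\<bar> + w < b"
  using P_upper[of j] P_less[of 0 j] P_0 w0 by (auto simp: abs_if)

lemma DV_between:
  assumes "k < M" "j \<le> n" "P j + w < q" "q < P (Suc j) - w"
  shows "(k, q) \<in> DV"
proof -
  have "p - b < q" using P_lower[of j] assms(3) w0 by simp
  moreover have "q < p + b" using P_upper[OF assms(2)] P_Suc[of j] assms(4) w0 by simp
  moreover have "w < \<bar>q - P i\<bar>" if "i \<in> {1..n}" for i
  proof (cases "i \<le> j")
    case True
    thus ?thesis using P_mono[of i j] assms(3) by (simp add: abs_if)
  next
    case False
    thus ?thesis using P_mono[of "Suc j" i] assms(4) by (simp add: abs_if)
  qed
  ultimately show ?thesis using assms(1) by (auto simp: DV_def abs_if)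
qed

lemma DV_gap: "j \<in> {1..n} \<Longrightarrow> \<bar>q - P j\<bar> \<le> w \<Longrightarrow> k < M \<Longrightarrow> (k, q) \<notin> DV"
proof
  assume j: "j \<in> {1..n}" and q: "\<bar>q - P j\<bar> \<le> w" and k: "k < M" and "(k, q) \<in> DV"
  hence "(k, q) \<in> C" by (force simp: DV_def)
  hence "b \<le> \<bar>q - p\<bar>" using Cb k by simp
  moreover have "\<bar>q - p\<bar> \<le> \<bar>q - P j\<bar> + \<bar>P j - p\<bar>" by simp
  ultimately show False using P_bound[of j] j q by auto
qed

lemma DV_C: "(k, q) \<in> DV \<Longrightarrow> (k, q) \<notin> C \<Longrightarrow> k < M \<and> \<bar>q - p\<bar> < b"
  by (auto simp: DV_def)

lemma \<mu>0: "0 < \<mu>" "\<mu> < 1"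
proof -
  have "Min (insert 1 (abs ` X)) > 0"
    using X by (subst Min_gr_iff) auto
  moreover have "Min (insert 1 (abs ` X)) \<le> 1" using X(1) by (intro Min_le) auto
  ultimately show "0 < \<mu>" "\<mu> < 1" by (auto simp: \<mu>_def)
qed

lemma \<mu>_less: "x \<in> X \<Longrightarrow> \<mu> < \<bar>x\<bar>"
proof -
  assume x: "x \<in> X"
  have "Min (insert 1 (abs ` X)) \<le> \<bar>x\<bar>" using x X(1) by (intro Min_le) auto
  moreover have "0 < \<bar>x\<bar>" using x X(2) by auto
  ultimately show ?thesis using \<mu>0 by (simp add: \<mu>_def)
qed

lemma X_abs: "x \<in> X \<Longrightarrow> \<bar>x\<bar> \<le> 1" using X(2) by (auto simp: abs_le_iff)

lemma \<mu>d: "0 < \<mu> ^ j * d" "\<mu> ^ j * d \<le> d"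
  using \<mu>0 d0 by (auto simp: power_le_one mult_le_cancel_right1)

lemma Ip_bound:
  assumes "(k, q) \<in> Ip i" "i \<le> j"
  shows "k = M" "\<mu> ^ Suc j * d < \<bar>q - p\<bar>" "\<bar>q - p\<bar> \<le> d"
proof -
  obtain x where x: "k = M" "x \<in> X" "q = pl p (\<mu> ^ i * d) x" using assms(1) by (auto simp: Ip_def)
  thus "k = M" by simp
  have q: "\<bar>q - p\<bar> = \<mu> ^ i * d * \<bar>x\<bar>" using \<mu>0 d0 by (simp add: x(3) pl_def abs_mult)
  have "\<mu> ^ Suc j * d \<le> \<mu> ^ Suc i * d"
    using \<mu>0 d0 assms(2) by (intro mult_right_mono power_decreasing) auto
  also have "\<dots> = \<mu> ^ i * d * \<mu>" by simp
  also have "\<dots> < \<mu> ^ i * d * \<bar>x\<bar>" using \<mu>_less[OF x(2)] \<mu>d(1)[of i] by (intro mult_strict_left_mono) auto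
  finally show "\<mu> ^ Suc j * d < \<bar>q - p\<bar>" using q by simp
  have "\<mu> ^ i * d * \<bar>x\<bar> \<le> \<mu> ^ i * d * 1" using X_abs[OF x(2)] \<mu>d(1)[of i] by (intro mult_left_mono) auto
  thus "\<bar>q - p\<bar> \<le> d" using q \<mu>d(2)[of i] by simp
qed

lemma IA_Suc: "IA (Suc j) = IA j \<union> Ip (Suc j)"
  unfolding IA_def by (auto simp: atLeastAtMostSuc_conv)

lemma Y_Suc: "Y (Suc j) = Y j \<union> {..<M} \<times> {P (Suc j)}"
  unfolding Y_def by (auto simp: atLeastAtMostSuc_conv)

lemma IA_bound: "(k, q) \<in> IA j \<Longrightarrow> k = M \<and> \<mu> ^ Suc j * d < \<bar>q - p\<bar> \<and> \<bar>q - p\<bar> \<le> d"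
  unfolding IA_def using Ip_bound by auto

section \<open>New sequences that fit over the tuples already chosen\<close>

abbreviation Bp :: "nat \<Rightarrow> rat set" where "Bp j \<equiv> pl (P (Suc j)) w ` X"

lemma Bp_bound: "q \<in> Bp j \<Longrightarrow> \<bar>q - P (Suc j)\<bar> \<le> w"
  using pl_bound[OF w0] X_abs by auto

lemma nu_C: "q \<in> C \<Longrightarrow> nu j q = q" by (simp add: nu_def mv_def)

lemma plX_notC: "x \<in> insert 0 X \<Longrightarrow> k < Suc M \<Longrightarrow> (k, pl p d x) \<notin> C"
proof
  assume x: "x \<in> insert 0 X" and "k < Suc M" "(k, pl p d x) \<in> C"
  hence "b \<le> \<bar>pl p d x - p\<bar>" by (intro Cb)
  moreover have "\<bar>pl p d x - p\<bar> \<le> d" using pl_bound[OF d0, of x p] x X_abs[of x] by auto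
  ultimately show False using b(1) by simp
qed

lemma nu_pl:
  "x \<in> insert 0 X \<Longrightarrow> k < M \<Longrightarrow> nu j (k, pl p d x) = (k, pl (P (Suc j)) w x)"
  "x \<in> insert 0 X \<Longrightarrow> nu j (M, pl p d x) = (M, pl p (\<mu> ^ Suc j * d) x)"
  using mv_pl[OF d0 plX_notC] by (simp_all add: nu_def)

text \<open>\<open>Z\<close> fits the array on \<open>IA j\<close> and on \<open>Y j\<close>,
  perhaps not on both together. Copies of the sequences of \<open>K\<close> are planted shortly
  before the gap at \<open>P (Suc j)\<close>. If each placement violated some
  \<open>\<theta> k\<close>, whose parameters include \<open>Y j\<close>, one row would be violated
  many times; the pieces of the array between these places satisfy \<open>\<theta> k\<close>,
  against its alternation bound.\<close>

lemma base_change_finite: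
  assumes Z: "Es (DV \<union> IA j) Z" "Es (DV \<union> Y j) Z" and j: "j < n" and V0: "finite V0" "V0 \<subseteq> DV"
    and \<theta>: "\<And>k. k < M \<Longrightarrow> dfn {} ((V0 \<union> Y j \<union> {k} \<times> Bp j) \<times> {..<m}) (\<theta> k)"
      "\<And>k. k < M \<Longrightarrow> \<theta> k e"
  shows "\<exists>z\<in>envs. agree (DV \<union> IA j \<union> Y j) z Z \<and> Es (V0 \<union> IA (Suc j)) z \<and>
    teq {} (CX \<times> {..<m}) (z \<circ> lift (nu j)) K \<and> (\<forall>k<M. \<theta> k z)"
proof (rule ccontr)
  assume "\<not> ?thesis"
  hence nosol: "\<exists>k<M. \<not> \<theta> k z" if "z \<in> envs" "agree (DV \<union> IA j \<union> Y j) z Z" "Es (V0 \<union> IA (Suc j)) z"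
    "teq {} (CX \<times> {..<m}) (z \<circ> lift (nu j)) K" for z
    using that by blast
  let ?P = "P (Suc j)"
  let ?W = "\<lambda>k. V0 \<union> Y j \<union> {k} \<times> Bp j"
  have Zenv: "Z \<in> envs" using Es_env[OF Z(1)] .
  define g where "g = ?P - w"
  \<comment> \<open>Between \<open>u\<close> and the left end \<open>g\<close> of the next gap, the
    rows below \<open>M\<close> are filled by the array and contain neither elements of
    \<open>V0\<close> nor tuples at \<open>Y j\<close>. All placements are made there.\<close>
  define u where "u = Max (insert (P j + w) (snd ` {x \<in> V0. fst x < M \<and> snd x < g}))"
  have finu: "finite (insert (P j + w) (snd ` {x \<in> V0. fst x < M \<and> snd x < g}))" using V0(1) by simp
  have u1: "P j + w \<le> u" unfolding u_def using finu by (intro Max_ge) auto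
  have u2: "q \<le> u" if "(k, q) \<in> V0" "k < M" "q < g" for k q
    unfolding u_def using finu that by (intro Max_ge) (auto simp: image_iff)
  have ug: "u < g"
    unfolding u_def using finu P_Suc[of j] w0 by (subst Max_less_iff) (auto simp: g_def)
  have inDV: "(k, q) \<in> DV" if "k < M" "u < q" "q < g" for k q
    using DV_between[of k j q] that j u1 by (simp add: g_def)
  have inb: "\<bar>q - p\<bar> < b" if "u < q" "q < g" for q
    using P_lower[of j] P_upper[of j] P_Suc[of j] that u1 j w0 by (auto simp: g_def abs_if)
  \<comment> \<open>alternation bounds for the formulas \<open>\<theta> k\<close>, as formulas in the tuple at \<open>{k} \<times> Bp j\<close>\<close>
  define G where "G k v = (if fst v \<in> {k} \<times> Bp j then Inl ((snd (fst v) - ?P) / w, snd v) else Inr v)"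
    for k and v :: "(nat \<times> rat) \<times> nat"
  have "\<exists>bb>0. \<forall>N\<ge>bb. \<forall>D s f. \<forall>c\<in>envs. Es D s \<and> blk (\<lambda>_. k) (<) (2 * N) X f \<and> (\<forall>i<2 * N. \<forall>x\<in>X. f i x \<in> D) \<longrightarrow>
    \<not> (\<forall>i<2 * N. \<theta> k (case_sum (\<lambda>y. s (f i (fst y), snd y)) c \<circ> G k) \<longleftrightarrow> even i)" if k: "k < M" for k
  proof (rule array_alternation[OF X(1)])
    show "dfn {} (Inl ` (X \<times> {..<m}) \<union> Inr ` UNIV) (\<lambda>h. \<theta> k (h \<circ> G k))"
      by (rule dfn_reindex[OF \<theta>(1)[OF k]]) (auto simp: G_def pl_inv[OF w0])
    fix N show "blk (\<lambda>_. k) (<) N X (\<lambda>i x. (k, 4 * of_nat i + x))"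
      unfolding blk_def
    proof (intro conjI allI impI ballI; (elim conjE)?)
      fix i j' :: nat and x y assume ij: "i < j'" and x: "x \<in> X" and y: "y \<in> X"
      have "of_nat i + 1 \<le> (of_nat j' :: rat)" using ij by (metis Suc_leI add.commute of_nat_Suc of_nat_mono)
      thus "snd (k, 4 * of_nat i + x) < snd (k, 4 * of_nat j' + y)"
        using X_abs[OF x] X_abs[OF y] by (auto simp: abs_le_iff)
    qed auto
  qed
  hence "\<forall>k\<in>{..<M}. \<exists>bb. bb > 0 \<and> (\<forall>N\<ge>bb. \<forall>D s f. \<forall>c\<in>envs. Es D s \<and> blk (\<lambda>_. k) (<) (2 * N) X f \<and> (\<forall>i<2 * N. \<forall>x\<in>X. f i x \<in> D) \<longrightarrow>
    \<not> (\<forall>i<2 * N. \<theta> k (case_sum (\<lambda>y. s (f i (fst y), snd y)) c \<circ> G k) \<longleftrightarrow> even i))" by simp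
  from bchoice[OF this] obtain bb where bb: "\<forall>k\<in>{..<M}. bb k > 0 \<and> (\<forall>N\<ge>bb k. \<forall>D s f. \<forall>c\<in>envs. Es D s \<and> blk (\<lambda>_. k) (<) (2 * N) X f \<and> (\<forall>i<2 * N. \<forall>x\<in>X. f i x \<in> D) \<longrightarrow>
    \<not> (\<forall>i<2 * N. \<theta> k (case_sum (\<lambda>y. s (f i (fst y), snd y)) c \<circ> G k) \<longleftrightarrow> even i))" by (elim exE)
  define B where "B = Suc (\<Sum>k<M. bb k)"
  have B: "bb k \<le> B" if "k < M" for k
    unfolding B_def using that member_le_sum[of k "{..<M}" bb] by simp
  \<comment> \<open>More than \<open>B\<close> times the number of rows, so that by pigeonhole some
    row has at least \<open>B\<close> violations.\<close>
  define N where "N = M * B + 1"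
  \<comment> \<open>Each placement gets two points: a block of the array at the even one, a new
    sequence at the odd one. The radius \<open>hh / 4\<close> keeps all blocks disjoint and between
    \<open>u\<close> and \<open>g\<close>.\<close>
  define hh where "hh = (g - u) / (2 * of_nat N + 1)"
  have N0: "(2 * of_nat N + 1 :: rat) > 0" by (simp add: add_nonneg_pos)
  have hh: "0 < hh" "hh * (2 * of_nat N + 1) = g - u" unfolding hh_def using ug N0 by auto
  define r where "r t = u + (of_nat t + 1 / 2) * hh" for t :: nat
  define w2 where "w2 = hh / 4"
  have w2: "0 < w2" using hh by (simp add: w2_def)
  have r_less: "r t + 2 * w2 < r t' - w2" if "t < t'" for t t'
  proof -
    have "of_nat t + 1 \<le> (of_nat t' :: rat)" using that by (metis Suc_leI add.commute of_nat_Suc of_nat_mono)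
    hence "(of_nat t + 1 + 1 / 2) * hh \<le> (of_nat t' + 1 / 2) * hh" using hh(1) by (intro mult_right_mono) auto
    thus ?thesis unfolding r_def w2_def using hh(1) by (simp add: algebra_simps)
  qed
  have r_in: "u < r t - w2" "r t + w2 < g" if "t < 2 * N" for t
  proof -
    have "0 \<le> of_nat t * hh" using hh(1) by simp
    moreover have rt: "r t = u + of_nat t * hh + hh / 2" by (simp add: r_def algebra_simps)
    ultimately show "u < r t - w2" unfolding rt w2_def using hh(1) by linarith
    have "(of_nat t + 1 :: rat) \<le> 2 * of_nat N"
      using that by (metis Suc_leI add.commute of_nat_Suc of_nat_mono of_nat_mult of_nat_numeral)
    hence "(of_nat t + 1) * hh \<le> 2 * of_nat N * hh" using hh(1) by (intro mult_right_mono) auto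
    moreover have "2 * of_nat N * hh + hh = g - u" using hh(2) by (simp add: algebra_simps)
    moreover have "(of_nat t + 1) * hh = of_nat t * hh + hh" by (simp add: algebra_simps)
    ultimately show "r t + w2 < g" unfolding rt w2_def using hh(1) by linarith
  qed
  have blkb: "\<bar>q - r t\<bar> \<le> w2" if "q \<in> pl (r t) w2 ` X" for q t using pl_bound[OF w2] X_abs that by auto
  have blkin: "u < q \<and> q < g" if "q \<in> pl (r t) w2 ` X" "t < 2 * N" for q t
    using blkb[OF that(1)] r_in[OF that(2)] by (auto simp: abs_le_iff)
  have blkdisj: "\<not> \<bar>q - r t'\<bar> \<le> w2" if "q \<in> pl (r t) w2 ` X" "t \<noteq> t'" for q t t'
    using blkb[OF that(1)] r_less[of t t'] r_less[of t' t] that(2) w2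
    by (cases "t < t'") (auto simp: abs_le_iff)
  define D0 where "D0 = C \<union> V0 \<union> IA j \<union> {..<M} \<times> (\<Union>t<N. pl (r (2 * t)) w2 ` X)"
  have D0sub: "D0 \<subseteq> DV \<union> IA j"
  proof -
    have "(k, q) \<in> DV" if "k < M" "t < N" "q \<in> pl (r (2 * t)) w2 ` X" for k t q
      using inDV[OF that(1)] blkin[OF that(3)] that(2) by simp
    thus ?thesis using V0(2) unfolding D0_def DV_def by blast
  qed
  \<comment> \<open>Of each placement only the sequence in the violating row is retained, since the
    new sequences in different rows fit the array separately but perhaps not together.\<close>
  define Dt where "Dt t kk = D0 \<union> (\<Union>s<t. {kk s} \<times> pl (r (2 * s + 1)) w2 ` X)" for t :: nat and kk :: "nat \<Rightarrow> nat"
  \<comment> \<open>Reads the block around \<open>x\<close> in row \<open>k\<close> in place of the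
    sequence at \<open>Bp j\<close>. All other variables keep their value in \<open>Z\<close>, in
    particular those at \<open>Y j\<close>.\<close>
  define put where "put W k x v = (if fst v \<in> {k} \<times> Bp j then W ((k, pl x w2 ((snd (fst v) - ?P) / w)), snd v) else Z v)"
    for W :: "(nat \<times> rat) \<times> nat \<Rightarrow> 'm" and k x and v :: "(nat \<times> rat) \<times> nat"
  have putenv: "put W k x \<in> envs" if "W \<in> envs" for W k x
    using that Zenv by (intro envsI) (auto simp: put_def envsD)
  have put_cong: "\<theta> k (put W k x) = \<theta> k (put W' k x)"
    if "k < M" "W \<in> envs" "W' \<in> envs" "agree ({k} \<times> pl x w2 ` X) W W'" for W W' k x
  proof (rule dfn_local[OF \<theta>(1)[OF that(1)] putenv[OF that(2)] putenv[OF that(3)]])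
    fix v assume "v \<in> ?W k \<times> {..<m}"
    thus "put W k x v = put W' k x v"
      using that(4) by (auto simp: put_def agree_def pl_inv[OF w0])
  qed
  have claim: "\<exists>W kk. Es (Dt t kk) W \<and> agree D0 W Z \<and>
    (\<forall>s<t. kk s < M \<and> \<not> \<theta> (kk s) (put W (kk s) (r (2 * s + 1))))" if "t \<le> N" for t
    using that
  proof (induction t)
    case 0
    have "Es (Dt 0 (\<lambda>_. 0)) Z" using Es_mono[OF Z(1)] D0sub by (simp add: Dt_def)
    thus ?case by (auto simp: agree_def)
  next
    case (Suc t)
    then obtain W kk where W: "Es (Dt t kk) W" "agree D0 W Z"
      "\<And>s. s < t \<Longrightarrow> kk s < M" "\<And>s. s < t \<Longrightarrow> \<not> \<theta> (kk s) (put W (kk s) (r (2 * s + 1)))" by auto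
    have tN: "2 * t + 1 < 2 * N" using Suc.prems by simp
    let ?r = "r (2 * t + 1)"
    let ?p' = "\<lambda>k. if k < M then ?r else p" and ?d' = "\<lambda>k. if k < M then w2 else \<mu> ^ Suc j * d"
    have DtD: "(k, q) \<in> C \<or> (k, q) \<in> V0 \<or> (k, q) \<in> IA j \<or>
        (k < M \<and> (\<exists>t'<2 * N. t' \<noteq> 2 * t + 1 \<and> q \<in> pl (r t') w2 ` X))" if "(k, q) \<in> Dt t kk" for k q
    proof -
      from that consider "(k, q) \<in> C \<or> (k, q) \<in> V0 \<or> (k, q) \<in> IA j"
        | t' where "k < M" "t' < N" "q \<in> pl (r (2 * t')) w2 ` X"
        | s where "s < t" "k = kk s" "q \<in> pl (r (2 * s + 1)) w2 ` X"
        unfolding Dt_def D0_def by blast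
      thus ?thesis
      proof cases
        case 2
        moreover have "2 * t' < 2 * N" "2 * t' \<noteq> 2 * t + 1" using 2(2) by presburger+
        ultimately show ?thesis by blast
      next
        case 3
        moreover have "2 * s + 1 < 2 * N" "2 * s + 1 \<noteq> 2 * t + 1" using 3(1) tN by auto
        ultimately show ?thesis using W(3) by blast
      qed blast
    qed
    \<comment> \<open>The sequences go around the odd point in the rows below \<open>M\<close>, and
      to the next smaller scale around \<open>p\<close> in row \<open>M\<close>.\<close>
    have "\<exists>K'. K' \<in> envs \<and> agree (Dt t kk) K' W \<and> (\<forall>k<Suc M. Es (Dt t kk \<union> {k} \<times> pl (?p' k) (?d' k) ` X) K') \<and>
      teq {} (CX \<times> {..<m}) (K' \<circ> lift (mv C p d ?p' ?d')) K"
    proof (rule gap_transfer[OF gap C(2) _ b Cb Es_env[OF DK] K _ _ W(1) DK])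
      show "X \<subseteq> {-1..1}" using X(2) by auto
      show "C \<subseteq> Dt t kk" by (auto simp: Dt_def D0_def)
      fix k q assume "(k, q) \<in> Dt t kk - C"
      then consider "(k, q) \<in> V0" "(k, q) \<notin> C" | "(k, q) \<in> IA j" | t' where "k < M" "t' < 2 * N" "q \<in> pl (r t') w2 ` X"
        using DtD[of k q] by blast
      thus "k < Suc M \<and> \<bar>q - p\<bar> < b"
      proof cases
        case 1
        hence "k < M \<and> \<bar>q - p\<bar> < b" using DV_C V0(2) by blast
        thus ?thesis by simp
      next
        case 2
        thus ?thesis using IA_bound[OF 2] b(1) by simp
      next
        case 3
        hence "\<bar>q - p\<bar> < b" using inb blkin by blast
        thus ?thesis using 3(1) by simp
      qed
    next
      fix k assume kM: "k < Suc M"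
      show "0 < ?d' k" using w2 \<mu>d(1)[of "Suc j"] by simp
      show "\<bar>?p' k - p\<bar> + ?d' k < b"
      proof (cases "k < M")
        case True
        have "\<bar>?r - w2 - p\<bar> < b" "\<bar>?r + w2 - p\<bar> < b"
          using inb[of "?r - w2"] inb[of "?r + w2"] r_in[OF tN] w2 by auto
        thus ?thesis using True w2 by (auto simp: abs_if split: if_splits)
      next
        case False
        thus ?thesis using \<mu>d(2)[of "Suc j"] b(1) by simp
      qed
      fix q assume q: "\<bar>q - ?p' k\<bar> \<le> ?d' k"
      show "(k, q) \<notin> Dt t kk"
      proof
        assume kq: "(k, q) \<in> Dt t kk"
        show False
        proof (cases "k < M")
          case True
          hence qr: "\<bar>q - ?r\<bar> \<le> w2" using q by simp
          hence qin: "u < q" "q < g" using r_in[OF tN] by (auto simp: abs_le_iff)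
          from DtD[OF kq] consider "(k, q) \<in> C" | "(k, q) \<in> V0" | "(k, q) \<in> IA j"
            | t' where "t' \<noteq> 2 * t + 1" "q \<in> pl (r t') w2 ` X" by blast
          thus False
          proof cases
            case 1
            thus False using Cb[OF 1] inb[OF qin] True by simp
          next
            case 2
            thus False using u2[OF 2 True qin(2)] qin(1) by simp
          next
            case 3
            thus False using IA_bound[OF 3] True by simp
          next
            case 4
            thus False using blkdisj[OF 4(2,1)] qr by simp
          qed
        next
          case False
          hence qr: "\<bar>q - p\<bar> \<le> \<mu> ^ Suc j * d" using q by simp
          from DtD[OF kq] consider "(k, q) \<in> C" | "(k, q) \<in> V0" "(k, q) \<notin> C" | "(k, q) \<in> IA j"
            using False by blast
          thus False
          proof cases
            case 1
            thus False using Cb[OF 1 kM] qr \<mu>d(2)[of "Suc j"] b(1) by simp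
          next
            case 2
            thus False using DV_C V0(2) False by blast
          next
            case 3
            thus False using IA_bound[OF 3] qr by simp
          qed
        qed
      qed
    qed
    then obtain K' where K': "K' \<in> envs" "agree (Dt t kk) K' W"
      "\<forall>k<Suc M. Es (Dt t kk \<union> {k} \<times> pl (?p' k) (?d' k) ` X) K'"
      "teq {} (CX \<times> {..<m}) (K' \<circ> lift (mv C p d ?p' ?d')) K"
      by (elim exE conjE)
    have D0Dt: "D0 \<subseteq> Dt t kk" by (auto simp: Dt_def)
    have K'Z: "agree D0 K' Z" using agree_trans[OF agree_mono[OF K'(2) D0Dt] W(2)] .
    \<comment> \<open>if every row were good, the new sequences could be moved into place\<close>
    have "\<exists>k<M. \<not> \<theta> k (put K' k ?r)"
    proof (rule ccontr)
      assume "\<not> (\<exists>k<M. \<not> \<theta> k (put K' k ?r))"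
      hence good: "\<theta> k (put K' k ?r)" if "k < M" for k using that by blast
      define z where "z v = (if fst v \<in> {..<M} \<times> Bp j then K' ((fst (fst v), pl ?r w2 ((snd (fst v) - ?P) / w)), snd v)
        else if fst v \<in> Ip (Suc j) then K' v else Z v)" for v :: "(nat \<times> rat) \<times> nat"
      have zenv: "z \<in> envs" using K'(1) Zenv by (intro envsI) (auto simp: z_def envsD)
      have BpO: "(k, q) \<notin> DV \<union> IA j \<union> Y j" if "k < M" "q \<in> Bp j" for k q
      proof -
        have 1: "\<bar>q - ?P\<bar> \<le> w" using Bp_bound[OF that(2)] .
        have "(k, q) \<notin> DV" using DV_gap[OF _ 1] j that(1) by simp
        moreover have "(k, q) \<notin> IA j" using IA_bound[of k q j] that(1) by auto
        moreover have "(k, q) \<notin> Y j"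
        proof
          assume "(k, q) \<in> Y j"
          then obtain i where "i \<le> j" "q = P i" by (auto simp: Y_def)
          thus False using P_less[of i "Suc j"] 1 w0 by (auto simp: abs_if split: if_splits)
        qed
        ultimately show ?thesis by blast
      qed
      have IpO: "(k, q) \<notin> DV \<union> IA j \<union> Y j" if kq: "(k, q) \<in> Ip (Suc j)" for k q
      proof -
        obtain x where x: "x \<in> X" "k = M" "q = pl p (\<mu> ^ Suc j * d) x" using kq unfolding Ip_def by blast
        have 1: "\<bar>q - p\<bar> \<le> \<mu> ^ Suc j * d" unfolding x(3) by (rule pl_bound[OF \<mu>d(1) X_abs[OF x(1)]])
        have "(k, q) \<notin> C" using Cb[of k q] 1 \<mu>d(2)[of "Suc j"] b(1) x(2) by auto
        hence "(k, q) \<notin> DV" using DV_C[of k q] x(2) by auto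
        moreover have "(k, q) \<notin> IA j" using IA_bound[of k q j] 1 by auto
        moreover have "(k, q) \<notin> Y j" using x(2) by (auto simp: Y_def)
        ultimately show ?thesis by blast
      qed
      have zO: "agree (DV \<union> IA j \<union> Y j) z Z"
      proof (rule agreeI)
        fix q c assume q: "q \<in> DV \<union> IA j \<union> Y j"
        have "q \<notin> {..<M} \<times> Bp j" using BpO q by (cases q) auto
        moreover have "q \<notin> Ip (Suc j)" using IpO q by (cases q) auto
        ultimately show "z (q, c) = Z (q, c)" by (simp add: z_def)
      qed
      moreover have "Es (V0 \<union> IA (Suc j)) z"
      proof (rule Es_agree)
        show "Es (V0 \<union> IA (Suc j)) K'"
          by (rule Es_mono[OF K'(3)[rule_format, of M]]) (auto simp: IA_Suc Ip_def Dt_def D0_def)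
        show "agree (V0 \<union> IA (Suc j)) z K'"
        proof (rule agreeI)
          fix q c assume q: "q \<in> V0 \<union> IA (Suc j)" and c: "c < m"
          show "z (q, c) = K' (q, c)"
          proof (cases "q \<in> Ip (Suc j)")
            case True
            hence "q \<notin> {..<M} \<times> Bp j" by (auto simp: Ip_def)
            thus ?thesis using True by (simp add: z_def)
          next
            case False
            hence "q \<in> V0 \<union> IA j" using q by (auto simp: IA_Suc)
            hence "z (q, c) = Z (q, c)" "Z (q, c) = K' (q, c)"
              using agreeD[OF zO _ c, of q] agreeD[OF K'Z _ c, of q] V0(2) by (auto simp: D0_def)
            thus ?thesis by simp
          qed
        qed
      qed (rule zenv)
      moreover have "teq {} (CX \<times> {..<m}) (z \<circ> lift (nu j)) K"
      proof (rule teq_trans[OF teq_agree' K'(4)])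
        show "z \<circ> lift (nu j) \<in> envs" "K' \<circ> lift (mv C p d ?p' ?d') \<in> envs" using zenv K'(1) by (auto intro: envs_comp)
        show "agree CX (z \<circ> lift (nu j)) (K' \<circ> lift (mv C p d ?p' ?d'))"
        proof (rule agreeI)
          fix q c assume q: "q \<in> C \<union> {..<Suc M} \<times> pl p d ` X" and c: "c < m"
          show "(z \<circ> lift (nu j)) (q, c) = (K' \<circ> lift (mv C p d ?p' ?d')) (q, c)"
          proof (cases "q \<in> C")
            case True
            hence "z (q, c) = K' (q, c)"
              using agreeD[OF zO _ c, of q] agreeD[OF K'Z _ c, of q] by (auto simp: D0_def DV_def)
            thus ?thesis using True by (simp add: nu_C) (simp add: mv_def)
          next
            case False
            then obtain k x where q': "q = (k, pl p d x)" "k < Suc M" "x \<in> X" using q by auto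
            have mvq: "mv C p d ?p' ?d' q = (k, pl (?p' k) (?d' k) x)"
              unfolding q'(1) by (rule mv_pl[OF d0]) (use plX_notC q'(2,3) in auto)
            show ?thesis
            proof (cases "k < M")
              case True
              hence "nu j q = (k, pl ?P w x)" using nu_pl(1)[of x k j] q' by simp
              thus ?thesis using True q'(3) mvq by (simp add: z_def pl_inv[OF w0])
            next
              case False
              hence k: "k = M" using q'(2) by simp
              hence "nu j q = (M, pl p (\<mu> ^ Suc j * d) x)" using nu_pl(2)[of x j] q' by simp
              moreover have "(M, pl p (\<mu> ^ Suc j * d) x) \<in> Ip (Suc j)" using q'(3) by (auto simp: Ip_def)
              ultimately show ?thesis using k mvq by (simp add: z_def)
            qed
          qed
        qed
      qed
      ultimately obtain k where k: "k < M" "\<not> \<theta> k z" using nosol[OF zenv] by blast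
      have "\<theta> k z = \<theta> k (put K' k ?r)"
      proof (rule dfn_local[OF \<theta>(1)[OF k(1)] zenv putenv[OF K'(1)]])
        fix v assume v: "v \<in> ?W k \<times> {..<m}"
        obtain q c where vq: "v = (q, c)" by (cases v)
        show "z v = put K' k ?r v"
        proof (cases "q \<in> {k} \<times> Bp j")
          case True
          thus ?thesis using k(1) by (auto simp: vq z_def put_def)
        next
          case False
          hence "q \<in> DV \<union> IA j \<union> Y j" "c < m" using v vq V0(2) by auto
          thus ?thesis using agreeD[OF zO] False by (simp add: vq put_def)
        qed
      qed
      thus False using good k by blast
    qed
    then obtain k where k: "k < M" "\<not> \<theta> k (put K' k ?r)" by blast
    define kk' where "kk' = kk(t := k)"
    have Dt': "Dt (Suc t) kk' = Dt t kk \<union> {k} \<times> pl ?r w2 ` X"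
    proof -
      have "(\<Union>s<t. {kk' s} \<times> pl (r (2 * s + 1)) w2 ` X) = (\<Union>s<t. {kk s} \<times> pl (r (2 * s + 1)) w2 ` X)"
        by (intro SUP_cong) (auto simp: kk'_def)
      thus ?thesis by (auto simp: Dt_def lessThan_Suc kk'_def)
    qed
    have "Es (Dt (Suc t) kk') K'" unfolding Dt' using K'(3)[rule_format, of k] k(1) by simp
    moreover have "kk' s < M \<and> \<not> \<theta> (kk' s) (put K' (kk' s) (r (2 * s + 1)))" if "s < Suc t" for s
    proof (cases "s = t")
      case True
      thus ?thesis using k by (simp add: kk'_def)
    next
      case False
      hence s: "s < t" using that by simp
      have "agree ({kk s} \<times> pl (r (2 * s + 1)) w2 ` X) K' W"
        by (rule agree_mono[OF K'(2)]) (use s in \<open>auto simp: Dt_def\<close>)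
      hence "\<theta> (kk s) (put K' (kk s) (r (2 * s + 1))) = \<theta> (kk s) (put W (kk s) (r (2 * s + 1)))"
        by (intro put_cong W(3)[OF s] K'(1) Es_env[OF W(1)])
      thus ?thesis using W(3,4)[OF s] False by (simp add: kk'_def)
    qed
    ultimately show ?case using K'Z by blast
  qed
  obtain W kk where W: "Es (Dt N kk) W" "agree D0 W Z"
    "\<forall>s<N. kk s < M \<and> \<not> \<theta> (kk s) (put W (kk s) (r (2 * s + 1)))" using claim[of N] by blast
  have Wenv: "W \<in> envs" using Es_env[OF W(1)] .
  have M0: "{..<M} \<noteq> {}" using W(3) N_def by (metis add_gr_0 lessThan_iff empty_iff less_one)
  have "\<exists>k\<in>{..<M}. card {..<N} \<le> card (kk -` {k} \<inter> {..<N}) * card {..<M}"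
    by (rule pigeonhole_card) (use W(3) M0 in auto)
  then obtain k where k: "k < M" "N \<le> card (kk -` {k} \<inter> {..<N}) * M" by auto
  define T where "T = kk -` {k} \<inter> {..<N}"
  have cT: "B \<le> card T"
  proof (rule ccontr)
    assume "\<not> B \<le> card T"
    hence "card T * M \<le> B * M" by (intro mult_right_mono) auto
    moreover have "N \<le> card T * M" using k(2) by (simp add: T_def)
    ultimately have "N \<le> M * B" by (metis mult.commute order_trans)
    thus False unfolding N_def by simp
  qed
  define sl where "sl = sorted_list_of_set T"
  have sl: "length sl = card T" "set sl = T" "sorted_wrt (<) sl"
    unfolding sl_def by (auto simp: T_def)
  have slT: "sl ! a < N" "kk (sl ! a) = k" if "a < B" for a
    using nth_mem[of a sl] sl(1,2) cT that by (auto simp: T_def)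
  have slm: "sl ! a < sl ! a'" if "a < a'" "a' < B" for a a'
    using sorted_wrt_nth_less[OF sl(3) that(1)] that(2) sl(1) cT by simp
  \<comment> \<open>Each retained violation, at an odd point, is preceded by the block of the array
    at the even point just before it.\<close>
  define ix where "ix i = 2 * sl ! (i div 2) + i mod 2" for i
  have ixN: "ix i < 2 * N" if "i < 2 * B" for i
    using slT(1)[of "i div 2"] that unfolding ix_def by linarith
  have ixm: "ix i < ix i'" if "i < i'" "i' < 2 * B" for i i'
  proof (cases "i div 2 = i' div 2")
    case True
    hence "i mod 2 < i' mod 2"
      using that(1) div_mult_mod_eq[of i 2] div_mult_mod_eq[of i' 2] by linarith
    thus ?thesis by (simp add: ix_def True)
  next
    case False
    hence "i div 2 < i' div 2" using div_le_mono[of i i' 2] that(1) by simp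
    moreover have "i' div 2 < B" using that(2) by simp
    ultimately have "sl ! (i div 2) < sl ! (i' div 2)" by (rule slm)
    moreover have "i mod 2 < 2" by simp
    ultimately show ?thesis unfolding ix_def by linarith
  qed
  define f where "f i x = (k, pl (r (ix i)) w2 x)" for i x
  have "blk (\<lambda>_. k) (<) (2 * B) X f"
    unfolding blk_def
  proof (intro conjI allI impI ballI; (elim conjE)?)
    fix i i' :: nat and x y assume ii: "i < i'" "i' < 2 * B" and x: "x \<in> X" and y: "y \<in> X"
    have "\<bar>pl (r (ix i)) w2 x - r (ix i)\<bar> \<le> w2" "\<bar>pl (r (ix i')) w2 y - r (ix i')\<bar> \<le> w2"
      using blkb x y by auto
    thus "snd (f i x) < snd (f i' y)"
      using r_less[OF ixm[OF ii]] w2 by (auto simp: f_def abs_le_iff)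
  qed (auto simp: f_def pl_less[OF w2])
  moreover have "\<forall>i<2 * B. \<forall>x\<in>X. f i x \<in> Dt N kk"
  proof (intro allI impI ballI)
    fix i x assume i: "i < 2 * B" and x: "x \<in> X"
    have s: "sl ! (i div 2) < N" "kk (sl ! (i div 2)) = k" using slT[of "i div 2"] i by auto
    show "f i x \<in> Dt N kk"
    proof (cases "even i")
      case True
      hence "ix i = 2 * sl ! (i div 2)" by (simp add: ix_def)
      thus ?thesis using s(1) x k(1) by (auto simp: f_def Dt_def D0_def)
    next
      case False
      hence "ix i = 2 * sl ! (i div 2) + 1" by (simp add: ix_def mod2_eq_if)
      thus ?thesis using s x by (auto simp: f_def Dt_def)
    qed
  qed
  ultimately have "\<not> (\<forall>i<2 * B. \<theta> k (case_sum (\<lambda>y. W (f i (fst y), snd y)) Z \<circ> G k) \<longleftrightarrow> even i)"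
    using bb[rule_format, of k] k(1) B[OF k(1)] Zenv W(1) by blast
  moreover have "case_sum (\<lambda>y. W (f i (fst y), snd y)) Z \<circ> G k = put W k (r (ix i))" for i
    by (rule ext) (auto simp: G_def put_def f_def)
  ultimately have "\<not> (\<forall>i<2 * B. \<theta> k (put W k (r (ix i))) \<longleftrightarrow> even i)" by simp
  moreover have "\<theta> k (put W k (r (ix i))) = even i" if i: "i < 2 * B" for i
  proof -
    have s: "sl ! (i div 2) < N" "kk (sl ! (i div 2)) = k" using slT[of "i div 2"] i by auto
    show ?thesis
    proof (cases "even i")
      case False
      hence "ix i = 2 * sl ! (i div 2) + 1" by (simp add: ix_def mod2_eq_if)
      thus ?thesis using W(3)[rule_format, OF s(1)] s(2) False by simp
    next
      case True
      let ?x = "r (ix i)"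
      have ixe: "ix i = 2 * sl ! (i div 2)" using True by (simp add: ix_def)
      have agr: "agree ({k} \<times> pl ?x w2 ` X) W Z"
        by (rule agree_mono[OF W(2)]) (use s(1) k(1) in \<open>auto simp: D0_def ixe\<close>)
      \<comment> \<open>The block at an even point and \<open>Bp j\<close> lie in the same cut over
        \<open>V0\<close> and \<open>Y j\<close>, and \<open>Z\<close> fits on the array together
        with \<open>Y j\<close>. Hence the block behaves as a correct sequence at
        \<open>Bp j\<close> would.\<close>
      have "Es (?W k) (put Z k ?x)"
      proof -
        define \<tau> where "\<tau> q = (if q \<in> {k} \<times> Bp j then (k, pl ?x w2 ((snd q - ?P) / w)) else q)" for q :: "nat \<times> rat"
        have im: "u < snd (\<tau> q) \<and> snd (\<tau> q) < g" if "q \<in> {k} \<times> Bp j" for q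
          using that blkin[of "snd (\<tau> q)" "ix i"] ixN[OF i] by (auto simp: \<tau>_def pl_inv[OF w0])
        have lo: "y \<le> u \<or> ?P + w < y" if ky: "(k, y) \<in> V0 \<union> Y j" for y
        proof (cases "(k, y) \<in> V0")
          case True
          hence "\<not> \<bar>y - ?P\<bar> \<le> w" using DV_gap[of "Suc j" y k] V0(2) j k(1) by auto
          thus ?thesis using u2[OF True k(1)] by (auto simp: g_def abs_le_iff)
        next
          case False
          then obtain i where "i \<le> j" "y = P i" using ky by (auto simp: Y_def)
          thus ?thesis using P_mono[of i j] u1 w0 by simp
        qed
        have "rowmono (?W k) \<tau>"
        proof (rule rowmonoI)
          show "fst (\<tau> (k', x)) = k'" if "(k', x) \<in> ?W k" for k' x using that by (auto simp: \<tau>_def)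
          fix k' x y assume x: "(k', x) \<in> ?W k" and y: "(k', y) \<in> ?W k" and xy: "x < y"
          show "snd (\<tau> (k', x)) < snd (\<tau> (k', y))"
          proof (cases "k' = k")
            case False
            thus ?thesis using xy by (simp add: \<tau>_def)
          next
            case kk: True
            consider "x \<in> Bp j" "y \<in> Bp j" | "x \<in> Bp j" "y \<notin> Bp j" | "x \<notin> Bp j" "y \<in> Bp j" | "x \<notin> Bp j" "y \<notin> Bp j" by blast
            thus ?thesis
            proof cases
              case 1
              then obtain x' y' where "x = pl ?P w x'" "y = pl ?P w y'" "x' \<in> X" "y' \<in> X" by blast
              thus ?thesis using xy kk by (auto simp: \<tau>_def pl_inv[OF w0] pl_less[OF w0] pl_less[OF w2])
            next
              case 2
              hence "y \<le> u \<or> ?P + w < y" using lo[of y] y kk by auto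
              moreover have "g \<le> x" using Bp_bound[OF 2(1)] by (auto simp: g_def abs_le_iff)
              ultimately show ?thesis using im[of "(k, x)"] 2 xy kk ug w0 by (auto simp: \<tau>_def g_def)
            next
              case 3
              hence "x \<le> u \<or> ?P + w < x" using lo[of x] x kk by auto
              moreover have "y \<le> ?P + w" using Bp_bound[OF 3(2)] by (auto simp: abs_le_iff)
              ultimately show ?thesis using im[of "(k, y)"] 3 xy kk by (auto simp: \<tau>_def)
            next
              case 4
              thus ?thesis using xy by (simp add: \<tau>_def)
            qed
          qed
        qed
        hence "Es (?W k) (Z \<circ> lift \<tau>)"
        proof (rule Es_reindex[OF Z(2)])
          show "\<tau> ` ?W k \<subseteq> DV \<union> Y j"
          proof
            fix q assume "q \<in> \<tau> ` ?W k"
            then obtain q' where q': "q' \<in> ?W k" "q = \<tau> q'" by blast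
            show "q \<in> DV \<union> Y j"
            proof (cases "q' \<in> {k} \<times> Bp j")
              case True
              hence "q = (k, snd (\<tau> q'))" using q'(2) by (simp add: \<tau>_def)
              thus ?thesis using inDV[OF k(1)] im[OF True] by auto
            next
              case False
              thus ?thesis using q' V0(2) by (auto simp: \<tau>_def)
            qed
          qed
        qed
        moreover have "Z \<circ> lift \<tau> = put Z k ?x" by (rule ext) (auto simp: \<tau>_def put_def)
        ultimately show ?thesis by simp
      qed
      hence "\<theta> k (put Z k ?x)" using EsD[OF _ \<theta>(1)[OF k(1)]] \<theta>(2)[OF k(1)] by blast
      thus ?thesis using put_cong[OF k(1) Wenv Zenv agr] True by blast
    qed
  qed
  ultimately show False by blast
qed

text \<open>Compactness replaces the finite part \<open>V0\<close> and the formulas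
  \<open>\<theta> k\<close> by complete types: row \<open>M\<close> fits together with all its
  earlier sequences over \<open>DV\<close>, and every other row fits over \<open>DV\<close> with
  \<open>Y j\<close>.\<close>

lemma base_change:
  assumes Z: "Es (DV \<union> IA j) Z" "Es (DV \<union> Y j) Z" and j: "j < n"
  shows "\<exists>z\<in>envs. agree (DV \<union> IA j \<union> Y j) z Z \<and> Es (DV \<union> IA (Suc j)) z \<and>
    teq {} (CX \<times> {..<m}) (z \<circ> lift (nu j)) K \<and>
    (\<forall>k<M. Es (DV \<union> Y j \<union> {k} \<times> Bp j) z)"
proof -
  define T where "T i = (case i of 0 \<Rightarrow> DV \<union> IA (Suc j) | Suc 0 \<Rightarrow> C \<union> {..<Suc M} \<times> pl p d ` X
     | Suc (Suc k) \<Rightarrow> DV \<union> Y j \<union> {k} \<times> Bp j) \<times> {..<m}" for i :: nat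
  define gg where "gg i = (if i = 1 then lift (nu j) else id)" for i :: nat
  define hh where "hh i = (if i = 1 then K else e)" for i :: nat
  have Zenv: "Z \<in> envs" using Es_env[OF Z(1)] .
  have "\<exists>z\<in>envs. (\<forall>v\<in>(DV \<union> IA j \<union> Y j) \<times> {..<m}. z v = Z v) \<and> (\<forall>i\<in>{..<M + 2}. teq {} (T i) (z \<circ> gg i) (hh i))"
  proof (rule compactness)
    show "|UNIV :: ((nat \<times> rat) \<times> nat) set| <o kb" by (rule small_countable) simp
    show "|{} :: 'm set| <o kb" by (rule small_finite) simp
    show "hh i \<in> envs" for i using e_env Es_env[OF DK] by (simp add: hh_def)
    fix Q assume Q: "\<And>i. i \<in> {..<M + 2} \<Longrightarrow> dfn {} (T i) (Q i)" "\<And>i. i \<in> {..<M + 2} \<Longrightarrow> Q i (hh i)"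
    have "\<forall>i\<in>{..<M + 2}. \<exists>S0. finite S0 \<and> S0 \<subseteq> T i \<and> dfn {} S0 (Q i)"
      using dfn_finite_ex[OF Q(1)] by blast
    from bchoice[OF this] obtain S where S: "\<forall>i\<in>{..<M + 2}. finite (S i) \<and> S i \<subseteq> T i \<and> dfn {} (S i) (Q i)"
      by (elim exE)
    define V0 where "V0 = fst ` (\<Union>i\<in>{..<M + 2}. S i) \<inter> DV"
    have V0: "finite V0" "V0 \<subseteq> DV" using S by (auto simp: V0_def)
    have V0I: "fst v \<in> V0" if "i < M + 2" "v \<in> S i" "fst v \<in> DV" for i v
      unfolding V0_def using that by (intro IntI imageI UN_I[of i]) auto
    have S0: "S 0 \<subseteq> (V0 \<union> IA (Suc j)) \<times> {..<m}"
    proof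
      fix v assume v: "v \<in> S 0"
      hence "v \<in> T 0" using S by auto
      thus "v \<in> (V0 \<union> IA (Suc j)) \<times> {..<m}"
        using V0I[OF _ v] by (auto simp: T_def mem_Times_iff)
    qed
    have SS: "S (Suc (Suc k)) \<subseteq> (V0 \<union> Y j \<union> {k} \<times> Bp j) \<times> {..<m}" if "k < M" for k
    proof
      fix v assume v: "v \<in> S (Suc (Suc k))"
      hence "v \<in> T (Suc (Suc k))" using S that by auto
      thus "v \<in> (V0 \<union> Y j \<union> {k} \<times> Bp j) \<times> {..<m}"
        using V0I[OF _ v] that by (auto simp: T_def mem_Times_iff)
    qed
    have "\<exists>z\<in>envs. agree (DV \<union> IA j \<union> Y j) z Z \<and> Es (V0 \<union> IA (Suc j)) z \<and>
      teq {} (CX \<times> {..<m}) (z \<circ> lift (nu j)) K \<and> (\<forall>k<M. Q (Suc (Suc k)) z)"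
    proof (rule base_change_finite[OF Z j V0])
      fix k assume k: "k < M"
      show "dfn {} ((V0 \<union> Y j \<union> {k} \<times> Bp j) \<times> {..<m}) (Q (Suc (Suc k)))"
        using S[rule_format, of "Suc (Suc k)"] k dfn_mono[OF _ order_refl SS[OF k]] by simp
      show "Q (Suc (Suc k)) e" using Q(2)[of "Suc (Suc k)"] k by (simp add: hh_def)
    qed
    then obtain z where z: "z \<in> envs" "agree (DV \<union> IA j \<union> Y j) z Z" "Es (V0 \<union> IA (Suc j)) z"
      "teq {} (CX \<times> {..<m}) (z \<circ> lift (nu j)) K" "\<forall>k<M. Q (Suc (Suc k)) z"
      by (elim bexE conjE)
    have "Q i (z \<circ> gg i)" if i: "i < M + 2" for i
    proof -
      consider "i = 0" | "i = 1" | k where "i = Suc (Suc k)" by (metis One_nat_def not0_implies_Suc)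
      thus ?thesis
      proof cases
        case 1
        have "dfn {} ((V0 \<union> IA (Suc j)) \<times> {..<m}) (Q 0)"
          using S[rule_format, of 0] dfn_mono[OF _ order_refl S0] by simp
        hence "Q 0 z" using EsD[OF z(3), of "Q 0"] Q(2)[of 0] by (simp add: hh_def)
        thus ?thesis by (simp add: 1 gg_def)
      next
        case 2
        have "dfn {} (CX \<times> {..<m}) (Q 1)"
          using Q(1)[of 1] by (simp add: T_def)
        hence "Q 1 (z \<circ> lift (nu j)) = Q 1 K" by (rule teqD[OF z(4)])
        thus ?thesis using Q(2)[of 1] by (simp add: 2 gg_def hh_def)
      next
        case 3
        thus ?thesis using z(5) i by (simp add: gg_def)
      qed
    qed
    moreover have "\<forall>v\<in>(DV \<union> IA j \<union> Y j) \<times> {..<m}. z v = Z v" using z(2) by (auto simp: agree_def)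
    ultimately show "\<exists>z\<in>envs. (\<forall>v\<in>(DV \<union> IA j \<union> Y j) \<times> {..<m}. z v = Z v) \<and> (\<forall>i\<in>{..<M + 2}. Q i (z \<circ> gg i))"
      using z(1) by (intro bexI[of _ z]) auto
  qed (use Zenv in auto)
  then obtain z where z: "z \<in> envs" "\<forall>v\<in>(DV \<union> IA j \<union> Y j) \<times> {..<m}. z v = Z v"
    "\<forall>i\<in>{..<M + 2}. teq {} (T i) (z \<circ> gg i) (hh i)" by (elim bexE conjE)
  have "agree (DV \<union> IA j \<union> Y j) z Z" using z(2) by (auto simp: agree_def)
  moreover have "Es (DV \<union> IA (Suc j)) z"
    using z(1) bspec[OF z(3), of 0] by (simp add: Es_def T_def gg_def hh_def)
  moreover have "teq {} (CX \<times> {..<m}) (z \<circ> lift (nu j)) K"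
    using bspec[OF z(3), of 1] by (simp add: T_def gg_def hh_def)
  moreover have "Es (DV \<union> Y j \<union> {k} \<times> Bp j) z" if "k < M" for k
    using z(1) bspec[OF z(3), of "Suc (Suc k)"] that by (simp add: Es_def T_def gg_def hh_def)
  ultimately show ?thesis using z(1) by blast
qed

text \<open>
  The stages of the construction: \<open>Z\<close> contains nested sequences at \<open>Ip 1, \<dots>, Ip j\<close> in the last
  row and tuples \<open>y\<^sub>i\<close> at \<open>{..<M} \<times> {P i}\<close> such that \<open>\<beta>(y\<^sub>i, z)\<close> fails whenever \<open>z\<close> lies inside \<open>Ip i\<close>.
\<close>

definition asm :: "((nat \<times> rat) \<times> nat \<Rightarrow> 'm) \<Rightarrow> ((nat \<times> rat) \<times> nat \<Rightarrow> 'm) \<Rightarrow> rat \<Rightarrow> (nat \<times> rat) \<times> nat \<Rightarrow> 'm" where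
  "asm Z Z' x v = (if fst v \<in> C then Z v else if fst (fst v) < M then Z ((fst (fst v), x), snd v) else Z' v)"

definition stage :: "(((nat \<times> rat) \<times> nat \<Rightarrow> 'm) \<Rightarrow> bool) \<Rightarrow> nat \<Rightarrow> ((nat \<times> rat) \<times> nat \<Rightarrow> 'm) \<Rightarrow> bool" where
  "stage \<beta> j Z \<longleftrightarrow> agree C Z K \<and> Es (DV \<union> IA j) Z \<and> Es (DV \<union> Y j) Z \<and>
     (\<forall>i\<in>{1..j}. \<forall>Z'. agree (C \<union> Ip i) Z' Z \<and> Es (C \<union> Ip i \<union> {(M, p)}) Z' \<longrightarrow> \<not> \<beta> (asm Z Z' (P i)))"

lemma asm_env: "Z \<in> envs \<Longrightarrow> Z' \<in> envs \<Longrightarrow> asm Z Z' x \<in> envs"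
  by (intro envsI) (auto simp: asm_def envsD)

text \<open>\<open>\<not> StarT M\<close>, applied in the gap at \<open>P (Suc j)\<close> over the
  base \<open>DV\<close> with \<open>Y j\<close>, yields tuples inside the new sequences of the rows
  below \<open>M\<close>. Together with any element that fits inside the new sequence of row
  \<open>M\<close>, they fit row by row into a copy of \<open>K\<close>; so \<open>\<beta>\<close>
  fails for them.\<close>

lemma stage_step:
  assumes \<beta>: "dfn {} ((C \<union> {..<Suc M} \<times> {p}) \<times> {..<m}) \<beta>"
    and no: "\<And>z. z \<in> envs \<Longrightarrow> agree CX z K \<Longrightarrow>
      (\<And>k. k < Suc M \<Longrightarrow> Es (C \<union> {k} \<times> insert p (pl p d ` X)) z) \<Longrightarrow> \<not> \<beta> z"
    and nS: "\<not> StarT M" and st: "stage \<beta> j Z" and j: "j < n"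
  shows "\<exists>Z. stage \<beta> (Suc j) Z"
proof -
  have Z: "agree C Z K" "Es (DV \<union> IA j) Z" "Es (DV \<union> Y j) Z"
    "\<forall>i\<in>{1..j}. \<forall>Z'. agree (C \<union> Ip i) Z' Z \<and> Es (C \<union> Ip i \<union> {(M, p)}) Z' \<longrightarrow> \<not> \<beta> (asm Z Z' (P i))"
    using st by (auto simp: stage_def)
  let ?P = "P (Suc j)"
  obtain z where z: "z \<in> envs" "agree (DV \<union> IA j \<union> Y j) z Z" "Es (DV \<union> IA (Suc j)) z"
    "teq {} (CX \<times> {..<m}) (z \<circ> lift (nu j)) K"
    "\<forall>k<M. Es (DV \<union> Y j \<union> {k} \<times> Bp j) z"
    using base_change[OF Z(2,3) j] by (elim bexE conjE)
  let ?D = "DV \<union> Y j"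
  have YP: "\<bar>q - ?P\<bar> > 2 * w" if kq: "(k, q) \<in> Y j" for k q
  proof -
    obtain i where "i \<le> j" "q = P i" using kq by (auto simp: Y_def)
    thus ?thesis using P_less[of i "Suc j"] w0 by (simp add: abs_if)
  qed
  have gapP: "gapok M ?P w w ?D"
    unfolding gapok_def
  proof (intro conjI allI impI)
    fix k q assume k: "k < M"
    show "(k, q) \<notin> ?D" if "\<bar>q - ?P\<bar> \<le> w"
      using DV_gap[of "Suc j" q k] YP[of k q] that j w0 k by auto
    show "(k, q) \<in> ?D" if q: "w < \<bar>q - ?P\<bar> \<and> \<bar>q - ?P\<bar> < w + w"
    proof -
      have "(k, q) \<in> DV"
      proof (cases "q < ?P")
        case True
        thus ?thesis using DV_between[of k j q] q k j P_Suc[of j] by (auto simp: abs_if)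
      next
        case False
        thus ?thesis using DV_between[of k "Suc j" q] q k j P_Suc[of "Suc j"] by (auto simp: abs_if)
      qed
      thus ?thesis by simp
    qed
  qed (use w0 in auto)
  have "\<exists>y. agree (?D \<union> {..<M} \<times> Bp j) y z \<and> Es (?D \<union> {..<M} \<times> {?P}) y \<and>
          (\<forall>k<M. Es (?D \<union> {k} \<times> insert ?P (Bp j)) y)"
  proof (rule ccontr)
    assume "\<not> ?thesis"
    moreover have "Es ?D z" by (rule Es_agree[OF Z(3) z(1) agree_mono[OF z(2)]]) auto
    ultimately have "StarT M" unfolding StarT_def using gapP X z(5) by blast
    thus False using nS by blast
  qed
  then obtain y where y: "agree (?D \<union> {..<M} \<times> Bp j) y z" "Es (?D \<union> {..<M} \<times> {?P}) y"
    "\<forall>k<M. Es (?D \<union> {k} \<times> insert ?P (Bp j)) y" by (elim exE conjE)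
  \<comment> \<open>Only the new tuples are taken from \<open>y\<close>. At the sequences of row
    \<open>M\<close> the values of \<open>z\<close> are kept, as \<open>y\<close> need not agree
    with \<open>z\<close> there.\<close>
  define Z1 where "Z1 v = (if fst v \<in> {..<M} \<times> {?P} then y v else z v)" for v
  have Z1env: "Z1 \<in> envs" unfolding Z1_def[abs_def] by (rule envs_merge[OF Es_env[OF y(2)] z(1)])
  have PO: "(k, ?P) \<notin> DV \<union> IA j \<union> Y j" if "k < M" for k
    using DV_gap[of "Suc j" ?P k] YP[of k ?P] IA_bound[of k ?P j] that j w0 by auto
  have Z1z: "agree (DV \<union> IA (Suc j) \<union> Y j) Z1 z"
  proof (rule agreeI)
    fix q c assume "q \<in> DV \<union> IA (Suc j) \<union> Y j"
    hence "q \<notin> {..<M} \<times> {?P}" using PO by (auto simp: IA_Suc Ip_def)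
    thus "Z1 (q, c) = z (q, c)" by (simp add: Z1_def)
  qed
  have Z1y: "agree (?D \<union> {..<M} \<times> insert ?P (Bp j)) Z1 y"
  proof (rule agreeI)
    fix q c assume q: "q \<in> ?D \<union> {..<M} \<times> insert ?P (Bp j)" and c: "c < m"
    show "Z1 (q, c) = y (q, c)"
    proof (cases "q \<in> {..<M} \<times> {?P}")
      case False
      hence "q \<in> ?D \<union> {..<M} \<times> Bp j" using q by auto
      thus ?thesis using agreeD[OF y(1) _ c] False by (simp add: Z1_def)
    qed (simp add: Z1_def)
  qed
  have Z1Z: "agree (DV \<union> IA j \<union> Y j) Z1 Z"
    by (rule agree_trans[OF agree_mono[OF Z1z] z(2)]) (auto simp: IA_Suc)
  have E1: "Es (DV \<union> IA (Suc j)) Z1" by (rule Es_agree[OF z(3) Z1env agree_mono[OF Z1z]]) auto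
  have E2: "Es (DV \<union> Y (Suc j)) Z1"
    by (rule Es_agree[OF Es_mono[OF y(2)] Z1env agree_mono[OF Z1y]]) (auto simp: Y_Suc)
  have CDV: "C \<subseteq> DV" by (auto simp: DV_def)
  have "\<not> \<beta> (asm Z1 Z' (P i))" if i: "i \<in> {1..Suc j}"
    and Z': "agree (C \<union> Ip i) Z' Z1" "Es (C \<union> Ip i \<union> {(M, p)}) Z'" for i Z'
  proof (cases "i \<le> j")
    case True
    have Ii: "Ip i \<subseteq> IA j" using True i by (auto simp: IA_def)
    have "agree (C \<union> Ip i) Z' Z"
      by (rule agree_trans[OF Z'(1) agree_mono[OF Z1Z]]) (use CDV Ii in auto)
    hence "\<not> \<beta> (asm Z Z' (P i))" using Z(4) True i Z'(2) by auto
    \<comment> \<open>The earlier stages survive because \<open>Z1\<close> agrees with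
      \<open>Z\<close> on \<open>C\<close> and on the tuples already chosen.\<close>
    moreover have "\<beta> (asm Z1 Z' (P i)) = \<beta> (asm Z Z' (P i))"
    proof (rule dfn_local[OF \<beta> asm_env[OF Z1env Es_env[OF Z'(2)]] asm_env[OF Es_env[OF Z(2)] Es_env[OF Z'(2)]]])
      fix v assume v: "v \<in> (C \<union> {..<Suc M} \<times> {p}) \<times> {..<m}"
      have "agree (C \<union> {..<M} \<times> {P i}) Z1 Z"
        by (rule agree_mono[OF Z1Z]) (use CDV True i in \<open>auto simp: Y_def\<close>)
      thus "asm Z1 Z' (P i) v = asm Z Z' (P i) v"
        using v by (auto simp: asm_def agree_def)
    qed
    ultimately show ?thesis by blast
  next
    case False
    hence i': "i = Suc j" using i by simp
    let ?T = "C \<union> {..<Suc M} \<times> pl p d ` X"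
    let ?T' = "C \<union> {..<Suc M} \<times> pl p d ` insert 0 X"
    have pM: "(M, p) \<notin> C" using Cb[of M p] b0 by auto
    define y1 where "y1 v = (if fst v = (M, p) then Z' v else Z1 v)" for v
    have y1env: "y1 \<in> envs" unfolding y1_def[abs_def] by (rule envs_merge[OF Es_env[OF Z'(2)] Z1env])
    have nuM: "nu j (M, pl p d 0) = (M, p)" using nu_pl(2)[of 0 j] by simp
    have nuq: "nu j q \<noteq> (M, p)" if qT: "q \<in> ?T" for q
    proof (cases "q \<in> C")
      case True
      hence "(M, p) \<noteq> q" using pM by auto
      thus ?thesis using True by (simp add: nu_C)
    next
      case False
      then obtain k x where q: "q = (k, pl p d x)" "k < Suc M" "x \<in> X" using qT by auto
      show ?thesis
      proof (cases "k < M")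
        case True
        thus ?thesis using nu_pl(1)[of x k j] q by simp
      next
        case False
        hence "nu j q = (M, pl p (\<mu> ^ Suc j * d) x)" using nu_pl(2)[of x j] q by (simp add: less_Suc_eq)
        moreover have "pl p (\<mu> ^ Suc j * d) x \<noteq> pl p (\<mu> ^ Suc j * d) 0"
          using pl_eq[OF \<mu>d(1), of p "Suc j" x 0] q(3) X(2) by auto
        ultimately show ?thesis by (simp del: power_Suc)
      qed
    qed
    have nuim: "nu j q \<in> C \<union> {..<M} \<times> Bp j \<union> Ip (Suc j)" if qT: "q \<in> ?T" for q
    proof (cases "q \<in> C")
      case True
      thus ?thesis by (simp add: nu_C)
    next
      case False
      then obtain k x where q: "q = (k, pl p d x)" "k < Suc M" "x \<in> X" using qT by auto
      thus ?thesis using nu_pl(1)[of x k j] nu_pl(2)[of x j]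
        by (cases "k < M") (auto simp: Ip_def less_Suc_eq simp del: power_Suc)
    qed
    have tK: "teq {} (?T \<times> {..<m}) (y1 \<circ> lift (nu j)) K"
    proof (rule teq_trans[OF teq_agree' z(4)])
      show "agree ?T (y1 \<circ> lift (nu j)) (z \<circ> lift (nu j))"
      proof (rule agreeI)
        fix q c assume q: "q \<in> ?T" and c: "c < m"
        have "y1 (nu j q, c) = Z1 (nu j q, c)" using nuq[OF q] by (simp add: y1_def)
        also have "\<dots> = z (nu j q, c)"
        proof -
          from nuim[OF q] consider "nu j q \<in> C \<union> Ip (Suc j)" | "nu j q \<in> {..<M} \<times> Bp j" by blast
          thus ?thesis
          proof cases
            case 1
            thus ?thesis using agreeD[OF Z1z _ c, of "nu j q"] CDV by (auto simp: IA_Suc)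
          next
            case 2
            thus ?thesis using agreeD[OF Z1y _ c, of "nu j q"] agreeD[OF y(1) _ c, of "nu j q"] by auto
          qed
        qed
        finally show "(y1 \<circ> lift (nu j)) (q, c) = (z \<circ> lift (nu j)) (q, c)" by simp
      qed
    qed (use y1env z(1) in \<open>auto intro: envs_comp\<close>)
    \<comment> \<open>The array pulled back along \<open>nu j\<close> has the type of
      \<open>K\<close> on \<open>CX\<close>, so its elements at the centres can be transported over
      \<open>K\<close> itself, where the assumption \<open>no\<close> applies.\<close>
    have "\<exists>x\<in>envs. agree ?T x K \<and> teq {} (?T' \<times> {..<m}) x (y1 \<circ> lift (nu j))"
      by (rule extend_pos[OF envs_comp[OF y1env] Es_env[OF DK] _ tK]) auto
    then obtain x where x: "x \<in> envs" "agree ?T x K" "teq {} (?T' \<times> {..<m}) x (y1 \<circ> lift (nu j))"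
      by (elim bexE conjE)
    have "Es (C \<union> {k} \<times> insert p (pl p d ` X)) x" if k: "k < Suc M" for k
    proof -
      have sub: "C \<union> {k} \<times> insert p (pl p d ` X) \<subseteq> ?T'" using k by auto
      have "Es (C \<union> {k} \<times> insert p (pl p d ` X)) (y1 \<circ> lift (nu j))"
      proof -
        have rm: "rowmono (C \<union> {k} \<times> insert p (pl p d ` X)) (nu j)"
        proof -
          have C': "(k, x) \<in> C \<Longrightarrow> x \<le> p - b \<or> p + b \<le> x" for x
            using Cb[of k x] k by (auto simp: abs_if split: if_splits)
          have X': "\<exists>x'\<in>insert 0 X. x = pl p d x'" if "x \<in> insert p (pl p d ` X)" for x
            using that by (auto intro: bexI[of _ 0])
          define pp dd where "pp = (if k < M then ?P else p)" and "dd = (if k < M then w else \<mu> ^ Suc j * d)"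
          have dd: "0 < dd" using w0 \<mu>d(1) by (simp add: dd_def del: power_Suc)
          have nuk: "nu j (k, pl p d x') = (k, pl pp dd x')" if "x' \<in> insert 0 X" for x'
            using nu_pl(1)[OF that, of k j] nu_pl(2)[OF that, of j] k
            by (cases "k < M") (auto simp: pp_def dd_def less_Suc_eq simp del: power_Suc)
          have ppb: "\<bar>pp - p\<bar> + dd < b"
            using P_bound[of "Suc j"] j \<mu>d(2)[of "Suc j"] b(1) by (auto simp: pp_def dd_def simp del: power_Suc)
          have plb: "p - b < pl pp dd x'" "pl pp dd x' < p + b" "p - b < pl p d x'" "pl p d x' < p + b"
            if "x' \<in> insert 0 X" for x'
          proof -
            have "\<bar>x'\<bar> \<le> 1" using that X_abs by auto
            hence "\<bar>pl pp dd x' - pp\<bar> \<le> dd" "\<bar>pl p d x' - p\<bar> \<le> d" using pl_bound dd d0 by auto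
            thus "p - b < pl pp dd x'" "pl pp dd x' < p + b" "p - b < pl p d x'" "pl p d x' < p + b"
              using ppb b(1) by (auto simp: abs_if split: if_splits)
          qed
          show ?thesis
          proof (rule rowmonoI)
            show "fst (nu j (k', x)) = k'" for k' x by (simp add: nu_def mv_def)
            fix k' x y assume x: "(k', x) \<in> C \<union> {k} \<times> insert p (pl p d ` X)" and y: "(k', y) \<in> C \<union> {k} \<times> insert p (pl p d ` X)"
              and xy: "x < y"
            consider "(k', x) \<in> C" "(k', y) \<in> C" | "(k', x) \<in> C" "k' = k" "y \<in> insert p (pl p d ` X)"
              | "(k', y) \<in> C" "k' = k" "x \<in> insert p (pl p d ` X)"
              | "k' = k" "x \<in> insert p (pl p d ` X)" "y \<in> insert p (pl p d ` X)" using x y by blast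
            thus "snd (nu j (k', x)) < snd (nu j (k', y))"
            proof cases
              case 1
              thus ?thesis using xy by (simp add: nu_C)
            next
              case 2
              then obtain y' where y': "y' \<in> insert 0 X" "y = pl p d y'" using X' by blast
              hence "x \<le> p - b" using C'[of x] 2 plb[OF y'(1)] xy by auto
              thus ?thesis using 2 y' plb[OF y'(1)] nuk[OF y'(1)] by (simp add: nu_C)
            next
              case 3
              then obtain x' where x': "x' \<in> insert 0 X" "x = pl p d x'" using X' by blast
              hence "p + b \<le> y" using C'[of y] 3 plb[OF x'(1)] xy by auto
              thus ?thesis using 3 x' plb[OF x'(1)] nuk[OF x'(1)] by (simp add: nu_C)
            next
              case 4
              then obtain x' y' where x': "x' \<in> insert 0 X" "x = pl p d x'" "y' \<in> insert 0 X" "y = pl p d y'"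
                using X'[of x] X'[of y] by blast
              thus ?thesis using xy 4(1) nuk[OF x'(1)] nuk[OF x'(3)] by (simp add: pl_less[OF dd] pl_less[OF d0])
            qed
          qed
        qed
        show ?thesis
        proof (cases "k < M")
          case True
          have "Es (C \<union> {k} \<times> insert ?P (Bp j)) y1"
          proof (rule Es_agree[OF Es_mono[OF y(3)[rule_format, OF True]] y1env])
            show "C \<union> {k} \<times> insert ?P (Bp j) \<subseteq> ?D \<union> {k} \<times> insert ?P (Bp j)" using CDV by auto
            have "agree (C \<union> {k} \<times> insert ?P (Bp j)) Z1 y" by (rule agree_mono[OF Z1y]) (use CDV True in auto)
            moreover have "agree (C \<union> {k} \<times> insert ?P (Bp j)) y1 Z1"
              using pM True by (auto simp: agree_def y1_def)
            ultimately show "agree (C \<union> {k} \<times> insert ?P (Bp j)) y1 y" using agree_trans by blast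
          qed
          thus ?thesis
          proof (rule Es_reindex[OF _ rm])
            show "nu j ` (C \<union> {k} \<times> insert p (pl p d ` X)) \<subseteq> C \<union> {k} \<times> insert ?P (Bp j)"
              using nu_pl(1)[OF _ True, of _ j] nu_pl(1)[of 0 k j] True by (auto simp: nu_C)
          qed
        next
          case False
          hence kM: "k = M" using k by simp
          have "Es (C \<union> Ip (Suc j) \<union> {(M, p)}) y1"
          proof (rule Es_agree[OF _ y1env])
            show "Es (C \<union> Ip (Suc j) \<union> {(M, p)}) Z'" using Z'(2) i' by simp
            show "agree (C \<union> Ip (Suc j) \<union> {(M, p)}) y1 Z'"
              using Z'(1) i' by (auto simp: agree_def y1_def)
          qed
          thus ?thesis
          proof (rule Es_reindex[OF _ rm])
            show "nu j ` (C \<union> {k} \<times> insert p (pl p d ` X)) \<subseteq> C \<union> Ip (Suc j) \<union> {(M, p)}"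
              using nu_pl(2)[of _ j] nuM by (auto simp: nu_C kM Ip_def simp del: power_Suc)
          qed
        qed
      qed
      moreover have "teq {} ((C \<union> {k} \<times> insert p (pl p d ` X)) \<times> {..<m}) x (y1 \<circ> lift (nu j))"
        by (rule teq_mono[OF x(3)]) (use sub in auto)
      ultimately show ?thesis using x(1) teq_trans unfolding Es_def by blast
    qed
    hence "\<not> \<beta> x" by (rule no[OF x(1,2)])
    moreover have "\<beta> x = \<beta> (y1 \<circ> lift (nu j))"
      by (rule teqD[OF x(3) dfn_mono[OF \<beta>]]) (auto intro!: image_eqI[of _ _ 0])
    moreover have "\<beta> (y1 \<circ> lift (nu j)) = \<beta> (asm Z1 Z' (P i))"
    proof (rule dfn_local[OF \<beta> envs_comp[OF y1env] asm_env[OF Z1env Es_env[OF Z'(2)]]])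
      fix v assume v: "v \<in> (C \<union> {..<Suc M} \<times> {p}) \<times> {..<m}"
      obtain k q c where vq: "v = ((k, q), c)" by (metis prod.exhaust)
      show "(y1 \<circ> lift (nu j)) v = asm Z1 Z' (P i) v"
      proof (cases "(k, q) \<in> C")
        case True
        hence "(k, q) \<noteq> (M, p)" using pM by auto
        thus ?thesis using True by (auto simp: vq nu_C y1_def asm_def)
      next
        case False
        hence "q = pl p d 0" "k < Suc M" using v vq by auto
        thus ?thesis using False nu_pl(1)[of 0 k j] nuM i'
          by (cases "k < M") (auto simp: vq y1_def asm_def less_Suc_eq)
      qed
    qed
    ultimately show ?thesis by blast
  qed
  moreover have "agree C Z1 K" by (rule agree_trans[OF agree_mono[OF Z1Z] Z(1)]) (use CDV in auto)
  ultimately show ?thesis using E1 E2 unfolding stage_def by blast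
qed

end

section \<open>Running through all stages and counting alternations\<close>

context gap_game
begin

lemma stage_exists:
  assumes "dfn {} ((C \<union> {..<Suc M} \<times> {p}) \<times> {..<m}) \<beta>"
    and "\<And>z. z \<in> envs \<Longrightarrow> agree (C \<union> {..<Suc M} \<times> pl p d ` X) z K \<Longrightarrow>
      (\<And>k. k < Suc M \<Longrightarrow> Es (C \<union> {k} \<times> insert p (pl p d ` X)) z) \<Longrightarrow> \<not> \<beta> z"
    and "\<not> StarT M" "j \<le> n"
  shows "\<exists>Z. stage \<beta> j Z"
  using assms(4)
proof (induction j)
  case 0
  have "Es C K" using Es_mono[OF DK C(2)] .
  moreover have "C \<subseteq> DV" by (auto simp: DV_def)
  ultimately obtain Z where "agree C Z K" "Es DV Z" using Es_extend by blast
  thus ?case by (intro exI[of _ Z]) (simp add: stage_def IA_def Y_def)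
next
  case (Suc j)
  then obtain Z where "stage \<beta> j Z" by auto
  thus ?case using stage_step[OF assms(1,2,3)] Suc.prems by simp
qed

text \<open>One element at \<open>(M, p)\<close> lies within all the nested copies, so
  \<open>\<beta>\<close> fails at each \<open>P i\<close>. Halfway between consecutive points
  \<open>P a\<close> and \<open>P (Suc a)\<close> the rows below \<open>M\<close> belong to the
  array and \<open>\<beta>\<close> holds. Thus one fixed element of row \<open>M\<close> produces
  \<open>2 * n\<close> alternations.\<close>

lemma stage_alternates:
  assumes \<beta>: "dfn {} ((C \<union> {..<Suc M} \<times> {p}) \<times> {..<m}) \<beta>" "\<beta> e" and st: "stage \<beta> n Z"
  shows "\<exists>Z'\<in>envs. \<forall>i<2 * n. \<beta> (asm Z Z' (p - b + 2 * w * (of_nat i + 1))) \<longleftrightarrow> even i"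
proof -
  have Z: "agree C Z K" "Es (DV \<union> IA n) Z" "Es (DV \<union> Y n) Z"
    "\<forall>i\<in>{1..n}. \<forall>Z'. agree (C \<union> Ip i) Z' Z \<and> Es (C \<union> Ip i \<union> {(M, p)}) Z' \<longrightarrow> \<not> \<beta> (asm Z Z' (P i))"
    using st by (auto simp: stage_def)
  obtain Z' where Z': "agree (DV \<union> IA n) Z' Z" "Es (DV \<union> IA n \<union> {(M, p)}) Z'"
    using Es_extend[OF Z(2), of "DV \<union> IA n \<union> {(M, p)}"] by auto
  have Z'env: "Z' \<in> envs" using Es_env[OF Z'(2)] .
  have CDV: "C \<subseteq> DV" by (auto simp: DV_def)
  have "\<beta> (asm Z Z' (p - b + 2 * w * (of_nat i + 1))) \<longleftrightarrow> even i" if i: "i < 2 * n" for i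
  proof (cases "even i")
    case False
    then obtain a where a: "i = 2 * a + 1" by (metis oddE)
    have "p - b + 2 * w * (of_nat i + 1) = P (Suc a)" by (simp add: P_def a algebra_simps)
    moreover have "\<not> \<beta> (asm Z Z' (P (Suc a)))"
    proof (rule Z(4)[rule_format])
      show a1: "Suc a \<in> {1..n}" using a i by simp
      hence Ii: "Ip (Suc a) \<subseteq> IA n" unfolding IA_def by blast
      show "agree (C \<union> Ip (Suc a)) Z' Z \<and> Es (C \<union> Ip (Suc a) \<union> {(M, p)}) Z'"
        using agree_mono[OF Z'(1), of "C \<union> Ip (Suc a)"] Es_mono[OF Z'(2), of "C \<union> Ip (Suc a) \<union> {(M, p)}"] CDV Ii by blast
    qed
    ultimately show ?thesis using False by simp
  next
    case True
    then obtain a where a: "i = 2 * a" by (metis evenE)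
    let ?x = "P a + 2 * w"
    have x: "p - b + 2 * w * (of_nat i + 1) = ?x" by (simp add: P_def a algebra_simps)
    have an: "a < n" using a i by simp
    have xDV: "(k, ?x) \<in> DV" if "k < M" for k
      using DV_between[OF that, of a ?x] an P_Suc[of a] w0 by simp
    have xb: "p - b < ?x" "?x < p + b" using P_lower[of a] P_upper[of a] an w0 by auto
    define \<tau> where "\<tau> q = (if q \<in> C then q else if fst q < M then (fst q, ?x) else q)" for q :: "nat \<times> rat"
    have "rowmono (C \<union> {..<Suc M} \<times> {p}) \<tau>"
    proof (rule rowmonoI)
      show "fst (\<tau> (k, y)) = k" for k y by (simp add: \<tau>_def)
      fix k y y' assume y: "(k, y) \<in> C \<union> {..<Suc M} \<times> {p}" "(k, y') \<in> C \<union> {..<Suc M} \<times> {p}" and yy: "y < y'"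
      have Ck: "y0 \<le> p - b \<or> p + b \<le> y0" if "(k, y0) \<in> C" "k < Suc M" for y0
        using Cb[OF that] by (auto simp: abs_if split: if_splits)
      show "snd (\<tau> (k, y)) < snd (\<tau> (k, y'))"
      proof (cases "k < M")
        case False
        thus ?thesis using yy by (simp add: \<tau>_def)
      next
        case True
        thus ?thesis using y yy Ck[of y] Ck[of y'] xb b0 by (auto simp: \<tau>_def)
      qed
    qed
    hence "Es (C \<union> {..<Suc M} \<times> {p}) (Z' \<circ> lift \<tau>)"
    proof (rule Es_reindex[OF Z'(2)])
      show "\<tau> ` (C \<union> {..<Suc M} \<times> {p}) \<subseteq> DV \<union> IA n \<union> {(M, p)}"
        using CDV xDV by (auto simp: \<tau>_def less_Suc_eq)
    qed
    hence "\<beta> (Z' \<circ> lift \<tau>)" using EsD[OF _ \<beta>(1)] \<beta>(2) by blast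
    moreover have "\<beta> (Z' \<circ> lift \<tau>) = \<beta> (asm Z Z' ?x)"
    proof (rule dfn_local[OF \<beta>(1) envs_comp[OF Z'env] asm_env[OF Es_env[OF Z(2)] Z'env]])
      fix v assume v: "v \<in> (C \<union> {..<Suc M} \<times> {p}) \<times> {..<m}"
      thus "(Z' \<circ> lift \<tau>) v = asm Z Z' ?x v"
        using agreeD[OF Z'(1)] CDV xDV by (auto simp: \<tau>_def asm_def less_Suc_eq)
    qed
    ultimately show ?thesis using True x by simp
  qed
  thus ?thesis using Z'env by blast
qed

end

section \<open>Induction on the number of rows\<close>

context ref_array
begin

text \<open>As a formula in the tuples of the rows below \<open>M\<close>, \<open>\<beta>\<close>
  has an alternation bound that depends neither on the array nor on the parameters. It can therefore
  be taken as the number of stages before any stage is built.\<close>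

theorem StarT_step: "StarT (Suc M) \<Longrightarrow> StarT M"
proof (rule ccontr)
  assume nS: "\<not> StarT M" and "StarT (Suc M)"
  then obtain p d \<epsilon> D X K where gap: "gapok (Suc M) p d \<epsilon> D" and X: "finite X" "X \<subseteq> {-1..1} - {0}"
    and DK: "Es D K" and K: "\<forall>k<Suc M. Es (D \<union> {k} \<times> pl p d ` X) K"
    and no: "\<not> (\<exists>z. agree (D \<union> {..<Suc M} \<times> pl p d ` X) z K \<and> Es (D \<union> {..<Suc M} \<times> {p}) z \<and>
          (\<forall>k<Suc M. Es (D \<union> {k} \<times> insert p (pl p d ` X)) z))"
    unfolding StarT_def by (elim exE conjE)
  have d: "0 < d" "0 < \<epsilon>" using gap by (auto simp: gapok_def)
  have pD: "(k, p) \<notin> D" if "k < Suc M" for k using gap that d by (auto simp: gapok_def)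
  have ex: "\<exists>C \<beta>. finite C \<and> C \<subseteq> D \<and> dfn {} ((C \<union> {..<Suc M} \<times> {p}) \<times> {..<m}) \<beta> \<and> \<beta> e \<and>
    (\<forall>z\<in>envs. agree (C \<union> {..<Suc M} \<times> pl p d ` X) z K \<and>
      (\<forall>k<Suc M. Es (C \<union> {k} \<times> insert p (pl p d ` X)) z) \<longrightarrow> \<not> \<beta> z)"
    by (rule gap_compact[OF Es_env[OF DK] finite_imageI[OF X(1)] _ no]) (rule pD)
  obtain C \<beta> where C: "finite C" "C \<subseteq> D" and \<beta>: "dfn {} ((C \<union> {..<Suc M} \<times> {p}) \<times> {..<m}) \<beta>" "\<beta> e"
    and no\<beta>: "\<forall>z\<in>envs. agree (C \<union> {..<Suc M} \<times> pl p d ` X) z K \<and>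
      (\<forall>k<Suc M. Es (C \<union> {k} \<times> insert p (pl p d ` X)) z) \<longrightarrow> \<not> \<beta> z"
    using ex by (elim exE conjE)
  \<comment> \<open>The distance of \<open>C\<close> from \<open>p\<close> in the relevant rows,
    capped so that the interval stays within the margin of the gap.\<close>
  define b where "b = Min (insert (d + \<epsilon>) ((\<lambda>q. \<bar>snd q - p\<bar>) ` {q \<in> C. fst q < Suc M}))"
  have finb: "finite (insert (d + \<epsilon>) ((\<lambda>q. \<bar>snd q - p\<bar>) ` {q \<in> C. fst q < Suc M}))" using C(1) by simp
  have b: "d < b" "b \<le> d + \<epsilon>"
  proof -
    have "d < \<bar>snd q - p\<bar>" if "q \<in> C" "fst q < Suc M" for q
      using that C(2) gap by (cases q) (force simp: gapok_def)
    thus "d < b" unfolding b_def using finb d by (subst Min_gr_iff) auto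
    show "b \<le> d + \<epsilon>" unfolding b_def using finb by (intro Min_le) auto
  qed
  have Cb: "b \<le> \<bar>q - p\<bar>" if "(k, q) \<in> C" "k < Suc M" for k q
    unfolding b_def using finb that by (intro Min_le) (auto simp: image_iff intro!: bexI[of _ "(k, q)"])
  define G where "G v = (if fst v \<notin> C \<and> fst (fst v) < M then Inl (fst (fst v), snd v) else Inr v)"
    for v :: "(nat \<times> rat) \<times> nat"
  have "\<exists>n>0. \<forall>N\<ge>n. \<forall>D s f. \<forall>c\<in>envs. Es D s \<and> blk (\<lambda>k. k) (\<lambda>_ _. False) (2 * N) {..<M} f \<and>
      (\<forall>i<2 * N. \<forall>x\<in>{..<M}. f i x \<in> D) \<longrightarrow>
    \<not> (\<forall>i<2 * N. \<beta> (case_sum (\<lambda>y. s (f i (fst y), snd y)) c \<circ> G) \<longleftrightarrow> even i)"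
  proof (rule array_alternation)
    show "dfn {} (Inl ` ({..<M} \<times> {..<m}) \<union> Inr ` UNIV) (\<lambda>h. \<beta> (h \<circ> G))"
      by (rule dfn_reindex[OF \<beta>(1)]) (auto simp: G_def)
    show "blk (\<lambda>k. k) (\<lambda>_ _. False) N {..<M} (\<lambda>i k. (k, of_nat i))" for N by (auto simp: blk_def)
  qed simp
  then obtain n where n: "\<forall>N\<ge>n. \<forall>D s f. \<forall>c\<in>envs. Es D s \<and> blk (\<lambda>k. k) (\<lambda>_ _. False) (2 * N) {..<M} f \<and>
      (\<forall>i<2 * N. \<forall>x\<in>{..<M}. f i x \<in> D) \<longrightarrow>
    \<not> (\<forall>i<2 * N. \<beta> (case_sum (\<lambda>y. s (f i (fst y), snd y)) c \<circ> G) \<longleftrightarrow> even i)" by (elim exE conjE)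
  interpret gg: gap_game L U kb e m M p d \<epsilon> D X K C b n
    by unfold_locales (use gap X DK K C b Cb in auto)
  obtain Z where st: "gg.stage \<beta> n Z"
    using gg.stage_exists[OF \<beta>(1) _ nS order_refl] no\<beta> by blast
  obtain Z' where Z': "Z' \<in> envs" "\<forall>i<2 * n. \<beta> (gg.asm Z Z' (p - b + 2 * gg.w * (of_nat i + 1))) \<longleftrightarrow> even i"
    using gg.stage_alternates[OF \<beta> st] by (elim bexE)
  have ZE: "Es (gg.DV \<union> gg.Y n) Z" using st by (auto simp: gg.stage_def)
  define f where "f i k = (k, p - b + 2 * gg.w * (of_nat i + 1))" for i k :: nat
  define c where "c v = (if fst v \<in> C then Z v else Z' v)" for v
  have cenv: "c \<in> envs" unfolding c_def[abs_def] by (rule envs_merge[OF Es_env[OF ZE] Z'(1)])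
  have "blk (\<lambda>k. k) (\<lambda>_ _. False) (2 * n) {..<M} f"
    using gg.w0 by (auto simp: blk_def f_def)
  moreover have "\<forall>i<2 * n. \<forall>x\<in>{..<M}. f i x \<in> gg.DV \<union> gg.Y n"
  proof (intro allI impI ballI)
    fix i k assume i: "i < 2 * n" and k: "k \<in> {..<M}"
    show "f i k \<in> gg.DV \<union> gg.Y n"
    proof (cases "even i")
      case True
      then obtain a where a: "i = 2 * a" by (metis evenE)
      have "p - b + 2 * gg.w * (of_nat i + 1) = gg.P a + 2 * gg.w" by (simp add: gg.P_def a algebra_simps)
      thus ?thesis
        using gg.DV_between[of k a "gg.P a + 2 * gg.w"] k i a gg.P_Suc[of a] gg.w0 by (simp add: f_def)
    next
      case False
      then obtain a where a: "i = 2 * a + 1" by (metis oddE)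
      have "p - b + 2 * gg.w * (of_nat i + 1) = gg.P (Suc a)" by (simp add: gg.P_def a algebra_simps)
      thus ?thesis using k i a by (auto simp: f_def gg.Y_def)
    qed
  qed
  ultimately have "\<not> (\<forall>i<2 * n. \<beta> (case_sum (\<lambda>y. Z (f i (fst y), snd y)) c \<circ> G) \<longleftrightarrow> even i)"
    using n[rule_format, OF order_refl cenv, of "gg.DV \<union> gg.Y n" Z f] ZE by blast
  moreover have "case_sum (\<lambda>y. Z (f i (fst y), snd y)) c \<circ> G = gg.asm Z Z' (p - b + 2 * gg.w * (of_nat i + 1))" for i
    by (rule ext) (auto simp: G_def c_def gg.asm_def f_def)
  ultimately show False using Z'(2) by simp
qed

corollary not_StarT: "\<not> StarT M"
  by (induction M) (use not_StarT_0 StarT_step in auto)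

end

section \<open>The finite-cofinite theorem\<close>

definition le_rel :: "'a::linorder rel" where "le_rel = {(x, y). x \<le> y}"

lemma Field_le_rel [simp]: "Field le_rel = UNIV"
  by (auto simp: le_rel_def Field_def)

lemma Linear_order_le_rel [simp]: "Linear_order le_rel"
  by (rule Linear_orderI) (auto simp: le_rel_def)

lemma le_rel_iff [simp]: "(x, y) \<in> le_rel \<longleftrightarrow> x \<le> y"
  by (simp add: le_rel_def)

text \<open>An element of \<open>F\<close> is sent to the entry of an increasing list in
  \<open>G\<close> whose place is its rank.\<close>

lemma finite_embed:
  fixes F :: "'q::linorder set"
  assumes F: "finite F" and r: "Linear_order r" and G: "G \<subseteq> Field r" "infinite G"
  shows "\<exists>f. (\<forall>x\<in>F. f x \<in> G) \<and> (\<forall>x\<in>F. \<forall>y\<in>F. x < y \<longrightarrow> (f x, f y) \<in> r \<and> f x \<noteq> f y)"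
proof -
  obtain G0 where G0: "G0 \<subseteq> G" "finite G0" "card G0 = card F"
    using infinite_arbitrarily_large[OF G(2)] by blast
  obtain us where us: "set us = G0" "increasing r us"
    using increasing_exists[OF G0(2) _ r] G0(1) G(1) by auto
  have len: "card F \<le> length us" using us(1) G0(3) card_length[of us] by simp
  define rk where "rk x = card {y \<in> F. y < x}" for x
  have rk: "rk x < card F" if "x \<in> F" for x
    unfolding rk_def by (rule psubset_card_mono[OF F]) (use that in auto)
  have rkm: "rk x < rk y" if "x \<in> F" "x < y" for x y
    unfolding rk_def by (rule psubset_card_mono) (use F that in auto)
  have "us ! rk x \<in> G" if "x \<in> F" for x
    using that rk[of x] len us(1) G0(1) nth_mem[of "rk x" us] by auto
  moreover have "(us ! rk x, us ! rk y) \<in> r \<and> us ! rk x \<noteq> us ! rk y" if "x \<in> F" "y \<in> F" "x < y" for x y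
    using increasing_nth[OF us(2) rkm[OF that(1,3)]] rk[of y] len that(2) by auto
  ultimately show ?thesis by (intro exI[of _ "\<lambda>x. us ! rk x"]) blast
qed

section \<open>Truth values along a sequence and the insertion of elements with the opposite
  value\<close>

context nip_monster
begin

lemma mi_mono: "mi A X r m h \<Longrightarrow> A' \<subseteq> A \<Longrightarrow> mi A' X r m h"
  unfolding mi_def by (meson order_refl teq_mono)

text \<open>The truth value \<open>b\<close> is kept as an argument so that a formula and its
  negation are treated together.\<close>

definition Tr :: "('f, 'r) fm \<Rightarrow> 'm list \<Rightarrow> nat \<Rightarrow> bool \<Rightarrow> ('p \<times> nat \<Rightarrow> 'm) \<Rightarrow> 'p \<Rightarrow> bool" where
  "Tr \<phi> a m b h p \<longleftrightarrow> (sat U (\<lambda>i. (a @ map (\<lambda>c. h (p, c)) [0..<m]) ! i) \<phi> \<longleftrightarrow> b)"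

text \<open>\<open>Tr\<close> with \<open>a\<close> replaced by variables, because the formulas in
  alternation bounds carry no parameters.\<close>

definition TrV :: "('f, 'r) fm \<Rightarrow> nat \<Rightarrow> nat \<Rightarrow> bool \<Rightarrow> ((unit \<times> nat) + nat \<Rightarrow> 'm) \<Rightarrow> bool" where
  "TrV \<phi> n m b h \<longleftrightarrow> (psat U (\<phi>, []) (map h (map Inr [0..<n] @ map (\<lambda>c. Inl ((), c)) [0..<m])) \<longleftrightarrow> b)"

lemma TrV_dfn:
  assumes "\<phi> \<in> fmlas L (n + m)"
  shows "dfn {} (Inl ` ({()} \<times> {..<m}) \<union> Inr ` {..<n}) (TrV \<phi> n m b)"
proof -
  let ?xs = "map Inr [0..<n] @ map (\<lambda>c. Inl ((), c)) [0..<m] :: ((unit \<times> nat) + nat) list"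
  have "dfn {} (set ?xs) (\<lambda>h. psat U (\<phi>, []) (map h ?xs))"
    by (rule pfm_imp_dfn) (use assms in \<open>simp add: pfmlas_def\<close>)
  hence "dfn {} (Inl ` ({()} \<times> {..<m}) \<union> Inr ` {..<n}) (\<lambda>h. psat U (\<phi>, []) (map h ?xs))"
    by (rule dfn_mono) auto
  hence "dfn {} (Inl ` ({()} \<times> {..<m}) \<union> Inr ` {..<n}) (\<lambda>h. psat U (\<phi>, []) (map h ?xs) \<longleftrightarrow> b)"
    by (intro dfn_iff dfn_const)
  thus ?thesis unfolding TrV_def[abs_def] .
qed

lemma Tr_TrV:
  assumes "\<And>i. i < length a \<Longrightarrow> ca i = a ! i"
  shows "TrV \<phi> (length a) m b (case_sum (\<lambda>y. h (p, snd y)) ca) \<longleftrightarrow> Tr \<phi> a m b h p"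
proof -
  have "map ca [0..<length a] = a" using assms by (intro nth_equalityI) auto
  thus ?thesis by (simp add: TrV_def Tr_def psat_def comp_def)
qed

lemma Tr_cong:
  assumes "\<And>c. c < m \<Longrightarrow> s (q, c) = s' (q', c)"
  shows "Tr \<phi> a m b s q = Tr \<phi> a m b s' q'"
proof -
  have eq: "map (\<lambda>c. s (q, c)) [0..<m] = map (\<lambda>c. s' (q', c)) [0..<m]" using assms by simp
  show ?thesis unfolding Tr_def eq ..
qed

lemma Tr_dfn:
  assumes \<phi>: "\<phi> \<in> fmlas L (length a + m)" and a: "set a \<subseteq> univ U"
  shows "dfn (set a) ({p} \<times> {..<m}) (\<lambda>h. Tr \<phi> a m b h p)"
proof -
  define ca where "ca i = (if i < length a then a ! i else u0)" for i
  have d: "dfn (set a) ({p} \<times> {..<m}) (\<lambda>h. TrV \<phi> (length a) m b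
      (\<lambda>v. case_sum h id (case v of Inl y \<Rightarrow> Inl (p, snd y) | Inr i \<Rightarrow> Inr (ca i))))"
  proof (rule dfn_subst[OF TrV_dfn[OF \<phi>]])
    show "c \<in> univ U" if "(case v of Inl y \<Rightarrow> Inl (p, snd y) | Inr i \<Rightarrow> Inr (ca i)) = Inr c" for v c
      using that a u0 by (auto simp: ca_def split: sum.splits if_splits)
    show "(case v of Inl y \<Rightarrow> Inl (p, snd y) | Inr i \<Rightarrow> Inr (ca i)) \<in> Inl ` ({p} \<times> {..<m}) \<union> Inr ` set a"
      if "v \<in> Inl ` ({()} \<times> {..<m}) \<union> Inr ` {..<length a}" for v
      using that by (auto simp: ca_def)
  qed simp
  have eq: "(\<lambda>v. case_sum h id (case v of Inl y \<Rightarrow> Inl (p, snd y) | Inr i \<Rightarrow> Inr (ca i))) =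
      case_sum (\<lambda>y. h (p, snd y)) ca" for h
    by (rule ext) (auto split: sum.splits)
  show ?thesis
    by (rule dfn_cong[OF d]) (unfold eq, rule Tr_TrV, simp add: ca_def)
qed

text \<open>In lexicographic order the rows form one indiscernible sequence with \<open>N\<close>
  gaps. False elements, one in each gap, cannot all be inserted, as they would alternate with the
  true elements of the array. Within a single gap there is a box: a finite sequence and a place
  \<open>g\<close> at which every element that fits is false. The boxes of all gaps together are a
  configuration of the kind excluded by \<open>not_StarT\<close>.\<close>

lemma insertion_contradiction:
  fixes e :: "(nat \<times> rat) \<times> nat \<Rightarrow> 'm"
  assumes e: "e \<in> envs" and \<phi>: "\<phi> \<in> fmlas L (length a + m)" and a: "set a \<subseteq> univ U"
    and lex: "\<And>(S :: nat set) f1 f2. strict_mono_on S f1 \<Longrightarrow> strict_mono_on S f2 \<Longrightarrow> teq {} (S \<times> {..<m}) (e \<circ> lift f1) (e \<circ> lift f2)"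
    and row: "\<And>S \<tau>. rowmono S \<tau> \<Longrightarrow> teq {} (S \<times> {..<m}) e (e \<circ> lift \<tau>)"
    and true: "\<And>q. Tr \<phi> a m b e q"
    and ins: "\<And>D X. finite X \<Longrightarrow> (\<And>q. q \<in> D \<Longrightarrow> (\<forall>x\<in>X. q < x) \<or> (\<forall>x\<in>X. x < q)) \<Longrightarrow>
      \<exists>s\<in>envs. (\<forall>v\<in>D \<times> {..<m}. s v = e v) \<and> teq {} ((D \<union> X) \<times> {..<m}) s e \<and> (\<forall>x\<in>X. \<not> Tr \<phi> a m b s x)"
  shows False
proof -
  interpret ref_array L U kb e m
    by unfold_locales (rule e, rule row)
  let ?T = "Tr \<phi> a m b"
  define ca where "ca i = (if i < length a then a ! i else u0)" for i
  have caenv: "ca \<in> envs" using a u0 by (intro envsI) (auto simp: ca_def)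
  have T: "TrV \<phi> (length a) m b (case_sum (\<lambda>y. s (q, snd y)) ca) \<longleftrightarrow> ?T s q" for s :: "(nat \<times> rat) \<times> nat \<Rightarrow> 'm" and q
    by (rule Tr_TrV) (simp add: ca_def)
  have TV: "dfn {} (Inl ` ({()} \<times> {..<m}) \<union> Inr ` {..<length a}) (TrV \<phi> (length a) m b)" by (rule TrV_dfn[OF \<phi>])
  \<comment> \<open>rows with a false element in the gap: only boundedly many\<close>
  define w where "w v = e ((0, of_nat (fst v)), snd (snd v))" for v :: "nat \<times> (unit \<times> nat)"
  have lex': "teq {} (S \<times> ({()} \<times> {..<m})) (\<lambda>v. e (f1 (fst v), snd (snd v))) (\<lambda>v. e (f2 (fst v), snd (snd v)))"
    if "strict_mono_on S f1" "strict_mono_on S f2" for S :: "nat set" and f1 f2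
  proof -
    have "teq {} (S \<times> ({()} \<times> {..<m})) (e \<circ> lift f1 \<circ> (\<lambda>v. (fst v, snd (snd v)))) (e \<circ> lift f2 \<circ> (\<lambda>v. (fst v, snd (snd v))))"
      by (rule teq_reindex[OF lex[OF that]]) auto
    thus ?thesis by (simp add: comp_def)
  qed
  have mono0: "strict_mono_on S (\<lambda>i. (0::nat, of_nat i :: rat))" for S :: "nat set"
    by (rule strict_mono_onI) (simp add: less_prod_def)
  have "\<exists>N>0. \<forall>N'\<ge>N. \<forall>w'\<in>envs. \<forall>c\<in>envs. teq {} ({..<2 * N'} \<times> ({()} \<times> {..<m})) w' w \<longrightarrow>
    \<not> (\<forall>i<2 * N'. TrV \<phi> (length a) m b (case_sum (\<lambda>x. w' (i, x)) c) \<longleftrightarrow> even i)"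
  proof (rule nip_alternation[OF _ _ TV])
    show "w \<in> envs" using envsD[OF e] by (intro envsI) (simp add: w_def)
    fix S and \<tau> :: "nat \<Rightarrow> nat" assume \<tau>: "strict_mono_on S \<tau>"
    have "strict_mono_on S (\<lambda>i. (0::nat, of_nat (\<tau> i) :: rat))"
      by (rule strict_mono_onI) (use strict_mono_onD[OF \<tau>] in \<open>simp add: less_prod_def\<close>)
    from lex'[OF mono0 this] show "teq {} (S \<times> ({()} \<times> {..<m})) w (w \<circ> map_prod \<tau> id)"
      by (simp add: w_def[abs_def] comp_def)
  qed simp
  then obtain N where N: "N > 0" "\<forall>N'\<ge>N. \<forall>w'\<in>envs. \<forall>c\<in>envs. teq {} ({..<2 * N'} \<times> ({()} \<times> {..<m})) w' w \<longrightarrow>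
    \<not> (\<forall>i<2 * N'. TrV \<phi> (length a) m b (case_sum (\<lambda>x. w' (i, x)) c) \<longleftrightarrow> even i)" by (elim exE conjE)
  have alt: "\<not> (\<forall>i<2 * N'. ?T s (f i) \<longleftrightarrow> even i)"
    if N': "N \<le> N'" and s: "Es D s" and f: "strict_mono_on {..<2 * N'} f" "f ` {..<2 * N'} \<subseteq> D" for N' D s f
  proof -
    define w' where "w' v = s (f (fst v), snd (snd v))" for v :: "nat \<times> (unit \<times> nat)"
    have "w' \<in> envs" using envsD[OF Es_env[OF s]] by (intro envsI) (simp add: w'_def)
    moreover have "teq {} ({..<2 * N'} \<times> ({()} \<times> {..<m})) w' w"
    proof (rule teq_trans)
      have "teq {} (D \<times> {..<m}) s e" using s by (simp add: Es_def)
      hence "teq {} ({..<2 * N'} \<times> ({()} \<times> {..<m})) (s \<circ> (\<lambda>v. (f (fst v), snd (snd v)))) (e \<circ> (\<lambda>v. (f (fst v), snd (snd v))))"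
        by (rule teq_reindex) (use f(2) in auto)
      thus "teq {} ({..<2 * N'} \<times> ({()} \<times> {..<m})) w' (\<lambda>v. e (f (fst v), snd (snd v)))"
        by (simp add: w'_def[abs_def] comp_def)
      show "teq {} ({..<2 * N'} \<times> ({()} \<times> {..<m})) (\<lambda>v. e (f (fst v), snd (snd v))) w"
        using lex'[OF f(1) mono0] by (simp add: w_def[abs_def])
    qed
    ultimately have "\<not> (\<forall>i<2 * N'. TrV \<phi> (length a) m b (case_sum (\<lambda>x. w' (i, x)) ca) \<longleftrightarrow> even i)"
      using N(2) N' caenv by blast
    thus ?thesis unfolding w'_def fst_conv snd_conv T .
  qed
  define D where "D = {(k :: nat, q :: rat). k < N \<and> 1 < \<bar>q\<bar>}"
  have noF: "\<not> (\<forall>k<N. \<not> ?T s (k, 0))" if s: "Es (D \<union> {..<N} \<times> {0}) s" "agree D s e" for s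
  proof
    assume F: "\<forall>k<N. \<not> ?T s (k, 0)"
    \<comment> \<open>In each row, -2 lies in the array before the gap and 0 in the gap.\<close>
    define f where "f i = (i div 2, if even i then -2 else 0 :: rat)" for i :: nat
    have "strict_mono_on {..<2 * N} f"
    proof (rule strict_mono_onI)
      fix i j :: nat assume ij: "i < j"
      show "f i < f j"
      proof (cases "i div 2 = j div 2")
        case True
        hence "i mod 2 < j mod 2" using ij div_mult_mod_eq[of i 2] div_mult_mod_eq[of j 2] by linarith
        hence "even i" "odd j" by (auto simp: even_iff_mod_2_eq_zero odd_iff_mod_2_eq_one)
        thus ?thesis using True by (simp add: f_def less_prod_def)
      next
        case False
        hence "i div 2 < j div 2" using div_le_mono[of i j 2] ij by simp
        thus ?thesis by (simp add: f_def less_prod_def)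
      qed
    qed
    moreover have "f ` {..<2 * N} \<subseteq> D \<union> {..<N} \<times> {0}" by (auto simp: f_def D_def split: if_splits)
    moreover have "?T s (f i) = even i" if "i < 2 * N" for i
    proof (cases "even i")
      case True
      hence "f i \<in> D" using that by (simp add: f_def D_def)
      hence "?T s (f i) = ?T e (f i)" using agreeD[OF s(2)] by (intro Tr_cong) auto
      thus ?thesis using true True by simp
    next
      case False
      thus ?thesis using F that by (simp add: f_def)
    qed
    ultimately show False using alt[OF order_refl s(1)] by blast
  qed
  \<comment> \<open>otherwise true elements could be inserted between all pairs of consecutive false ones\<close>
  have box: "\<exists>X g s. finite X \<and> X \<subseteq> {-1<..<1} \<and> g \<in> {-1<..<1} - X \<and> agree D s e \<and> Es (D \<union> {k} \<times> X) s \<and>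
      (\<forall>s'. agree (D \<union> {k} \<times> X) s' s \<and> Es (D \<union> {k} \<times> insert g X) s' \<longrightarrow> \<not> ?T s' (k, g))" if k: "k < N" for k
  proof (rule ccontr)
    assume "\<not> ?thesis"
    hence nobox: "\<exists>s'. agree (D \<union> {k} \<times> X) s' s \<and> Es (D \<union> {k} \<times> insert g X) s' \<and> ?T s' (k, g)"
      if "finite X" "X \<subseteq> {-1<..<1}" "g \<in> {-1<..<1} - X" "agree D s e" "Es (D \<union> {k} \<times> X) s" for X g s
      using that by blast
    \<comment> \<open>\<open>2 * N\<close> increasing places in the gap. False elements are inserted
      at all odd places at once, true ones then at the even places one after another.\<close>
    define y :: "nat \<Rightarrow> rat" where "y i = of_nat i / of_nat (2 * N)" for i :: nat
    have yb: "y i \<in> {-1<..<1}" if "i < 2 * N" for i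
    proof -
      have "0 \<le> y i" by (simp add: y_def)
      moreover have "y i < 1" using that by (simp add: y_def divide_less_eq_1)
      ultimately show ?thesis by simp
    qed
    have ym: "y i < y j" if "i < j" for i j
      unfolding y_def using that N(1) by (intro divide_strict_right_mono) auto
    have yinj: "y i = y j \<longleftrightarrow> i = j" for i j using ym[of i j] ym[of j i] by (metis less_irrefl linorder_neqE_nat)
    define Xo where "Xo = y ` {i. odd i \<and> i < 2 * N}"
    define Xe where "Xe j = y ` {i. even i \<and> i < 2 * j}" for j :: nat
    have "\<exists>s. agree D s e \<and> Es (D \<union> {k} \<times> (Xo \<union> Xe j)) s \<and> (\<forall>i<2 * N. odd i \<longrightarrow> \<not> ?T s (k, y i)) \<and>
      (\<forall>i<2 * j. even i \<longrightarrow> ?T s (k, y i))" if "j \<le> N" for j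
      using that
    proof (induction j)
      case 0
      have "\<exists>s\<in>envs. (\<forall>v\<in>D \<times> {..<m}. s v = e v) \<and> teq {} ((D \<union> {k} \<times> Xo) \<times> {..<m}) s e \<and> (\<forall>x\<in>{k} \<times> Xo. \<not> ?T s x)"
      proof (rule ins)
        show "finite ({k} \<times> Xo)" by (auto simp: Xo_def)
        fix q assume "q \<in> D"
        then obtain k' x where q: "q = (k', x)" "1 < \<bar>x\<bar>" by (auto simp: D_def)
        have "-1 < x'" "x' < 1" if "x' \<in> Xo" for x' using that yb by (auto simp: Xo_def)
        moreover have "x < -1 \<or> 1 < x" using q(2) by (auto simp: abs_if split: if_splits)
        ultimately show "(\<forall>x\<in>{k} \<times> Xo. q < x) \<or> (\<forall>x\<in>{k} \<times> Xo. x < q)"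
          using q(1) by (cases "k' < k"; cases "k < k'") (fastforce simp: less_prod_def)+
      qed
      then obtain s where s: "s \<in> envs" "\<forall>v\<in>D \<times> {..<m}. s v = e v" "teq {} ((D \<union> {k} \<times> Xo) \<times> {..<m}) s e"
        "\<forall>x\<in>{k} \<times> Xo. \<not> ?T s x" by (elim bexE conjE)
      have "Xe 0 = {}" by (simp add: Xe_def)
      thus ?case using s by (intro exI[of _ s]) (auto simp: Es_def agree_def Xo_def)
    next
      case (Suc j)
      then obtain s where s: "agree D s e" "Es (D \<union> {k} \<times> (Xo \<union> Xe j)) s" "\<forall>i<2 * N. odd i \<longrightarrow> \<not> ?T s (k, y i)"
        "\<forall>i<2 * j. even i \<longrightarrow> ?T s (k, y i)" by auto
      have jN: "2 * j < 2 * N" using Suc.prems by simp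
      have "\<exists>s'. agree (D \<union> {k} \<times> (Xo \<union> Xe j)) s' s \<and> Es (D \<union> {k} \<times> insert (y (2 * j)) (Xo \<union> Xe j)) s' \<and> ?T s' (k, y (2 * j))"
      proof (rule nobox[OF _ _ _ s(1,2)])
        show "finite (Xo \<union> Xe j)" by (auto simp: Xo_def Xe_def)
        show "Xo \<union> Xe j \<subseteq> {-1<..<1}" using yb Suc.prems by (auto simp: Xo_def Xe_def)
        show "y (2 * j) \<in> {-1<..<1} - (Xo \<union> Xe j)" using yb[OF jN] yinj by (auto simp: Xo_def Xe_def)
      qed
      then obtain s' where s': "agree (D \<union> {k} \<times> (Xo \<union> Xe j)) s' s" "Es (D \<union> {k} \<times> insert (y (2 * j)) (Xo \<union> Xe j)) s'"
        "?T s' (k, y (2 * j))" by (elim exE conjE)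
      have Xe: "Xe (Suc j) = insert (y (2 * j)) (Xe j)"
      proof -
        have "{i. even i \<and> i < 2 * Suc j} = insert (2 * j) {i. even i \<and> i < 2 * j}"
          by (auto elim!: evenE)
        thus ?thesis by (simp add: Xe_def)
      qed
      have old: "?T s' (k, y i) = ?T s (k, y i)" if "y i \<in> Xo \<union> Xe j" for i
        using agreeD[OF s'(1)] that by (intro Tr_cong) auto
      show ?case
      proof (intro exI[of _ s'] conjI allI impI)
        show "agree D s' e" by (rule agree_trans[OF agree_mono[OF s'(1)] s(1)]) auto
        show "Es (D \<union> {k} \<times> (Xo \<union> Xe (Suc j))) s'" using s'(2) by (simp add: Xe)
        show "\<not> ?T s' (k, y i)" if "i < 2 * N" "odd i" for i
          using old[of i] s(3) that by (auto simp: Xo_def)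
        show "?T s' (k, y i)" if "i < 2 * Suc j" "even i" for i
        proof (cases "i = 2 * j")
          case True
          thus ?thesis using s'(3) by simp
        next
          case False
          hence "i < 2 * j" using that by (auto elim!: evenE)
          thus ?thesis using old[of i] s(4) that(2) by (auto simp: Xe_def)
        qed
      qed
    qed
    from this[of N] obtain s where s: "Es (D \<union> {k} \<times> (Xo \<union> Xe N)) s" "\<forall>i<2 * N. odd i \<longrightarrow> \<not> ?T s (k, y i)"
      "\<forall>i<2 * N. even i \<longrightarrow> ?T s (k, y i)" by auto
    have "\<not> (\<forall>i<2 * N. ?T s (k, y i) \<longleftrightarrow> even i)"
    proof (rule alt[OF order_refl s(1)])
      show "strict_mono_on {..<2 * N} (\<lambda>i. (k, y i))" by (rule strict_mono_onI) (simp add: less_prod_def ym)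
      show "(\<lambda>i. (k, y i)) ` {..<2 * N} \<subseteq> D \<union> {k} \<times> (Xo \<union> Xe N)" by (auto simp: Xo_def Xe_def)
    qed
    thus False using s(2,3) by blast
  qed
  hence "\<forall>k\<in>{..<N}. \<exists>X g s. finite X \<and> X \<subseteq> {-1<..<1} \<and> g \<in> {-1<..<1} - X \<and> agree D s e \<and> Es (D \<union> {k} \<times> X) s \<and>
      (\<forall>s'. agree (D \<union> {k} \<times> X) s' s \<and> Es (D \<union> {k} \<times> insert g X) s' \<longrightarrow> \<not> ?T s' (k, g))" by simp
  then obtain X g s where B: "\<And>k. k < N \<Longrightarrow> finite (X k) \<and> X k \<subseteq> {-1<..<1} \<and> g k \<in> {-1<..<1} - X k \<and> agree D (s k) e \<and>
      Es (D \<union> {k} \<times> X k) (s k) \<and>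
      (\<forall>s'. agree (D \<union> {k} \<times> X k) s' (s k) \<and> Es (D \<union> {k} \<times> insert (g k) (X k)) s' \<longrightarrow> \<not> ?T s' (k, g k))"
    by (metis lessThan_iff)
  \<comment> \<open>move all the boxes so that they are centered at \<open>0\<close>\<close>
  define \<eta> where "\<eta> k = (1 - \<bar>g k\<bar>) / 2" for k
  define t where "t k = pwl (-1) 1 (g k - \<eta> k) (g k + \<eta> k) (-1/2) (1/2)" for k
  have g1: "\<bar>g k\<bar> < 1" if "k < N" for k using B[OF that] by (auto simp: abs_if)
  have \<eta>: "0 < \<eta> k" "-1 < g k - \<eta> k" "g k + \<eta> k < 1" if "k < N" for k
    using g1[OF that] by (auto simp: \<eta>_def abs_if field_simps split: if_splits)
  have tm: "t k x < t k x'" if "k < N" "x < x'" for k x x'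
    unfolding t_def by (rule pwl_strict_mono) (use \<eta>[OF that(1)] that(2) in auto)
  have t0: "t k (g k) = 0" if "k < N" for k
    using \<eta>[OF that] by (simp add: t_def pwl_def field_simps)
  have tb: "t k x \<in> {-1<..<1}" if "k < N" "x \<in> {-1<..<1}" for k x
    using tm[OF that(1), of "-1" x] tm[OF that(1), of x 1] that(2) by (auto simp: t_def pwl_def)
  have tout: "t k x = x" if "1 < \<bar>x\<bar>" for k x
    using that by (auto simp: t_def pwl_def abs_if split: if_splits)
  define XX where "XX = (\<Union>k<N. t k ` X k)"
  have XXk: "t k ` X k \<subseteq> XX" if "k < N" for k using that by (auto simp: XX_def)
  have XXfin: "finite XX" using B by (auto simp: XX_def)
  have XXsub: "XX \<subseteq> {-1..1} - {0}"
  proof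
    fix x assume "x \<in> XX"
    then obtain k x' where k: "k < N" "x' \<in> X k" "x = t k x'" by (auto simp: XX_def)
    have "x' \<in> {-1<..<1}" "x' \<noteq> g k" using B[OF k(1)] k(2) by auto
    moreover have "t k x' \<noteq> t k (g k)" using tm[OF k(1), of x' "g k"] tm[OF k(1), of "g k" x'] calculation(2) by (auto simp: neq_iff)
    ultimately show "x \<in> {-1..1} - {0}" using tb[OF k(1), of x'] t0[OF k(1)] k(3) by auto
  qed
  define tt where "tt k q = (if fst q = k then (k, t k (snd q)) else q)" for k and q :: "nat \<times> rat"
  have ttm: "rowmono S (tt k)" if "k < N" for S k
    by (rule rowmonoI) (use tm[OF that] in \<open>auto simp: tt_def\<close>)
  have ttD: "tt k q = q" if "q \<in> D" for k q
    using that tout by (auto simp: tt_def D_def)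
  define K0 where "K0 k = s k \<circ> lift (inv_into (D \<union> {k} \<times> X k) (tt k))" for k
  have K0: "agree D (K0 k) e \<and> Es (D \<union> {k} \<times> t k ` X k) (K0 k) \<and>
      (\<forall>x\<in>X k. \<forall>c. K0 k ((k, t k x), c) = s k ((k, x), c))" if k: "k < N" for k
  proof -
    let ?S = "D \<union> {k} \<times> X k"
    have inj: "inj_on (tt k) ?S"
    proof (rule inj_onI)
      fix q q' assume "tt k q = tt k q'"
      thus "q = q'" using tm[OF k, of "snd q" "snd q'"] tm[OF k, of "snd q'" "snd q"]
        by (cases q; cases q'; cases "snd q" "snd q'" rule: linorder_cases) (auto simp: tt_def split: if_splits)
    qed
    have inv: "inv_into ?S (tt k) (tt k q) = q" if "q \<in> ?S" for q using inj that by simp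
    have im: "tt k ` ?S = D \<union> {k} \<times> t k ` X k"
    proof -
      have "tt k ` D = (\<lambda>q. q) ` D" by (rule image_cong) (auto simp: ttD)
      hence "tt k ` D = D" by simp
      moreover have "tt k ` ({k} \<times> X k) = {k} \<times> t k ` X k" by (force simp: tt_def)
      ultimately show ?thesis by (simp add: image_Un)
    qed
    have "rowmono (tt k ` ?S) (inv_into ?S (tt k))"
      unfolding rowmono_def
    proof (intro conjI ballI impI)
      fix q assume "q \<in> tt k ` ?S"
      then obtain u where "u \<in> ?S" "q = tt k u" by blast
      thus "fst (inv_into ?S (tt k) q) = fst q" using inv[of u] by (simp add: tt_def)
    next
      fix q q' assume "q \<in> tt k ` ?S" "q' \<in> tt k ` ?S" and l: "fst q = fst q' \<and> snd q < snd q'"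
      then obtain u u' where u: "u \<in> ?S" "u' \<in> ?S" "q = tt k u" "q' = tt k u'" by blast
      have "fst u = fst u'" using l u(3,4) by (auto simp: tt_def split: if_splits)
      hence "snd u < snd u'" using l u(3,4) tm[OF k, of "snd u'" "snd u"]
        by (cases "snd u" "snd u'" rule: linorder_cases) (auto simp: tt_def split: if_splits)
      thus "snd (inv_into ?S (tt k) q) < snd (inv_into ?S (tt k) q')" using inv u by simp
    qed
    hence "Es (tt k ` ?S) (K0 k)"
      unfolding K0_def using B[OF k] by (intro Es_reindex[of ?S "s k"]) (simp_all add: image_subset_iff inv)
    moreover have "agree D (K0 k) e"
    proof (rule agreeI)
      fix q c assume q: "q \<in> D" and c: "c < m"
      have "inv_into ?S (tt k) q = q" using inv[of q] ttD[OF q] q by simp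
      thus "K0 k (q, c) = e (q, c)" using agreeD[of D "s k" e q c] B[OF k] q c by (simp add: K0_def)
    qed
    moreover have "K0 k ((k, t k x), c) = s k ((k, x), c)" if "x \<in> X k" for x c
      using inv[of "(k, x)"] that by (simp add: K0_def tt_def)
    ultimately show ?thesis using im by simp
  qed
  \<comment> \<open>\<open>StarT\<close> uses the same relative positions in all rows, so each box
    is enlarged to the union \<open>XX\<close> of all of them.\<close>
  have "\<forall>k\<in>{..<N}. \<exists>K1. agree (D \<union> {k} \<times> t k ` X k) K1 (K0 k) \<and> Es (D \<union> {k} \<times> XX) K1"
  proof
    fix k assume "k \<in> {..<N}"
    hence "Es (D \<union> {k} \<times> t k ` X k) (K0 k)" "D \<union> {k} \<times> t k ` X k \<subseteq> D \<union> {k} \<times> XX" using K0[of k] XXk[of k] by auto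
    thus "\<exists>K1. agree (D \<union> {k} \<times> t k ` X k) K1 (K0 k) \<and> Es (D \<union> {k} \<times> XX) K1" by (rule Es_extend)
  qed
  then obtain K1 where K1: "\<And>k. k < N \<Longrightarrow> agree (D \<union> {k} \<times> t k ` X k) (K1 k) (K0 k) \<and> Es (D \<union> {k} \<times> XX) (K1 k)"
    by (metis lessThan_iff)
  define K where "K v = (if fst v \<in> {..<N} \<times> XX then K1 (fst (fst v)) v else e v)" for v
  have Kenv: "K \<in> envs"
  proof (rule envsI)
    fix v show "K v \<in> univ U"
      using K1[of "fst (fst v)"] envsD[OF e, of v] envsD[OF Es_env[of _ "K1 (fst (fst v))"], of _ v]
      by (auto simp: K_def mem_Times_iff)
  qed
  have XD: "(k, x) \<notin> D" if "x \<in> XX" for k x using XXsub that by (auto simp: D_def abs_if split: if_splits)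
  have KD: "agree D K e" by (rule agreeI) (use XD in \<open>auto simp: K_def\<close>)
  have EsDe: "Es D e" using e by (simp add: Es_def teq_refl)
  have "\<not> StarT N" by (rule not_StarT)
  moreover have "StarT N"
    unfolding StarT_def
  proof (intro exI conjI allI impI)
    show "gapok N 0 1 1 D" by (auto simp: gapok_def D_def)
    show "finite XX" "XX \<subseteq> {-1..1} - {0}" by (rule XXfin, rule XXsub)
    show "Es D K" by (rule Es_agree[OF EsDe Kenv KD])
    have pl1: "pl 0 1 ` XX = XX" by (simp add: pl_def)
    show "Es (D \<union> {k} \<times> pl 0 1 ` XX) K" if k: "k < N" for k
      unfolding pl1
    proof (rule Es_agree[OF _ Kenv])
      show "Es (D \<union> {k} \<times> XX) (K1 k)" using K1[OF k] by simp
      show "agree (D \<union> {k} \<times> XX) K (K1 k)"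
      proof (rule agreeI)
        fix q c assume q: "q \<in> D \<union> {k} \<times> XX" and c: "c < m"
        show "K (q, c) = K1 k (q, c)"
        proof (cases "q \<in> D")
          case True
          thus ?thesis using agreeD[OF KD True c] K1[OF k] K0[OF k] c by (auto simp: agree_def)
        next
          case False
          thus ?thesis using q k by (auto simp: K_def)
        qed
      qed
    qed
    show "\<not> (\<exists>z. agree (D \<union> {..<N} \<times> pl 0 1 ` XX) z K \<and> Es (D \<union> {..<N} \<times> {0}) z \<and>
          (\<forall>k<N. Es (D \<union> {k} \<times> insert 0 (pl 0 1 ` XX)) z))"
      unfolding pl1
    proof
      assume "\<exists>z. agree (D \<union> {..<N} \<times> XX) z K \<and> Es (D \<union> {..<N} \<times> {0}) z \<and> (\<forall>k<N. Es (D \<union> {k} \<times> insert 0 XX) z)"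
      then obtain z where z: "agree (D \<union> {..<N} \<times> XX) z K" "Es (D \<union> {..<N} \<times> {0}) z" "\<forall>k<N. Es (D \<union> {k} \<times> insert 0 XX) z"
        by (elim exE conjE)
      have zD: "agree D z e" by (rule agree_trans[OF agree_mono[OF z(1)] KD]) auto
      have "\<not> ?T z (k, 0)" if k: "k < N" for k
      proof -
        have "Es (D \<union> {k} \<times> insert (g k) (X k)) (z \<circ> lift (tt k))"
        proof (rule Es_reindex[OF z(3)[rule_format, OF k] ttm[OF k]])
          show "tt k ` (D \<union> {k} \<times> insert (g k) (X k)) \<subseteq> D \<union> {k} \<times> insert 0 XX"
          proof
            fix q assume "q \<in> tt k ` (D \<union> {k} \<times> insert (g k) (X k))"
            then consider u where "u \<in> D" "q = tt k u" | x where "x \<in> insert (g k) (X k)" "q = tt k (k, x)" by blast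
            thus "q \<in> D \<union> {k} \<times> insert 0 XX"
            proof cases
              case 1
              thus ?thesis using ttD by simp
            next
              case 2
              thus ?thesis using t0[OF k] XXk[OF k] by (auto simp: tt_def)
            qed
          qed
        qed
        moreover have "agree (D \<union> {k} \<times> X k) (z \<circ> lift (tt k)) (s k)"
        proof (rule agreeI)
          fix q c assume q: "q \<in> D \<union> {k} \<times> X k" and c: "c < m"
          show "(z \<circ> lift (tt k)) (q, c) = s k (q, c)"
          proof (cases "q \<in> D")
            case True
            thus ?thesis using agreeD[OF zD True c] B[OF k] c ttD[OF True] by (auto simp: agree_def)
          next
            case False
            then obtain x where x: "q = (k, x)" "x \<in> X k" using q by auto
            have tx: "t k x \<in> XX" using XXk[OF k] x by auto
            have "z ((k, t k x), c) = K ((k, t k x), c)" using agreeD[OF z(1) _ c] tx k by auto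
            also have "\<dots> = K1 k ((k, t k x), c)" using tx k by (simp add: K_def)
            also have "\<dots> = K0 k ((k, t k x), c)" using K1[OF k] x c by (auto simp: agree_def)
            also have "\<dots> = s k ((k, x), c)" using K0[OF k] x by auto
            finally show ?thesis by (simp add: x(1) tt_def)
          qed
        qed
        ultimately have "\<not> ?T (z \<circ> lift (tt k)) (k, g k)" using B[OF k] by blast
        moreover have "?T (z \<circ> lift (tt k)) (k, g k) = ?T z (k, 0)"
          by (rule Tr_cong) (simp add: tt_def t0[OF k])
        ultimately show ?thesis by simp
      qed
      thus False using noF[OF z(2) zD] by blast
    qed
  qed
  ultimately show False by blast
qed

text \<open>For an array that is already mutually indiscernible, all monotone copies of a finite
  configuration have one type; extraction therefore changes the index orders and preserves the types
  of finite parts.\<close>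

theorem mi_stretch:
  fixes h :: "('x \<times> 'i) \<times> nat \<Rightarrow> 'm" and r' :: "'x \<Rightarrow> 'j rel"
  assumes mi: "mi A X r m h" and h: "h \<in> envs" and A: "|A| <o kb" "A \<subseteq> univ U" and X: "|X| <o kb"
    and r: "\<And>i. i \<in> X \<Longrightarrow> Linear_order (r i)" "\<And>i. i \<in> X \<Longrightarrow> infinite (Field (r i))"
    and r': "\<And>i. i \<in> X \<Longrightarrow> Linear_order (r' i)" "\<And>i. i \<in> X \<Longrightarrow> |Field (r' i)| <o kb"
  shows "\<exists>h'\<in>envs. mi A X r' m h' \<and>
    (\<forall>S \<sigma>. finite S \<longrightarrow> S \<subseteq> rdom X r' \<longrightarrow> rmono r' r S \<sigma> \<longrightarrow> teq A (vs m S) h' (h \<circ> lift \<sigma>))"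
proof (rule extraction[OF h A X r r', where m = m])
  fix h' assume h': "h' \<in> envs" "mi A X r' m h'"
    "\<And>S P. finite S \<Longrightarrow> S \<subseteq> rdom X r' \<Longrightarrow> dfn A (vs m S) P \<Longrightarrow>
       (\<And>\<sigma>. rmono r' r S \<sigma> \<Longrightarrow> P (h \<circ> lift \<sigma>)) \<Longrightarrow> P h'"
  have "teq A (vs m S) h' (h \<circ> lift \<sigma>)" if S: "finite S" "S \<subseteq> rdom X r'" and \<sigma>: "rmono r' r S \<sigma>" for S \<sigma>
    unfolding teq_def
  proof (intro allI impI)
    fix P assume P: "dfn A (vs m S) P"
    have "P h' = P (h \<circ> lift \<sigma>)"
    proof (rule h'(3)[OF S, of "\<lambda>k. P k \<longleftrightarrow> P (h \<circ> lift \<sigma>)"])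
      show "dfn A (vs m S) (\<lambda>k. P k \<longleftrightarrow> P (h \<circ> lift \<sigma>))" by (rule dfn_iff[OF P dfn_const])
      fix \<sigma>' assume "rmono r' r S \<sigma>'"
      hence "teq A (vs m S) (h \<circ> lift \<sigma>') (h \<circ> lift \<sigma>)" by (intro mi_two[OF mi h r(1) r'(1) S(2) _ \<sigma>])
      thus "P (h \<circ> lift \<sigma>') = P (h \<circ> lift \<sigma>)" by (rule teqD[OF _ P])
    qed
    thus "P h' = P (h \<circ> lift \<sigma>)" .
  qed
  with h'(1,2) show ?thesis by (intro bexI[of _ h']) simp_all
qed

text \<open>On \<open>J0\<close> and \<open>J1\<close> the formula has a constant value
  \<open>b\<close>, so the opposite value occurs infinitely often on \<open>I\<close>, at the set
  \<open>F\<close>. The whole sequence is indiscernible over the empty set only. The inserted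
  elements accordingly fit the array over the empty set, while their truth value over
  \<open>a\<close> is that of \<open>F\<close>.\<close>

theorem finite_cofinite:
  fixes J0 :: "('i, 'm) tseq" and I :: "('j, 'm) tseq" and J1 :: "('l, 'm) tseq"
  assumes inf: "infinite (idx J0)" "infinite (idx J1)"
    and full: "indiscernible L U {} (J0 \<oplus>\<^sub>s I \<oplus>\<^sub>s J1)" and out: "indiscernible L U A (J0 \<oplus>\<^sub>s J1)"
    and a: "set a \<subseteq> univ U" "set a \<subseteq> A" and seq: "sequence_of U m (J0 \<oplus>\<^sub>s I \<oplus>\<^sub>s J1)"
    and \<phi>: "\<phi> \<in> fmlas L (length a + m)"
  shows "finite {j \<in> idx I. sat U (\<lambda>i. (a @ snd I j) ! i) \<phi>} \<or> finite {j \<in> idx I. \<not> sat U (\<lambda>i. (a @ snd I j) ! i) \<phi>}"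
proof (rule ccontr)
  assume H: "\<not> ?thesis"
  define K1 where "K1 = J0 \<oplus>\<^sub>s I \<oplus>\<^sub>s J1"
  define K2 where "K2 = J0 \<oplus>\<^sub>s J1"
  define r1 where "r1 = (\<lambda>_ :: unit. fst K1)"
  define r2 where "r2 = (\<lambda>_ :: unit. fst K2)"
  \<comment> \<open>Rows of rationals in lexicographic order: a single sequence that can also be
    read as the array of \<open>ref_array\<close>.\<close>
  define lr where "lr = (\<lambda>_ :: unit. le_rel :: (nat \<times> rat) rel)"
  define mm where "mm = (\<lambda>_ :: unit. m)"
  have seqs: "sequence_of U m J0" "sequence_of U m I" "sequence_of U m J1" "sequence_of U m K1" "sequence_of U m K2"
    using seq by (auto simp: sequence_of_append K1_def K2_def)
  define h1 where "h1 = senv {()} mm (\<lambda>_. K1)"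
  define h2 where "h2 = senv {()} mm (\<lambda>_. K2)"
  have env: "h1 \<in> envs" "h2 \<in> envs" unfolding h1_def h2_def by (rule senv_envs, simp add: seqs mm_def)+
  have mi1: "mi {} {()} r1 mm h1"
    unfolding h1_def r1_def by (rule mi_senv) (use full in \<open>simp_all add: K1_def[symmetric] indiscernible_single seqs mm_def\<close>)
  have "mi A {()} r2 mm h2"
    unfolding h2_def r2_def by (rule mi_senv) (use out in \<open>simp_all add: K2_def[symmetric] indiscernible_single seqs mm_def\<close>)
  hence mi2: "mi (set a) {()} r2 mm h2" by (rule mi_mono[OF _ a(2)])
  have lin: "Linear_order (r1 x)" "Linear_order (r2 x)" "Linear_order (lr x)" for x
    using seqs Linear_order_le_rel by (auto simp: r1_def r2_def lr_def sequence_of_def simp del: Linear_order_le_rel)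
  have infr: "infinite (Field (r2 x))" for x
    using inf by (auto simp: r2_def K2_def finite_image_iff)
  have lin0: "Linear_order (fst J0)" "Linear_order (fst I)" "Linear_order (fst J1)" using seqs by (auto simp: sequence_of_def)
  have h2v: "h2 ((u, t), c) = snd K2 t ! c" if "t \<in> idx K2" "c < m" for u t c
    using that by (simp add: h2_def senv_def mm_def)
  have h1v: "h1 ((u, t), c) = snd K1 t ! c" if "t \<in> idx K1" "c < m" for u t c
    using that by (simp add: h1_def senv_def mm_def)
  define \<iota> :: "'i + 'l \<Rightarrow> ('i + 'j) + 'l" where "\<iota> = map_sum Inl id"
  have \<iota>F: "\<iota> t \<in> idx K1" if "t \<in> idx K2" for t using that by (auto simp: \<iota>_def K1_def K2_def)
  have \<iota>h: "h1 ((u, \<iota> t), c) = h2 ((u, t), c)" if "t \<in> idx K2" "c < m" for u t c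
    using h1v[OF \<iota>F[OF that(1)] that(2)] h2v[OF that] that(1) by (auto simp: \<iota>_def K1_def K2_def)
  have \<iota>m: "(\<iota> t, \<iota> t') \<in> fst K1 \<and> \<iota> t \<noteq> \<iota> t'" if "(t, t') \<in> fst K2" "t \<noteq> t'" for t t'
    using that by (cases t; cases t') (auto simp: \<iota>_def K1_def K2_def)
  have "\<exists>e\<in>envs. mi (set a) {()} lr mm e \<and>
    (\<forall>S \<sigma>. finite S \<longrightarrow> S \<subseteq> rdom {()} lr \<longrightarrow> rmono lr r2 S \<sigma> \<longrightarrow> teq (set a) (vs mm S) e (h2 \<circ> lift \<sigma>))"
  proof (rule mi_stretch[OF mi2 env(2)])
    show "|set a| <o kb" "|{()}| <o kb" by (simp_all add: small_finite)
    show "|Field (lr x)| <o kb" for x by (rule small_countable) simp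
  qed (use a lin infr in auto)
  then obtain e where e': "e \<in> envs" "mi (set a) {()} lr mm e"
    "\<forall>S \<sigma>. finite S \<longrightarrow> S \<subseteq> rdom {()} lr \<longrightarrow> rmono lr r2 S \<sigma> \<longrightarrow> teq (set a) (vs mm S) e (h2 \<circ> lift \<sigma>)"
    by (elim bexE conjE)
  note e = e'(1,2) e'(3)[rule_format]
  have rd: "S \<subseteq> rdom {()} lr" for S by (auto simp: lr_def)
  \<comment> \<open>Over the empty set the stretched sequence also has the type of all of
    \<open>K1\<close>, by way of the inclusion \<open>\<iota>\<close> of \<open>K2\<close> into
    \<open>K1\<close>.\<close>
  have EM1: "teq {} (vs mm S) e (h1 \<circ> lift \<sigma>)" if S: "finite S" and \<sigma>: "rmono lr r1 S \<sigma>" for S \<sigma>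
  proof -
    have "\<exists>f. (\<forall>x\<in>snd ` S. f x \<in> idx K2) \<and> (\<forall>x\<in>snd ` S. \<forall>y\<in>snd ` S. x < y \<longrightarrow> (f x, f y) \<in> fst K2 \<and> f x \<noteq> f y)"
    proof (rule finite_embed)
      show "Linear_order (fst K2)" using lin(2) by (simp add: r2_def)
      show "infinite (idx K2)" using infr by (simp add: r2_def)
    qed (use S in auto)
    then obtain f where f': "\<forall>x\<in>snd ` S. f x \<in> idx K2"
      "\<forall>x\<in>snd ` S. \<forall>y\<in>snd ` S. x < y \<longrightarrow> (f x, f y) \<in> fst K2 \<and> f x \<noteq> f y" by (elim exE conjE)
    note f = f'[rule_format]
    define \<sigma>2 where "\<sigma>2 p = (fst p, f (snd p))" for p :: "unit \<times> nat \<times> rat"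
    have "rmono lr r2 S \<sigma>2"
    proof (rule rmonoI)
      fix p q assume p: "p \<in> S" "q \<in> S" "(snd p, snd q) \<in> lr (fst p)" "snd p \<noteq> snd q"
      hence "snd p < snd q" by (simp add: lr_def)
      thus "(snd (\<sigma>2 p), snd (\<sigma>2 q)) \<in> r2 (fst p) \<and> snd (\<sigma>2 p) \<noteq> snd (\<sigma>2 q)"
        using f(2)[of "snd p" "snd q"] p(1,2) by (simp add: \<sigma>2_def r2_def)
    qed (use f in \<open>simp_all add: \<sigma>2_def r2_def\<close>)
    from e(3)[OF S rd this] have "teq {} (vs mm S) e (h2 \<circ> lift \<sigma>2)" by (rule teq_mono) auto
    moreover have "teq {} (vs mm S) (h2 \<circ> lift \<sigma>2) (h1 \<circ> lift (\<lambda>p. (fst p, \<iota> (f (snd p)))))"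
    proof (rule teq_agree)
      fix v assume "v \<in> vs mm S"
      then obtain p c where v: "v = (p, c)" "p \<in> S" "c < m" by (auto simp: vs_def mm_def)
      thus "(h2 \<circ> lift \<sigma>2) v = (h1 \<circ> lift (\<lambda>p. (fst p, \<iota> (f (snd p))))) v"
        using \<iota>h[OF f(1)[OF imageI[OF v(2)]] v(3)] by (simp add: \<sigma>2_def)
    qed (use env in \<open>simp_all add: envs_comp\<close>)
    moreover have "teq {} (vs mm S) (h1 \<circ> lift (\<lambda>p. (fst p, \<iota> (f (snd p))))) (h1 \<circ> lift \<sigma>)"
    proof (rule mi_two[OF mi1 env(1) lin(1,3) rd _ \<sigma>])
      show "rmono lr r1 S (\<lambda>p. (fst p, \<iota> (f (snd p))))"
      proof (rule rmonoI)
        fix p q assume p: "p \<in> S" "q \<in> S" "(snd p, snd q) \<in> lr (fst p)" "snd p \<noteq> snd q"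
        hence "snd p < snd q" by (simp add: lr_def)
        thus "(snd (fst p, \<iota> (f (snd p))), snd (fst q, \<iota> (f (snd q)))) \<in> r1 (fst p) \<and>
          snd (fst p, \<iota> (f (snd p))) \<noteq> snd (fst q, \<iota> (f (snd q)))"
          using \<iota>m f(2)[of "snd p" "snd q"] p(1,2) by (simp add: r1_def)
      qed (use f \<iota>F in \<open>simp_all add: r1_def\<close>)
    qed
    ultimately show ?thesis by (meson teq_trans)
  qed
  obtain t0 where t0: "t0 \<in> idx K2" using infr by (fastforce simp: r2_def)
  define b where "b = Tr \<phi> a m True h2 ((), t0)"
  have Trd: "dfn (set a) (vs mm {p}) (\<lambda>h. Tr \<phi> a m b h p)" for p :: "unit \<times> 'q" and b
    using Tr_dfn[OF \<phi> a(1), of p b] by (rule dfn_mono) (auto simp: vs_def mm_def)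
  have Trb: "Tr \<phi> a m b h p \<longleftrightarrow> (Tr \<phi> a m True h p \<longleftrightarrow> b)" for b h and p :: "unit \<times> 'q"
    by (auto simp: Tr_def)
  have T2: "Tr \<phi> a m b h2 ((), t)" if t: "t \<in> idx K2" for t
  proof -
    have "teq (set a) (vs mm {((), t)}) h2 (h2 \<circ> lift (\<lambda>_. ((), t0)))"
      using mi2 t t0 unfolding mi_def by (auto simp: rmono_def r2_def)
    from teqD[OF this Trd] have "Tr \<phi> a m True h2 ((), t) \<longleftrightarrow> Tr \<phi> a m True (h2 \<circ> lift (\<lambda>_. ((), t0))) ((), t)" .
    also have "\<dots> = b" unfolding b_def by (rule Tr_cong) simp
    finally show ?thesis by (subst Trb) simp
  qed
  have Te: "Tr \<phi> a m b e ((), q)" for q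
  proof -
    have "teq (set a) (vs mm {((), q)}) e (h2 \<circ> lift (\<lambda>_. ((), t0)))"
      by (rule e(3)[OF _ rd]) (use t0 in \<open>auto simp: rmono_def r2_def\<close>)
    from teqD[OF this Trd] have "Tr \<phi> a m b e ((), q) \<longleftrightarrow> Tr \<phi> a m b (h2 \<circ> lift (\<lambda>_. ((), t0))) ((), q)" .
    also have "\<dots> = Tr \<phi> a m b h2 ((), t0)" by (rule Tr_cong) simp
    finally show ?thesis using T2[OF t0] by simp
  qed
  define F where "F = {j \<in> idx I. \<not> (sat U (\<lambda>i. (a @ snd I j) ! i) \<phi> \<longleftrightarrow> b)}"
  have Finf: "infinite F" using H unfolding F_def by (cases b) simp_all
  have TF: "\<not> Tr \<phi> a m b h1 ((), Inl (Inr j))" if j: "j \<in> F" for j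
  proof -
    have jK: "Inl (Inr j) \<in> idx K1" using j by (auto simp: F_def K1_def)
    have eq: "map (\<lambda>c. h1 (((), Inl (Inr j)), c)) [0..<m] = snd I j"
    proof (rule nth_equalityI)
      show "length (map (\<lambda>c. h1 (((), Inl (Inr j)), c)) [0..<m]) = length (snd I j)"
        using sequence_of_length[OF seqs(2), of j] j by (simp add: F_def)
    qed (simp add: h1v[OF jK], simp add: K1_def)
    show ?thesis using j unfolding Tr_def eq F_def mem_Collect_eq by (rule conjunct2)
  qed
  define inj where "inj = (\<lambda>v :: (nat \<times> rat) \<times> nat. (((), fst v), snd v))"
  \<comment> \<open>Positions of \<open>D\<close> below the cut are sent to \<open>J0\<close>, those
    above it to \<open>J1\<close>, and \<open>X\<close> to \<open>F\<close> in between. The copy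
    obtained in this way is carried over to \<open>e\<close> by extending a type over
    \<open>a\<close>.\<close>
  have fin_ins: "\<exists>s\<in>envs. (\<forall>v\<in>D \<times> {..<m}. s v = (e \<circ> inj) v) \<and> teq {} ((D \<union> X) \<times> {..<m}) s (e \<circ> inj) \<and> (\<forall>x\<in>X. \<not> Tr \<phi> a m b s x)"
    if D: "finite D" and X: "finite X" and cut: "\<And>q. q \<in> D \<Longrightarrow> (\<forall>x\<in>X. q < x) \<or> (\<forall>x\<in>X. x < q)" for D X
  proof -
    define Dl where "Dl = {q \<in> D. \<forall>x\<in>X. q < x}"
    obtain f where f': "\<forall>x\<in>D. f x \<in> idx J0" "\<forall>x\<in>D. \<forall>y\<in>D. x < y \<longrightarrow> (f x, f y) \<in> fst J0 \<and> f x \<noteq> f y"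
      using finite_embed[OF D lin0(1) order_refl inf(1)] by (elim exE conjE)
    note f = f'[rule_format]
    obtain k where k': "\<forall>x\<in>D. k x \<in> idx J1" "\<forall>x\<in>D. \<forall>y\<in>D. x < y \<longrightarrow> (k x, k y) \<in> fst J1 \<and> k x \<noteq> k y"
      using finite_embed[OF D lin0(3) order_refl inf(2)] by (elim exE conjE)
    note k = k'[rule_format]
    have FI: "F \<subseteq> idx I" by (auto simp: F_def)
    obtain g where g': "\<forall>x\<in>X. g x \<in> F" "\<forall>x\<in>X. \<forall>y\<in>X. x < y \<longrightarrow> (g x, g y) \<in> fst I \<and> g x \<noteq> g y"
      using finite_embed[OF X lin0(2) FI Finf] by (elim exE conjE)
    note g = g'[rule_format]
    define s2 where "s2 q = (if q \<in> Dl then Inl (f q) else Inr (k q))" for q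
    define s1 where "s1 q = (if q \<in> X then Inl (Inr (g q)) else \<iota> (s2 q))" for q
    have DX: "q \<notin> X" if "q \<in> D" for q using cut[OF that] by blast
    have s2F: "s2 q \<in> idx K2" if "q \<in> D" for q using that f(1)[of q] k(1)[of q] by (auto simp: s2_def K2_def)
    have s2m: "(s2 q, s2 q') \<in> fst K2 \<and> s2 q \<noteq> s2 q'" if "q \<in> D" "q' \<in> D" "q < q'" for q q'
    proof -
      have "q \<in> Dl" if "q' \<in> Dl" using that less_trans[OF \<open>q < q'\<close>] \<open>q \<in> D\<close> unfolding Dl_def by blast
      thus ?thesis using that f(1)[of q] f(2)[of q q'] k(1)[of q'] k(2)[of q q'] by (auto simp: s2_def K2_def)
    qed
    have s1F: "s1 q \<in> idx K1" if "q \<in> D \<union> X" for q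
      using that g(1)[of q] FI \<iota>F[OF s2F[of q]] by (auto simp: s1_def K1_def)
    have s1m: "(s1 q, s1 q') \<in> fst K1 \<and> s1 q \<noteq> s1 q'" if "q \<in> D \<union> X" "q' \<in> D \<union> X" "q < q'" for q q'
    proof -
      consider "q \<in> X" "q' \<in> X" | "q \<in> D" "q' \<in> D" | "q \<in> X" "q' \<in> D" | "q \<in> D" "q' \<in> X"
        using UnE[OF \<open>q \<in> D \<union> X\<close>] UnE[OF \<open>q' \<in> D \<union> X\<close>] by metis
      thus ?thesis
      proof cases
        case 1
        thus ?thesis using g(2)[OF 1 that(3)] by (simp add: s1_def K1_def)
      next
        case 2
        thus ?thesis using \<iota>m s2m[OF 2 that(3)] DX by (simp add: s1_def)
      next
        case 3
        hence "q' \<notin> Dl" using that(3) less_not_sym[of q q'] unfolding Dl_def by blast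
        thus ?thesis using 3 g(1)[of q] FI k(1)[of q'] DX by (auto simp: s1_def s2_def K1_def \<iota>_def)
      next
        case 4
        hence "q \<in> Dl" using cut[OF 4(1)] that(3) less_not_sym[of q q'] unfolding Dl_def by blast
        thus ?thesis using 4 g(1)[of q'] FI f(1)[of q] DX by (auto simp: s1_def s2_def K1_def \<iota>_def)
      qed
    qed
    define \<sigma>1 where "\<sigma>1 p = (fst p, s1 (snd p))" for p :: "unit \<times> nat \<times> rat"
    define \<sigma>2 where "\<sigma>2 p = (fst p, s2 (snd p))" for p :: "unit \<times> nat \<times> rat"
    have rm1: "rmono lr r1 ({()} \<times> (D \<union> X)) \<sigma>1"
    proof (rule rmonoI)
      fix p q assume p: "p \<in> {()} \<times> (D \<union> X)" "q \<in> {()} \<times> (D \<union> X)" "(snd p, snd q) \<in> lr (fst p)" "snd p \<noteq> snd q"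
      hence "snd p < snd q" by (simp add: lr_def)
      thus "(snd (\<sigma>1 p), snd (\<sigma>1 q)) \<in> r1 (fst p) \<and> snd (\<sigma>1 p) \<noteq> snd (\<sigma>1 q)"
        using s1m[of "snd p" "snd q"] p(1,2) by (auto simp: \<sigma>1_def r1_def mem_Times_iff)
    qed (use s1F in \<open>auto simp: \<sigma>1_def r1_def mem_Times_iff\<close>)
    have rm2: "rmono lr r2 ({()} \<times> D) \<sigma>2"
    proof (rule rmonoI)
      fix p q assume p: "p \<in> {()} \<times> D" "q \<in> {()} \<times> D" "(snd p, snd q) \<in> lr (fst p)" "snd p \<noteq> snd q"
      hence "snd p < snd q" by (simp add: lr_def)
      thus "(snd (\<sigma>2 p), snd (\<sigma>2 q)) \<in> r2 (fst p) \<and> snd (\<sigma>2 p) \<noteq> snd (\<sigma>2 q)"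
        using s2m[of "snd p" "snd q"] p(1,2) by (auto simp: \<sigma>2_def r2_def mem_Times_iff)
    qed (use s2F in \<open>auto simp: \<sigma>2_def r2_def mem_Times_iff\<close>)
    have "teq (set a) (vs mm ({()} \<times> D)) e (h2 \<circ> lift \<sigma>2)" by (rule e(3)[OF _ rd rm2]) (use D in simp)
    moreover have "teq (set a) (vs mm ({()} \<times> D)) (h2 \<circ> lift \<sigma>2) (h1 \<circ> lift \<sigma>1)"
    proof (rule teq_agree)
      fix v assume "v \<in> vs mm ({()} \<times> D)"
      then obtain q c where v: "v = (((), q), c)" "q \<in> D" "c < m" by (auto simp: vs_def mm_def)
      thus "(h2 \<circ> lift \<sigma>2) v = (h1 \<circ> lift \<sigma>1) v"
        using \<iota>h[OF s2F[OF v(2)] v(3)] DX by (simp add: \<sigma>1_def \<sigma>2_def s1_def)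
    qed (use env in \<open>simp_all add: envs_comp\<close>)
    ultimately have t: "teq (set a) (vs mm ({()} \<times> D)) (h1 \<circ> lift \<sigma>1) e" by (meson teq_trans teq_sym)
    have "\<exists>k\<in>envs. (\<forall>v\<in>vs mm ({()} \<times> D). k v = e v) \<and> teq (set a) (vs mm ({()} \<times> (D \<union> X))) k (h1 \<circ> lift \<sigma>1)"
    proof (rule extend_type[OF _ _ a(1) _ e(1) _ t])
      show "|vs mm ({()} \<times> (D \<union> X))| <o kb" by (rule small_countable) simp
    qed (use env in \<open>auto simp: envs_comp small_finite intro!: vs_mono\<close>)
    then obtain k where k: "k \<in> envs" "\<forall>v\<in>vs mm ({()} \<times> D). k v = e v" "teq (set a) (vs mm ({()} \<times> (D \<union> X))) k (h1 \<circ> lift \<sigma>1)"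
      by (elim bexE conjE)
    have ke: "teq {} (vs mm ({()} \<times> (D \<union> X))) k e"
    proof (rule teq_trans)
      show "teq {} (vs mm ({()} \<times> (D \<union> X))) k (h1 \<circ> lift \<sigma>1)" by (rule teq_mono[OF k(3)]) auto
      show "teq {} (vs mm ({()} \<times> (D \<union> X))) (h1 \<circ> lift \<sigma>1) e"
        by (rule teq_sym, rule EM1[OF _ rm1]) (use D X in simp)
    qed
    show ?thesis
    proof (intro bexI[of _ "k \<circ> inj"] conjI ballI)
      fix v assume "v \<in> D \<times> {..<m}"
      thus "(k \<circ> inj) v = (e \<circ> inj) v" using k(2) by (auto simp: inj_def vs_def mm_def)
    next
      show "teq {} ((D \<union> X) \<times> {..<m}) (k \<circ> inj) (e \<circ> inj)"
        by (rule teq_reindex[OF ke]) (auto simp: inj_def vs_def mm_def)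
      fix x assume x: "x \<in> X"
      have "dfn (set a) (vs mm ({()} \<times> (D \<union> X))) (\<lambda>h. Tr \<phi> a m b h ((), x))"
        by (rule dfn_mono[OF Trd]) (use x in \<open>auto simp: vs_def\<close>)
      from teqD[OF k(3) this] have "Tr \<phi> a m b k ((), x) = Tr \<phi> a m b (h1 \<circ> lift \<sigma>1) ((), x)" .
      also have "\<dots> = Tr \<phi> a m b h1 ((), Inl (Inr (g x)))" by (rule Tr_cong) (use x in \<open>simp add: \<sigma>1_def s1_def\<close>)
      finally have "\<not> Tr \<phi> a m b k ((), x)" using TF[OF g(1)[OF x]] by simp
      moreover have "Tr \<phi> a m b (k \<circ> inj) x = Tr \<phi> a m b k ((), x)" by (rule Tr_cong) (simp add: inj_def)
      ultimately show "\<not> Tr \<phi> a m b (k \<circ> inj) x" by simp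
    qed (use k in \<open>simp add: envs_comp\<close>)
  qed
  \<comment> \<open>Infinite \<open>D\<close> is reached by compactness: each condition is forced by
    the insertion over some finite part of \<open>D\<close>.\<close>
  have ins: "\<exists>s\<in>envs. (\<forall>v\<in>D \<times> {..<m}. s v = (e \<circ> inj) v) \<and> teq {} ((D \<union> X) \<times> {..<m}) s (e \<circ> inj) \<and> (\<forall>x\<in>X. \<not> Tr \<phi> a m b s x)"
    if X: "finite X" and cut: "\<And>q. q \<in> D \<Longrightarrow> (\<forall>x\<in>X. q < x) \<or> (\<forall>x\<in>X. x < q)" for D X
  proof -
    define C where "C = (e \<circ> inj) ` (D \<times> {..<m}) \<union> set a"
    define good where "good P D0 \<longleftrightarrow> finite D0 \<and> D0 \<subseteq> D \<and> (\<forall>s\<in>envs. (\<forall>v\<in>D0 \<times> {..<m}. s v = (e \<circ> inj) v) \<and>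
      teq {} ((D0 \<union> X) \<times> {..<m}) s (e \<circ> inj) \<and> (\<forall>x\<in>X. \<not> Tr \<phi> a m b s x) \<longrightarrow> P s)" for P D0
    define \<Sigma> where "\<Sigma> = {P. dfn C ((D \<union> X) \<times> {..<m}) P \<and> (\<exists>D0. good P D0)}"
    have "\<exists>s\<in>envs. \<forall>P\<in>\<Sigma>. P s"
    proof (rule realize)
      show "|(D \<union> X) \<times> {..<m}| <o kb" "|C| <o kb"
        unfolding C_def by (rule small_countable, simp add: countable_finite)+
      show "C \<subseteq> univ U" using a(1) envsD[OF envs_comp[OF e(1), of inj]] by (auto simp: C_def simp del: o_apply)
      show "dfn C ((D \<union> X) \<times> {..<m}) P" if "P \<in> \<Sigma>" for P using that by (simp add: \<Sigma>_def)
      fix \<Sigma>0 assume \<Sigma>0: "finite \<Sigma>0" "\<Sigma>0 \<subseteq> \<Sigma>"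
      hence "\<forall>P\<in>\<Sigma>0. \<exists>D0. good P D0" by (auto simp: \<Sigma>_def)
      hence "\<exists>G. \<forall>P\<in>\<Sigma>0. good P (G P)" by (rule bchoice)
      then obtain G where "\<forall>P\<in>\<Sigma>0. good P (G P)" by (rule exE)
      note G = bspec[OF this]
      define D0 where "D0 = (\<Union>P\<in>\<Sigma>0. G P)"
      have D0: "finite D0" "D0 \<subseteq> D" using \<Sigma>0(1) G by (auto simp: D0_def good_def)
      have "\<exists>s\<in>envs. (\<forall>v\<in>D0 \<times> {..<m}. s v = (e \<circ> inj) v) \<and> teq {} ((D0 \<union> X) \<times> {..<m}) s (e \<circ> inj) \<and> (\<forall>x\<in>X. \<not> Tr \<phi> a m b s x)"
        by (rule fin_ins[OF D0(1) X cut]) (use D0(2) in auto)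
      then obtain s where s: "s \<in> envs" "\<forall>v\<in>D0 \<times> {..<m}. s v = (e \<circ> inj) v"
        "teq {} ((D0 \<union> X) \<times> {..<m}) s (e \<circ> inj)" "\<forall>x\<in>X. \<not> Tr \<phi> a m b s x" by (elim bexE conjE)
      show "\<exists>s\<in>envs. \<forall>P\<in>\<Sigma>0. P s"
      proof (intro bexI[OF _ s(1)] ballI)
        fix P assume P: "P \<in> \<Sigma>0"
        hence sub: "G P \<subseteq> D0" by (auto simp: D0_def)
        have "teq {} ((G P \<union> X) \<times> {..<m}) s (e \<circ> inj)" by (rule teq_mono[OF s(3)]) (use sub in auto)
        moreover have "\<forall>v\<in>G P \<times> {..<m}. s v = (e \<circ> inj) v" using s(2) sub by blast
        ultimately show "P s" using G[OF P] s(1,4) unfolding good_def by simp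
      qed
    qed
    then obtain s where s: "s \<in> envs" "\<forall>P\<in>\<Sigma>. P s" by (elim bexE)
    show ?thesis
    proof (intro bexI[OF _ s(1)] conjI ballI)
      fix v assume v: "v \<in> D \<times> {..<m}"
      have "(\<lambda>s. s v = (e \<circ> inj) v) \<in> \<Sigma>"
        unfolding \<Sigma>_def mem_Collect_eq
      proof (intro conjI exI)
        show "dfn C ((D \<union> X) \<times> {..<m}) (\<lambda>s. s v = (e \<circ> inj) v)"
          by (rule dfn_eq_const) (use v in \<open>auto simp: C_def\<close>)
        show "good (\<lambda>s. s v = (e \<circ> inj) v) {fst v}" using v unfolding good_def by (cases v) auto
      qed
      thus "s v = (e \<circ> inj) v" using s(2) by (rule bspec[rotated])
    next
      show "teq {} ((D \<union> X) \<times> {..<m}) s (e \<circ> inj)"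
      proof (rule teq_finite)
        fix S0 assume S0: "finite S0" "S0 \<subseteq> (D \<union> X) \<times> {..<m}"
        show "teq {} S0 s (e \<circ> inj)"
          unfolding teq_def
        proof (intro allI impI)
          fix P assume P: "dfn {} S0 P"
          let ?D0 = "fst ` S0 \<inter> D"
          have P': "dfn {} ((?D0 \<union> X) \<times> {..<m}) P" by (rule dfn_mono[OF P]) (use S0(2) in force)+
          have "(\<lambda>s. P s \<longleftrightarrow> P (e \<circ> inj)) \<in> \<Sigma>"
            unfolding \<Sigma>_def mem_Collect_eq
          proof (intro conjI exI)
            show "dfn C ((D \<union> X) \<times> {..<m}) (\<lambda>s. P s \<longleftrightarrow> P (e \<circ> inj))"
              by (rule dfn_iff[OF dfn_mono[OF P] dfn_const]) (use S0(2) in auto)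
            show "good (\<lambda>s. P s \<longleftrightarrow> P (e \<circ> inj)) ?D0"
              unfolding good_def using S0(1) teqD[OF _ P'] by auto
          qed
          thus "P s = P (e \<circ> inj)" using s(2) by (rule bspec[rotated])
        qed
      qed
      fix x assume x: "x \<in> X"
      have "(\<lambda>s. \<not> Tr \<phi> a m b s x) \<in> \<Sigma>"
        unfolding \<Sigma>_def mem_Collect_eq
      proof (intro conjI exI)
        show "dfn C ((D \<union> X) \<times> {..<m}) (\<lambda>s. \<not> Tr \<phi> a m b s x)"
          by (rule dfn_Neg, rule dfn_mono[OF Tr_dfn[OF \<phi> a(1)]]) (use x in \<open>auto simp: C_def\<close>)
        show "good (\<lambda>s. \<not> Tr \<phi> a m b s x) {}" using x unfolding good_def by simp
      qed
      thus "\<not> Tr \<phi> a m b s x" using s(2) by (rule bspec[rotated])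
    qed
  qed
  have mi0: "mi {} {()} lr mm e" by (rule mi_mono[OF e(2)]) simp
  show False
  proof (rule insertion_contradiction[OF _ \<phi> a(1) _ _ _ ins])
    show "e \<circ> inj \<in> envs" by (rule envs_comp[OF e(1)])
    show "Tr \<phi> a m b (e \<circ> inj) q" for q
    proof -
      have "Tr \<phi> a m b (e \<circ> inj) q = Tr \<phi> a m b e ((), q)" by (rule Tr_cong) (simp add: inj_def)
      thus ?thesis using Te by simp
    qed
  next
    fix S :: "nat set" and f1 f2 :: "nat \<Rightarrow> nat \<times> rat" assume f: "strict_mono_on S f1" "strict_mono_on S f2"
    let ?r = "\<lambda>_ :: unit. le_rel :: nat rel"
    have "teq {} (vs mm ({()} \<times> S)) (e \<circ> lift (\<lambda>p. (fst p, f1 (snd p)))) (e \<circ> lift (\<lambda>p. (fst p, f2 (snd p))))"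
    proof (rule mi_two[OF mi0 e(1) lin(3)])
      show "Linear_order (?r i)" for i by (rule Linear_order_le_rel)
      show "{()} \<times> S \<subseteq> rdom {()} ?r" by auto
      show "rmono ?r lr ({()} \<times> S) (\<lambda>p. (fst p, f1 (snd p)))" "rmono ?r lr ({()} \<times> S) (\<lambda>p. (fst p, f2 (snd p)))"
      proof -
        have "rmono ?r lr ({()} \<times> S) (\<lambda>p. (fst p, f (snd p)))" if f: "strict_mono_on S f" for f
        proof (rule rmonoI)
          fix p q assume p: "p \<in> {()} \<times> S" "q \<in> {()} \<times> S" "(snd p, snd q) \<in> ?r (fst p)" "snd p \<noteq> snd q"
          hence "f (snd p) < f (snd q)" by (intro strict_mono_onD[OF f]) auto
          thus "(snd (fst p, f (snd p)), snd (fst q, f (snd q))) \<in> lr (fst p) \<and> snd (fst p, f (snd p)) \<noteq> snd (fst q, f (snd q))"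
            by (simp add: lr_def less_imp_le less_imp_neq)
        qed (simp_all add: lr_def)
        note mono = this
        show "rmono ?r lr ({()} \<times> S) (\<lambda>p. (fst p, f1 (snd p)))" by (rule mono[OF f(1)])
        show "rmono ?r lr ({()} \<times> S) (\<lambda>p. (fst p, f2 (snd p)))" by (rule mono[OF f(2)])
      qed
    qed
    hence "teq {} (S \<times> {..<m}) (e \<circ> lift (\<lambda>p. (fst p, f1 (snd p))) \<circ> (\<lambda>v. (((), fst v), snd v)))
        (e \<circ> lift (\<lambda>p. (fst p, f2 (snd p))) \<circ> (\<lambda>v. (((), fst v), snd v)))" 
      by (rule teq_reindex) (auto simp: vs_def mm_def)
    thus "teq {} (S \<times> {..<m}) (e \<circ> inj \<circ> lift f1) (e \<circ> inj \<circ> lift f2)"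
      by (simp add: comp_def inj_def map_prod_def split_beta)
  next
    fix S and \<tau> :: "nat \<times> rat \<Rightarrow> nat \<times> rat" assume \<tau>: "rowmono S \<tau>"
    have "teq {} (vs mm ({()} \<times> S)) (e \<circ> lift (\<lambda>p. (fst p, snd p))) (e \<circ> lift (\<lambda>p. (fst p, \<tau> (snd p))))"
    proof (rule mi_two[OF mi0 e(1) lin(3) lin(3) rd])
      show "rmono lr lr ({()} \<times> S) (\<lambda>p. (fst p, snd p))" by (rule rmonoI) (auto simp: lr_def)
      show "rmono lr lr ({()} \<times> S) (\<lambda>p. (fst p, \<tau> (snd p)))"
      proof (rule rmonoI)
        fix p p' assume p: "p \<in> {()} \<times> S" "p' \<in> {()} \<times> S" "(snd p, snd p') \<in> lr (fst p)" "snd p \<noteq> snd p'"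
        hence "snd p < snd p'" by (simp add: lr_def)
        hence "\<tau> (snd p) < \<tau> (snd p')" using \<tau> p(1,2) unfolding rowmono_def less_prod_def' by (auto simp: mem_Times_iff)
        thus "(snd (fst p, \<tau> (snd p)), snd (fst p', \<tau> (snd p'))) \<in> lr (fst p) \<and> snd (fst p, \<tau> (snd p)) \<noteq> snd (fst p', \<tau> (snd p'))"
          by (simp add: lr_def less_imp_le less_imp_neq)
      qed (auto simp: lr_def)
    qed
    hence "teq {} (S \<times> {..<m}) (e \<circ> lift (\<lambda>p. (fst p, snd p)) \<circ> (\<lambda>v. (((), fst v), snd v)))
        (e \<circ> lift (\<lambda>p. (fst p, \<tau> (snd p))) \<circ> (\<lambda>v. (((), fst v), snd v)))" 
      by (rule teq_reindex) (auto simp: vs_def mm_def)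
    thus "teq {} (S \<times> {..<m}) (e \<circ> inj) (e \<circ> inj \<circ> lift \<tau>)"
      by (simp add: comp_def inj_def map_prod_def split_beta)
  qed
qed

end

section \<open>Stability and op-dimension\<close>

lemma dir_image_iff: "inj g \<Longrightarrow> (g x, g y) \<in> dir_image r g \<longleftrightarrow> (x, y) \<in> r"
  by (auto simp: dir_image_def dest: injD)

lemma indiscernible_mono: "indiscernible L M A' I \<Longrightarrow> A \<subseteq> A' \<Longrightarrow> indiscernible L M A I"
proof -
  assume I: "indiscernible L M A' I" and A: "A \<subseteq> A'"
  have "pfmlas L A n \<subseteq> pfmlas L A' n" for n
    using lists_mono[OF A] by (auto simp: pfmlas_def)
  thus ?thesis using I unfolding indiscernible_def by blast
qed

lemma mutually_indiscernible_row:
  "mutually_indiscernible L M A X I \<Longrightarrow> i \<in> X \<Longrightarrow> A' \<subseteq> A \<Longrightarrow> indiscernible L M A' (I i)"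
  unfolding mutually_indiscernible_def by (rule indiscernible_mono[of L M "A \<union> (\<Union>j\<in>X - {i}. elems (I j))"]) auto

lemma mutually_indiscernible_inj:
  assumes I: "mutually_indiscernible L M A X I" and f: "inj_on f Y" "f ` Y \<subseteq> X" and A': "A' \<subseteq> A"
  shows "mutually_indiscernible L M A' Y (\<lambda>i. I (f i))"
  unfolding mutually_indiscernible_def
proof
  fix i assume i: "i \<in> Y"
  have "(\<Union>j\<in>Y - {i}. elems (I (f j))) \<subseteq> (\<Union>j\<in>X - {f i}. elems (I j))"
    using f i by (fastforce dest: inj_onD)
  moreover have "indiscernible L M (A \<union> (\<Union>j\<in>X - {f i}. elems (I j))) (I (f i))"
    using I f(2) i unfolding mutually_indiscernible_def by blast
  ultimately show "indiscernible L M (A' \<union> (\<Union>j\<in>Y - {i}. elems (I (f j)))) (I (f i))"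
    using A' by (elim indiscernible_mono) blast
qed

lemma mutually_stable_single:
  fixes kb :: "'k rel" and I :: "'x \<Rightarrow> ('k, 'm) tseq"
  assumes "mutually_stable L U kb A Y I" "i \<in> Y"
  shows "stable_over L U kb A (I i)"
proof -
  obtain J0 J1 :: "'x \<Rightarrow> ('k, 'm) tseq" where J: "\<forall>i\<in>Y. small_seq kb (J0 i) \<and> small_seq kb (J1 i) \<and>
      infinite (idx (J0 i)) \<and> infinite (idx (J1 i)) \<and> indiscernible L U {} (J0 i \<oplus>\<^sub>s I i \<oplus>\<^sub>s J1 i)"
    and m: "mutually_indiscernible L U A Y (\<lambda>i. J0 i \<oplus>\<^sub>s J1 i)"
    using assms(1) unfolding mutually_stable_def by (elim exE conjE) (rule that, assumption+)
  have "mutually_indiscernible L U A {()} (\<lambda>_. J0 i \<oplus>\<^sub>s J1 i)"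
    using mutually_indiscernible_row[OF m assms(2) order_refl] by (simp add: mutually_indiscernible_def)
  moreover have "small_seq kb (I i) \<and> indiscernible L U {} (I i)"
    using assms unfolding mutually_stable_def by blast
  ultimately show ?thesis
    using J assms(2) unfolding stable_over_def mutually_stable_def
    by (intro conjI, simp, intro exI[of _ "\<lambda>_. J0 i"] exI[of _ "\<lambda>_. J1 i"]) simp
qed

section \<open>Countable index orders and sequences read off from environments\<close>

context monster
begin

text \<open>The index orders in the definitions live on the carrier type of \<open>kb\<close>, so
  countable orders are copied into it.\<close>

lemma countable_inj: "\<exists>g :: 'c::countable \<Rightarrow> 'k. inj g"
proof -
  have "infinite (UNIV :: 'k set)" using kb_inf finite_subset[OF subset_UNIV] by blast
  then obtain f :: "nat \<Rightarrow> 'k" where f: "inj f" using infinite_countable_subset by blast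
  have "inj (\<lambda>x :: 'c. f (to_nat x))" using f by (auto intro!: injI dest: injD)
  thus ?thesis by (rule exI[of inj])
qed

lemma mi_teq:
  assumes mi: "mi A X r m h" and k: "teq A (vs m (rdom X r)) k h"
  shows "mi A X r m k"
  unfolding mi_def
proof (intro allI impI, elim conjE)
  fix S \<tau> assume S: "finite S" "S \<subseteq> rdom X r" and \<tau>: "rmono r r S \<tau>"
  have "teq A (vs m S) k h" by (rule teq_mono[OF k order_refl vs_mono[OF S(2)]])
  moreover have "teq A (vs m S) h (h \<circ> lift \<tau>)" using mi S \<tau> unfolding mi_def by blast
  moreover have "teq A (vs m S) (k \<circ> lift \<tau>) (h \<circ> lift \<tau>)"
    by (rule teq_reindex[OF k lift_vs[OF rmonoD(1)[OF \<tau>] rmono_image[OF \<tau> S(2)]]])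
  ultimately show "teq A (vs m S) k (k \<circ> lift \<tau>)" by (meson teq_trans teq_sym)
qed

lemma sequence_of_row:
  assumes "h \<in> envs" "Linear_order r"
  shows "sequence_of U m (r, \<lambda>t. map (\<lambda>c. h (f t, c)) [0..<m])"
  using assms envsD[OF assms(1)] by (auto simp: sequence_of_def tuples_def)

end

context nip_monster
begin

text \<open>Each row is stretched by a copy of the natural numbers on both sides. The middle part of
  the stretched array has the type of the given family and is made equal to it by extending types
  over \<open>B\<close>, which keeps the whole mutually indiscernible over \<open>B\<close>.\<close>

theorem mutually_indiscernible_imp_stable:
  fixes I :: "'x \<Rightarrow> ('k, 'm) tseq"
  assumes mut: "mutually_indiscernible L U B X I" and B: "small_subset U kb B" and X: "|X| <o kb"
    and seq: "\<And>i. i \<in> X \<Longrightarrow> sequence_of U (m i) (I i)" and small: "\<And>i. i \<in> X \<Longrightarrow> small_seq kb (I i)"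
    and inf: "\<And>i. i \<in> X \<Longrightarrow> infinite (idx (I i))"
  shows "mutually_stable L U kb B X I"
proof -
  obtain g :: "nat \<Rightarrow> 'k" where g: "inj g" using countable_inj by (rule exE)
  define w where "w = dir_image (le_rel :: nat rel) g"
  have w: "Linear_order w"
    unfolding w_def by (rule Linear_order_dir_image[OF Linear_order_le_rel inj_on_subset[OF g subset_UNIV]])
  have winf: "infinite (Field w)" using finite_imageD[of g UNIV] g by (auto simp: w_def dir_image_Field)
  have wsm: "|Field w| <o kb" unfolding w_def dir_image_Field by (rule small_countable) simp
  define W :: "('k, 'm) tseq" where "W = (w, \<lambda>_. [])"
  define r where "r i = fst (I i)" for i
  define r' where "r' i = fst (W \<oplus>\<^sub>s I i \<oplus>\<^sub>s W)" for i
  have lin: "Linear_order (r i)" if "i \<in> X" for i using seq[OF that] by (simp add: r_def sequence_of_def)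
  have lin': "Linear_order (r' i)" if "i \<in> X" for i
    unfolding r'_def by (intro Linear_order_seq_append) (use w lin[OF that] in \<open>simp_all add: W_def r_def\<close>)
  have Fr': "Field (r' i) = Inl ` (Inl ` Field w \<union> Inr ` idx (I i)) \<union> Inr ` Field w" for i by (simp add: r'_def W_def)
  have sm: "|Field (r' i)| <o kb" if "i \<in> X" for i
    unfolding Fr' using small[OF that] wsm by (intro small_Un small_image) (simp_all add: small_seq_def)
  define h where "h = senv X m I"
  have henv: "h \<in> envs" unfolding h_def by (rule senv_envs[OF seq])
  have mih: "mi B X r m h" unfolding h_def r_def by (rule mi_senv[OF mut seq])
  have hval: "h ((i, t), c) = snd (I i) t ! c" if "i \<in> X" "t \<in> idx (I i)" "c < m i" for i t c
    using that by (simp add: h_def senv_def)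
  have Bs: "|B| <o kb" "B \<subseteq> univ U" using B by (simp_all add: small_subset_def)
  have "\<exists>h'\<in>envs. mi B X r' m h' \<and>
    (\<forall>S \<sigma>. finite S \<longrightarrow> S \<subseteq> rdom X r' \<longrightarrow> rmono r' r S \<sigma> \<longrightarrow> teq B (vs m S) h' (h \<circ> lift \<sigma>))"
    by (rule mi_stretch[OF mih henv Bs X lin inf[folded r_def] lin' sm])
  then obtain h' where h'': "h' \<in> envs" "mi B X r' m h'"
    "\<forall>S \<sigma>. finite S \<longrightarrow> S \<subseteq> rdom X r' \<longrightarrow> rmono r' r S \<sigma> \<longrightarrow> teq B (vs m S) h' (h \<circ> lift \<sigma>)"
    by (elim bexE conjE)
  note h' = h''(1,2) h''(3)[rule_format]
  define D :: "('x \<times> (('k + 'k) + 'k)) set" where "D = {(i, Inl (Inr t)) | i t. i \<in> X \<and> t \<in> idx (I i)}"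
  define \<mu> where "\<mu> p = (fst p, projr (projl (snd p)))" for p :: "'x \<times> (('k + 'k) + 'k)"
  have Dsub: "D \<subseteq> rdom X r'" by (auto simp: D_def Fr')
  have \<mu>: "rmono r' r D \<mu>"
    by (rule rmonoI) (auto simp: D_def \<mu>_def r_def r'_def)
  have teqD: "teq B (vs m D) h' (h \<circ> lift \<mu>)"
  proof (rule teq_finite)
    fix S0 assume S0: "finite S0" "S0 \<subseteq> vs m D"
    have sub: "fst ` S0 \<subseteq> D" using S0(2) by (auto simp: vs_def)
    have "teq B (vs m (fst ` S0)) h' (h \<circ> lift \<mu>)"
      by (rule h'(3)) (use S0 sub Dsub rmono_subset[OF \<mu> sub] in auto)
    thus "teq B S0 h' (h \<circ> lift \<mu>)" by (rule teq_mono) (use S0(2) in \<open>force simp: vs_def\<close>)+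
  qed
  have "\<exists>k\<in>envs. (\<forall>v\<in>vs m D. k v = (h \<circ> lift \<mu>) v) \<and> teq B (vs m (rdom X r')) k h'"
    by (rule extend_type[OF small_vs[OF X sm] Bs h'(1) envs_comp[OF henv] vs_mono[OF Dsub] teqD])
  then obtain k where k: "k \<in> envs" "\<forall>v\<in>vs m D. k v = (h \<circ> lift \<mu>) v" "teq B (vs m (rdom X r')) k h'"
    by (elim bexE conjE)
  have mik: "mi B X r' m k" by (rule mi_teq[OF h'(2) k(3)])
  define J0 where "J0 i = (w, \<lambda>t. map (\<lambda>c. k ((i, Inl (Inl t)), c)) [0..<m i])" for i
  define J1 where "J1 i = (w, \<lambda>t. map (\<lambda>c. k ((i, Inr t), c)) [0..<m i])" for i
  have seqJ: "sequence_of U (m i) (J0 i)" "sequence_of U (m i) (J1 i)" for i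
    unfolding J0_def J1_def by (rule sequence_of_row[OF k(1) w])+
  have rJ: "r' i = fst (J0 i \<oplus>\<^sub>s I i \<oplus>\<^sub>s J1 i)" for i
    by (simp add: r'_def seq_append_def J0_def J1_def W_def)
  have full: "mutually_indiscernible L U B X (\<lambda>i. J0 i \<oplus>\<^sub>s I i \<oplus>\<^sub>s J1 i)"
  proof (rule mutually_indiscernible_mi[of B X _ m k])
    show "mi B X (\<lambda>i. fst (J0 i \<oplus>\<^sub>s I i \<oplus>\<^sub>s J1 i)) m k" using mik by (simp add: rJ[symmetric])
    show "sequence_of U (m i) (J0 i \<oplus>\<^sub>s I i \<oplus>\<^sub>s J1 i)" if "i \<in> X" for i
      using seqJ seq[OF that] by (simp add: sequence_of_append)
    fix i t c assume *: "i \<in> X" "t \<in> idx (J0 i \<oplus>\<^sub>s I i \<oplus>\<^sub>s J1 i)" "c < m i"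
    have "k ((i, Inl (Inr t')), c) = snd (I i) t' ! c" if "t' \<in> idx (I i)" for t'
    proof -
      have "((i, Inl (Inr t')), c) \<in> vs m D" using * that by (auto simp: vs_def D_def)
      thus ?thesis using k(2) hval[OF *(1) that *(3)] by (simp add: \<mu>_def)
    qed
    thus "k ((i, t), c) = snd (J0 i \<oplus>\<^sub>s I i \<oplus>\<^sub>s J1 i) t ! c"
      using * by (auto simp: J0_def J1_def)
  qed (rule k(1))
  have out: "mutually_indiscernible L U B X (\<lambda>i. J0 i \<oplus>\<^sub>s J1 i)"
  proof (rule mutually_indiscernible_mi[of B X _ m "k \<circ> lift (\<lambda>p. (fst p, map_sum Inl id (snd p)))"])
    have linJ: "Linear_order (fst (J0 i \<oplus>\<^sub>s J1 i))" for i
      by (rule Linear_order_seq_append) (simp_all add: J0_def J1_def w)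
    have rm: "rmono (\<lambda>i. fst (J0 i \<oplus>\<^sub>s J1 i)) r' (rdom X (\<lambda>i. fst (J0 i \<oplus>\<^sub>s J1 i))) (\<lambda>p. (fst p, map_sum Inl id (snd p)))"
      by (rule rmonoI) (auto simp: rJ J0_def J1_def)
    show "mi B X (\<lambda>i. fst (J0 i \<oplus>\<^sub>s J1 i)) m (k \<circ> lift (\<lambda>p. (fst p, map_sum Inl id (snd p))))"
      by (rule mi_reindex[OF mik k(1) lin' linJ rm])
    show "sequence_of U (m i) (J0 i \<oplus>\<^sub>s J1 i)" if "i \<in> X" for i using seqJ by (simp add: sequence_of_append)
    show "(k \<circ> lift (\<lambda>p. (fst p, map_sum Inl id (snd p)))) ((i, t), c) = snd (J0 i \<oplus>\<^sub>s J1 i) t ! c"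
      if "i \<in> X" "t \<in> idx (J0 i \<oplus>\<^sub>s J1 i)" "c < m i" for i t c
      using that by (auto simp: J0_def J1_def)
  qed (rule envs_comp[OF k(1)])
  show ?thesis
    unfolding mutually_stable_def
  proof (rule conjI, intro ballI conjI)
    fix i assume i: "i \<in> X"
    show "small_seq kb (I i)" by (rule small[OF i])
    show "indiscernible L U {} (I i)" by (rule mutually_indiscernible_row[OF mut i]) simp
  next
    show "\<exists>(J0 :: 'x \<Rightarrow> ('k, 'm) tseq) (J1 :: 'x \<Rightarrow> ('k, 'm) tseq). (\<forall>i\<in>X. small_seq kb (J0 i) \<and> small_seq kb (J1 i) \<and>
           infinite (idx (J0 i)) \<and> infinite (idx (J1 i)) \<and> indiscernible L U {} (J0 i \<oplus>\<^sub>s I i \<oplus>\<^sub>s J1 i)) \<and>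
        mutually_indiscernible L U B X (\<lambda>i. J0 i \<oplus>\<^sub>s J1 i)"
  proof (rule exI[of _ J0], rule exI[of _ J1], intro conjI ballI)
    fix i assume i: "i \<in> X"
    show "small_seq kb (J0 i)" "small_seq kb (J1 i)" using wsm by (simp_all add: small_seq_def J0_def J1_def)
    show "infinite (idx (J0 i))" "infinite (idx (J1 i))" using winf by (simp_all add: J0_def J1_def)
    show "indiscernible L U {} (J0 i \<oplus>\<^sub>s I i \<oplus>\<^sub>s J1 i)" by (rule mutually_indiscernible_row[OF full i]) simp
  qed (rule out)
  qed
qed

text \<open>The parameters of \<open>p\<close> lie in \<open>A\<close> and are appended to
  \<open>a\<close>; \<open>g\<close> exchanges the block of these parameters with the block of the
  sequence variables.\<close>

theorem stable_finite_cofinite: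
  fixes I :: "('k, 'm) tseq"
  assumes st: "stable_over L U kb A I" and seq: "sequence_of U m I" and a: "a \<in> tuples U n" "set a \<subseteq> A"
    and A: "A \<subseteq> univ U" and p: "p \<in> pfmlas L A (n + m)"
  shows "finite {j \<in> idx I. psat U p (a @ snd I j)} \<or> finite {j \<in> idx I. \<not> psat U p (a @ snd I j)}"
proof (cases "idx I = {}")
  case False
  obtain \<phi> c where p': "p = (\<phi>, c)" "set c \<subseteq> A" "wf_fm L \<phi>" "fv \<phi> \<subseteq> {..<n + m + length c}"
    using p by (auto simp: pfmlas_def fmlas_def)
  define l where "l = length c"
  define g where "g i = (if i < n then i else if i < n + m then i + l else i - m)" for i
  obtain \<phi>' where \<phi>': "wf_fm L \<phi>'" "fv \<phi>' \<subseteq> g ` fv \<phi>" "\<forall>e. sat U e \<phi>' \<longleftrightarrow> sat U (e \<circ> g) \<phi>"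
    using renaming[OF p'(3), of g U] by (elim exE conjE)
  have la: "length a = n" using a by (simp add: tuples_def)
  have gf: "g i < n + l + m" if "i \<in> fv \<phi>" for i
    using that p'(4) by (auto simp: g_def l_def split: if_splits)
  have "\<phi>' \<in> fmlas L (length (a @ c) + m)"
    using \<phi>'(1,2) gf la unfolding fmlas_def l_def by fastforce
  note fc = finite_cofinite[OF _ _ _ _ _ _ _ this]
  have eq: "psat U p (a @ snd I j) \<longleftrightarrow> sat U (\<lambda>i. ((a @ c) @ snd I j) ! i) \<phi>'" if "j \<in> idx I" for j
  proof -
    have lj: "length (snd I j) = m" by (rule sequence_of_length[OF seq that])
    have "sat U (\<lambda>i. ((a @ c) @ snd I j) ! i) \<phi>' \<longleftrightarrow> sat U ((\<lambda>i. ((a @ c) @ snd I j) ! i) \<circ> g) \<phi>" using \<phi>'(3) by blast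
    also have "\<dots> \<longleftrightarrow> sat U (\<lambda>i. ((a @ snd I j) @ c) ! i) \<phi>"
    proof (rule sat_cong)
      fix i assume "i \<in> fv \<phi>"
      hence "i < n + m + l" using p'(4) by (auto simp: l_def)
      thus "((\<lambda>i. ((a @ c) @ snd I j) ! i) \<circ> g) i = ((a @ snd I j) @ c) ! i"
        using la lj by (auto simp: g_def l_def nth_append add.commute)
    qed
    finally show ?thesis by (simp add: psat_def p'(1))
  qed
  obtain J0 J1 :: "unit \<Rightarrow> ('k, 'm) tseq" where J: "\<forall>i\<in>{()}. small_seq kb (J0 i) \<and> small_seq kb (J1 i) \<and>
      infinite (idx (J0 i)) \<and> infinite (idx (J1 i)) \<and> indiscernible L U {} (J0 i \<oplus>\<^sub>s I \<oplus>\<^sub>s J1 i)"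
    and mut: "mutually_indiscernible L U A {()} (\<lambda>i. J0 i \<oplus>\<^sub>s J1 i)"
    using st unfolding stable_over_def mutually_stable_def by (elim exE conjE) (rule that, assumption+)
  then obtain m' where m': "sequence_of U m' (J0 () \<oplus>\<^sub>s I \<oplus>\<^sub>s J1 ())" unfolding indiscernible_def by blast
  hence "sequence_of U m' I" by (simp add: sequence_of_append)
  moreover obtain t where "t \<in> idx I" using False by blast
  ultimately have "m' = m" by (rule sequence_of_unique[OF _ seq])
  have "finite {j \<in> idx I. sat U (\<lambda>i. ((a @ c) @ snd I j) ! i) \<phi>'} \<or> finite {j \<in> idx I. \<not> sat U (\<lambda>i. ((a @ c) @ snd I j) ! i) \<phi>'}"
  proof (rule fc)
    show "indiscernible L U A (J0 () \<oplus>\<^sub>s J1 ())" by (rule mutually_indiscernible_row[OF mut]) auto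
    show "sequence_of U m (J0 () \<oplus>\<^sub>s I \<oplus>\<^sub>s J1 ())" using m' \<open>m' = m\<close> by simp
    show "set (a @ c) \<subseteq> univ U" "set (a @ c) \<subseteq> A" using a p'(2) A by auto
  qed (use J in auto)
  moreover have "{j \<in> idx I. psat U p (a @ snd I j)} = {j \<in> idx I. sat U (\<lambda>i. ((a @ c) @ snd I j) ! i) \<phi>'}"
    "{j \<in> idx I. \<not> psat U p (a @ snd I j)} = {j \<in> idx I. \<not> sat U (\<lambda>i. ((a @ c) @ snd I j) ! i) \<phi>'}"
    using eq by (blast, blast)
  ultimately show ?thesis by simp
qed simp

theorem pattern_not_stable:
  assumes B: "small_subset U kb B" and \<kappa>: "Card_order \<kappa>" "\<kappa> <o kb" and pat: "dlr_pattern L U kb B n \<pi> \<kappa>"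
  shows "\<exists>(I :: 'k \<Rightarrow> ('k, 'm) tseq) a. mutually_stable L U kb B (Field \<kappa>) I \<and> realizes U n \<pi> a \<and>
    (\<forall>i\<in>Field \<kappa>. \<not> stable_over L U kb (B \<union> set a) (I i))"
proof -
  obtain a and I :: "'k \<Rightarrow> ('k, 'm) tseq" and m \<phi> where a: "realizes U n \<pi> a" and mut: "mutually_indiscernible L U B (Field \<kappa>) I"
    and I: "\<forall>i\<in>Field \<kappa>. small_seq kb (I i) \<and> sequence_of U (m i) (I i) \<and> \<phi> i \<in> pfmlas L B (n + m i) \<and>
           infinite {j \<in> idx (I i). psat U (\<phi> i) (a @ snd (I i) j)} \<and>
           infinite {j \<in> idx (I i). \<not> psat U (\<phi> i) (a @ snd (I i) j)}"
    using pat unfolding dlr_pattern_def by (elim exE conjE)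
  have X: "|Field \<kappa>| <o kb" using card_of_Field_ordIso[OF \<kappa>(1)] \<kappa>(2) ordIso_ordLess_trans by blast
  have at: "a \<in> tuples U n" using a by (simp add: realizes_def)
  have "mutually_stable L U kb B (Field \<kappa>) I"
  proof (rule mutually_indiscernible_imp_stable[OF mut B X, of m])
    fix i assume i: "i \<in> Field \<kappa>"
    show "infinite (idx (I i))"
    proof
      assume "finite (idx (I i))"
      hence "finite {j \<in> idx (I i). psat U (\<phi> i) (a @ snd (I i) j)}" by simp
      thus False using I i by blast
    qed
  qed (use I in blast)+
  moreover have "\<not> stable_over L U kb (B \<union> set a) (I i)" if i: "i \<in> Field \<kappa>" for i
  proof
    assume st: "stable_over L U kb (B \<union> set a) (I i)"
    have sub: "B \<union> set a \<subseteq> univ U" using at B by (auto simp: tuples_def small_subset_def)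
    have "\<phi> i \<in> pfmlas L B (n + m i)" and sq: "sequence_of U (m i) (I i)" using I i by blast+
    hence "\<phi> i \<in> pfmlas L (B \<union> set a) (n + m i)" by (auto simp: pfmlas_def)
    from stable_finite_cofinite[OF st sq at _ sub this] show False using I i by blast
  qed
  ultimately show ?thesis using a by blast
qed

subsection \<open>Extraction on both sides of a sequence\<close>

text \<open>The halves of each row are extracted as separate rows \<open>(i, b)\<close> over a base
  \<open>E\<close> that contains the inner elements. Put together again, they are as indiscernible
  over \<open>A\<close> as the original rows: every instance of indiscernibility is a condition over
  \<open>E\<close> that holds for all monotone choices from the original halves, hence for
  \<open>h'\<close>. Positions with \<open>side p = None\<close> are inner and are read from
  \<open>h1\<close>.\<close>

lemma extraction_transfer:
  fixes h1 :: "('x \<times> 'i) \<times> nat \<Rightarrow> 'm" and r3 :: "'x \<Rightarrow> 'p rel" and side :: "'p \<Rightarrow> (bool \<times> rat) option"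
    and r :: "'x \<times> bool \<Rightarrow> 'j rel" and emb :: "bool \<Rightarrow> 'j \<Rightarrow> 'i"
  assumes mi1: "mi A Y r1 m h1" and env: "h1 \<in> envs" "h \<in> envs" "h' \<in> envs"
    and lin: "\<And>i. i \<in> Y \<Longrightarrow> Linear_order (r1 i)" "\<And>i. i \<in> Y \<Longrightarrow> Linear_order (r3 i)"
    and EM: "\<And>S P. finite S \<Longrightarrow> fst ` fst ` S \<subseteq> Y \<Longrightarrow> dfn E (vs (\<lambda>p. m (fst p)) S) P \<Longrightarrow>
       (\<And>\<sigma>. rmono (\<lambda>_. le_rel) r S \<sigma> \<Longrightarrow> P (h \<circ> lift \<sigma>)) \<Longrightarrow> P h'"
    and hval: "\<And>i b t c. i \<in> Y \<Longrightarrow> t \<in> Field (r (i, b)) \<Longrightarrow> c < m i \<Longrightarrow> h (((i, b), t), c) = h1 ((i, emb b t), c)"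
    and AE: "A \<subseteq> E"
    and inner: "\<And>i p c. i \<in> Y \<Longrightarrow> p \<in> Field (r3 i) \<Longrightarrow> side p = None \<Longrightarrow> c < m i \<Longrightarrow> h1 ((i, inn p), c) \<in> E"
    and mono: "\<And>S \<sigma>. S \<subseteq> rdom Y r3 \<Longrightarrow>
       rmono (\<lambda>_. le_rel) r {((i, fst bq), snd bq) | i p bq. (i, p) \<in> S \<and> side p = Some bq} \<sigma> \<Longrightarrow>
       rmono r3 r1 S (\<lambda>p. (fst p, case side (snd p) of Some bq \<Rightarrow> emb (fst bq) (snd (\<sigma> ((fst p, fst bq), snd bq))) | None \<Rightarrow> inn (snd p)))"
  shows "mi A Y r3 m (\<lambda>v. case side (snd (fst v)) of Some bq \<Rightarrow> h' (((fst (fst v), fst bq), snd bq), snd v)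
      | None \<Rightarrow> h1 ((fst (fst v), inn (snd (fst v))), snd v))"
proof -
  define \<xi> where "\<xi> v = (case side (snd (fst v)) of Some bq \<Rightarrow> Inl (((fst (fst v), fst bq), snd bq), snd v)
      | None \<Rightarrow> Inr (h1 ((fst (fst v), inn (snd (fst v))), snd v)))" for v :: "('x \<times> 'p) \<times> nat"
  define comb where "comb g v = case_sum g id (\<xi> v)" for g :: "(('x \<times> bool) \<times> rat) \<times> nat \<Rightarrow> 'm" and v
  have combenv: "comb g \<in> envs" if "g \<in> envs" for g
    using envsD[OF that] envsD[OF env(1)] by (intro envsI) (simp add: comb_def \<xi>_def split: option.split)
  have "mi A Y r3 m (comb h')"
    unfolding mi_def
  proof (intro allI impI, elim conjE)
    fix S \<tau> assume S: "finite S" "S \<subseteq> rdom Y r3" and \<tau>: "rmono r3 r3 S \<tau>"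
    define S' where "S' = S \<union> \<tau> ` S"
    have S': "finite S'" "S' \<subseteq> rdom Y r3" using S rmono_image[OF \<tau> S(2)] by (auto simp: S'_def)
    define S2 where "S2 = {((i, fst bq), snd bq) | i p bq. (i, p) \<in> S' \<and> side p = Some bq}"
    have "S2 \<subseteq> (\<lambda>x. ((fst x, fst (the (side (snd x)))), snd (the (side (snd x))))) ` S'"
      unfolding S2_def by force
    hence S2: "finite S2" using S'(1) finite_surj by blast
    have S2Y: "fst ` fst ` S2 \<subseteq> Y" using S'(2) by (fastforce simp: S2_def)
    have sub: "dfn E (vs (\<lambda>p. m (fst p)) S2) (\<lambda>g. Q (comb g))" if Q: "dfn A (vs m S') Q" for Q
      unfolding comb_def[abs_def]
    proof (rule dfn_subst[OF Q _ _ AE])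
      show "c \<in> univ U" if "\<xi> v = Inr c" for v c
        using that envsD[OF env(1)] by (auto simp: \<xi>_def split: option.splits)
      fix v assume "v \<in> vs m S'"
      then obtain i p c where v: "v = ((i, p), c)" "(i, p) \<in> S'" "c < m i" by (auto simp: vs_def)
      have ip: "i \<in> Y" "p \<in> Field (r3 i)" using v(2) S'(2) by auto
      show "\<xi> v \<in> Inl ` vs (\<lambda>p. m (fst p)) S2 \<union> Inr ` E"
      proof (cases "side p")
        case None
        thus ?thesis using inner[OF ip None v(3)] v(1) by (simp add: \<xi>_def)
      next
        case (Some bq)
        hence "((i, fst bq), snd bq) \<in> S2" using v(2) unfolding S2_def by blast
        thus ?thesis using Some v(1,3) by (simp add: \<xi>_def vs_def)
      qed
    qed
    show "teq A (vs m S) (comb h') (comb h' \<circ> lift \<tau>)"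
      unfolding teq_def
    proof (intro allI impI)
      fix P assume P: "dfn A (vs m S) P"
      have P1: "dfn A (vs m S') P" by (rule dfn_mono[OF P order_refl vs_mono]) (simp add: S'_def)
      have P2: "dfn A (vs m S') (\<lambda>g. P (g \<circ> lift \<tau>))"
        by (rule dfn_reindex[OF P lift_vs]) (use rmonoD(1)[OF \<tau>] in \<open>auto simp: S'_def\<close>)
      show "P (comb h') = P (comb h' \<circ> lift \<tau>)"
      proof (rule EM[OF S2 S2Y, of "\<lambda>g. P (comb g) \<longleftrightarrow> P (comb g \<circ> lift \<tau>)"])
        show "dfn E (vs (\<lambda>p. m (fst p)) S2) (\<lambda>g. P (comb g) \<longleftrightarrow> P (comb g \<circ> lift \<tau>))"
          by (rule dfn_iff[OF sub[OF P1] sub[OF P2]])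
        fix \<sigma> assume \<sigma>: "rmono (\<lambda>_. le_rel) r S2 \<sigma>"
        define s where "s p = (fst p, case side (snd p) of Some bq \<Rightarrow> emb (fst bq) (snd (\<sigma> ((fst p, fst bq), snd bq)))
          | None \<Rightarrow> inn (snd p))" for p
        have rs: "rmono r3 r1 S' s" unfolding s_def[abs_def] by (rule mono[OF S'(2)]) (use \<sigma> in \<open>simp add: S2_def\<close>)
        have agree: "comb (h \<circ> lift \<sigma>) v = (h1 \<circ> lift s) v" if "v \<in> vs m S'" for v
        proof -
          from that obtain i p c where v: "v = ((i, p), c)" "(i, p) \<in> S'" "c < m i" by (auto simp: vs_def)
          have ip: "i \<in> Y" using v(2) S'(2) by auto
          show ?thesis
          proof (cases "side p")
            case None
            thus ?thesis using v(1) by (simp add: comb_def \<xi>_def s_def)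
          next
            case (Some bq)
            hence m2: "((i, fst bq), snd bq) \<in> S2" using v(2) unfolding S2_def by blast
            have "\<sigma> ((i, fst bq), snd bq) = ((i, fst bq), snd (\<sigma> ((i, fst bq), snd bq)))"
              using rmonoD(1)[OF \<sigma> m2] by (simp add: prod_eq_iff)
            hence "h (\<sigma> ((i, fst bq), snd bq), c) = h (((i, fst bq), snd (\<sigma> ((i, fst bq), snd bq))), c)" by (rule arg_cong)
            also have "\<dots> = h1 ((i, emb (fst bq) (snd (\<sigma> ((i, fst bq), snd bq)))), c)"
              using rmonoD(2)[OF \<sigma> m2] by (intro hval[OF ip _ v(3)]) simp
            finally show ?thesis using Some v(1) by (simp add: comb_def \<xi>_def s_def)
          qed
        qed
        have he: "comb (h \<circ> lift \<sigma>) \<in> envs" "h1 \<circ> lift s \<in> envs" using combenv[OF envs_comp[OF env(2)]] envs_comp[OF env(1)] by auto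
        have "teq A (vs m S) (h1 \<circ> lift s) (h1 \<circ> lift (s \<circ> \<tau>))"
        proof (rule mi_two[OF mi1 env(1) lin S(2)])
          show "rmono r3 r1 S s" by (rule rmono_subset[OF rs]) (simp add: S'_def)
          show "rmono r3 r1 S (s \<circ> \<tau>)" by (rule rmono_comp[OF \<tau> rmono_subset[OF rs]]) (simp add: S'_def)
        qed
        from teqD[OF this P] have "P (h1 \<circ> lift s) = P (h1 \<circ> lift s \<circ> lift \<tau>)" by (simp add: comp_assoc map_prod.comp)
        moreover have "P (comb (h \<circ> lift \<sigma>)) = P (h1 \<circ> lift s)" by (rule dfn_local[OF P1 he agree])
        moreover have "P (comb (h \<circ> lift \<sigma>) \<circ> lift \<tau>) = P (h1 \<circ> lift s \<circ> lift \<tau>)" by (rule dfn_local[OF P2 he agree])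
        ultimately show "P (comb (h \<circ> lift \<sigma>)) = P (comb (h \<circ> lift \<sigma>) \<circ> lift \<tau>)" by simp
      qed
    qed
  qed
  moreover have "comb h' = (\<lambda>v. case side (snd (fst v)) of Some bq \<Rightarrow> h' (((fst (fst v), fst bq), snd bq), snd v)
      | None \<Rightarrow> h1 ((fst (fst v), inn (snd (fst v))), snd v))"
    by (rule ext) (simp add: comb_def \<xi>_def split: option.split)
  ultimately show ?thesis by simp
qed

lemma lift_vs2:
  assumes "\<And>p. p \<in> S \<Longrightarrow> m' (fst (f p)) = m (fst p)"
  shows "lift f ` vs m S \<subseteq> vs m' (f ` S)"
proof
  fix v assume "v \<in> lift f ` vs m S"
  then obtain p c where "v = (f p, c)" "p \<in> S" "c < m (fst p)" by (auto simp: vs_def)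
  thus "v \<in> vs m' (f ` S)" using assms by (simp add: vs_def)
qed

text \<open>Two halves become one row, since the lexicographic order on
  \<open>bool \<times> rat\<close> puts the half \<open>False\<close> before the half
  \<open>True\<close>.\<close>

definition joined :: "((('x \<times> bool) \<times> rat) \<times> nat \<Rightarrow> 'm) \<Rightarrow> ('x \<times> (bool \<times> rat)) \<times> nat \<Rightarrow> 'm" where
  "joined h v = h (((fst (fst v), fst (snd (fst v))), snd (snd (fst v))), snd v)"

abbreviation lexr :: "'x \<Rightarrow> (bool \<times> rat) rel" where "lexr \<equiv> \<lambda>_. le_rel"

lemma joined_envs: "h \<in> envs \<Longrightarrow> joined h \<in> envs"
  by (intro envsI) (simp add: joined_def envsD)

lemma lex_rmonoD:
  assumes "rmono lexr lexr S \<tau>" "(i, s) \<in> S" "(i, s') \<in> S" "s < s'"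
  shows "snd (\<tau> (i, s)) < snd (\<tau> (i, s'))"
  using rmonoD(3)[OF assms(1,2,3)] assms(4) by (auto simp: less_le simp del: less_prod_simp)

lemma lex_rmonoI:
  assumes "\<And>p. p \<in> S \<Longrightarrow> fst (\<tau> p) = fst p"
    "\<And>i s s'. (i, s) \<in> S \<Longrightarrow> (i, s') \<in> S \<Longrightarrow> s < s' \<Longrightarrow> snd (\<tau> (i, s)) < snd (\<tau> (i, s'))"
  shows "rmono lexr lexr S \<tau>"
proof (rule rmonoI)
  fix p q assume *: "p \<in> S" "q \<in> S" "fst p = fst q" "(snd p, snd q) \<in> le_rel" "snd p \<noteq> snd q"
  hence "snd p < snd q" by simp
  moreover have e: "(fst p, snd p) = p" "(fst p, snd q) = q" using *(3) by (simp_all add: prod_eq_iff)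
  ultimately have "snd (\<tau> p) < snd (\<tau> q)" using assms(2)[of "fst p" "snd p" "snd q", unfolded e] *(1,2) by blast
  thus "(snd (\<tau> p), snd (\<tau> q)) \<in> le_rel \<and> snd (\<tau> p) \<noteq> snd (\<tau> q)" by (simp add: less_imp_le less_imp_neq)
qed (use assms(1) in simp_all)

text \<open>As separate rows the halves are mutually indiscernible over \<open>E\<close>. The type
  over \<open>E\<close> of a configuration thus depends only on which of its positions lie in which
  half.\<close>

lemma same_sides:
  fixes h :: "(('x \<times> bool) \<times> rat) \<times> nat \<Rightarrow> 'm"
  assumes mi: "mi E (Y \<times> UNIV) (\<lambda>_. le_rel) (\<lambda>p. m (fst p)) h" and h: "h \<in> envs"
    and S: "S \<subseteq> Y \<times> UNIV" and \<tau>: "rmono lexr lexr S \<tau>1" "rmono lexr lexr S \<tau>2"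
    and side: "\<And>p. p \<in> S \<Longrightarrow> fst (snd (\<tau>1 p)) = fst (snd (\<tau>2 p))"
  shows "teq E (vs m S) (joined h \<circ> lift \<tau>1) (joined h \<circ> lift \<tau>2)"
proof -
  define \<delta> where "\<delta> p = ((fst p, fst (snd (\<tau>1 p))), snd p)" for p
  define s where "s \<tau> d = (fst d, snd (snd (\<tau> (fst (fst d), snd d))))" for \<tau> :: "'x \<times> (bool \<times> rat) \<Rightarrow> 'x \<times> (bool \<times> rat)" and d :: "('x \<times> bool) \<times> (bool \<times> rat)"
  have rm: "rmono lexr (\<lambda>_. le_rel) (\<delta> ` S) (s \<tau>)" if \<tau>: "rmono lexr lexr S \<tau>" "\<And>p. p \<in> S \<Longrightarrow> fst (snd (\<tau>1 p)) = fst (snd (\<tau> p))" for \<tau>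
  proof (rule rmonoI)
    fix d d' assume *: "d \<in> \<delta> ` S" "d' \<in> \<delta> ` S" "fst d = fst d'" "(snd d, snd d') \<in> le_rel" "snd d \<noteq> snd d'"
    obtain i x where p: "(i, x) \<in> S" "d = \<delta> (i, x)" using *(1) by auto
    obtain i' x' where p': "(i', x') \<in> S" "d' = \<delta> (i', x')" using *(2) by auto
    have ii: "i' = i" "fst (snd (\<tau> (i, x))) = fst (snd (\<tau> (i, x')))" using *(3) p p' \<tau>(2) by (auto simp: \<delta>_def)
    have "x < x'" using *(4,5) p(2) p'(2) by (simp add: \<delta>_def)
    hence "snd (\<tau> (i, x)) < snd (\<tau> (i, x'))" using lex_rmonoD[OF \<tau>(1) p(1)] p'(1) ii(1) by simp
    hence "snd (snd (\<tau> (i, x))) < snd (snd (\<tau> (i, x')))" using ii(2) unfolding less_prod_def' by simp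
    thus "(snd (s \<tau> d), snd (s \<tau> d')) \<in> le_rel \<and> snd (s \<tau> d) \<noteq> snd (s \<tau> d')"
      using p(2) p'(2) ii(1) by (simp add: s_def \<delta>_def)
  qed (simp_all add: s_def)
  have "teq E (vs (\<lambda>p. m (fst p)) (\<delta> ` S)) (h \<circ> lift (s \<tau>1)) (h \<circ> lift (s \<tau>2))"
  proof (rule mi_two[OF mi h Linear_order_le_rel Linear_order_le_rel])
    show "\<delta> ` S \<subseteq> rdom (Y \<times> UNIV) lexr" using S by (auto simp: \<delta>_def)
    show "rmono lexr (\<lambda>_. le_rel) (\<delta> ` S) (s \<tau>1)" "rmono lexr (\<lambda>_. le_rel) (\<delta> ` S) (s \<tau>2)"
      by (rule rm[OF \<tau>(1) refl], rule rm[OF \<tau>(2) side])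
  qed
  hence "teq E (vs m S) (h \<circ> lift (s \<tau>1) \<circ> lift \<delta>) (h \<circ> lift (s \<tau>2) \<circ> lift \<delta>)"
    by (rule teq_reindex, intro lift_vs2) (auto simp: \<delta>_def)
  moreover have "teq E (vs m S) (h \<circ> lift (s \<tau>) \<circ> lift \<delta>) (joined h \<circ> lift \<tau>)"
    if \<tau>: "rmono lexr lexr S \<tau>" "\<And>p. p \<in> S \<Longrightarrow> fst (snd (\<tau>1 p)) = fst (snd (\<tau> p))" for \<tau>
  proof (rule teq_agree)
    fix v assume "v \<in> vs m S"
    then obtain p c where v: "v = (p, c)" "p \<in> S" by (auto simp: vs_def)
    thus "(h \<circ> lift (s \<tau>) \<circ> lift \<delta>) v = (joined h \<circ> lift \<tau>) v"
      using rmonoD(1)[OF \<tau>(1) v(2)] \<tau>(2)[OF v(2)] by (simp add: s_def \<delta>_def joined_def)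
  qed (intro envs_comp joined_envs h)+
  ultimately show ?thesis using \<tau> side by (meson teq_trans teq_sym)
qed

subsection \<open>Crossing formulas\<close>

text \<open>The parameters of a crossing formula come from the far positions, the pattern from the
  middle ones. The middle positions form an interval around the cut, with the far ones below it on
  the left and above it on the right.\<close>

definition farpos :: "(bool \<times> rat) set" where "farpos = {False} \<times> {..< -1} \<union> {True} \<times> {1<..}"
definition midpos :: "(bool \<times> rat) set" where "midpos = {False} \<times> {-1<..} \<union> {True} \<times> {..<1}"
definition midr :: "'x \<Rightarrow> (bool \<times> rat) rel" where "midr = (\<lambda>_. {(x, y). x \<le> y \<and> x \<in> midpos \<and> y \<in> midpos})"

lemma Field_midr [simp]: "Field (midr i) = midpos"
  by (auto simp: midr_def Field_def)

lemma Linear_order_midr: "Linear_order (midr i)"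
proof (rule Linear_orderI)
  fix x y assume "x \<in> Field (midr i)" "y \<in> Field (midr i)"
  hence xy: "x \<in> midpos" "y \<in> midpos" by simp_all
  thus "(x, x) \<in> midr i" by (simp add: midr_def)
  show "(x, y) \<in> midr i \<or> (y, x) \<in> midr i" using xy linear[of x y] unfolding midr_def by blast
next
  fix x y z assume "(x, y) \<in> midr i" "(y, z) \<in> midr i"
  thus "(x, z) \<in> midr i" using order_trans[of x y z] unfolding midr_def by blast
next
  fix x y assume "(x, y) \<in> midr i" "(y, x) \<in> midr i"
  thus "x = y" using antisym[of x y] unfolding midr_def by blast
qed

text \<open>A monotone map of middle positions extends by the identity to all far positions, so the
  far elements may be added to the base.\<close>

lemma mi_midpos:
  assumes mi: "mi A Y lexr m H" and H: "H \<in> envs"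
  shows "mi (A \<union> H ` vs m (Y \<times> farpos)) Y midr m H"
  unfolding mi_def
proof (intro allI impI, elim conjE)
  fix S \<tau> assume S: "finite S" "S \<subseteq> rdom Y midr" and \<tau>: "rmono midr midr S \<tau>"
  have disj: "p \<notin> S" if "snd p \<in> farpos" for p
    using that domD[OF S(2), of p] by (auto simp: farpos_def midpos_def)
  have fm: "s < s'" if "s \<in> farpos" "fst s = False" "s' \<in> midpos" for s s'
    using that by (auto simp: farpos_def midpos_def less_prod_def')
  have mf: "s' < s" if "s \<in> farpos" "fst s = True" "s' \<in> midpos" for s s'
    using that by (auto simp: farpos_def midpos_def less_prod_def')
  define \<tau>' where "\<tau>' p = (if p \<in> S then \<tau> p else p)" for p
  have \<tau>S: "snd (\<tau> p) \<in> midpos" "snd p \<in> midpos" if "p \<in> S" for p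
    using rmonoD(2)[OF \<tau> that] domD[OF S(2) that] by auto
  have rm: "rmono lexr lexr (S \<union> Y \<times> farpos) \<tau>'"
  proof (rule lex_rmonoI)
    show "fst (\<tau>' p) = fst p" if "p \<in> S \<union> Y \<times> farpos" for p using rmonoD(1)[OF \<tau>] by (simp add: \<tau>'_def)
    fix i s s' assume s: "(i, s) \<in> S \<union> Y \<times> farpos" "(i, s') \<in> S \<union> Y \<times> farpos" "s < s'"
    consider "(i, s) \<in> S" "(i, s') \<in> S" | "(i, s) \<in> S" "(i, s') \<notin> S" "s' \<in> farpos" |
      "(i, s) \<notin> S" "s \<in> farpos" "(i, s') \<in> S" | "(i, s) \<notin> S" "(i, s') \<notin> S" using s by auto
    thus "snd (\<tau>' (i, s)) < snd (\<tau>' (i, s'))"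
    proof cases
      case 1
      hence "(s, s') \<in> midr i" "s \<noteq> s'" using s(3) \<tau>S[OF 1(1)] \<tau>S[OF 1(2)] by (auto simp: midr_def less_imp_le simp del: less_eq_prod_simp less_prod_simp)
      thus ?thesis using rmonoD(3)[OF \<tau> 1] 1 by (auto simp: \<tau>'_def midr_def less_le simp del: less_eq_prod_simp less_prod_simp)
    next
      case 2
      hence "fst s' = True" using fm[OF 2(3), of s] \<tau>S(2)[OF 2(1)] s(3) less_not_sym[of s s'] by auto
      thus ?thesis using mf[OF 2(3) _ \<tau>S(1)[OF 2(1)]] 2 by (simp add: \<tau>'_def)
    next
      case 3
      hence "fst s = False" using mf[OF 3(2), of s'] \<tau>S(2)[OF 3(3)] s(3) less_not_sym[of s s'] by auto
      thus ?thesis using fm[OF 3(2) _ \<tau>S(1)[OF 3(3)]] 3 by (simp add: \<tau>'_def)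
    next
      case 4
      thus ?thesis using s(3) by (simp add: \<tau>'_def del: less_prod_simp)
    qed
  qed
  have sub: "S \<union> Y \<times> farpos \<subseteq> rdom Y lexr" using S(2) by auto
  have "teq A (vs m (S \<union> Y \<times> farpos)) (H \<circ> lift id) (H \<circ> lift \<tau>')"
    by (rule mi_two[OF mi H Linear_order_le_rel Linear_order_le_rel sub rmono_id[OF sub] rm])
  hence t: "teq A (vs m (S \<union> Y \<times> farpos)) H (H \<circ> lift \<tau>')" by (simp add: map_prod.id)
  show "teq (A \<union> H ` vs m (Y \<times> farpos)) (vs m S) H (H \<circ> lift \<tau>)"
    unfolding teq_def
  proof (intro allI impI)
    fix P assume P: "dfn (A \<union> H ` vs m (Y \<times> farpos)) (vs m S) P"
    obtain Q where Q: "dfn A (vs m S \<union> vs m (Y \<times> farpos)) Q"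
      "\<forall>h\<in>envs. (\<forall>v\<in>vs m (Y \<times> farpos). h v = H v) \<longrightarrow> (Q h \<longleftrightarrow> P h)"
      using dfn_unfix_ex[OF P] by (elim exE conjE)
    have "vs m S \<union> vs m (Y \<times> farpos) = vs m (S \<union> Y \<times> farpos)" by (auto simp: vs_def)
    with Q(1) have "Q H = Q (H \<circ> lift \<tau>')" by (intro teqD[OF t]) simp
    moreover have "Q H = P H" using Q(2) H by simp
    moreover have "Q (H \<circ> lift \<tau>') = P (H \<circ> lift \<tau>')"
    proof (rule Q(2)[rule_format, OF envs_comp[OF H]])
      fix v assume "v \<in> vs m (Y \<times> farpos)"
      hence "fst v \<notin> S" by (intro disj) (auto simp: vs_def)
      thus "(H \<circ> lift \<tau>') v = H v" by (cases v) (simp add: \<tau>'_def)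
    qed
    moreover have "P (H \<circ> lift \<tau>') = P (H \<circ> lift \<tau>)"
    proof (rule dfn_local[OF P envs_comp[OF H] envs_comp[OF H]])
      fix v assume "v \<in> vs m S"
      thus "(H \<circ> lift \<tau>') v = (H \<circ> lift \<tau>) v" by (auto simp: vs_def \<tau>'_def)
    qed
    ultimately show "P H = P (H \<circ> lift \<tau>)" by simp
  qed
qed

text \<open>The sides in the other rows are fixed, so by \<open>same_sides\<close> the truth of
  \<open>P\<close> depends only on how many positions of row \<open>i\<close> lie on the left. It
  differs for two such numbers, hence for some neighbours \<open>k\<close> and \<open>Suc k\<close>,
  between which only the position of rank \<open>k\<close> crosses the cut. With the other positions
  moved far away, this gives a formula in one tuple that detects its side.\<close>

theorem crossing_formula:
  fixes h :: "(('x \<times> bool) \<times> rat) \<times> nat \<Rightarrow> 'm"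
  assumes mi: "mi E (Y \<times> UNIV) (\<lambda>_. le_rel) (\<lambda>p. m (fst p)) h" and h: "h \<in> envs" and AE: "A \<union> set a \<subseteq> E"
    and a: "a \<in> tuples U n" and i: "i \<in> Y" and S: "finite S" "S \<subseteq> Y \<times> UNIV"
    and \<tau>: "rmono lexr lexr S \<tau>" "\<And>p. p \<in> S \<Longrightarrow> fst p \<noteq> i \<Longrightarrow> \<tau> p = p"
    and bad: "\<not> teq (A \<union> set a) (vs m S) (joined h) (joined h \<circ> lift \<tau>)"
  shows "\<exists>p\<in>pfmlas L (A \<union> joined h ` vs m (Y \<times> farpos)) (n + m i).
    (\<forall>q>-1. psat U p (a @ map (\<lambda>c. joined h ((i, (False, q)), c)) [0..<m i])) \<and>
    (\<forall>q<1. \<not> psat U p (a @ map (\<lambda>c. joined h ((i, (True, q)), c)) [0..<m i]))"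
proof -
  let ?H = "joined h"
  have H: "?H \<in> envs" by (rule joined_envs[OF h])
  obtain P where P: "dfn (A \<union> set a) (vs m S) P" "P ?H \<noteq> P (?H \<circ> lift \<tau>)"
    using bad unfolding teq_def by blast
  define Si where "Si = {s. (i, s) \<in> S}"
  have Si: "finite Si" using finite_imageI[OF S(1), of snd] by (rule finite_subset[rotated]) (force simp: Si_def)
  define N where "N = card Si"
  define rk where "rk s = card {s' \<in> Si. s' < s}" for s
  have rkN: "rk s < N" if "s \<in> Si" for s
    unfolding rk_def N_def by (rule psubset_card_mono[OF Si]) (use that in auto)
  have rkm: "rk s < rk s'" if "s \<in> Si" "s < s'" for s s'
    unfolding rk_def
  proof (rule psubset_card_mono)
    show "finite {t \<in> Si. t < s'}" using Si by simp
    show "{t \<in> Si. t < s} \<subset> {t \<in> Si. t < s'}" using that less_trans[OF _ that(2)] less_irrefl[of s] by blast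
  qed
  have rkinj: "inj_on rk Si"
    by (rule inj_onI) (metis rkm less_irrefl linorder_neqE)
  have rkimg: "rk ` Si = {..<N}"
    by (rule card_subset_eq) (use rkN card_image[OF rkinj] in \<open>auto simp: N_def\<close>)
  obtain M :: rat where M: "\<And>p. p \<in> S \<Longrightarrow> \<bar>snd (snd p)\<bar> < M"
  proof -
    have fin: "finite ((\<lambda>p. \<bar>snd (snd p)\<bar>) ` S)" using S(1) by simp
    show thesis
    proof (rule that[of "Max (insert 0 ((\<lambda>p. \<bar>snd (snd p)\<bar>) ` S)) + 1"])
      fix p assume "p \<in> S"
      hence "\<bar>snd (snd p)\<bar> \<le> Max (insert 0 ((\<lambda>p. \<bar>snd (snd p)\<bar>) ` S))" using fin by (intro Max_ge) auto
      thus "\<bar>snd (snd p)\<bar> < Max (insert 0 ((\<lambda>p. \<bar>snd (snd p)\<bar>) ` S)) + 1" by simp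
    qed
  qed
  \<comment> \<open>\<open>\<kappa> k\<close> puts the first \<open>k\<close> elements of row \<open>i\<close> on the left and everything far away from the cut\<close>
  define \<kappa> where "\<kappa> k p = (if fst p = i
      then (i, if rk (snd p) < k then (False, of_nat (rk (snd p)) - 2 - of_nat N) else (True, 2 + of_nat (rk (snd p))))
      else (fst p, (fst (snd p), snd (snd p) + (if fst (snd p) then M + 1 else - (M + 1)))))" for k p
  \<comment> \<open>The offsets suffice because ranks are below \<open>N\<close> and the coordinates
    occurring in \<open>S\<close> are below \<open>M\<close> in absolute value.\<close>
  have \<kappa>far: "snd (\<kappa> k p) \<in> farpos" if p: "p \<in> S" for k p
  proof (cases "fst p = i")
    case True
    hence "snd p \<in> Si" using p by (cases p) (auto simp: Si_def)
    hence "(of_nat (rk (snd p)) :: rat) < of_nat N" using rkN by simp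
    moreover have "(0 :: rat) \<le> of_nat (rk (snd p))" by simp
    ultimately show ?thesis using True by (auto simp: \<kappa>_def farpos_def)
  next
    case False
    thus ?thesis using M[OF p] by (auto simp: \<kappa>_def farpos_def abs_if split: if_splits)
  qed
  have \<kappa>fst: "fst (\<kappa> k p) = fst p" for k p by (simp add: \<kappa>_def)
  have \<kappa>i: "snd (\<kappa> k (i, s)) < snd (\<kappa> k (i, s'))" if "rk s < rk s'" for k s s'
    using that by (auto simp: \<kappa>_def less_prod_def')
  have \<kappa>o: "snd (\<kappa> k (j, s)) < snd (\<kappa> k (j, s'))" if "j \<noteq> i" "s < s'" for k j s s'
    using that by (auto simp: \<kappa>_def less_prod_def')
  have \<kappa>m: "rmono lexr lexr S (\<kappa> k)" for k
  proof (rule lex_rmonoI[OF \<kappa>fst])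
    fix j s s' assume "(j, s) \<in> S" "(j, s') \<in> S" "s < s'"
    thus "snd (\<kappa> k (j, s)) < snd (\<kappa> k (j, s'))"
      using \<kappa>i[OF rkm] \<kappa>o by (cases "j = i") (simp_all add: Si_def)
  qed
  have PE: "dfn E (vs m S) P" by (rule dfn_mono[OF P(1) AE order_refl])
  have sides: "\<exists>k\<le>N. P (?H \<circ> lift \<tau>') \<longleftrightarrow> P (?H \<circ> lift (\<kappa> k))"
    if \<tau>': "rmono lexr lexr S \<tau>'" "\<And>p. p \<in> S \<Longrightarrow> fst p \<noteq> i \<Longrightarrow> \<tau>' p = p" for \<tau>'
  proof -
    define F where "F = {s \<in> Si. \<not> fst (snd (\<tau>' (i, s)))}"
    have FS: "F \<subseteq> Si" "finite F" using Si by (auto simp: F_def)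
    have down: "s \<in> F" if "s \<in> Si" "s' \<in> F" "s < s'" for s s'
    proof -
      have "snd (\<tau>' (i, s)) < snd (\<tau>' (i, s'))" by (rule lex_rmonoD[OF \<tau>'(1)]) (use that in \<open>auto simp: F_def Si_def\<close>)
      thus ?thesis using that by (auto simp: F_def less_prod_def')
    qed
    have iff: "rk s < card F \<longleftrightarrow> s \<in> F" if s: "s \<in> Si" for s
    proof
      assume "s \<in> F"
      hence "{s' \<in> Si. s' < s} \<subset> F" using down less_irrefl[of s] by blast
      thus "rk s < card F" unfolding rk_def by (rule psubset_card_mono[OF FS(2)])
    next
      assume l: "rk s < card F"
      show "s \<in> F"
      proof (rule ccontr)
        assume "s \<notin> F"
        hence "s' < s" if "s' \<in> F" for s' using down[OF s that] that by (metis linorder_neqE)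
        hence "F \<subseteq> {s' \<in> Si. s' < s}" using FS(1) by blast
        hence "card F \<le> rk s" unfolding rk_def by (intro card_mono) (use Si in auto)
        thus False using l by simp
      qed
    qed
    have "teq E (vs m S) (?H \<circ> lift \<tau>') (?H \<circ> lift (\<kappa> (card F)))"
    proof (rule same_sides[OF mi h S(2) \<tau>'(1) \<kappa>m])
      fix p assume p: "p \<in> S"
      show "fst (snd (\<tau>' p)) = fst (snd (\<kappa> (card F) p))"
      proof (cases "fst p = i")
        case True
        then obtain s where s: "p = (i, s)" by (cases p) simp
        hence "s \<in> Si" using p by (simp add: Si_def)
        thus ?thesis using iff[of s] by (simp add: s \<kappa>_def F_def)
      next
        case False
        thus ?thesis using \<tau>'(2)[OF p False] by (simp add: \<kappa>_def)
      qed
    qed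
    moreover have "card F \<le> N" unfolding N_def by (rule card_mono[OF Si FS(1)])
    ultimately show ?thesis using teqD[OF _ PE] by blast
  qed
  define f where "f k = P (?H \<circ> lift (\<kappa> k))" for k
  have "rmono lexr lexr S id" by (rule rmono_id[of S UNIV]) auto
  then obtain k1 where k1: "k1 \<le> N" "P ?H = f k1" using sides[of id] by (auto simp: f_def map_prod.id)
  obtain k2 where k2: "k2 \<le> N" "P (?H \<circ> lift \<tau>) = f k2" using sides[of \<tau>] \<tau> unfolding f_def by blast
  have "\<exists>k<N. f k \<noteq> f (Suc k)"
  proof (rule ccontr)
    assume "\<not> ?thesis"
    hence "f k = f 0" if "k \<le> N" for k using that by (induction k) auto
    thus False using k1 k2 P(2) by metis
  qed
  then obtain k where k: "k < N" "f k \<noteq> f (Suc k)" by (elim exE conjE)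
  obtain s0 where s0: "s0 \<in> Si" "rk s0 = k" using rkimg k(1) by (metis imageE lessThan_iff)
  \<comment> \<open>Normalized to be true when the position of rank \<open>k\<close> is on the
    left.\<close>
  define P' where "P' g \<longleftrightarrow> (P g \<longleftrightarrow> f (Suc k))" for g
  have P'd: "dfn (A \<union> set a) (vs m S) P'" unfolding P'_def[abs_def] by (rule dfn_iff[OF P(1) dfn_const])
  have P'E: "dfn E (vs m S) P'" by (rule dfn_mono[OF P'd AE order_refl])
  have P'v: "P' (?H \<circ> lift (\<kappa> (Suc k)))" "\<not> P' (?H \<circ> lift (\<kappa> k))" using k(2) by (auto simp: P'_def f_def)
  \<comment> \<open>All positions except the crossing one are frozen at their far places and turn
    into parameters.\<close>
  define W where "W g w = (if fst w = (i, s0) then g (snd w) else (?H \<circ> lift (\<kappa> k)) w)" for g w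
  have Wenv: "W g \<in> envs" if "g \<in> envs" for g
    using envsD[OF that] envsD[OF H] by (intro envsI) (simp add: W_def)
  let ?A' = "A \<union> ?H ` vs m (Y \<times> farpos)"
  have dW: "dfn (?A' \<union> set a) {..<m i} (\<lambda>g. P' (W g))"
  proof -
    define \<xi> where "\<xi> w = (if fst w = (i, s0) then Inl (snd w) else Inr ((?H \<circ> lift (\<kappa> k)) w))" for w
    have "dfn (?A' \<union> set a) {..<m i} (\<lambda>g. P' (\<lambda>w. case_sum g id (\<xi> w)))"
    proof (rule dfn_subst[OF P'd])
      show "c \<in> univ U" if "\<xi> w = Inr c" for w c
        using that envsD[OF envs_comp[OF H, of "lift (\<kappa> k)"], of w] by (auto simp: \<xi>_def split: if_splits)
      fix w assume "w \<in> vs m S"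
      then obtain p c where w: "w = (p, c)" "p \<in> S" "c < m (fst p)" by (auto simp: vs_def)
      show "\<xi> w \<in> Inl ` {..<m i} \<union> Inr ` (?A' \<union> set a)"
      proof (cases "p = (i, s0)")
        case False
        have "\<kappa> k p \<in> Y \<times> farpos" using \<kappa>far[OF w(2)] \<kappa>fst[of k p] w(2) S(2) by (auto simp: mem_Times_iff)
        hence "(\<kappa> k p, c) \<in> vs m (Y \<times> farpos)" using w(3) \<kappa>fst[of k p] by (simp add: vs_def)
        thus ?thesis using False w(1) by (simp add: \<xi>_def)
      qed (use w in \<open>simp add: \<xi>_def\<close>)
    qed auto
    moreover have "(\<lambda>w. case_sum g id (\<xi> w)) = W g" for g by (rule ext) (simp add: \<xi>_def W_def)
    ultimately show ?thesis by simp
  qed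
  have upd: "P' (W (\<lambda>c. ?H ((i, x), c))) \<longleftrightarrow> P' (?H \<circ> lift (\<kappa> k'))"
    if k': "k' = k \<or> k' = Suc k" and x: "fst x = fst (snd (\<kappa> k' (i, s0)))"
      "\<And>s. rk s < k \<Longrightarrow> s \<in> Si \<Longrightarrow> snd (\<kappa> k' (i, s)) < x" "\<And>s. k < rk s \<Longrightarrow> s \<in> Si \<Longrightarrow> x < snd (\<kappa> k' (i, s))" for x k'
  proof -
    define \<tau>' where "\<tau>' = (\<kappa> k')((i, s0) := (i, x))"
    have rm: "rmono lexr lexr S \<tau>'"
    proof (rule lex_rmonoI)
      show "fst (\<tau>' p) = fst p" for p by (simp add: \<tau>'_def \<kappa>fst)
      fix j s s' assume s: "(j, s) \<in> S" "(j, s') \<in> S" "s < s'"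
      have ne: "s \<noteq> s'" using s(3) by auto
      show "snd (\<tau>' (j, s)) < snd (\<tau>' (j, s'))"
      proof (cases "j = i")
        case True
        hence sS: "s \<in> Si" "s' \<in> Si" using s by (auto simp: Si_def)
        have r: "rk s < rk s'" by (rule rkm[OF sS(1) s(3)])
        show ?thesis
          using True ne \<kappa>i[OF r, of k'] x(2)[OF _ sS(1)] x(3)[OF _ sS(2)] r s0(2) by (auto simp: \<tau>'_def)
      next
        case False
        thus ?thesis using \<kappa>o[OF False s(3)] by (simp add: \<tau>'_def)
      qed
    qed
    have "teq E (vs m S) (?H \<circ> lift \<tau>') (?H \<circ> lift (\<kappa> k'))"
      by (rule same_sides[OF mi h S(2) rm \<kappa>m]) (use x(1) in \<open>auto simp: \<tau>'_def\<close>)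
    from teqD[OF this P'E] have "P' (?H \<circ> lift \<tau>') = P' (?H \<circ> lift (\<kappa> k'))" .
    moreover have "P' (W (\<lambda>c. ?H ((i, x), c))) \<longleftrightarrow> P' (?H \<circ> lift \<tau>')"
    proof (rule dfn_local[OF P'd Wenv envs_comp[OF H]])
      show "(\<lambda>c. ?H ((i, x), c)) \<in> envs" using envsD[OF H] by (intro envsI)
      fix w assume "w \<in> vs m S"
      then obtain p c where w: "w = (p, c)" "p \<in> S" by (auto simp: vs_def)
      have "\<kappa> k p = \<kappa> k' p" if "p \<noteq> (i, s0)"
      proof (cases "fst p = i")
        case True
        hence "snd p \<in> Si" "snd p \<noteq> s0" using w(2) that by (auto simp: Si_def prod_eq_iff)
        hence "rk (snd p) \<noteq> k" using inj_onD[OF rkinj _ _ s0(1)] s0(2) by metis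
        thus ?thesis using k' by (auto simp: \<kappa>_def)
      qed (simp add: \<kappa>_def)
      thus "W (\<lambda>c. ?H ((i, x), c)) w = (?H \<circ> lift \<tau>') w" using w(1) by (auto simp: W_def \<tau>'_def)
    qed
    ultimately show ?thesis by simp
  qed
  have left: "P' (W (\<lambda>c. ?H ((i, (False, q)), c)))" if q: "q > -1" for q
  proof -
    have "(of_nat (rk s) :: rat) < of_nat N" if "s \<in> Si" for s using rkN[OF that] by simp
    hence "P' (W (\<lambda>c. ?H ((i, (False, q)), c))) \<longleftrightarrow> P' (?H \<circ> lift (\<kappa> (Suc k)))"
      using q by (intro upd) (fastforce simp: \<kappa>_def s0 less_prod_def')+
    thus ?thesis using P'v(1) by simp
  qed
  have right: "\<not> P' (W (\<lambda>c. ?H ((i, (True, q)), c)))" if q: "q < 1" for q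
  proof -
    have "(0 :: rat) \<le> of_nat (rk s)" for s by simp
    hence "q < 2 + of_nat (rk s)" for s using q by (smt (verit) add_increasing2 less_le_trans one_le_numeral)
    hence "P' (W (\<lambda>c. ?H ((i, (True, q)), c))) \<longleftrightarrow> P' (?H \<circ> lift (\<kappa> k))"
      by (intro upd) (auto simp: \<kappa>_def s0 less_prod_def')
    thus ?thesis using P'v(2) by simp
  qed
  define ca where "ca j = (if j < n then a ! j else u0)" for j
  have la: "length a = n" and aU: "set a \<subseteq> univ U" using a by (auto simp: tuples_def)
  have caenv: "ca \<in> envs" using aU la u0 by (intro envsI) (auto simp: ca_def)
  \<comment> \<open>The entries of \<open>a\<close> are turned back into variables, which leaves
    parameters from \<open>A\<close> and the far elements only.\<close>
  define cc where "cc = case_sum (\<lambda>_ :: nat. u0) ca"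
  have "ca ` {..<n} = set a" using la by (auto simp: ca_def in_set_conv_nth)
  hence "cc ` (Inr ` {..<n}) = set a" by (simp add: cc_def image_image)
  moreover have "dfn (?A' \<union> set a) (Inl ` {..<m i}) (\<lambda>g :: nat + nat \<Rightarrow> 'm. P' (W (g \<circ> Inl)))" by (rule dfn_reindex[OF dW order_refl])
  ultimately have "dfn (?A' \<union> cc ` (Inr ` {..<n})) (Inl ` {..<m i}) (\<lambda>g :: nat + nat \<Rightarrow> 'm. P' (W (g \<circ> Inl)))" by simp
  from dfn_unfix_ex[OF this] obtain Q where Q: "dfn ?A' (Inl ` {..<m i} \<union> Inr ` {..<n}) Q"
    "\<forall>g\<in>envs. (\<forall>v\<in>Inr ` {..<n}. g v = cc v) \<longrightarrow> (Q g \<longleftrightarrow> P' (W (g \<circ> Inl)))" by (elim exE conjE)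
  let ?xs = "map Inr [0..<n] @ map Inl [0..<m i] :: (nat + nat) list"
  have "\<exists>p\<in>pfmlas L ?A' (length ?xs). \<forall>g\<in>envs. psat U p (map g ?xs) \<longleftrightarrow> Q g"
    by (rule dfn_pfm_ex[OF Q(1)]) auto
  then obtain p where p: "p \<in> pfmlas L ?A' (length ?xs)" "\<forall>g\<in>envs. psat U p (map g ?xs) \<longleftrightarrow> Q g" by (elim bexE)
  have val: "psat U p (a @ map y [0..<m i]) \<longleftrightarrow> P' (W y)" if y: "y \<in> envs" for y
  proof -
    have env: "case_sum y ca \<in> envs" using envsD[OF y] envsD[OF caenv] by (intro envsI) (simp split: sum.split)
    have "map ca [0..<n] = a" using la by (intro nth_equalityI) (auto simp: ca_def)
    hence "map (case_sum y ca) ?xs = a @ map y [0..<m i]" by (simp add: comp_def)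
    hence "psat U p (a @ map y [0..<m i]) \<longleftrightarrow> Q (case_sum y ca)" using p(2) env by metis
    also have "\<dots> = P' (W (case_sum y ca \<circ> Inl))" by (rule Q(2)[rule_format, OF env]) (auto simp: cc_def)
    also have "case_sum y ca \<circ> Inl = y" by (rule ext) simp
    finally show ?thesis .
  qed
  have yenv: "(\<lambda>c. ?H ((i, x), c)) \<in> envs" for x using envsD[OF H] by (intro envsI)
  show ?thesis
  proof (intro bexI[of _ p] conjI allI impI)
    show "psat U p (a @ map (\<lambda>c. ?H ((i, (False, q)), c)) [0..<m i])" if "-1 < q" for q
      unfolding val[OF yenv] by (rule left[OF that])
    show "\<not> psat U p (a @ map (\<lambda>c. ?H ((i, (True, q)), c)) [0..<m i])" if "q < 1" for q
      unfolding val[OF yenv] by (rule right[OF that])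
    show "p \<in> pfmlas L ?A' (n + m i)" using p(1) by simp
  qed
qed

subsection \<open>Changing the base of a pattern\<close>

text \<open>A pattern over \<open>A\<close> has to become indiscernible over a prescribed set
  \<open>C\<close> as well. Extraction yields an array that is indiscernible over
  \<open>A \<union> C\<close> and has the old type over \<open>A\<close>; moving \<open>a\<close>
  along with it to \<open>a'\<close> preserves the truth of all formulas over
  \<open>A\<close>.\<close>

lemma base_change_pattern:
  fixes h :: "('x \<times> 'j) \<times> nat \<Rightarrow> 'm"
  assumes mi: "mi A Y r m h" and h: "h \<in> envs" and A: "|A| <o kb" "A \<subseteq> univ U" and Y: "|Y| <o kb"
    and C: "|C| <o kb" "C \<subseteq> univ U"
    and r: "\<And>i. i \<in> Y \<Longrightarrow> Linear_order (r i)" "\<And>i. i \<in> Y \<Longrightarrow> infinite (Field (r i))" "\<And>i. i \<in> Y \<Longrightarrow> |Field (r i)| <o kb"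
    and a: "a \<in> tuples U n"
  shows "\<exists>h'\<in>envs. \<exists>a'\<in>tuples U n. mi (A \<union> C) Y r m h' \<and> (\<forall>p\<in>pfmlas L A n. psat U p a' \<longleftrightarrow> psat U p a) \<and>
    (\<forall>i\<in>Y. \<forall>t\<in>Field (r i). \<forall>p\<in>pfmlas L A (n + m i).
      psat U p (a' @ map (\<lambda>c. h' ((i, t), c)) [0..<m i]) \<longleftrightarrow> psat U p (a @ map (\<lambda>c. h ((i, t), c)) [0..<m i]))"
proof (rule extraction[OF h _ _ Y r(1,2) r(1,3), where A = "A \<union> C" and m = m])
  show "|A \<union> C| <o kb" "A \<union> C \<subseteq> univ U" using small_Un A C by auto
  fix h' assume h': "h' \<in> envs" "mi (A \<union> C) Y r m h'"
    "\<And>S P. finite S \<Longrightarrow> S \<subseteq> rdom Y r \<Longrightarrow> dfn (A \<union> C) (vs m S) P \<Longrightarrow>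
       (\<And>\<sigma>. rmono r r S \<sigma> \<Longrightarrow> P (h \<circ> lift \<sigma>)) \<Longrightarrow> P h'"
  let ?V = "vs m (rdom Y r)"
  have hh: "teq A ?V h' h"
  proof (rule teq_finite)
    fix S0 assume S0: "finite S0" "S0 \<subseteq> ?V"
    define S where "S = fst ` S0"
    have S: "finite S" "S \<subseteq> rdom Y r" using S0 by (auto simp: S_def vs_def)
    have "S0 \<subseteq> vs m S" using S0(2) by (force simp: S_def vs_def)
    show "teq A S0 h' h"
      unfolding teq_def
    proof (intro allI impI)
      fix P assume "dfn A S0 P"
      hence P: "dfn A (vs m S) P" by (rule dfn_mono[OF _ order_refl \<open>S0 \<subseteq> vs m S\<close>])
      show "P h' = P h"
      proof (rule h'(3)[OF S, of "\<lambda>g. P g \<longleftrightarrow> P h"])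
        show "dfn (A \<union> C) (vs m S) (\<lambda>g. P g \<longleftrightarrow> P h)" by (rule dfn_iff[OF dfn_mono[OF P] dfn_const]) auto
        fix \<sigma> assume "rmono r r S \<sigma>"
        hence "teq A (vs m S) h (h \<circ> lift \<sigma>)" using mi S unfolding mi_def by blast
        thus "P (h \<circ> lift \<sigma>) = P h" using teqD[OF _ P] by blast
      qed
    qed
  qed
  have la: "length a = n" and aU: "set a \<subseteq> univ U" using a by (auto simp: tuples_def)
  define ca where "ca j = (if j < n then a ! j else u0)" for j
  have caenv: "ca \<in> envs" using aU la u0 by (intro envsI) (auto simp: ca_def)
  have mapa: "map ca [0..<n] = a" using la by (intro nth_equalityI) (auto simp: ca_def)
  have env: "case_sum h ca \<in> envs" "case_sum h' ca \<in> envs"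
    using envsD[OF h] envsD[OF h'(1)] envsD[OF caenv] by (auto intro!: envsI split: sum.split)
  have t: "teq A (Inl ` ?V) (case_sum h ca) (case_sum h' ca)"
    unfolding teq_def
  proof (intro allI impI)
    fix P :: "((('x \<times> 'j) \<times> nat) + nat \<Rightarrow> 'm) \<Rightarrow> bool" assume P: "dfn A (Inl ` ?V) P"
    have "dfn A ?V (\<lambda>g. P (\<lambda>v. case_sum g id (map_sum id ca v)))"
      by (rule dfn_subst[OF P]) (use envsD[OF caenv] in \<open>auto simp: map_sum_def split: sum.splits\<close>)
    moreover have "(\<lambda>v. case_sum g id (map_sum id ca v)) = case_sum g ca" for g :: "('x \<times> 'j) \<times> nat \<Rightarrow> 'm"
      by (rule ext) (simp split: sum.split)
    ultimately have "dfn A ?V (\<lambda>g. P (case_sum g ca))" by simp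
    from teqD[OF hh this] show "P (case_sum h ca) = P (case_sum h' ca)" by simp
  qed
  let ?W = "Inl ` ?V \<union> Inr ` {..<n}"
  have "\<exists>k\<in>envs. (\<forall>v\<in>Inl ` ?V. k v = case_sum h' ca v) \<and> teq A ?W k (case_sum h ca)"
  proof (rule extend_type[OF _ A env _ t])
    show "|?W| <o kb" by (rule small_Un[OF small_image[OF small_vs[OF Y r(3)]] small_finite]) simp_all
  qed simp
  then obtain k where k: "k \<in> envs" "\<forall>v\<in>Inl ` ?V. k v = case_sum h' ca v" "teq A ?W k (case_sum h ca)" by (elim bexE conjE)
  define a' where "a' = map (\<lambda>j. k (Inr j)) [0..<n]"
  have at: "a' \<in> tuples U n" using envsD[OF k(1)] by (auto simp: a'_def tuples_def)
  have xs: "psat U p (map k xs) = psat U p (map (case_sum h ca) xs)" if "p \<in> pfmlas L A (length xs)" "set xs \<subseteq> ?W" for p xs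
    by (rule teqD[OF k(3) dfn_mono[OF pfm_imp_dfn[OF that(1)] order_refl that(2)]])
  have 1: "psat U p a' = psat U p a" if "p \<in> pfmlas L A n" for p
  proof -
    have "psat U p (map k (map Inr [0..<n])) \<longleftrightarrow> psat U p (map (case_sum h ca) (map Inr [0..<n]))"
      by (rule xs) (use that in auto)
    thus ?thesis using mapa by (simp add: a'_def comp_def)
  qed
  have 2: "psat U p (a' @ map (\<lambda>c. h' ((i, t), c)) [0..<m i]) \<longleftrightarrow> psat U p (a @ map (\<lambda>c. h ((i, t), c)) [0..<m i])"
    if "i \<in> Y" "t \<in> Field (r i)" and p: "p \<in> pfmlas L A (n + m i)" for i t p
  proof -
    let ?xs = "map Inr [0..<n] @ map (\<lambda>c. Inl ((i, t), c)) [0..<m i]"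
    have inV: "((i, t), c) \<in> ?V" if "c < m i" for c using that \<open>i \<in> Y\<close> \<open>t \<in> Field (r i)\<close> by (simp add: vs_def)
    have "map k ?xs = a' @ map (\<lambda>c. h' ((i, t), c)) [0..<m i]" using inV k(2) by (auto simp: a'_def)
    moreover have "map (case_sum h ca) ?xs = a @ map (\<lambda>c. h ((i, t), c)) [0..<m i]" using mapa by (simp add: comp_def)
    moreover have "psat U p (map k ?xs) = psat U p (map (case_sum h ca) ?xs)" by (rule xs) (use p inV in auto)
    ultimately show ?thesis by metis
  qed
  show ?thesis by (intro bexI[OF _ h'(1)] bexI[OF _ at] conjI ballI h'(2) 1 2)
qed (use r in simp_all)

text \<open>Constants from the base, appended to every tuple of a row, do not disturb
  indiscernibility over that base. In this way parameters of crossing formulas become coordinates of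
  the sequences.\<close>

lemma mi_absorb:
  assumes mi: "mi A X r m h" and h: "h \<in> envs" and A: "A \<subseteq> univ U" and d: "\<And>i. i \<in> X \<Longrightarrow> set (d i) \<subseteq> A"
  shows "mi A X r (\<lambda>i. m i + length (d i)) (\<lambda>v. if snd v < m (fst (fst v)) then h v
    else if fst (fst v) \<in> X \<and> snd v < m (fst (fst v)) + length (d (fst (fst v))) then d (fst (fst v)) ! (snd v - m (fst (fst v))) else u0)"
    (is "mi A X r ?m ?h")
  unfolding mi_def
proof (intro allI impI, elim conjE)
  fix S \<tau> assume S: "finite S" "S \<subseteq> rdom X r" and \<tau>: "rmono r r S \<tau>"
  define cst where "cst v = (if fst (fst v) \<in> X \<and> m (fst (fst v)) \<le> snd v \<and> snd v < ?m (fst (fst v))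
    then d (fst (fst v)) ! (snd v - m (fst (fst v))) else u0)" for v :: "('a \<times> 'b) \<times> nat"
  define T :: "(('a \<times> 'b) \<times> nat) set" where "T = {v. m (fst (fst v)) \<le> snd v}"
  have cA: "cst v \<in> A" if "fst (fst v) \<in> X" "m (fst (fst v)) \<le> snd v" "snd v < ?m (fst (fst v))" for v
  proof -
    have "d (fst (fst v)) ! (snd v - m (fst (fst v))) \<in> set (d (fst (fst v)))" using that by (intro nth_mem) auto
    thus ?thesis using d[OF that(1)] that by (auto simp: cst_def)
  qed
  have cenv: "cst \<in> envs"
  proof (rule envsI)
    fix v show "cst v \<in> univ U" using cA[of v] A u0 by (auto simp: cst_def)
  qed
  have heq: "?h = (\<lambda>v. if v \<in> T then cst v else h v)" by (rule ext) (auto simp: T_def cst_def)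
  have t: "teq A (vs m S) h (h \<circ> lift \<tau>)" using mi S \<tau> unfolding mi_def by blast
  show "teq A (vs ?m S) ?h (?h \<circ> lift \<tau>)"
    unfolding teq_def
  proof (intro allI impI)
    fix P assume P: "dfn A (vs ?m S) P"
    have "dfn A (vs m S) (\<lambda>g. P (\<lambda>v. if v \<in> T then cst v else g v))"
    proof (rule dfn_fix[OF P cenv order_refl])
      show "cst ` (vs ?m S \<inter> T) \<subseteq> A" using cA domD[OF S(2)] by (fastforce simp: vs_def T_def)
      show "vs ?m S - T \<subseteq> vs m S" by (auto simp: vs_def T_def)
    qed
    from teqD[OF t this] have "P ?h \<longleftrightarrow> P (\<lambda>v. if v \<in> T then cst v else (h \<circ> lift \<tau>) v)" unfolding heq by simp
    also have "\<dots> = P (?h \<circ> lift \<tau>)"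
    proof (rule dfn_local[OF P envs_merge[OF cenv envs_comp[OF h]]])
      show "?h \<circ> lift \<tau> \<in> envs" unfolding heq by (rule envs_comp[OF envs_merge[OF cenv h]])
      fix v assume "v \<in> vs ?m S"
      then obtain p c where v: "v = (p, c)" "p \<in> S" by (auto simp: vs_def)
      thus "(if v \<in> T then cst v else (h \<circ> lift \<tau>) v) = (?h \<circ> lift \<tau>) v"
        using rmonoD(1)[OF \<tau> v(2)] unfolding heq by (simp add: T_def cst_def)
    qed
    finally show "P ?h = P (?h \<circ> lift \<tau>)" .
  qed
qed

text \<open>The middle parts of the rows are mutually indiscernible over \<open>A\<close> and the
  far elements. After the change of base to include \<open>B\<close>, the parameters of
  \<open>p i\<close> are absorbed into row \<open>i\<close>. The remaining formulas have no
  parameters; they hold at infinitely many places left of the cut and fail at infinitely many right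
  of it.\<close>

theorem crossing_pattern:
  fixes H :: "('k \<times> (bool \<times> rat)) \<times> nat \<Rightarrow> 'm" and \<kappa> :: "'k rel"
  assumes mi: "mi A Y lexr m H" and H: "H \<in> envs" and A: "|A| <o kb" "A \<subseteq> univ U" and Y: "|Y| <o kb"
    and B: "small_subset U kb B" and a: "realizes U n \<pi> a" and \<pi>: "\<pi> \<subseteq> pfmlas L A n"
    and f: "inj_on f (Field \<kappa>)" "f ` Field \<kappa> \<subseteq> Y"
    and p: "\<And>i. i \<in> f ` Field \<kappa> \<Longrightarrow> p i \<in> pfmlas L (A \<union> H ` vs m (Y \<times> farpos)) (n + m i)"
      "\<And>i q. i \<in> f ` Field \<kappa> \<Longrightarrow> -1 < q \<Longrightarrow> psat U (p i) (a @ map (\<lambda>c. H ((i, (False, q)), c)) [0..<m i])"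
      "\<And>i q. i \<in> f ` Field \<kappa> \<Longrightarrow> q < 1 \<Longrightarrow> \<not> psat U (p i) (a @ map (\<lambda>c. H ((i, (True, q)), c)) [0..<m i])"
  shows "dlr_pattern L U kb B n \<pi> \<kappa>"
proof -
  define A' where "A' = A \<union> H ` vs m (Y \<times> farpos)"
  have at: "a \<in> tuples U n" using a by (simp add: realizes_def)
  have Bs: "|B| <o kb" "B \<subseteq> univ U" using B by (auto simp: small_subset_def)
  have A': "|A'| <o kb" "A' \<subseteq> univ U"
  proof -
    have "|vs m (rdom Y lexr)| <o kb" by (rule small_vs[OF Y]) (simp add: small_countable)
    hence "|vs m (Y \<times> farpos)| <o kb" by (rule small_subset_mono) (auto simp: vs_def)
    thus "|A'| <o kb" using A(1) by (simp add: A'_def small_Un small_image)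
    show "A' \<subseteq> univ U" using A(2) envsD[OF H] by (auto simp: A'_def)
  qed
  have mid: "mi A' Y midr m H" unfolding A'_def by (rule mi_midpos[OF mi H])
  have infL: "infinite {(False, q) | q :: rat. -1 < q}" and infR: "infinite {(True, q) | q :: rat. q < 1}"
  proof -
    have e: "{(False, q) | q :: rat. -1 < q} = Pair False ` {-1<..}" "{(True, q) | q :: rat. q < 1} = Pair True ` {..<1}" by auto
    have "infinite {-1 :: rat<..}" "infinite {..<1 :: rat}" by (simp_all add: infinite_Ioi infinite_Iio)
    thus "infinite {(False, q) | q :: rat. -1 < q}" "infinite {(True, q) | q :: rat. q < 1}"
      unfolding e by (simp_all add: finite_image_iff inj_on_def)
  qed
  have midinf: "infinite midpos"
    using infL by (rule infinite_super[rotated]) (auto simp: midpos_def)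
  have midF: "infinite (Field (midr i))" "|Field (midr i)| <o kb" for i :: 'k by (simp_all add: midinf small_countable)
  obtain h' a' where h': "h' \<in> envs" "a' \<in> tuples U n" "mi (A' \<union> B) Y midr m h'" "\<forall>p\<in>pfmlas L A' n. psat U p a' \<longleftrightarrow> psat U p a"
    "\<forall>i\<in>Y. \<forall>t\<in>Field (midr i). \<forall>p\<in>pfmlas L A' (n + m i).
      psat U p (a' @ map (\<lambda>c. h' ((i, t), c)) [0..<m i]) \<longleftrightarrow> psat U p (a @ map (\<lambda>c. H ((i, t), c)) [0..<m i])"
    using base_change_pattern[OF mid H A' Y Bs Linear_order_midr midF at] by (elim bexE conjE)
  define X where "X = f ` Field \<kappa>"
  define d where "d i = snd (p i)" for i
  have d: "set (d i) \<subseteq> A' \<union> B" if "i \<in> X" for i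
    using p(1) that unfolding X_def A'_def[symmetric] pfmlas_def d_def by fastforce
  define m' where "m' i = m i + length (d i)" for i
  define hh where "hh v = (if snd v < m (fst (fst v)) then h' v
    else if fst (fst v) \<in> X \<and> snd v < m (fst (fst v)) + length (d (fst (fst v))) then d (fst (fst v)) ! (snd v - m (fst (fst v))) else u0)"
    for v :: "('k \<times> (bool \<times> rat)) \<times> nat"
  have AB: "A' \<union> B \<subseteq> univ U" using A'(2) Bs(2) by simp
  have "mi (A' \<union> B) X midr m h'"
    using h'(3) f(2) unfolding mi_def X_def by (meson Sigma_mono order_refl order_trans)
  hence mihh: "mi (A' \<union> B) X midr m' hh"
    unfolding hh_def[abs_def] m'_def[abs_def] by (rule mi_absorb[OF _ h'(1) AB d])
  have hhenv: "hh \<in> envs"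
  proof (rule envsI)
    fix v :: "('k \<times> (bool \<times> rat)) \<times> nat"
    have "d (fst (fst v)) ! (snd v - m (fst (fst v))) \<in> univ U" if "fst (fst v) \<in> X" "\<not> snd v < m (fst (fst v))" "snd v < m (fst (fst v)) + length (d (fst (fst v)))"
      using d[OF that(1)] AB nth_mem[of "snd v - m (fst (fst v))" "d (fst (fst v))"] that by fastforce
    thus "hh v \<in> univ U" using envsD[OF h'(1)] u0 by (simp add: hh_def)
  qed
  obtain g :: "bool \<times> rat \<Rightarrow> 'k" where g: "inj g" using countable_inj by (rule exE)
  define rk where "rk = dir_image (midr ()) g"
  have rk: "Linear_order rk" unfolding rk_def by (rule Linear_order_dir_image[OF Linear_order_midr inj_on_subset[OF g subset_UNIV]])
  have Frk: "Field rk = g ` midpos" by (simp add: rk_def dir_image_Field)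
  define K where "K i = (rk, \<lambda>t. map (\<lambda>c. hh ((i, inv g t), c)) [0..<m' i])" for i
  have seqK: "sequence_of U (m' i) (K i)" for i
    using sequence_of_row[OF hhenv rk, of "m' i" "\<lambda>t. (i, inv g t)"] by (simp add: K_def)
  have "mutually_indiscernible L U (A' \<union> B) X K"
  proof (rule mutually_indiscernible_mi[of _ _ _ m' "hh \<circ> lift (\<lambda>p. (fst p, inv g (snd p)))"])
    have rm: "rmono (\<lambda>i. fst (K i)) midr (rdom X (\<lambda>i. fst (K i))) (\<lambda>p. (fst p, inv g (snd p)))"
    proof (rule rmonoI)
      fix x y assume *: "x \<in> rdom X (\<lambda>i. fst (K i))" "y \<in> rdom X (\<lambda>i. fst (K i))" "fst x = fst y"
        "(snd x, snd y) \<in> fst (K (fst x))" "snd x \<noteq> snd y"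
      obtain u v where "snd x = g u" "snd y = g v" using *(1,2) by (auto simp: K_def Frk)
      thus "(snd (fst x, inv g (snd x)), snd (fst y, inv g (snd y))) \<in> midr (fst x) \<and> snd (fst x, inv g (snd x)) \<noteq> snd (fst y, inv g (snd y))"
        using *(4,5) g by (auto simp: K_def rk_def dir_image_iff midr_def)
    qed (use g in \<open>auto simp: K_def Frk\<close>)
    show "mi (A' \<union> B) X (\<lambda>i. fst (K i)) m' (hh \<circ> lift (\<lambda>p. (fst p, inv g (snd p))))"
      by (rule mi_reindex[OF mihh hhenv Linear_order_midr _ rm]) (simp add: K_def rk)
    show "(hh \<circ> lift (\<lambda>p. (fst p, inv g (snd p)))) ((i, t), c) = snd (K i) t ! c" if "i \<in> X" "t \<in> idx (K i)" "c < m' i" for i t c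
      using that by (simp add: K_def)
  qed (use seqK envs_comp[OF hhenv] in auto)
  hence mut: "mutually_indiscernible L U B (Field \<kappa>) (\<lambda>i. K (f i))"
    by (rule mutually_indiscernible_inj[OF _ f(1)]) (auto simp: X_def)
  have row: "psat U (fst (p i), []) (a' @ snd (K i) (g x)) \<longleftrightarrow> psat U (p i) (a @ map (\<lambda>c. H ((i, x), c)) [0..<m i])"
    if i: "i \<in> X" and x: "x \<in> midpos" for i x
  proof -
    have e: "snd (K i) (g x) = map (\<lambda>c. h' ((i, x), c)) [0..<m i] @ d i"
      by (rule nth_equalityI) (auto simp: K_def m'_def hh_def g i nth_append)
    have "psat U (fst (p i), []) (a' @ snd (K i) (g x)) \<longleftrightarrow> psat U (p i) (a' @ map (\<lambda>c. h' ((i, x), c)) [0..<m i])"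
      unfolding e psat_def d_def by simp
    also have "\<dots> \<longleftrightarrow> psat U (p i) (a @ map (\<lambda>c. H ((i, x), c)) [0..<m i])"
      using h'(5) i x p(1)[of i] f(2) unfolding X_def A'_def Field_midr by blast
    finally show ?thesis .
  qed
  have Kidx: "g x \<in> idx (K i)" if "x \<in> midpos" for x i using that by (simp add: K_def Frk)
  have "realizes U n \<pi> a'"
    using a h'(2,4) \<pi> unfolding realizes_def A'_def pfmlas_def by (force simp: subset_iff)
  moreover have "small_seq kb (K i)" for i
    unfolding small_seq_def by (rule small_countable) (simp add: K_def Frk)
  moreover have "(fst (p (f i)), []) \<in> pfmlas L B (n + m' (f i))" if "i \<in> Field \<kappa>" for i
    using p(1)[of "f i"] that by (auto simp: pfmlas_def m'_def d_def add.assoc)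
  moreover have "infinite {j \<in> idx (K (f i)). psat U (fst (p (f i)), []) (a' @ snd (K (f i)) j)}" if i: "i \<in> Field \<kappa>" for i
  proof (rule infinite_super)
    show "infinite (g ` {(False, q) | q. -1 < q})" using infL g by (simp add: finite_image_iff inj_on_subset[OF g])
    show "g ` {(False, q) | q. -1 < q} \<subseteq> {j \<in> idx (K (f i)). psat U (fst (p (f i)), []) (a' @ snd (K (f i)) j)}"
      using i row[of "f i"] p(2)[of "f i"] Kidx by (auto simp: X_def midpos_def)
  qed
  moreover have "infinite {j \<in> idx (K (f i)). \<not> psat U (fst (p (f i)), []) (a' @ snd (K (f i)) j)}" if i: "i \<in> Field \<kappa>" for i
  proof (rule infinite_super)
    show "infinite (g ` {(True, q) | q. q < 1})" using infR g by (simp add: finite_image_iff inj_on_subset[OF g])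
    show "g ` {(True, q) | q. q < 1} \<subseteq> {j \<in> idx (K (f i)). \<not> psat U (fst (p (f i)), []) (a' @ snd (K (f i)) j)}"
      using i row[of "f i"] p(3)[of "f i"] Kidx by (auto simp: X_def midpos_def)
  qed
  ultimately show ?thesis
    unfolding dlr_pattern_def
    by (intro exI[of _ a'] exI[of _ "\<lambda>i. K (f i)"] exI[of _ "\<lambda>i. m' (f i)"] exI[of _ "\<lambda>i. (fst (p (f i)), [])"] conjI ballI mut seqK)
qed

subsection \<open>Bounded op-dimension implies stability outside a small set\<close>

text \<open>A monotone map is a composition of maps that move one row each, so it is enough that
  single moves in the rows of \<open>Z\<close> preserve the type over the base.\<close>

lemma joined_row_by_row:
  assumes H: "H \<in> envs" and ZY: "Z \<subseteq> Y"
    and good: "\<And>i S \<tau>. i \<in> Z \<Longrightarrow> finite S \<Longrightarrow> S \<subseteq> Y \<times> UNIV \<Longrightarrow> rmono lexr lexr S \<tau> \<Longrightarrow>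
      (\<And>p. p \<in> S \<Longrightarrow> fst p \<noteq> i \<Longrightarrow> \<tau> p = p) \<Longrightarrow> teq A (vs m S) H (H \<circ> lift \<tau>)"
  shows "mi A Z lexr m H"
  unfolding mi_def
proof (intro allI impI, elim conjE)
  fix S \<tau> assume S: "finite S" "S \<subseteq> rdom Z lexr" and \<tau>: "rmono lexr lexr S \<tau>"
  define t where "t R p = (if fst p \<in> R then \<tau> p else p)" for R p
  have tfst: "fst (t R p) = fst p" if "p \<in> S" for R p using rmonoD(1)[OF \<tau> that] by (simp add: t_def)
  have "teq A (vs m S) H (H \<circ> lift (t R))" if "finite R" "R \<subseteq> Z" for R
    using that
  proof (induction R)
    case empty
    have "t {} = id" by (rule ext) (simp add: t_def)
    thus ?case by (simp add: map_prod.id teq_refl)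
  next
    case (insert i R)
    define t' where "t' p = (if fst p = i then \<tau> p else p)" for p
    have inS: "(i, s) \<in> S" if im: "(i, s) \<in> t R ` S" for s
    proof -
      from im obtain p where p: "p \<in> S" "t R p = (i, s)" by force
      hence "fst p = i" using tfst[OF p(1), of R] by simp
      thus ?thesis using p insert.hyps(2) by (simp add: t_def)
    qed
    have "teq A (vs m (t R ` S)) H (H \<circ> lift t')"
    proof (rule good[of i])
      show "i \<in> Z" using insert.prems by simp
      show "finite (t R ` S)" using S(1) by simp
      show "t R ` S \<subseteq> Y \<times> UNIV"
      proof
        fix x assume "x \<in> t R ` S"
        then obtain p where p: "p \<in> S" "x = t R p" by blast
        thus "x \<in> Y \<times> UNIV" using tfst[OF p(1), of R] domD[OF S(2) p(1)] ZY by (auto simp: mem_Times_iff)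
      qed
      show "rmono lexr lexr (t R ` S) t'"
      proof (rule lex_rmonoI)
        fix p assume "p \<in> t R ` S"
        thus "fst (t' p) = fst p" using inS[of "snd p"] rmonoD(1)[OF \<tau>, of p] by (cases p) (auto simp: t'_def)
      next
        fix j s s' assume s: "(j, s) \<in> t R ` S" "(j, s') \<in> t R ` S" "s < s'"
        show "snd (t' (j, s)) < snd (t' (j, s'))"
        proof (cases "j = i")
          case True
          thus ?thesis using lex_rmonoD[OF \<tau> inS inS s(3)] s(1,2) by (simp add: t'_def)
        qed (use s(3) in \<open>simp add: t'_def\<close>)
      qed
      show "t' p = p" if "fst p \<noteq> i" for p using that by (simp add: t'_def)
    qed
    hence "teq A (vs m S) (H \<circ> lift (t R)) (H \<circ> lift t' \<circ> lift (t R))"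
      by (rule teq_reindex) (rule lift_vs2, simp add: tfst)
    moreover have "teq A (vs m S) (H \<circ> lift t' \<circ> lift (t R)) (H \<circ> lift (t (insert i R)))"
    proof (rule teq_agree)
      fix v assume "v \<in> vs m S"
      then obtain p c where v: "v = (p, c)" "p \<in> S" by (auto simp: vs_def)
      have "t' (t R p) = t (insert i R) p" using rmonoD(1)[OF \<tau> v(2)] insert.hyps(2) by (auto simp: t_def t'_def)
      thus "(H \<circ> lift t' \<circ> lift (t R)) v = (H \<circ> lift (t (insert i R))) v" using v(1) by simp
    qed (intro envs_comp H)+
    ultimately show ?case using insert.IH insert.prems by (meson insert_subset teq_trans)
  qed
  from this[of "fst ` S"] have "teq A (vs m S) H (H \<circ> lift (t (fst ` S)))" using S by force
  moreover have "teq A (vs m S) (H \<circ> lift (t (fst ` S))) (H \<circ> lift \<tau>)"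
  proof (rule teq_agree)
    fix v assume "v \<in> vs m S"
    then obtain p c where v: "v = (p, c)" "p \<in> S" by (auto simp: vs_def)
    thus "(H \<circ> lift (t (fst ` S))) v = (H \<circ> lift \<tau>) v" by (simp add: t_def)
  qed (intro envs_comp H)+
  ultimately show "teq A (vs m S) H (H \<circ> lift \<tau>)" by (rule teq_trans)
qed

text \<open>After the outer halves have been extracted over \<open>A\<close>, \<open>a\<close> and
  all the \<open>I i\<close>, indiscernibility over \<open>a\<close> can fail only by crossing a
  cut. Rows in which no single move changes the type over \<open>a\<close> can be moved together, so
  just the bad rows are discarded, and each of these supplies a crossing formula.\<close>

theorem no_pattern_imp_mutually_stable:
  fixes I :: "'k \<Rightarrow> ('k, 'm) tseq" and \<kappa> :: "'k rel"
  assumes B: "small_subset U kb B" and no: "\<not> dlr_pattern L U kb B n \<pi> \<kappa>" and \<kappa>: "Card_order \<kappa>"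
    and A: "small_subset U kb A" and \<pi>: "\<pi> \<subseteq> pfmlas L A n" and Y: "|Y| <o kb"
    and st: "mutually_stable L U kb A Y I" and a: "realizes U n \<pi> a"
  shows "\<exists>X\<subseteq>Y. |X| <o \<kappa> \<and> mutually_stable L U kb (A \<union> set a) (Y - X) I"
proof -
  obtain J0 J1 :: "'k \<Rightarrow> ('k, 'm) tseq" where J: "\<forall>i\<in>Y. small_seq kb (J0 i) \<and> small_seq kb (J1 i) \<and>
      infinite (idx (J0 i)) \<and> infinite (idx (J1 i)) \<and> indiscernible L U {} (J0 i \<oplus>\<^sub>s I i \<oplus>\<^sub>s J1 i)"
    and mut: "mutually_indiscernible L U A Y (\<lambda>i. J0 i \<oplus>\<^sub>s J1 i)"
    using st unfolding mutually_stable_def by (elim exE conjE) (rule that, assumption+)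
  let ?J = "\<lambda>i. J0 i \<oplus>\<^sub>s I i \<oplus>\<^sub>s J1 i"
  have Is: "small_seq kb (I i)" "indiscernible L U {} (I i)" if "i \<in> Y" for i
    using st that unfolding mutually_stable_def by blast+
  have "\<forall>i\<in>Y. \<exists>m. sequence_of U m (?J i)"
    using J unfolding indiscernible_def by blast
  hence "\<exists>m. \<forall>i\<in>Y. sequence_of U (m i) (?J i)" by (rule bchoice)
  then obtain m where m: "\<forall>i\<in>Y. sequence_of U (m i) (?J i)" by (rule exE)
  have seqs: "sequence_of U (m i) (J0 i)" "sequence_of U (m i) (I i)" "sequence_of U (m i) (J1 i)"
      "sequence_of U (m i) (?J i)" "sequence_of U (m i) (J0 i \<oplus>\<^sub>s J1 i)" if "i \<in> Y" for i
    using m that by (auto simp: sequence_of_append)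
  have As: "|A| <o kb" "A \<subseteq> univ U" using A by (auto simp: small_subset_def)
  have at: "a \<in> tuples U n" using a by (simp add: realizes_def)
  hence aU: "set a \<subseteq> univ U" by (auto simp: tuples_def)
  define h2 where "h2 = senv Y m (\<lambda>i. J0 i \<oplus>\<^sub>s J1 i)"
  have h2: "h2 \<in> envs" unfolding h2_def by (rule senv_envs) (rule seqs(5))
  define r where "r p = fst ((if snd p then J1 else J0) (fst p))" for p :: "'k \<times> bool"
  define emb :: "bool \<Rightarrow> 'k \<Rightarrow> 'k + 'k" where "emb b t = (if b then Inr t else Inl t)" for b t
  \<comment> \<open>Each row is split into its halves: over a base containing \<open>a\<close>,
    indiscernibility can be enforced within the halves but not across the cut.\<close>
  define h where "h = h2 \<circ> (\<lambda>v. ((fst (fst (fst v)), emb (snd (fst (fst v))) (snd (fst v))), snd v))"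
  have henv: "h \<in> envs" unfolding h_def by (rule envs_comp[OF h2])
  have hval: "h (((i, b), t), c) = snd ((if b then J1 else J0) i) t ! c" if "i \<in> Y" "t \<in> Field (r (i, b))" "c < m i" for i b t c
    using that by (auto simp: h_def h2_def senv_def emb_def r_def)
  define E where "E = A \<union> set a \<union> (\<Union>i\<in>Y. elems (I i))"
  have E: "|E| <o kb" "E \<subseteq> univ U"
  proof -
    have "|elems (I i)| <o kb" if "i \<in> Y" for i
      unfolding elems_def using Is(1)[OF that] by (intro small_UN) (auto simp: small_seq_def small_finite)
    hence "|\<Union>i\<in>Y. elems (I i)| <o kb" by (rule small_UN[OF Y])
    moreover have "|set a| <o kb" by (simp add: small_finite)
    ultimately show "|E| <o kb" unfolding E_def by (intro small_Un As(1))
    have "elems (I i) \<subseteq> univ U" if "i \<in> Y" for i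
      using seqs(2)[OF that] by (auto simp: elems_def sequence_of_def tuples_def)
    thus "E \<subseteq> univ U" using As aU by (auto simp: E_def)
  qed
  have linr: "Linear_order (r p)" "infinite (Field (r p))" if "p \<in> Y \<times> UNIV" for p
    using that seqs(1,3)[of "fst p"] J by (auto simp: r_def sequence_of_def)
  show ?thesis
  proof (rule extraction[OF henv E _ linr, where X = "Y \<times> UNIV" and r' = "\<lambda>_. le_rel :: rat rel" and m = "\<lambda>p. m (fst p)"])
    show "|Y \<times> (UNIV :: bool set)| <o kb" by (rule small_Sigma[OF Y]) (simp add: small_finite)
    show "Linear_order (le_rel :: rat rel)" by (rule Linear_order_le_rel)
    show "|Field (le_rel :: rat rel)| <o kb" by (rule small_countable) simp
    fix h' :: "(('k \<times> bool) \<times> rat) \<times> nat \<Rightarrow> 'm" assume h': "h' \<in> envs" "mi E (Y \<times> UNIV) (\<lambda>_. le_rel) (\<lambda>p. m (fst p)) h'"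
      "\<And>S P. finite S \<Longrightarrow> S \<subseteq> rdom (Y \<times> UNIV) (\<lambda>_. le_rel) \<Longrightarrow> dfn E (vs (\<lambda>p. m (fst p)) S) P \<Longrightarrow>
         (\<And>\<sigma>. rmono (\<lambda>_. le_rel) r S \<sigma> \<Longrightarrow> P (h \<circ> lift \<sigma>)) \<Longrightarrow> P h'"
    have EM: "P h'" if "finite S" "fst ` fst ` S \<subseteq> Y'" "Y' \<subseteq> Y" "dfn E (vs (\<lambda>p. m (fst p)) S) P"
      "\<And>\<sigma>. rmono (\<lambda>_. le_rel) r S \<sigma> \<Longrightarrow> P (h \<circ> lift \<sigma>)" for S :: "(('k \<times> bool) \<times> rat) set" and P Y'
    proof (rule h'(3)[OF that(1) _ that(4,5)])
      show "S \<subseteq> rdom (Y \<times> UNIV) (\<lambda>_. le_rel)" using that(2,3) by force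
    qed
    let ?H = "joined h'"
    have H: "?H \<in> envs" by (rule joined_envs[OF h'(1)])
    \<comment> \<open>Joined again, the new halves are still mutually indiscernible over
      \<open>A\<close>. There are no inner positions here, so the map that would read them is
      \<open>undefined\<close>.\<close>
    have mib: "mi A Y lexr m ?H"
    proof -
      have "mi A Y lexr m (\<lambda>v. case Some (snd (fst v)) of Some bq \<Rightarrow> h' (((fst (fst v), fst bq), snd bq), snd v)
        | None \<Rightarrow> h2 ((fst (fst v), undefined (snd (fst v))), snd v))"
      proof (rule extraction_transfer[where E = E and r = r and emb = emb and h = h])
        show "mi A Y (\<lambda>i. fst (J0 i \<oplus>\<^sub>s J1 i)) m h2" unfolding h2_def by (rule mi_senv[OF mut seqs(5)])
        show "Linear_order (fst (J0 i \<oplus>\<^sub>s J1 i))" if "i \<in> Y" for i using seqs(5)[OF that] by (simp add: sequence_of_def)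
        show "h (((i, b), t), c) = h2 ((i, emb b t), c)" for i b t c by (simp add: h_def)
        show "A \<subseteq> E" by (auto simp: E_def)
        show "P h'" if "finite S" "fst ` fst ` S \<subseteq> Y" "dfn E (vs (\<lambda>p. m (fst p)) S) P"
          "\<And>\<sigma>. rmono (\<lambda>_. le_rel) r S \<sigma> \<Longrightarrow> P (h \<circ> lift \<sigma>)" for S P by (rule EM[OF that(1,2) order_refl that(3,4)])
        fix S \<sigma> assume S: "S \<subseteq> rdom Y lexr"
          and \<sigma>: "rmono (\<lambda>_. le_rel) r {((i, fst bq), snd bq) | i p bq. (i, p) \<in> S \<and> Some p = Some bq} \<sigma>"
        let ?s = "\<lambda>p. (fst p, case Some (snd p) of Some bq \<Rightarrow> emb (fst bq) (snd (\<sigma> ((fst p, fst bq), snd bq))) | None \<Rightarrow> undefined (snd p))"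
        have mem: "((i, b), q) \<in> {((i, fst bq), snd bq) | i p bq. (i, p) \<in> S \<and> Some p = Some bq}" if "(i, (b, q)) \<in> S" for i b q
          using that by force
        have sF: "snd (\<sigma> ((i, b), q)) \<in> Field (r (i, b))" if "(i, (b, q)) \<in> S" for i b q
          using rmonoD(2)[OF \<sigma> mem[OF that]] by simp
        have sm: "(snd (\<sigma> ((i, b), q)), snd (\<sigma> ((i, b), q'))) \<in> r (i, b) \<and> snd (\<sigma> ((i, b), q)) \<noteq> snd (\<sigma> ((i, b), q'))"
          if "(i, (b, q)) \<in> S" "(i, (b, q')) \<in> S" "q < q'" for i b q q'
          using rmonoD(3)[OF \<sigma> mem[OF that(1)] mem[OF that(2)]] that(3) by simp
        show "rmono lexr (\<lambda>i. fst (J0 i \<oplus>\<^sub>s J1 i)) S ?s"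
        proof (rule rmonoI)
          fix p assume p: "p \<in> S"
          obtain i b q where e: "p = (i, (b, q))" by (cases p) auto
          show "fst (?s p) = fst p" by simp
          show "snd (?s p) \<in> idx (J0 (fst p) \<oplus>\<^sub>s J1 (fst p))"
            using sF[of i b q] p by (cases b) (simp_all add: e emb_def r_def)
        next
          fix p p' assume p: "p \<in> S" "p' \<in> S" "fst p = fst p'" "(snd p, snd p') \<in> le_rel" "snd p \<noteq> snd p'"
          obtain i b q where e: "p = (i, (b, q))" by (cases p) auto
          obtain b' q' where e': "p' = (i, (b', q'))" using p(3) by (cases p') (auto simp: e)
          have l: "b < b' \<or> b = b' \<and> q < q'" using p(4,5) by (auto simp: e e')
          show "(snd (?s p), snd (?s p')) \<in> fst (J0 (fst p) \<oplus>\<^sub>s J1 (fst p)) \<and> snd (?s p) \<noteq> snd (?s p')"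
          proof (cases "b = b'")
            case True
            thus ?thesis using l sm[of i b q q'] p(1,2) by (cases b) (simp_all add: e e' emb_def r_def)
          next
            case False
            hence "\<not> b" "b'" using l by auto
            thus ?thesis using sF[of i b q] sF[of i b' q'] p(1,2) by (simp add: e e' emb_def r_def)
          qed
        qed
      qed (use h2 henv h'(1) Linear_order_le_rel in simp_all)
      moreover have "(\<lambda>v. case Some (snd (fst v)) of Some bq \<Rightarrow> h' (((fst (fst v), fst bq), snd bq), snd v)
        | None \<Rightarrow> h2 ((fst (fst v), undefined (snd (fst v))), snd v)) = ?H" by (rule ext) (simp add: joined_def)
      ultimately show ?thesis by simp
    qed
    obtain g :: "rat \<Rightarrow> 'k" where g: "inj g" using countable_inj by (rule exE)
    define w where "w = dir_image (le_rel :: rat rel) g"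
    have w: "Linear_order w"
      unfolding w_def by (rule Linear_order_dir_image[OF Linear_order_le_rel inj_on_subset[OF g subset_UNIV]])
    have Fw: "Field w = range g" by (simp add: w_def dir_image_Field)
    have winf: "infinite (Field w)" unfolding Fw using finite_imageD[of g UNIV] g infinite_UNIV_char_0 by blast
    have wsm: "|Field w| <o kb" unfolding Fw by (rule small_countable) simp
    have wlt: "inv g t < inv g t'" if tw: "(t, t') \<in> w" "t \<noteq> t'" for t t'
    proof -
      from tw(1) obtain x y where "t = g x" "t' = g y" "x \<le> y" by (auto simp: w_def dir_image_def)
      thus ?thesis using tw(2) g by (cases "x = y") auto
    qed
    define K0 where "K0 i = (w, \<lambda>t. map (\<lambda>c. h' (((i, False), inv g t), c)) [0..<m i])" for i
    define K1 where "K1 i = (w, \<lambda>t. map (\<lambda>c. h' (((i, True), inv g t), c)) [0..<m i])" for i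
    let ?K = "\<lambda>i. K0 i \<oplus>\<^sub>s I i \<oplus>\<^sub>s K1 i"
    have seqK: "sequence_of U (m i) (K0 i)" "sequence_of U (m i) (K1 i)" for i
      unfolding K0_def K1_def by (rule sequence_of_row[OF h'(1) w])+
    have fK [simp]: "fst (K0 i) = w" "fst (K1 i) = w" for i by (simp_all add: K0_def K1_def)
    \<comment> \<open>Here the inner positions carry \<open>I i\<close>, and a single row over the
      empty set is considered.\<close>
    have full: "indiscernible L U {} (?K i)" if i: "i \<in> Y" for i
    proof -
      define h1 where "h1 = senv {i} m (\<lambda>i. J0 i \<oplus>\<^sub>s I i \<oplus>\<^sub>s J1 i)"
      have h1: "h1 \<in> envs" unfolding h1_def by (rule senv_envs) (use seqs(4)[OF i] in simp)
      have h1v: "h1 ((i, t), c) = snd (?J i) t ! c" if "t \<in> idx (?J i)" "c < m i" for t c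
        using that by (simp add: h1_def senv_def)
      define sd where "sd = case_sum (case_sum (\<lambda>t. Some (False, inv g t)) (\<lambda>_ :: 'k. None)) (\<lambda>t. Some (True, inv g t))"
      define em :: "bool \<Rightarrow> 'k \<Rightarrow> ('k + 'k) + 'k" where "em b t = (if b then Inr t else Inl (Inl t))" for b t
      have cut: "t \<in> idx (?K i) \<longleftrightarrow> (\<exists>u\<in>Field w. t = Inl (Inl u)) \<or> (\<exists>u\<in>idx (I i). t = Inl (Inr u)) \<or> (\<exists>u\<in>Field w. t = Inr u)" for t
        by auto
      define G where "G = (\<lambda>v. case sd (snd (fst v)) of Some bq \<Rightarrow> h' (((fst (fst v), fst bq), snd bq), snd v)
        | None \<Rightarrow> h1 ((fst (fst v), snd (fst v)), snd v))"
      have Genv: "G \<in> envs" using envsD[OF h'(1)] envsD[OF h1] by (intro envsI) (simp add: G_def split: option.split)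
      have "mi {} {i} (\<lambda>i. fst (?K i)) m G"
        unfolding G_def
      proof (rule extraction_transfer[where E = E and r = r and emb = em and h = h and inn = "\<lambda>p. p"])
        have "mutually_indiscernible L U {} {i} (\<lambda>i. J0 i \<oplus>\<^sub>s I i \<oplus>\<^sub>s J1 i)" using J i by (simp add: mutually_indiscernible_def)
        thus "mi {} {i} (\<lambda>i. fst (?J i)) m h1"
          unfolding h1_def by (rule mi_senv) (use seqs(4)[OF i] in simp)
        show "Linear_order (fst (?J j))" if "j \<in> {i}" for j
          using seqs(4)[OF i] that by (simp add: sequence_of_def)
        show "Linear_order (fst (?K j))" if "j \<in> {i}" for j
          using seqs(2)[OF i] w that by (intro Linear_order_seq_append) (simp_all add: sequence_of_def)
        show "h (((j, b), t), c) = h1 ((j, em b t), c)" if "j \<in> {i}" "t \<in> Field (r (j, b))" "c < m j" for j b t c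
          using hval[OF i, of t b c] h1v[of "em b t" c] that by (cases b) (auto simp: em_def r_def)
        show "P h'" if "finite S" "fst ` fst ` S \<subseteq> {i}" "dfn E (vs (\<lambda>p. m (fst p)) S) P"
          "\<And>\<sigma>. rmono (\<lambda>_. le_rel) r S \<sigma> \<Longrightarrow> P (h \<circ> lift \<sigma>)" for S P by (rule EM[OF that(1,2) _ that(3,4)]) (use i in simp)
        show "h1 ((j, t), c) \<in> E" if t: "j \<in> {i}" "t \<in> idx (?K j)" "sd t = None" "c < m j" for j t c
        proof -
          obtain u where u: "u \<in> idx (I i)" "t = Inl (Inr u)" using t(1-3) by (auto simp: sd_def)
          have "h1 ((j, t), c) = snd (I i) u ! c" using h1v[of t c] u t(1,4) by simp
          moreover have "snd (I i) u ! c \<in> elems (I i)"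
            unfolding elems_def by (rule UN_I[OF u(1)], rule nth_mem)
              (use sequence_of_length[OF seqs(2)[OF i] u(1)] t(1,4) in simp)
          ultimately show ?thesis using i by (auto simp: E_def)
        qed
        fix S \<sigma> assume S: "S \<subseteq> rdom {i} (\<lambda>i. fst (?K i))"
          and \<sigma>: "rmono (\<lambda>_. le_rel) r {((i, fst bq), snd bq) | i p bq. (i, p) \<in> S \<and> sd p = Some bq} \<sigma>"
        let ?s = "\<lambda>p. (fst p, case sd (snd p) of Some bq \<Rightarrow> em (fst bq) (snd (\<sigma> ((fst p, fst bq), snd bq))) | None \<Rightarrow> snd p)"
        have mem: "((i, b), q) \<in> {((i, fst bq), snd bq) | i p bq. (i, p) \<in> S \<and> sd p = Some bq}" if "(i, t) \<in> S" "sd t = Some (b, q)" for t b q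
          using that by force
        have sF: "snd (\<sigma> ((i, b), q)) \<in> Field (r (i, b))" if "(i, t) \<in> S" "sd t = Some (b, q)" for t b q
          using rmonoD(2)[OF \<sigma> mem[OF that]] by simp
        have sm: "(snd (\<sigma> ((i, b), q)), snd (\<sigma> ((i, b), q'))) \<in> r (i, b) \<and> snd (\<sigma> ((i, b), q)) \<noteq> snd (\<sigma> ((i, b), q'))"
          if "(i, t) \<in> S" "sd t = Some (b, q)" "(i, t') \<in> S" "sd t' = Some (b, q')" "q < q'" for t t' b q q'
          using rmonoD(3)[OF \<sigma> mem[OF that(1,2)] mem[OF that(3,4)]] that(5) by simp
        define s where "s = ?s"
        have sl: "snd (s (i, Inl (Inl u))) = Inl (Inl (snd (\<sigma> ((i, False), inv g u))))"
          "snd (s (i, Inl (Inr u))) = Inl (Inr u)" "snd (s (i, Inr u)) = Inr (snd (\<sigma> ((i, True), inv g u)))" for u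
          by (simp_all add: s_def sd_def em_def)
        have F0: "snd (\<sigma> ((i, False), inv g u)) \<in> idx (J0 i)" if "(i, Inl (Inl u)) \<in> S" for u
          using sF[OF that, of False "inv g u"] by (simp add: sd_def r_def)
        have F1: "snd (\<sigma> ((i, True), inv g u)) \<in> idx (J1 i)" if "(i, Inr u) \<in> S" for u
          using sF[OF that, of True "inv g u"] by (simp add: sd_def r_def)
        have "rmono (\<lambda>i. fst (?K i)) (\<lambda>i. fst (?J i)) S s"
        proof (rule rmonoI)
          fix p assume p: "p \<in> S"
          have f: "fst p = i" "snd p \<in> idx (?K i)" using domD[OF S p] by auto
          show "fst (s p) = fst p" by (simp add: s_def)
          obtain t where e: "p = (i, t)" using f(1) by (cases p) simp
          from f(2) consider u where "t = Inl (Inl u)" | u where "u \<in> idx (I i)" "t = Inl (Inr u)" | u where "t = Inr u"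
            unfolding e snd_conv cut by blast
          thus "snd (s p) \<in> idx (J0 (fst p) \<oplus>\<^sub>s I (fst p) \<oplus>\<^sub>s J1 (fst p))"
            by cases (use F0 F1 p in \<open>auto simp: e sl\<close>)
        next
          fix p p' assume p: "p \<in> S" "p' \<in> S" "fst p = fst p'" "(snd p, snd p') \<in> fst (K0 (fst p) \<oplus>\<^sub>s I (fst p) \<oplus>\<^sub>s K1 (fst p))" "snd p \<noteq> snd p'"
          have f: "fst p = i" "snd p \<in> idx (?K i)" "snd p' \<in> idx (?K i)" using domD[OF S p(1)] domD[OF S p(2)] p(3) by auto
          obtain t where e: "p = (i, t)" using f(1) by (cases p) simp
          obtain t' where e': "p' = (i, t')" using f(1) p(3) by (cases p') simp
          have tt: "(t, t') \<in> fst (?K i)" "t \<noteq> t'" using p(4,5) by (simp_all add: e e')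
          have m0: "(snd (\<sigma> ((i, False), inv g u)), snd (\<sigma> ((i, False), inv g u'))) \<in> fst (J0 i) \<and> snd (\<sigma> ((i, False), inv g u)) \<noteq> snd (\<sigma> ((i, False), inv g u'))"
            if "t = Inl (Inl u)" "t' = Inl (Inl u')" for u u'
            using sm[of t False "inv g u" t' "inv g u'"] wlt[of u u'] that tt p(1,2) by (simp add: e e' sd_def r_def)
          have m1: "(snd (\<sigma> ((i, True), inv g u)), snd (\<sigma> ((i, True), inv g u'))) \<in> fst (J1 i) \<and> snd (\<sigma> ((i, True), inv g u)) \<noteq> snd (\<sigma> ((i, True), inv g u'))"
            if "t = Inr u" "t' = Inr u'" for u u'
            using sm[of t True "inv g u" t' "inv g u'"] wlt[of u u'] that tt p(1,2) by (simp add: e e' sd_def r_def)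
          from f(2) consider u where "t = Inl (Inl u)" | u where "u \<in> idx (I i)" "t = Inl (Inr u)" | u where "t = Inr u"
            unfolding e snd_conv cut by blast
          note T = this
          from f(3) consider u where "t' = Inl (Inl u)" | u where "u \<in> idx (I i)" "t' = Inl (Inr u)" | u where "t' = Inr u"
            unfolding e' snd_conv cut by blast
          thus "(snd (s p), snd (s p')) \<in> fst (J0 (fst p) \<oplus>\<^sub>s I (fst p) \<oplus>\<^sub>s J1 (fst p)) \<and> snd (s p) \<noteq> snd (s p')"
            by (cases; cases rule: T) (use F0 F1 p(1,2) tt m0 m1 in \<open>simp_all add: e e' sl\<close>)
        qed
        thus "rmono (\<lambda>i. fst (?K i)) (\<lambda>i. fst (?J i)) S ?s"
          unfolding s_def .
      qed (use h1 henv h'(1) in simp_all)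
      hence "mutually_indiscernible L U {} {i} (\<lambda>i. K0 i \<oplus>\<^sub>s I i \<oplus>\<^sub>s K1 i)"
      proof (rule mutually_indiscernible_mi[OF _ Genv])
        show "sequence_of U (m j) (?K j)" if "j \<in> {i}" for j
          using seqK seqs(2)[OF i] that by (simp add: sequence_of_append)
        show "G ((j, t), c) = snd (?K j) t ! c" if "j \<in> {i}" "t \<in> idx (?K j)" "c < m j" for j t c
          using that h1v[of t c] by (auto simp: G_def sd_def K0_def K1_def)
      qed
      thus ?thesis by (simp add: mutually_indiscernible_def)
    qed
    \<comment> \<open>The type is tested in the presence of all rows, bad ones included, so that the
      good rows can afterwards be moved one by one.\<close>
    define bad where "bad i \<longleftrightarrow> (\<exists>S \<tau>. finite S \<and> S \<subseteq> Y \<times> UNIV \<and> rmono lexr lexr S \<tau> \<and> (\<forall>p\<in>S. fst p \<noteq> i \<longrightarrow> \<tau> p = p) \<and>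
      \<not> teq (A \<union> set a) (vs m S) ?H (?H \<circ> lift \<tau>))" for i
    define X where "X = {i \<in> Y. bad i}"
    have mig: "mi (A \<union> set a) (Y - X) lexr m ?H"
    proof (rule joined_row_by_row[OF H, of _ Y])
      show "teq (A \<union> set a) (vs m S) ?H (?H \<circ> lift \<tau>)" if "i \<in> Y - X" "finite S" "S \<subseteq> Y \<times> UNIV" "rmono lexr lexr S \<tau>"
        "\<And>p. p \<in> S \<Longrightarrow> fst p \<noteq> i \<Longrightarrow> \<tau> p = p" for i S \<tau>
      proof (rule ccontr)
        assume "\<not> ?thesis"
        hence "bad i" unfolding bad_def using that by (intro exI[of _ S] exI[of _ \<tau>]) blast
        thus False using that(1) by (simp add: X_def)
      qed
    qed simp
    have mutK: "mutually_indiscernible L U (A \<union> set a) (Y - X) (\<lambda>i. K0 i \<oplus>\<^sub>s K1 i)"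
    proof -
      define ps where "ps p = (fst p, case_sum (\<lambda>t. (False, inv g t)) (\<lambda>t. (True, inv g t)) (snd p))" for p :: "'k \<times> ('k + 'k)"
      have lin: "Linear_order (fst (K0 i \<oplus>\<^sub>s K1 i))" for i by (rule Linear_order_seq_append) (simp_all add: w)
      have rm: "rmono (\<lambda>i. fst (K0 i \<oplus>\<^sub>s K1 i)) lexr (rdom (Y - X) (\<lambda>i. fst (K0 i \<oplus>\<^sub>s K1 i))) ps"
      proof (rule rmonoI)
        fix p q :: "'k \<times> ('k + 'k)" assume "(snd p, snd q) \<in> fst (K0 (fst p) \<oplus>\<^sub>s K1 (fst p))" "snd p \<noteq> snd q"
        thus "(snd (ps p), snd (ps q)) \<in> le_rel \<and> snd (ps p) \<noteq> snd (ps q)"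
          using wlt by (cases "snd p"; cases "snd q") (force simp: ps_def less_imp_le)+
      qed (simp_all add: ps_def)
      have "mi (A \<union> set a) (Y - X) (\<lambda>i. fst (K0 i \<oplus>\<^sub>s K1 i)) m (?H \<circ> lift ps)"
        by (rule mi_reindex[OF mig H Linear_order_le_rel lin rm])
      thus ?thesis
      proof (rule mutually_indiscernible_mi[OF _ envs_comp[OF H]])
        show "sequence_of U (m i) (K0 i \<oplus>\<^sub>s K1 i)" if "i \<in> Y - X" for i using seqK by (simp add: sequence_of_append)
        show "(?H \<circ> lift ps) ((i, t), c) = snd (K0 i \<oplus>\<^sub>s K1 i) t ! c" if "i \<in> Y - X" "t \<in> idx (K0 i \<oplus>\<^sub>s K1 i)" "c < m i" for i t c
          using that by (auto simp: ps_def K0_def K1_def joined_def)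
      qed
    qed
    have stable: "mutually_stable L U kb (A \<union> set a) (Y - X) I"
      unfolding mutually_stable_def
    proof (rule conjI)
      show "\<forall>i\<in>Y - X. small_seq kb (I i) \<and> indiscernible L U {} (I i)" using Is by simp
      have K: "\<forall>i\<in>Y - X. small_seq kb (K0 i) \<and> small_seq kb (K1 i) \<and> infinite (idx (K0 i)) \<and> infinite (idx (K1 i)) \<and>
          indiscernible L U {} (?K i)"
        using full winf wsm by (simp add: small_seq_def)
      show "\<exists>(J0 :: 'k \<Rightarrow> ('k, 'm) tseq) (J1 :: 'k \<Rightarrow> ('k, 'm) tseq).
        (\<forall>i\<in>Y - X. small_seq kb (J0 i) \<and> small_seq kb (J1 i) \<and> infinite (idx (J0 i)) \<and> infinite (idx (J1 i)) \<and>
           indiscernible L U {} (J0 i \<oplus>\<^sub>s I i \<oplus>\<^sub>s J1 i)) \<and>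
        mutually_indiscernible L U (A \<union> set a) (Y - X) (\<lambda>i. J0 i \<oplus>\<^sub>s J1 i)"
        by (rule exI[of _ K0], rule exI[of _ K1], rule conjI[OF K mutK])
    qed
    have "|X| <o \<kappa>"
    proof (rule ccontr)
      assume "\<not> |X| <o \<kappa>"
      hence "\<kappa> \<le>o |X|" using not_ordLess_iff_ordLeq[OF card_order_on_well_order_on[OF \<kappa>] card_of_Well_order] by blast
      hence "|Field \<kappa>| \<le>o |X|" using card_of_Field_ordIso[OF \<kappa>] ordIso_ordLeq_trans by blast
      then obtain f where f: "inj_on f (Field \<kappa>)" "f ` Field \<kappa> \<subseteq> X" unfolding card_of_ordLeq[symmetric] by blast
      have "\<forall>i\<in>X. \<exists>p. p \<in> pfmlas L (A \<union> ?H ` vs m (Y \<times> farpos)) (n + m i) \<and>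
        (\<forall>q>-1. psat U p (a @ map (\<lambda>c. ?H ((i, (False, q)), c)) [0..<m i])) \<and>
        (\<forall>q<1. \<not> psat U p (a @ map (\<lambda>c. ?H ((i, (True, q)), c)) [0..<m i]))"
        (is "\<forall>i\<in>X. \<exists>p. ?cross i p")
      proof
        fix i assume "i \<in> X"
        hence i: "i \<in> Y" "bad i" by (simp_all add: X_def)
        obtain S \<tau> where S: "finite S" "S \<subseteq> Y \<times> UNIV" "rmono lexr lexr S \<tau>" "\<forall>p\<in>S. fst p \<noteq> i \<longrightarrow> \<tau> p = p"
          "\<not> teq (A \<union> set a) (vs m S) ?H (?H \<circ> lift \<tau>)" using i(2) unfolding bad_def by (elim exE conjE)
        have "A \<union> set a \<subseteq> E" by (auto simp: E_def)
        from crossing_formula[OF h'(2,1) this at i(1) S(1,2,3) S(4)[rule_format] S(5)]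
        show "\<exists>p. ?cross i p" by blast
      qed
      from bchoice[OF this] obtain p where p: "\<forall>i\<in>X. ?cross i (p i)" by (rule exE)
      have "dlr_pattern L U kb B n \<pi> \<kappa>"
        by (rule crossing_pattern[OF mib H As Y B a \<pi> f(1), of p]) (use f(2) p in \<open>auto simp: X_def\<close>)
      thus False using no by simp
    qed
    moreover have "X \<subseteq> Y" by (auto simp: X_def)
    ultimately show ?thesis using stable by (intro exI[of _ X]) simp
  qed
qed

end

section \<open>Equivalence of bounded op-dimension with the two stability conditions\<close>

theorem proposition4p3:
  fixes L :: "('f, 'r) lang" and T :: "('f, 'r) fm set"
    and U :: "('f, 'r, 'm) struct" and kb :: "'k rel"
    and n :: nat and \<pi> :: "('f, 'r, 'm) pfm set" and \<kappa> :: "'k rel" and B :: "'m set"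
  assumes "complete_theory L T"
    and "monster_model L T U kb"
    and "NIP L U"
    and "small_subset U kb B" and "partial_type_over L U B n \<pi>"
    and "Card_order \<kappa>" and "\<kappa> <o kb"
  shows
    "(dlr_less L U kb n \<pi> \<kappa> \<longleftrightarrow>
       (\<forall>A (I :: 'k \<Rightarrow> ('k, 'm) tseq) a.
          small_subset U kb A \<and> params \<pi> \<subseteq> A \<and>
          mutually_stable L U kb A (Field \<kappa>) I \<and> realizes U n \<pi> a \<longrightarrow>
          (\<exists>i\<in>Field \<kappa>. stable_over L U kb (A \<union> set a) (I i))))
     \<and>
     (dlr_less L U kb n \<pi> \<kappa> \<longleftrightarrow>
       (\<forall>A (\<Lambda> :: 'k rel) (I :: 'k \<Rightarrow> ('k, 'm) tseq) a.
          small_subset U kb A \<and> params \<pi> \<subseteq> A \<and> Card_order \<Lambda> \<and> \<Lambda> <o kb \<and>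
          mutually_stable L U kb A (Field \<Lambda>) I \<and> realizes U n \<pi> a \<longrightarrow>
          (\<exists>X\<subseteq>Field \<Lambda>. |X| <o \<kappa> \<and>
             mutually_stable L U kb (A \<union> set a) (Field \<Lambda> - X) I)))"
  proof -
  have mm: "Card_order kb" "regularCard kb" "|{\<phi> :: ('f, 'r) fm. wf_fm L \<phi>}| <o kb" "model_of L T U" "saturated L U kb"
    using assms(2) by (auto simp: monster_model_def)
  \<comment> \<open>There are infinitely many formulas, so the bound on their number already makes
    \<open>kb\<close> uncountable.\<close>
  have unc: "natLeq <o kb"
  proof -
    have "inj (\<lambda>v. Eq (Var v) (Var v) :: ('f, 'r) fm)" by (rule injI) simp
    moreover have "range (\<lambda>v. Eq (Var v) (Var v)) \<subseteq> {\<phi> :: ('f, 'r) fm. wf_fm L \<phi>}" by auto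
    ultimately have "infinite {\<phi> :: ('f, 'r) fm. wf_fm L \<phi>}" using range_inj_infinite finite_subset by blast
    hence "natLeq \<le>o |{\<phi> :: ('f, 'r) fm. wf_fm L \<phi>}|" using infinite_iff_natLeq_ordLeq by blast
    thus ?thesis using mm(3) by (rule ordLeq_ordLess_trans)
  qed
  have ne: "univ U \<noteq> {}" using mm(4) by (simp add: model_of_def structure_of_def)
  interpret nip_monster L U kb
    by unfold_locales (use ne mm unc assms(3) in auto)
  have \<pi>B: "\<pi> \<subseteq> pfmlas L B n" using assms(5) by (simp add: partial_type_over_def)
  have \<pi>A: "\<pi> \<subseteq> pfmlas L A n" if "params \<pi> \<subseteq> A" for A
  proof
    fix p assume p: "p \<in> \<pi>"
    hence "set (snd p) \<subseteq> A" using that by (auto simp: params_def)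
    thus "p \<in> pfmlas L A n" using p \<pi>B by (auto simp: pfmlas_def)
  qed
  have parB: "params \<pi> \<subseteq> B" using \<pi>B by (fastforce simp: params_def pfmlas_def)
  let ?two = "\<forall>A (I :: 'k \<Rightarrow> ('k, 'm) tseq) a. small_subset U kb A \<and> params \<pi> \<subseteq> A \<and>
    mutually_stable L U kb A (Field \<kappa>) I \<and> realizes U n \<pi> a \<longrightarrow>
    (\<exists>i\<in>Field \<kappa>. stable_over L U kb (A \<union> set a) (I i))"
  let ?three = "\<forall>A (\<Lambda> :: 'k rel) (I :: 'k \<Rightarrow> ('k, 'm) tseq) a.
    small_subset U kb A \<and> params \<pi> \<subseteq> A \<and> Card_order \<Lambda> \<and> \<Lambda> <o kb \<and>
    mutually_stable L U kb A (Field \<Lambda>) I \<and> realizes U n \<pi> a \<longrightarrow>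
    (\<exists>X\<subseteq>Field \<Lambda>. |X| <o \<kappa> \<and> mutually_stable L U kb (A \<union> set a) (Field \<Lambda> - X) I)"
  have "?three" if "dlr_less L U kb n \<pi> \<kappa>"
  proof (intro allI impI, elim conjE)
    fix A and \<Lambda> :: "'k rel" and I :: "'k \<Rightarrow> ('k, 'm) tseq" and a
    assume *: "small_subset U kb A" "params \<pi> \<subseteq> A" "Card_order \<Lambda>" "\<Lambda> <o kb"
      "mutually_stable L U kb A (Field \<Lambda>) I" "realizes U n \<pi> a"
    obtain B0 where B0: "small_subset U kb B0" "\<not> dlr_pattern L U kb B0 n \<pi> \<kappa>"
      using \<open>dlr_less L U kb n \<pi> \<kappa>\<close> unfolding dlr_less_def by blast
    have "|Field \<Lambda>| <o kb" using card_of_Field_ordIso[OF *(3)] *(4) ordIso_ordLess_trans by blast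
    from no_pattern_imp_mutually_stable[OF B0 assms(6) *(1) \<pi>A[OF *(2)] this *(5,6)]
    show "\<exists>X\<subseteq>Field \<Lambda>. |X| <o \<kappa> \<and> mutually_stable L U kb (A \<union> set a) (Field \<Lambda> - X) I" .
  qed
  moreover have "?two" if "?three"
  proof (intro allI impI, elim conjE)
    fix A and I :: "'k \<Rightarrow> ('k, 'm) tseq" and a
    assume *: "small_subset U kb A" "params \<pi> \<subseteq> A" "mutually_stable L U kb A (Field \<kappa>) I" "realizes U n \<pi> a"
    have "\<exists>X\<subseteq>Field \<kappa>. |X| <o \<kappa> \<and> mutually_stable L U kb (A \<union> set a) (Field \<kappa> - X) I"
      using * assms(6,7) by (intro \<open>?three\<close>[rule_format] conjI)
    then obtain X where X: "|X| <o \<kappa>" "mutually_stable L U kb (A \<union> set a) (Field \<kappa> - X) I" by blast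
    \<comment> \<open>A set of size below \<open>\<kappa>\<close> cannot exhaust the index set, and
      any remaining row is stable by itself.\<close>
    have "\<not> Field \<kappa> \<subseteq> X"
    proof
      assume "Field \<kappa> \<subseteq> X"
      hence "|Field \<kappa>| <o \<kappa>" using X(1) card_of_mono1 ordLeq_ordLess_trans by blast
      thus False using card_of_Field_ordIso[OF assms(6)] not_ordLess_ordIso by blast
    qed
    then obtain i where "i \<in> Field \<kappa> - X" by blast
    thus "\<exists>i\<in>Field \<kappa>. stable_over L U kb (A \<union> set a) (I i)" using mutually_stable_single[OF X(2)] by blast
  qed
  moreover have "dlr_less L U kb n \<pi> \<kappa>" if "?two"
  proof (rule ccontr)
    assume "\<not> dlr_less L U kb n \<pi> \<kappa>"
    \<comment> \<open>Since \<open>dlr_less\<close> asks for some base without a pattern, its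
      failure provides a pattern over the given \<open>B\<close>.\<close>
    hence pat: "dlr_pattern L U kb B n \<pi> \<kappa>" using assms(4) parB unfolding dlr_less_def by blast
    obtain I :: "'k \<Rightarrow> ('k, 'm) tseq" and a where Ia: "mutually_stable L U kb B (Field \<kappa>) I" "realizes U n \<pi> a"
      "\<forall>i\<in>Field \<kappa>. \<not> stable_over L U kb (B \<union> set a) (I i)"
      using pattern_not_stable[OF assms(4,6,7) pat] by (elim exE conjE)
    have "\<exists>i\<in>Field \<kappa>. stable_over L U kb (B \<union> set a) (I i)"
      using assms(4) parB Ia(1,2) by (intro \<open>?two\<close>[rule_format] conjI)
    thus False using Ia(3) by blast
  qed
  ultimately show ?thesis by (intro conjI iffI) blast+
qed

end
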